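(* Let $T>0$, and let $\mathbf{f}\in C^1([0,T];[L^2(\mathbb{R}^d)]^d)$, $\mathbf{u}_0\in[H^{2s,2}(\mathbb{R}^d)]^d$, and $\mathbf{v}_0\in[H^{s,2}(\mathbb{R}^d)]^d$. Suppose that $\rho$ is an even function that is in Class B, with associated operator $\mathbb{L}$. Suppose that $\lambda$ is a nonnegative constant satisfying $\lambda>\lambda_0-1$, where $\lambda_0$ is the solvability constant for the steady problem described in the context. Then there exists a unique solution $$\mathbf{u}\in C([0,T];[H^{2s,2}(\mathbb{R}^d)]^d)\cap C^1([0,T];[H^{s,2}(\mathbb{R}^d)]^d)\cap C^2([0,T];[L^2(\mathbb{R}^d)]^d)$$ to $$\begin{cases}\partial_{tt}\mathbf{u}+\mathbb{L}\mathbf{u}+\lambda\mathbf{u}=\mathbf{f}, & (x,t)\in\mathbb{R}^d\times[0,T],\\ \mathbf{u}(x,0)=\mathbf{u}_0(x), & x\in\mathbb{R}^d,\\ \partial_t\mathbf{u}(x,0)=\mathbf{v}_0(x), & x\in\mathbb{R}^d.\end{cases}$$ In the case that $\mathbf{f}(x,t)=\mathbf{f}_0(x)$, the solution $\mathbf{u}$ additionally satisfies the conservation law $$\begin{aligned}&\|\partial_t\mathbf{u}(t)\|_{L^2(\mathbb{R}^d)}^2+\int_{\mathbb{R}^d}\int_{\mathbb{R}^d}\rho(x-y)\left((\mathbf{u}(x,t)-\mathbf{u}(y,t))\cdot\frac{x-y}{|x-y|}\right)^2dy\,dx+\lambda\|\mathbf{u}(t)\|_{L^2(\mathbb{R}^d)}^2+2\int_{\mathbb{R}^d}\langle\mathbf{f}_0,\mathbf{u}(t)\rangle\,dx\\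 &=\|\mathbf{v}_0\|_{L^2(\mathbb{R}^d)}^2+\int_{\mathbb{R}^d}\int_{\mathbb{R}^d}\rho(x-y)\left((\mathbf{u}_0(x)-\mathbf{u}_0(y))\cdot\frac{x-y}{|x-y|}\right)^2dy\,dx+\lambda\|\mathbf{u}_0\|_{L^2(\mathbb{R}^d)}^2+2\int_{\mathbb{R}^d}\langle\mathbf{f}_0,\mathbf{u}_0\rangle\,dx.\end{aligned}$$ If $\lambda_0<1$, then $\lambda$ can be taken to be $0$, that is, solving the system $\partial_{tt}\mathbf{u}+\mathbb{L}\mathbf{u}=\mathbf{f}$ in $\mathbb{R}^d\times[0,T]$ with the same initial conditions.
   Context: Vector fields are $\mathbb{R}^d$-valued and $\langle\cdot,\cdot\rangle$ is the Euclidean inner product. Fourier transform: $\widehat f(\xi)=\int_{\mathbb{R}^d}e^{-2\pi i x\cdot\xi}f(x)\,dx$, with inverse $(\cdot)^\vee$. $B_r$ is the open ball of radius $r$ centered at $0$ (with $B_\infty=\mathbb{R}^d$). Class B: $\rho$ is a nonnegative kernel of the form $\rho(y)=\frac{m(y)}{|y|^{d+2s}}\mathbf{1}_{\Lambda_r}(y)$, where $s\in(0,1)$, $0<r\le\infty$, $\Lambda_r=\Lambda\cap B_r$, $\Lambda=\{x\in\mathbb{R}^d: x/|x|\in\Gamma\cup-\Gamma\}$ is the double cone corresponding to a given measurable set $\Gamma\subseteq\mathbb{S}^{d-1}$ of positive Hausdorff (surface) measure, and $m:\mathbb{R}^d\to[0,\infty)$ is measurable with $0<\alpha_1\le m(y)\le\alpha_2<\infty$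 for constants $\alpha_1,\alpha_2$. When $s=1/2$ one additionally assumes $\int_{\partial B_\mu}y_iy_jy_k\,\rho(y)\,d\sigma(y)=0$ for all $i,j,k\in\{1,\dots,d\}$ and all $\mu>0$ (automatic when $m$ is even). Operator: $-\mathbb{L}\mathbf{u}(x)=\mathrm{p.v.}\int_{\mathbb{R}^d}\left(\frac{y\otimes y}{|y|^2}\right)\left(\mathbf{u}(x+y)-\mathbf{u}(x)-\varepsilon(\mathbf{u})(x)\,y\,\chi^{(s)}(y)\right)\rho(y)\,dy$, where $\varepsilon(\mathbf{u})=\frac12(\nabla\mathbf{u}+\nabla\mathbf{u}^{\top})$ and $\chi^{(s)}(y)=0$ if $s\in(0,1/2)$, $\chi^{(s)}=\mathbf{1}_{B_1}$ if $s=1/2$, $\chi^{(s)}=1$ if $s\in(1/2,1)$. For even $\rho$ the $\varepsilon(\mathbf{u})$ term drops out of the principal value. The operator is continuous from $[H^{2s,2}(\mathbb{R}^d)]^d$ to $[L^2(\mathbb{R}^d)]^d$ (by extension from Schwartz vector fields). Spaces: for $\sigma>0$, $[H^{\sigma,2}(\mathbb{R}^d)]^d$ is the space of $\mathbf{u}\in[\mathcal{S}'(\mathbb{R}^d)]^d$ (tempered distributions) with $\|\mathbf{u}\|_{H^{\sigma,2}}=\|((1+4\pi^2|\xi|^2)^{\sigma/2}\widehat{\mathbf{u}})^\vee\|_{L^2}<\infty$; and $(-\Delta)^{\sigma}\mathbf{u}=((4\pi^2|\xi|^2)^{\sigma}\widehat{\mathbf{u}})^\vee$. The constant $\lambda_0=\lambda_0(d,s,\Lambda,r,\alpha_1)>0$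 is a constant, known to exist for Class B kernels, with the following property: for every $\lambda>\lambda_0$ and every $\mathbf{g}\in[L^2(\mathbb{R}^d)]^d$ the equation $\mathbb{L}\mathbf{u}+\lambda\mathbf{u}=\mathbf{g}$ in $\mathbb{R}^d$ has a unique strong (almost everywhere) solution $\mathbf{u}\in[H^{2s,2}(\mathbb{R}^d)]^d$, and it satisfies $\|(-\Delta)^s\mathbf{u}\|_{L^2}+\sqrt{\lambda}\,\|(-\Delta)^{s/2}\mathbf{u}\|_{L^2}+(\lambda-\lambda_0)\|\mathbf{u}\|_{L^2}\le C\|\mathbf{g}\|_{L^2}$ with $C=C(d,s,\Lambda,\alpha_1)>0$.
   Formalization: The conservation law is corrected: the double integral carries the factor 1/2 and the forcing term is −2∫⟨f0,u⟩ instead of +2∫⟨f0,u⟩; as printed it fails, e.g. for f0 = 0 and u0 = v0 a nonzero Schwartz field. *)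

theory Defs
  imports "HOL-Analysis.Analysis"
begin

type_synonym 'n field = "real^'n \<Rightarrow> real^'n"
type_synonym 'n functional = "(real^'n \<Rightarrow> complex) \<Rightarrow> complex"


section \<open>Schwartz functions and tempered distributions\<close>

definition partial :: "'n::finite \<Rightarrow> (real^'n \<Rightarrow> complex) \<Rightarrow> real^'n \<Rightarrow> complex" where
  "partial i f x = frechet_derivative f (at x) (axis i 1)"

primrec iter_partial :: "'n::finite list \<Rightarrow> (real^'n \<Rightarrow> complex) \<Rightarrow> real^'n \<Rightarrow> complex" where
  "iter_partial [] f = f"
| "iter_partial (i # is) f = partial i (iter_partial is f)"

definition schwartz :: "(real^'n::finite \<Rightarrow> complex) \<Rightarrow> bool" where
  "schwartz f \<longleftrightarrow> (\<forall>is. (\<forall>x. iter_partial is f differentiable at x) \<and>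
     (\<forall>k::nat. bounded (range (\<lambda>x. norm x ^ k *\<^sub>R iter_partial is f x))))"

definition schwartz_seminorm :: "nat \<Rightarrow> 'n::finite list \<Rightarrow> (real^'n \<Rightarrow> complex) \<Rightarrow> real" where
  "schwartz_seminorm k is f = (SUP x. norm x ^ k * norm (iter_partial is f x))"

text \<open>Distributions are functionals on all functions of which only the values on Schwartz
  functions matter; equality of distributions is equality there.\<close>

definition tempered_dist :: "'n::finite functional \<Rightarrow> bool" where
  "tempered_dist D \<longleftrightarrow>
     (\<forall>f g. schwartz f \<longrightarrow> schwartz g \<longrightarrow> D (\<lambda>x. f x + g x) = D f + D g) \<and>
     (\<forall>c f. schwartz f \<longrightarrow> D (\<lambda>x. c * f x) = c * D f) \<and>
     (\<exists>C N. \<forall>f. schwartz f \<longrightarrow>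
        norm (D f) \<le> C * (\<Sum>k\<le>N. \<Sum>is\<in>{is. length is \<le> N}. schwartz_seminorm k is f))"

definition dist_eq :: "'n::finite functional \<Rightarrow> 'n functional \<Rightarrow> bool" where
  "dist_eq D E \<longleftrightarrow> (\<forall>\<phi>. schwartz \<phi> \<longrightarrow> D \<phi> = E \<phi>)"

definition dist_of :: "(real^'n::finite \<Rightarrow> complex) \<Rightarrow> 'n functional" where
  "dist_of g \<phi> = (LINT x|lebesgue. g x * \<phi> x)"

definition tempered_fun :: "(real^'n::finite \<Rightarrow> complex) \<Rightarrow> bool" where
  "tempered_fun g \<longleftrightarrow> g \<in> borel_measurable lebesgue \<and>
     (\<forall>\<phi>. schwartz \<phi> \<longrightarrow> integrable lebesgue (\<lambda>x. g x * \<phi> x)) \<and> tempered_dist (dist_of g)"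

definition fourier :: "(real^'n::finite \<Rightarrow> complex) \<Rightarrow> real^'n \<Rightarrow> complex" where
  "fourier f \<xi> = (LINT x|lborel. exp (- 2 * of_real pi * \<i> * of_real (x \<bullet> \<xi>)) * f x)"

definition inv_fourier :: "(real^'n::finite \<Rightarrow> complex) \<Rightarrow> real^'n \<Rightarrow> complex" where
  "inv_fourier f x = (LINT \<xi>|lborel. exp (2 * of_real pi * \<i> * of_real (x \<bullet> \<xi>)) * f \<xi>)"

definition dist_fourier :: "'n::finite functional \<Rightarrow> 'n functional" where
  "dist_fourier D \<phi> = D (fourier \<phi>)"

definition dist_inv_fourier :: "'n::finite functional \<Rightarrow> 'n functional" where
  "dist_inv_fourier D \<phi> = D (inv_fourier \<phi>)"

definition dist_mult :: "(real^'n::finite \<Rightarrow> real) \<Rightarrow> 'n functional \<Rightarrow> 'n functional" where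
  "dist_mult w D \<phi> = D (\<lambda>x. of_real (w x) * \<phi> x)"

definition comp_fun :: "'n::finite field \<Rightarrow> 'n \<Rightarrow> real^'n \<Rightarrow> complex" where
  "comp_fun u i x = of_real (u x $ i)"

definition schwartz_field :: "'n::finite field \<Rightarrow> bool" where
  "schwartz_field u \<longleftrightarrow> (\<forall>i. schwartz (comp_fun u i))"


section \<open>Lebesgue and Sobolev spaces\<close>

text \<open>Elements of these spaces are represented by functions, two functions being the same element
  when they agree almost everywhere.\<close>

definition L2 :: "'n::finite field set" where
  "L2 = {u. u \<in> borel_measurable lebesgue \<and> integrable lebesgue (\<lambda>x. (norm (u x))\<^sup>2)}"

definition L2_norm :: "'n::finite field \<Rightarrow> real" where
  "L2_norm u = sqrt (LINT x|lebesgue. (norm (u x))\<^sup>2)"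

definition bessel_potential :: "real \<Rightarrow> 'n::finite functional \<Rightarrow> 'n functional" where
  "bessel_potential \<sigma> D =
     dist_inv_fourier (dist_mult (\<lambda>\<xi>. (1 + 4 * pi\<^sup>2 * (norm \<xi>)\<^sup>2) powr (\<sigma> / 2)) (dist_fourier D))"

definition bessel_field :: "real \<Rightarrow> 'n::finite field \<Rightarrow> 'n field \<Rightarrow> bool" where
  "bessel_field \<sigma> u v \<longleftrightarrow>
     (\<forall>i. dist_eq (dist_of (comp_fun v i)) (bessel_potential \<sigma> (dist_of (comp_fun u i))))"

text \<open>For \<open>\<sigma> > 0\<close> every tempered distribution with finite norm is a square integrable function,
  so it is no restriction to let \<open>u\<close> range over distributions given by functions.\<close>

definition sobolev :: "real \<Rightarrow> 'n::finite field set" where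
  "sobolev \<sigma> = {u. (\<forall>i. tempered_fun (comp_fun u i)) \<and> (\<exists>v\<in>L2. bessel_field \<sigma> u v)}"

definition sobolev_norm :: "real \<Rightarrow> 'n::finite field \<Rightarrow> real" where
  "sobolev_norm \<sigma> u = L2_norm (SOME v. v \<in> L2 \<and> bessel_field \<sigma> u v)"

text \<open>\<open>frac_laplacian \<sigma> u v\<close> says that \<open>v = (-\<Delta>)\<^sup>\<sigma> u\<close>. The symbol is not smooth at the origin, so the
  Fourier transform of \<open>u\<close> has to be a function, here \<open>U\<close>.\<close>

definition frac_laplacian :: "real \<Rightarrow> 'n::finite field \<Rightarrow> 'n field \<Rightarrow> bool" where
  "frac_laplacian \<sigma> u v \<longleftrightarrow> (\<exists>U :: 'n \<Rightarrow> real^'n \<Rightarrow> complex. \<forall>i.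
     tempered_fun (U i) \<and> dist_eq (dist_of (U i)) (dist_fourier (dist_of (comp_fun u i))) \<and>
     tempered_fun (\<lambda>\<xi>. of_real ((4 * pi\<^sup>2 * (norm \<xi>)\<^sup>2) powr \<sigma>) * U i \<xi>) \<and>
     dist_eq (dist_of (comp_fun v i))
       (dist_inv_fourier (dist_of (\<lambda>\<xi>. of_real ((4 * pi\<^sup>2 * (norm \<xi>)\<^sup>2) powr \<sigma>) * U i \<xi>))))"


section \<open>Hausdorff measure\<close>

text \<open>The normalisation makes the measure of dimension \<open>k\<close> agree with surface measure. The empty set
  gets weight zero also for \<open>k = 0\<close>, where \<open>0 ^ 0 = 1\<close>. The diameter of an unbounded set is
  unspecified, hence the boundedness condition on the covering sets.\<close>

definition hausdorff_weight :: "nat \<Rightarrow> 'a::metric_space set \<Rightarrow> ennreal" where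
  "hausdorff_weight k C =
     (if C = {} then 0 else ennreal (unit_ball_vol (real k) * (diameter C / 2) ^ k))"

definition hausdorff_outer :: "nat \<Rightarrow> 'a::metric_space set \<Rightarrow> ennreal" where
  "hausdorff_outer k A = (SUP \<delta>\<in>{0<..}.
     INF C\<in>{C :: nat \<Rightarrow> 'a set. A \<subseteq> (\<Union>i. C i) \<and> (\<forall>i. bounded (C i) \<and> diameter (C i) \<le> \<delta>)}.
       \<Sum>i. hausdorff_weight k (C i))"

text \<open>The measurable sets are those of Caratheodory.\<close>

definition hausdorff :: "nat \<Rightarrow> 'a::metric_space measure" where
  "hausdorff k = measure_of UNIV (lambda_system UNIV UNIV (hausdorff_outer k)) (hausdorff_outer k)"


section \<open>Kernels of Class B and their operators\<close>

definition double_cone :: "(real^'n::finite) set \<Rightarrow> (real^'n) set" where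
  "double_cone \<Gamma> = {x. x /\<^sub>R norm x \<in> \<Gamma> \<union> uminus ` \<Gamma>}"

text \<open>Measurability of \<open>\<rho>\<close> follows from that of \<open>\<Gamma>\<close> and \<open>m\<close>; it is stated for convenience.\<close>

definition class_B :: "real \<Rightarrow> (real^'n::finite) set \<Rightarrow> ereal \<Rightarrow> real \<Rightarrow> (real^'n \<Rightarrow> real) \<Rightarrow> bool" where
  "class_B s \<Gamma> r \<alpha>1 \<rho> \<longleftrightarrow>
     0 < s \<and> s < 1 \<and> 0 < r \<and> 0 < \<alpha>1 \<and>
     \<Gamma> \<subseteq> sphere 0 1 \<and> \<Gamma> \<in> sets (hausdorff (CARD('n) - 1)) \<and>
     0 < emeasure (hausdorff (CARD('n) - 1)) \<Gamma> \<and>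
     \<rho> \<in> borel_measurable lebesgue \<and>
     (\<exists>m \<alpha>2. m \<in> borel_measurable lebesgue \<and> (\<forall>y. \<alpha>1 \<le> m y \<and> m y \<le> \<alpha>2) \<and>
        (\<forall>y. \<rho> y = (if y \<in> double_cone \<Gamma> \<and> ereal (norm y) < r
                     then m y / norm y powr (real CARD('n) + 2 * s) else 0))) \<and>
     (s = 1/2 \<longrightarrow> (\<forall>i j k. \<forall>\<mu>>0.
        (LINT y:sphere 0 \<mu>|hausdorff (CARD('n) - 1). y $ i * y $ j * y $ k * \<rho> y) = 0))"

definition strain :: "'n::finite field \<Rightarrow> real^'n \<Rightarrow> real^'n^'n" where
  "strain u x = (1/2) *\<^sub>R (matrix (frechet_derivative u (at x))
                          + transpose (matrix (frechet_derivative u (at x))))"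

definition cutoff :: "real \<Rightarrow> real^'n::finite \<Rightarrow> real" where
  "cutoff s y = (if s < 1/2 then 0 else if s = 1/2 then indicator (ball 0 1) y else 1)"

text \<open>The matrix \<open>y \<otimes> y / |y|\<^sup>2\<close> applied to \<open>w\<close> is \<open>((y \<bullet> w) / |y|\<^sup>2) y\<close>.\<close>

definition nonlocal_op :: "(real^'n \<Rightarrow> real) \<Rightarrow> real \<Rightarrow> 'n::finite field \<Rightarrow> 'n field" where
  "nonlocal_op \<rho> s u x = - Lim (at_right 0) (\<lambda>\<delta>.
     LINT y:{y. \<delta> < norm y}|lebesgue. \<rho> y *\<^sub>R
       ((y \<bullet> (u (x + y) - u x - cutoff s y *\<^sub>R (strain u x *v y)) / (norm y)\<^sup>2) *\<^sub>R y))"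

text \<open>\<open>nonlocal_op_ext \<rho> s u w\<close> says that \<open>w\<close> is the value at \<open>u\<close> of the extension by continuity of
  the operator from Schwartz vector fields to a map from \<open>sobolev (2 * s)\<close> to \<open>L2\<close>.\<close>

definition nonlocal_op_ext ::
    "(real^'n \<Rightarrow> real) \<Rightarrow> real \<Rightarrow> 'n::finite field \<Rightarrow> 'n field \<Rightarrow> bool" where
  "nonlocal_op_ext \<rho> s u w \<longleftrightarrow> u \<in> sobolev (2 * s) \<and> w \<in> L2 \<and>
     (\<exists>\<phi> :: nat \<Rightarrow> 'n field. (\<forall>k. schwartz_field (\<phi> k) \<and> nonlocal_op \<rho> s (\<phi> k) \<in> L2) \<and>
        (\<lambda>k. sobolev_norm (2 * s) (\<lambda>x. \<phi> k x - u x)) \<longlonglongrightarrow> 0 \<and>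
        (\<lambda>k. L2_norm (\<lambda>x. nonlocal_op \<rho> s (\<phi> k) x - w x)) \<longlonglongrightarrow> 0)"


section \<open>The steady problem\<close>

definition steady_solution ::
    "(real^'n \<Rightarrow> real) \<Rightarrow> real \<Rightarrow> real \<Rightarrow> 'n::finite field \<Rightarrow> 'n field \<Rightarrow> bool" where
  "steady_solution \<rho> s lam g u \<longleftrightarrow> u \<in> sobolev (2 * s) \<and>
     (\<exists>w. nonlocal_op_ext \<rho> s u w \<and> (AE x in lebesgue. w x + lam *\<^sub>R u x = g x))"

text \<open>The constant \<open>\<lambda>\<^sub>0\<close> may depend on \<open>d, s, \<Lambda>, r, \<alpha>\<^sub>1\<close> and \<open>C\<close> on \<open>d, s, \<Lambda>, \<alpha>\<^sub>1\<close>. As \<open>C\<close> is independent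
  of \<open>r\<close>, the constants \<open>\<lambda>\<^sub>0\<close> are treated as a function \<open>lam0\<close> of \<open>r\<close>.\<close>

definition solvability_constant ::
    "real \<Rightarrow> (real^'n::finite) set \<Rightarrow> real \<Rightarrow> (ereal \<Rightarrow> real) \<Rightarrow> bool" where
  "solvability_constant s \<Gamma> \<alpha>1 lam0 \<longleftrightarrow> (\<forall>r>0. 0 < lam0 r) \<and>
     (\<exists>C>0. \<forall>r>0. \<forall>\<rho>. class_B s \<Gamma> r \<alpha>1 \<rho> \<longrightarrow> (\<forall>lam>lam0 r. \<forall>g\<in>L2.
        \<exists>u. steady_solution \<rho> s lam g u \<and>
          (\<forall>w. steady_solution \<rho> s lam g w \<longrightarrow> (AE x in lebesgue. w x = u x)) \<and>
          (\<exists>a\<in>L2. \<exists>b\<in>L2. frac_laplacian s u a \<and> frac_laplacian (s / 2) u b \<and>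
             L2_norm a + sqrt lam * L2_norm b + (lam - lam0 r) * L2_norm u \<le> C * L2_norm g)))"


section \<open>The evolution problem\<close>

text \<open>Continuity and differentiability on \<open>[0, T]\<close> of curves in a space \<open>X\<close> with norm \<open>N\<close>,
  one-sided at the end points.\<close>

definition curve_deriv ::
    "('n::finite field \<Rightarrow> real) \<Rightarrow> real \<Rightarrow> (real \<Rightarrow> 'n field) \<Rightarrow> (real \<Rightarrow> 'n field) \<Rightarrow> bool" where
  "curve_deriv N T u u' \<longleftrightarrow> (\<forall>t\<in>{0..T}.
     ((\<lambda>\<tau>. N (\<lambda>x. (u \<tau> x - u t x) /\<^sub>R (\<tau> - t) - u' t x)) \<longlongrightarrow> 0) (at t within {0..T}))"

definition curve_C0 ::
    "'n::finite field set \<Rightarrow> ('n field \<Rightarrow> real) \<Rightarrow> real \<Rightarrow> (real \<Rightarrow> 'n field) \<Rightarrow> bool" where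
  "curve_C0 X N T u \<longleftrightarrow> (\<forall>t\<in>{0..T}. u t \<in> X \<and>
     ((\<lambda>\<tau>. N (\<lambda>x. u \<tau> x - u t x)) \<longlongrightarrow> 0) (at t within {0..T}))"

definition curve_C1 ::
    "'n::finite field set \<Rightarrow> ('n field \<Rightarrow> real) \<Rightarrow> real \<Rightarrow> (real \<Rightarrow> 'n field) \<Rightarrow> bool" where
  "curve_C1 X N T u \<longleftrightarrow> curve_C0 X N T u \<and> (\<exists>u'. curve_deriv N T u u' \<and> curve_C0 X N T u')"

definition curve_C2 ::
    "'n::finite field set \<Rightarrow> ('n field \<Rightarrow> real) \<Rightarrow> real \<Rightarrow> (real \<Rightarrow> 'n field) \<Rightarrow> bool" where
  "curve_C2 X N T u \<longleftrightarrow> curve_C0 X N T u \<and> (\<exists>u'. curve_deriv N T u u' \<and> curve_C1 X N T u')"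

definition L2_curve_deriv :: "real \<Rightarrow> (real \<Rightarrow> 'n::finite field) \<Rightarrow> (real \<Rightarrow> 'n field) \<Rightarrow> bool" where
  "L2_curve_deriv T u u' \<longleftrightarrow> curve_C0 L2 L2_norm T u' \<and> curve_deriv L2_norm T u u'"

definition wave_solution :: "(real^'n \<Rightarrow> real) \<Rightarrow> real \<Rightarrow> real \<Rightarrow> real \<Rightarrow>
    (real \<Rightarrow> 'n field) \<Rightarrow> 'n field \<Rightarrow> 'n field \<Rightarrow> (real \<Rightarrow> 'n::finite field) \<Rightarrow> bool" where
  "wave_solution \<rho> s lam T f u0 v0 u \<longleftrightarrow>
     curve_C0 (sobolev (2 * s)) (sobolev_norm (2 * s)) T u \<and>
     curve_C1 (sobolev s) (sobolev_norm s) T u \<and>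
     curve_C2 L2 L2_norm T u \<and>
     (\<exists>ut utt. L2_curve_deriv T u ut \<and> L2_curve_deriv T ut utt \<and>
        (\<forall>t\<in>{0..T}. \<exists>w. nonlocal_op_ext \<rho> s (u t) w \<and>
           (AE x in lebesgue. utt t x + w x + lam *\<^sub>R u t x = f t x)) \<and>
        (AE x in lebesgue. u 0 x = u0 x) \<and> (AE x in lebesgue. ut 0 x = v0 x))"

definition pair_density :: "(real^'n \<Rightarrow> real) \<Rightarrow> 'n::finite field \<Rightarrow> real^'n \<Rightarrow> real^'n \<Rightarrow> real" where
  "pair_density \<rho> u x y = \<rho> (x - y) * ((u x - u y) \<bullet> ((x - y) /\<^sub>R norm (x - y)))\<^sup>2"

definition finite_pair_energy :: "(real^'n \<Rightarrow> real) \<Rightarrow> 'n::finite field \<Rightarrow> bool" where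
  "finite_pair_energy \<rho> u \<longleftrightarrow>
     (\<integral>\<^sup>+ x. \<integral>\<^sup>+ y. ennreal (pair_density \<rho> u x y) \<partial>lebesgue \<partial>lebesgue) < \<infinity>"

text \<open>The factor \<open>1/2\<close> and the sign of the forcing term are those for which the energy is conserved
  by \<open>u\<^sub>t\<^sub>t + Lu + \<lambda>u = f\<^sub>0\<close>: since \<open>\<rho>\<close> is even, the integral of \<open>\<langle>Lu, u\<rangle>\<close> is half the double integral,
  so that testing the equation with \<open>2 u\<^sub>t\<close> gives exactly this expression. The variant with
  coefficient \<open>1\<close> and forcing term \<open>+ 2 \<integral>\<langle>f\<^sub>0, u\<rangle>\<close> is not conserved: for \<open>f\<^sub>0 = 0\<close> and initial data
  \<open>u\<^sub>0 = v\<^sub>0\<close> its derivative at \<open>t = 0\<close> is the double integral of \<open>u\<^sub>0\<close>.\<close>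

definition wave_energy ::
    "(real^'n \<Rightarrow> real) \<Rightarrow> real \<Rightarrow> 'n field \<Rightarrow> 'n field \<Rightarrow> 'n::finite field \<Rightarrow> real" where
  "wave_energy \<rho> lam f0 u v =
     (L2_norm v)\<^sup>2
     + (1/2) * (LINT x|lebesgue. LINT y|lebesgue. pair_density \<rho> u x y)
     + lam * (L2_norm u)\<^sup>2
     - 2 * (LINT x|lebesgue. f0 x \<bullet> u x)"

end

theory Submission
  imports Defs "HOL-Probability.Probability"
begin

text \<open>Since \<open>\<rho>\<close> is even, averaging over y and -y removes the strain term,
  and on a Schwartz field the operator becomes an absolutely convergent integral of second
  differences. On the frequency side it is multiplication by the matrix \<open>symb xi\<close>, the
  integral of \<open>\<rho> y\<close> times 1 - cos(2 pi y.xi) times the projection onto y. This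
  matrix is symmetric, positive semidefinite and, by scaling, of order (1 + |xi|^2)^s. Fields are
  real, so the Hartley transform with kernel cos + sin is used in place of the Fourier transform: it
  is real, unitary, its own inverse, and conjugates even multipliers exactly as the Fourier
  transform does. In this picture L2 is a real Hilbert space, the Sobolev space of order \<sigma> is
  the domain of multiplication by \<open>wt \<sigma>\<close> (\<open>sobolev_iff\<close>,
  \<open>sobolev_norm_eq\<close>), and the operator, extended by continuity, is multiplication by
  \<open>symb\<close> (\<open>nonlocal_op_ext_iff\<close>).

  A lower bound for the symbol comes from the steady problem. Its estimate holds for every
  right-hand side, hence for fields concentrated near one frequency, and this localises it to a
  bound on the single matrix \<open>symb xi\<close> (\<open>symb_pointwise\<close>). An eigenvector
  argument (\<open>form_lower_bound\<close>) turns the bound on the matrix into a bound on its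
  quadratic form. Thus the symbol plus 1 is equivalent to the weight of order 2 s, as an operator
  and as a form (\<open>symb_coercive\<close>), and the operator and form domains are the Sobolev
  spaces of orders 2 s and s.

  What remains is a wave equation for a nonnegative symmetric operator whose truncations to
  frequencies |xi| <= k are bounded. Each truncated equation is a linear differential equation in
  Hilbert space, solved by Picard iteration. The energy of the solution and the energy of its time
  derivative, controlled by f in C^1, u0 in the operator domain and v0 in the form domain, give
  bounds independent of k (\<open>data_bound_exists\<close>). The difference of two truncated
  solutions solves the same kind of equation with truncation errors as data, so the truncated
  solutions converge uniformly in all the norms required (\<open>wave_exists\<close>). Conversely,
  the truncation of any solution solves a truncated equation, where symmetry makes the energy
  calculus legitimate; this gives uniqueness (\<open>wave_unique\<close>) and conservation
  (\<open>wave_energy_conserved\<close>). Finally, Tonelli's theorem and Plancherel's identity in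
  the difference variable identify the double integral with twice the quadratic form of the symbol
  (\<open>pair_energy\<close>), so the conserved quantity is \<open>wave_energy\<close>.\<close>

section \<open>Schwartz functions and the smooth multipliers that preserve them\<close>

section \<open>Schwartz functions\<close>

text \<open>A family closed under all partial derivatives contains every iterated derivative of its
  members, so differentiability and decay need only be checked on members themselves. The closure
  proofs for products, Fourier transforms and Gaussians consist in choosing such a family.\<close>

lemma schwartzI:
  assumes "f \<in> X"
    and diff: "\<And>g x. g \<in> X \<Longrightarrow> g differentiable at x"
    and dec: "\<And>g k. g \<in> X \<Longrightarrow> \<exists>C. \<forall>x. norm x ^ k * norm (g x) \<le> C"
    and part: "\<And>g i. g \<in> X \<Longrightarrow> partial i g \<in> X"
  shows "schwartz f"
proof -
  have X: "iter_partial js f \<in> X" for js by (induction js) (auto simp: assms)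
  have "bounded (range (\<lambda>x. norm x ^ k *\<^sub>R iter_partial js f x))" for k js
    using dec[OF X, of k js] by (auto simp: bounded_iff)
  then show ?thesis unfolding schwartz_def using diff[OF X] by blast
qed

lemma schwartz_differentiable: "schwartz f \<Longrightarrow> f differentiable at x"
  unfolding schwartz_def by (metis iter_partial.simps(1))

lemma schwartz_decay:
  assumes "schwartz f"
  shows "\<exists>C. \<forall>x. norm x ^ k * norm (f x) \<le> C"
proof -
  have "bounded (range (\<lambda>x. norm x ^ k *\<^sub>R iter_partial [] f x))"
    using assms unfolding schwartz_def by blast
  then show ?thesis by (auto simp: bounded_iff)
qed

lemma schwartz_partial:
  assumes "schwartz f"
  shows "schwartz (partial i f)"
proof -
  have "iter_partial js (partial i f) = iter_partial (js @ [i]) f" for js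
    by (induction js) auto
  then show ?thesis using assms unfolding schwartz_def by metis
qed

lemma partial_eq: "(f has_derivative D) (at x) \<Longrightarrow> partial i f x = D (axis i 1)"
  unfolding partial_def using frechet_derivative_at by metis

lemma has_derivative_partial:
  assumes "f differentiable at x"
  shows "(f has_derivative (\<lambda>h. \<Sum>i\<in>UNIV. (h $ i) *\<^sub>R partial i f x)) (at x)"
proof -
  obtain D where D: "(f has_derivative D) (at x)" using assms by (auto simp: differentiable_def)
  then interpret linear D by (simp add: has_derivative_linear)
  have "D h = (\<Sum>i\<in>UNIV. (h $ i) *\<^sub>R partial i f x)" for h
  proof -
    have "D h = D (\<Sum>i\<in>UNIV. (h $ i) *\<^sub>R axis i 1)"
      using basis_expansion[of h] by (simp add: scalar_mult_eq_scaleR)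
    then show ?thesis by (simp add: sum scaleR partial_eq[OF D])
  qed
  then have "D = (\<lambda>h. \<Sum>i\<in>UNIV. (h $ i) *\<^sub>R partial i f x)" by auto
  then show ?thesis using D by simp
qed

lemma has_derivative_frechet: "f differentiable at x \<Longrightarrow> (f has_derivative frechet_derivative f (at x)) (at x)"
  by (simp add: frechet_derivative_works)

lemma partial_add:
  assumes "f differentiable at x" "g differentiable at x"
  shows "partial i (\<lambda>x. f x + g x) x = partial i f x + partial i g x"
  using partial_eq[OF has_derivative_add[OF assms[THEN has_derivative_frechet]]]
  by (simp add: partial_def)

lemma partial_mult:
  assumes "f differentiable at x" "g differentiable at x"
  shows "partial i (\<lambda>x. f x * g x) x = f x * partial i g x + partial i f x * g x"
  using partial_eq[OF has_derivative_mult[OF assms[THEN has_derivative_frechet]]]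
  by (simp add: partial_def)

text \<open>Smooth functions of polynomial growth, generated so that closure under partial
  derivatives can be proved by induction. Weights serve the Bessel potentials, waves the modulation
  by characters; the remaining rules provide what differentiation of these produces.\<close>

inductive slow :: "(real^'n::finite \<Rightarrow> complex) \<Rightarrow> bool" where
  const: "slow (\<lambda>x. c)"
| coord: "slow (\<lambda>x. of_real (x $ i))"
| weight: "slow (\<lambda>x. of_real ((1 + 4 * pi\<^sup>2 * (norm x)\<^sup>2) powr \<tau>))"
| wave: "slow (\<lambda>x. cis (b \<bullet> x))"
| add: "slow f \<Longrightarrow> slow g \<Longrightarrow> slow (\<lambda>x. f x + g x)"
| mult: "slow f \<Longrightarrow> slow g \<Longrightarrow> slow (\<lambda>x. f x * g x)"

lemma weight_pos: "0 < 1 + 4 * pi\<^sup>2 * (norm x)\<^sup>2"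
  by (simp add: add_pos_nonneg)

lemma has_derivative_weight:
  "((\<lambda>x::real^'n::finite. complex_of_real ((1 + 4 * pi\<^sup>2 * (norm x)\<^sup>2) powr \<tau>)) has_derivative
    (\<lambda>h. of_real (\<tau> * (1 + 4 * pi\<^sup>2 * (norm x)\<^sup>2) powr (\<tau> - 1) * (8 * pi\<^sup>2 * (x \<bullet> h))))) (at x)"
proof -
  have 1: "((\<lambda>x::real^'n. 1 + 4 * pi\<^sup>2 * (x \<bullet> x)) has_derivative (\<lambda>h. 8 * pi\<^sup>2 * (x \<bullet> h))) (at x)"
    by (auto intro!: derivative_eq_intros simp: inner_commute)
  have p: "1 + 4 * pi\<^sup>2 * (x \<bullet> x) > 0" using weight_pos[of x] by (simp add: power2_norm_eq_inner)
  have 2: "((\<lambda>y. y powr \<tau>) has_derivative (\<lambda>h. h * (\<tau> * (1 + 4 * pi\<^sup>2 * (x \<bullet> x)) powr (\<tau> - 1))))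
     (at (1 + 4 * pi\<^sup>2 * (x \<bullet> x)))"
    using DERIV_powr[OF DERIV_ident p DERIV_const[of \<tau>]] has_real_derivative_powr[OF p, of \<tau>]
    by (simp add: has_field_derivative_def mult.commute[of _ "\<tau> * _"] mult_commute_abs)
  have "((\<lambda>x::real^'n. (1 + 4 * pi\<^sup>2 * (x \<bullet> x)) powr \<tau>) has_derivative
     (\<lambda>h. (8 * pi\<^sup>2 * (x \<bullet> h)) * (\<tau> * (1 + 4 * pi\<^sup>2 * (x \<bullet> x)) powr (\<tau> - 1)))) (at x)"
    using has_derivative_compose[OF 1 2] by (simp add: o_def)
  from has_derivative_of_real[OF this] show ?thesis
    by (simp add: power2_norm_eq_inner mult_ac)
qed

lemma has_derivative_wave:
  "((\<lambda>x. cis (b \<bullet> x)) has_derivative (\<lambda>h. \<i> * of_real (b \<bullet> h) * cis (b \<bullet> x))) (at x)"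
proof -
  have "((\<lambda>x. \<i> * complex_of_real (b \<bullet> x)) has_derivative (\<lambda>h. \<i> * of_real (b \<bullet> h))) (at x)"
    by (intro has_derivative_mult_right has_derivative_of_real has_derivative_inner_right has_derivative_ident)
  from has_derivative_compose[OF this, of exp "\<lambda>z. z * exp (\<i> * of_real (b \<bullet> x))"]
  show ?thesis using DERIV_exp[of "\<i> * of_real (b \<bullet> x)"]
    by (simp add: cis_conv_exp has_field_derivative_def mult_commute_abs)
qed

lemma has_derivative_coord:
  "((\<lambda>x. complex_of_real (x $ i)) has_derivative (\<lambda>h. of_real (h $ i))) (at x)"
  by (intro has_derivative_of_real bounded_linear.has_derivative[OF bounded_linear_vec_nth] has_derivative_ident)

lemma slow_differentiable: "slow f \<Longrightarrow> f differentiable at x"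
proof (induction rule: slow.induct)
  case weight then show ?case using has_derivative_weight unfolding differentiable_def by fast
next
  case wave then show ?case using has_derivative_wave unfolding differentiable_def by fast
next
  case coord then show ?case using has_derivative_coord unfolding differentiable_def by fast
qed (auto intro: differentiable_add differentiable_mult)

lemma inner_axis_1: "x \<bullet> axis i (1::real) = x $ i"
  by (simp add: inner_axis)

lemma slow_partial: "slow f \<Longrightarrow> slow (partial i f)"
proof (induction rule: slow.induct)
  case (const c)
  have "partial i (\<lambda>x. c) = (\<lambda>x. 0)" by (rule ext, rule partial_eq[where D="\<lambda>h. 0", simplified]) auto
  then show ?case using slow.const[of 0] by simp
next
  case (coord j)
  have "partial i (\<lambda>x. complex_of_real (x $ j)) = (\<lambda>x. of_real (axis i 1 $ j))"
    by (rule ext, rule partial_eq, rule has_derivative_coord)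
  then show ?case by (simp only: slow.const)
next
  case (weight \<tau>)
  have "partial i (\<lambda>x. complex_of_real ((1 + 4 * pi\<^sup>2 * (norm x)\<^sup>2) powr \<tau>)) =
    (\<lambda>x. of_real (8 * pi\<^sup>2 * \<tau>) * (of_real ((1 + 4 * pi\<^sup>2 * (norm x)\<^sup>2) powr (\<tau> - 1)) * of_real (x $ i)))"
    by (rule ext, subst partial_eq, rule has_derivative_weight) (simp add: inner_axis_1)
  then show ?case by (simp only:) (intro slow.intros)
next
  case (wave b)
  have "partial i (\<lambda>x. cis (b \<bullet> x)) = (\<lambda>x. (\<i> * of_real (b $ i)) * cis (b \<bullet> x))"
    by (rule ext, subst partial_eq, rule has_derivative_wave) (simp add: inner_axis_1)
  then show ?case by (simp only:) (intro slow.intros)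
next
  case (add f g)
  have "partial i (\<lambda>x. f x + g x) = (\<lambda>x. partial i f x + partial i g x)"
    using add slow_differentiable by (auto intro!: partial_add)
  then show ?case by (simp only:) (intro slow.intros add)
next
  case (mult f g)
  have "partial i (\<lambda>x. f x * g x) = (\<lambda>x. f x * partial i g x + partial i f x * g x)"
    using mult slow_differentiable by (auto intro!: partial_mult)
  then show ?case by (simp only:) (intro slow.intros mult)
qed

lemma slow_bound: "slow f \<Longrightarrow> \<exists>C k. \<forall>x. norm (f x) \<le> C * (1 + norm x) ^ k"
proof (induction rule: slow.induct)
  case (const c)
  show ?case by (rule exI[of _ "norm c"], rule exI[of _ 0]) auto
next
  case (coord i)
  show ?case by (rule exI[of _ 1], rule exI[of _ 1])
    (auto intro: order.trans[OF component_le_norm_cart])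
next
  case (weight \<tau>)
  \<comment> \<open>An integer exponent above the absolute value of \<open>\<tau>\<close> replaces
    the real one; the base is at least 1, so negative \<open>\<tau>\<close> is covered too.\<close>
  define m where "m = nat \<lceil>\<bar>\<tau>\<bar>\<rceil>"
  have "(1 + 4 * pi\<^sup>2 * (norm x)\<^sup>2) powr \<tau> \<le> (4 * pi\<^sup>2) ^ m * (1 + norm x) ^ (2 * m)" for x :: "real^'n"
  proof -
    have p2: "pi\<^sup>2 \<ge> 1" using pi_gt3 by (simp add: one_le_power)
    have b: "1 \<le> 1 + 4 * pi\<^sup>2 * (norm x)\<^sup>2" by simp
    have "(1 + 4 * pi\<^sup>2 * (norm x)\<^sup>2) powr \<tau> \<le> (1 + 4 * pi\<^sup>2 * (norm x)\<^sup>2) powr real m"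
      using b unfolding m_def by (intro powr_mono) linarith+
    also have "\<dots> = (1 + 4 * pi\<^sup>2 * (norm x)\<^sup>2) ^ m" using weight_pos[of x] by (simp add: powr_realpow)
    also have "1 + 4 * pi\<^sup>2 * (norm x)\<^sup>2 \<le> 4 * pi\<^sup>2 * (1 + norm x)\<^sup>2"
      using p2 by (simp add: power2_sum algebra_simps) (rule add_increasing2, simp, linarith)
    then have "(1 + 4 * pi\<^sup>2 * (norm x)\<^sup>2) ^ m \<le> (4 * pi\<^sup>2 * (1 + norm x)\<^sup>2) ^ m"
      by (intro power_mono) auto
    finally show ?thesis by (simp add: power_mult_distrib power_mult)
  qed
  then show ?case by (intro exI[of _ "(4 * pi\<^sup>2) ^ m"] exI[of _ "2 * m"]) auto
next
  case (wave b)
  show ?case by (rule exI[of _ 1], rule exI[of _ 0]) auto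
next
  case (add f g)
  then obtain C k D l where f: "\<forall>x. norm (f x) \<le> C * (1 + norm x) ^ k"
    and g: "\<forall>x. norm (g x) \<le> D * (1 + norm x) ^ l" by blast
  have C: "C \<ge> 0" using f[rule_format, of 0] order.trans[OF norm_ge_zero[of "f 0"]] by simp
  have D: "D \<ge> 0" using g[rule_format, of 0] order.trans[OF norm_ge_zero[of "g 0"]] by simp
  have "norm (f x + g x) \<le> (C + D) * (1 + norm x) ^ (k + l)" for x
  proof -
    have "norm (f x + g x) \<le> C * (1 + norm x) ^ k + D * (1 + norm x) ^ l"
      using f g norm_triangle_ineq[of "f x" "g x"] by (smt (verit))
    also have "\<dots> \<le> C * (1 + norm x) ^ (k + l) + D * (1 + norm x) ^ (k + l)"
      using C D by (intro add_mono mult_left_mono power_increasing) auto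
    finally show ?thesis by (simp add: algebra_simps)
  qed
  then show ?case by blast
next
  case (mult f g)
  then obtain C k D l where f: "\<forall>x. norm (f x) \<le> C * (1 + norm x) ^ k"
    and g: "\<forall>x. norm (g x) \<le> D * (1 + norm x) ^ l" by blast
  have "norm (f x * g x) \<le> (C * D) * (1 + norm x) ^ (k + l)" for x
  proof -
    have "norm (f x * g x) \<le> (C * (1 + norm x) ^ k) * (D * (1 + norm x) ^ l)"
      unfolding norm_mult using f g by (intro mult_mono) (auto intro: order.trans[OF norm_ge_zero])
    then show ?thesis by (simp add: power_add mult_ac)
  qed
  then show ?case by blast
qed

lemma schwartz_decay_strong:
  assumes "schwartz f"
  shows "\<exists>C\<ge>0. \<forall>x. (1 + norm x) ^ k * norm (f x) \<le> C"
proof -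
  obtain A B where A: "\<forall>x. norm x ^ 0 * norm (f x) \<le> A" and B: "\<forall>x. norm x ^ k * norm (f x) \<le> B"
    using schwartz_decay[OF assms] by metis
  have "(1 + norm x) ^ k * norm (f x) \<le> 2 ^ k * (A + B)" for x
  proof -
    have "(1 + norm x) ^ k \<le> (2 * max 1 (norm x)) ^ k" by (intro power_mono) auto
    also have "\<dots> \<le> 2 ^ k * (1 + norm x ^ k)"
      by (auto simp: power_mult_distrib max_def)
    finally have "(1 + norm x) ^ k * norm (f x) \<le> 2 ^ k * (1 + norm x ^ k) * norm (f x)"
      by (intro mult_right_mono) auto
    also have "\<dots> = 2 ^ k * (norm (f x) + norm x ^ k * norm (f x))" by (simp add: algebra_simps)
    also have "\<dots> \<le> 2 ^ k * (A + B)" using A B by (intro mult_left_mono add_mono) auto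
    finally show ?thesis .
  qed
  moreover from this[of 0] have "0 \<le> 2 ^ k * (A + B)"
    by (rule order.trans[rotated]) simp
  ultimately show ?thesis by blast
qed

text \<open>Leibniz' rule splits one product into two, so single products are not evidently closed
  under differentiation; their finite sums are, and form a family for
  \<open>schwartzI\<close>.\<close>

inductive slow_span :: "(real^'n::finite \<Rightarrow> complex) \<Rightarrow> bool" where
  base: "slow g \<Longrightarrow> schwartz f \<Longrightarrow> slow_span (\<lambda>x. g x * f x)"
| add: "slow_span f \<Longrightarrow> slow_span g \<Longrightarrow> slow_span (\<lambda>x. f x + g x)"

lemma slow_span_schwartz:
  assumes "slow_span h"
  shows "schwartz h"
proof (rule schwartzI[of h "Collect slow_span"])
  show h: "h \<in> Collect slow_span" using assms by simp
  have diff: "slow_span g \<Longrightarrow> g differentiable at x" for g x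
    by (induction rule: slow_span.induct)
      (auto intro: differentiable_add differentiable_mult slow_differentiable schwartz_differentiable)
  show "g \<in> Collect slow_span \<Longrightarrow> g differentiable at x" for g x using diff by simp
  have "slow_span g \<Longrightarrow> \<exists>C. \<forall>x. norm x ^ k * norm (g x) \<le> C" for g k
  proof (induction rule: slow_span.induct)
    case (base g f)
    obtain C m where C: "\<forall>x. norm (g x) \<le> C * (1 + norm x) ^ m" using slow_bound[OF base(1)] by blast
    obtain D where D: "\<forall>x. (1 + norm x) ^ (k + m) * norm (f x) \<le> D" using schwartz_decay_strong[OF base(2)] by blast
    have C0: "C \<ge> 0" using C[rule_format, of 0] order.trans[OF norm_ge_zero[of "g 0"]] by simp
    have "norm x ^ k * norm (g x * f x) \<le> C * D" for x
    proof -
      have "norm x ^ k * norm (g x * f x) \<le> (1 + norm x) ^ k * ((C * (1 + norm x) ^ m) * norm (f x))"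
        unfolding norm_mult using C by (intro mult_mono power_mono mult_right_mono) auto
      also have "\<dots> = C * ((1 + norm x) ^ (k + m) * norm (f x))" by (simp add: power_add mult_ac)
      also have "\<dots> \<le> C * D" using D C0 by (intro mult_left_mono) auto
      finally show ?thesis .
    qed
    then show ?case by blast
  next
    case (add f g)
    then obtain C D where C: "\<forall>x. norm x ^ k * norm (f x) \<le> C" and D: "\<forall>x. norm x ^ k * norm (g x) \<le> D" by blast
    have "norm x ^ k * norm (f x + g x) \<le> C + D" for x
    proof -
      have "norm x ^ k * norm (f x + g x) \<le> norm x ^ k * (norm (f x) + norm (g x))"
        by (intro mult_left_mono norm_triangle_ineq) auto
      then show ?thesis using C[rule_format, of x] D[rule_format, of x] by (simp add: algebra_simps)
    qed
    then show ?case by blast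
  qed
  then show "g \<in> Collect slow_span \<Longrightarrow> \<exists>C. \<forall>x. norm x ^ k * norm (g x) \<le> C" for g k by simp
  have "slow_span g \<Longrightarrow> slow_span (partial i g)" for g i
  proof (induction rule: slow_span.induct)
    case (base g f)
    have "partial i (\<lambda>x. g x * f x) = (\<lambda>x. g x * partial i f x + partial i g x * f x)"
      using base by (intro ext partial_mult slow_differentiable schwartz_differentiable)
    then show ?case by (simp only:) (intro slow_span.intros base slow_partial schwartz_partial)
  next
    case (add f g)
    have "partial i (\<lambda>x. f x + g x) = (\<lambda>x. partial i f x + partial i g x)"
      using add diff by (auto intro!: partial_add)
    then show ?case by (simp only:) (intro slow_span.intros add)
  qed
  then show "g \<in> Collect slow_span \<Longrightarrow> partial i g \<in> Collect slow_span" for g i by simp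
qed

lemma schwartz_slow_mult: "slow g \<Longrightarrow> schwartz f \<Longrightarrow> schwartz (\<lambda>x. g x * f x)"
  by (rule slow_span_schwartz[OF slow_span.base])

lemma schwartz_cmult: "schwartz f \<Longrightarrow> schwartz (\<lambda>x. c * f x)"
  by (rule schwartz_slow_mult[OF slow.const])

lemma schwartz_add:
  assumes "schwartz f" "schwartz g"
  shows "schwartz (\<lambda>x. f x + g x)"
  using slow_span.add[OF slow_span.base[OF slow.const[of 1] assms(1)] slow_span.base[OF slow.const[of 1] assms(2)]]
  by (auto dest: slow_span_schwartz)

lemma schwartz_bounded_linear:
  assumes T: "bounded_linear (T :: complex \<Rightarrow> complex)" and "schwartz f"
  shows "schwartz (\<lambda>x. T (f x))"
proof (rule schwartzI[of _ "{\<lambda>x. T (f x) | f. schwartz f}"])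
  have D: "((\<lambda>x. T (g x)) has_derivative (\<lambda>h. T (frechet_derivative g (at x) h))) (at x)" if "schwartz g" for g x
    by (rule bounded_linear.has_derivative[OF T has_derivative_frechet[OF schwartz_differentiable[OF that]]])
  show "(\<lambda>x. T (f x)) \<in> {\<lambda>x. T (f x) | f. schwartz f}" using assms by blast
  fix g assume "g \<in> {\<lambda>x. T (f x) | f. schwartz f}"
  then obtain f where f: "schwartz f" and g: "g = (\<lambda>x. T (f x))" by blast
  show "g differentiable at x" for x using D[OF f] unfolding g differentiable_def by blast
  show "partial i g \<in> {\<lambda>x. T (f x) | f. schwartz f}" for i
  proof -
    have "partial i g = (\<lambda>x. T (partial i f x))" unfolding g
      by (rule ext, subst partial_eq, rule D[OF f]) (simp add: partial_def)
    then show ?thesis using schwartz_partial[OF f] by blast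
  qed
  fix k
  obtain K where K: "\<forall>z. norm (T z) \<le> norm z * K" using bounded_linear.bounded[OF T] by blast
  have "K \<ge> 0" using K[rule_format, of 1] order.trans[OF norm_ge_zero[of "T 1"]] by simp
  obtain C where C: "\<forall>x. norm x ^ k * norm (f x) \<le> C" using schwartz_decay[OF f] by blast
  have "norm x ^ k * norm (g x) \<le> C * K" for x
  proof -
    have "norm x ^ k * norm (g x) \<le> norm x ^ k * (norm (f x) * K)" unfolding g using K by (intro mult_left_mono) auto
    also have "\<dots> \<le> C * K" using C \<open>K \<ge> 0\<close> by (simp add: mult.assoc[symmetric] mult_right_mono)
    finally show ?thesis .
  qed
  then show "\<exists>C. \<forall>x. norm x ^ k * norm (g x) \<le> C" by blast
qed

lemma schwartz_continuous: "schwartz f \<Longrightarrow> continuous_on UNIV f"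
  by (simp add: continuous_at_imp_continuous_on differentiable_imp_continuous_within schwartz_differentiable)

lemma schwartz_measurable[measurable_dest]: "schwartz f \<Longrightarrow> f \<in> borel_measurable borel"
  by (simp add: borel_measurable_continuous_onI schwartz_continuous)

section \<open>Integrability of power functions at the origin and at infinity\<close>

section \<open>Integrability of powers\<close>

lemma emeasure_lborel_cball:
  "r \<ge> 0 \<Longrightarrow> emeasure lborel (cball (c::real^'n::finite) r) = ennreal (unit_ball_vol (real CARD('n)) * r ^ CARD('n))"
  using emeasure_cball[of r c] by (simp add: ennreal_mult)

lemma ennreal_le_suminf: "f k \<le> (\<Sum>k. f k :: ennreal)"
  using sum_le_suminf[of f "{k}"] by (simp add: summableI)

text \<open>A replacement for polar coordinates: the function is dominated by constants on
  concentric balls, and only the scaling of ball volumes enters. The radii may grow or shrink, so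
  the criterion serves both at infinity and at the origin.\<close>

lemma nn_integral_dyadic:
  fixes f :: "real^'n::finite \<Rightarrow> ennreal"
  assumes f: "\<And>x. f x \<le> (\<Sum>k. ennreal (c k) * indicator (cball 0 (R k)) x)"
    and R: "\<And>k. R k \<ge> 0" and c: "\<And>k. c k \<ge> 0" "summable (\<lambda>k. c k * R k ^ CARD('n))"
  shows "(\<integral>\<^sup>+x. f x \<partial>lborel) < \<infinity>"
proof -
  let ?V = "unit_ball_vol (real CARD('n))"
  have "(\<integral>\<^sup>+x. f x \<partial>lborel) \<le> (\<integral>\<^sup>+x. (\<Sum>k. ennreal (c k) * indicator (cball 0 (R k)) (x::real^'n)) \<partial>lborel)"
    by (intro nn_integral_mono f)
  also have "\<dots> = (\<Sum>k. \<integral>\<^sup>+x. ennreal (c k) * indicator (cball 0 (R k)) (x::real^'n) \<partial>lborel)"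
    by (rule nn_integral_suminf) (auto intro!: borel_measurable_times_ennreal borel_measurable_indicator borel_closed)
  also have "\<dots> = (\<Sum>k. ennreal (?V * (c k * R k ^ CARD('n))))"
  proof (rule suminf_cong)
    fix k
    have "(\<integral>\<^sup>+x. ennreal (c k) * indicator (cball 0 (R k)) (x::real^'n) \<partial>lborel) = ennreal (c k) * emeasure lborel (cball (0::real^'n) (R k))"
      by (subst nn_integral_cmult) (auto intro!: borel_measurable_indicator borel_closed)
    also have "\<dots> = ennreal (c k * (?V * R k ^ CARD('n)))"
      using c R by (subst emeasure_lborel_cball) (auto simp: ennreal_mult)
    finally show "(\<integral>\<^sup>+x. ennreal (c k) * indicator (cball 0 (R k)) (x::real^'n) \<partial>lborel) = ennreal (?V * (c k * R k ^ CARD('n)))"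
      by (simp only: mult.left_commute)
  qed
  also have "\<dots> < \<infinity>"
    using c R by (subst suminf_ennreal2) (auto intro!: summable_mult mult_nonneg_nonneg)
  finally show ?thesis .
qed

lemma nn_integral_powr_outside:
  assumes "a > 0"
  shows "(\<integral>\<^sup>+x. ennreal (indicator {x. 1 < norm x} x * norm x powr (- (real CARD('n) + a))) \<partial>(lborel :: (real^'n::finite) measure)) < \<infinity>"
\<comment> \<open>On the shell between radii \<open>2 ^ k\<close> and \<open>2 ^ Suc k\<close> the
  power is largest at the inner radius, and the outer radius gives the volume; the series is
  geometric with ratio \<open>2 powr (-a)\<close>.\<close>
proof (rule nn_integral_dyadic[where c="\<lambda>k. (2 ^ k) powr (- (real CARD('n) + a))" and R="\<lambda>k. 2 ^ (Suc k)"])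
  show "summable (\<lambda>k. (2 ^ k) powr - (real CARD('n) + a) * (2 ^ Suc k) ^ CARD('n))"
  proof -
    have "(2 ^ k) powr - (real CARD('n) + a) * (2 ^ Suc k) ^ CARD('n) = 2 ^ CARD('n) * (2 powr (-a)) ^ k" for k :: nat
    proof -
      have "(2 ^ k) powr - (real CARD('n) + a) = 2 powr (- (real k * real CARD('n))) * 2 powr (- (real k * a))"
        by (simp add: powr_realpow[symmetric] powr_powr algebra_simps flip: powr_add)
      moreover have "(2 ^ Suc k) ^ CARD('n) = 2 ^ CARD('n) * 2 powr (real k * real CARD('n))"
        by (simp add: powr_realpow[symmetric] powr_powr power_mult_distrib flip: powr_add)
      moreover have "(2 powr (-a)) ^ k = 2 powr (- (real k * a))"
        by (simp add: powr_realpow[symmetric] powr_powr mult_ac)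
      moreover have "2 powr (- (real k * real CARD('n))) * 2 powr (real k * real CARD('n)) = 1"
        by (simp flip: powr_add)
      ultimately show ?thesis by (simp add: mult_ac)
    qed
    moreover have "summable (\<lambda>k. 2 ^ CARD('n) * (2 powr (-a)) ^ k)"
      using assms by (intro summable_mult summable_geometric) (simp add: powr_less_one)
    ultimately show ?thesis by (simp only:)
  qed
  fix x :: "real^'n"
  show "ennreal (indicator {x. 1 < norm x} x * norm x powr - (real CARD('n) + a))
    \<le> (\<Sum>k. ennreal ((2 ^ k) powr - (real CARD('n) + a)) * indicator (cball 0 (2 ^ Suc k)) x)"
  proof (cases "1 < norm x")
    case True
    define k where "k = nat \<lfloor>log 2 (norm x)\<rfloor>"
    have x: "0 < norm x" using True by linarith
    have l: "log 2 (norm x) > 0" using True x by (subst zero_less_log_cancel_iff) auto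
    have k: "real k \<le> log 2 (norm x)" "log 2 (norm x) \<le> real (Suc k)"
      using l unfolding k_def by linarith+
    have 1: "2 powr real k \<le> norm x" using k(1) x by (subst powr_le_iff) simp_all
    have 2: "norm x \<le> 2 powr real (Suc k)" using k(2) x by (subst le_powr_iff) simp_all
    have "ennreal (indicator {x. 1 < norm x} x * norm x powr - (real CARD('n) + a))
       \<le> ennreal ((2 ^ k) powr - (real CARD('n) + a)) * indicator (cball 0 (2 ^ Suc k)) x"
    proof -
      have "norm x powr - (real CARD('n) + a) \<le> (2 ^ k) powr - (real CARD('n) + a)"
        using 1 assms by (intro powr_mono2') (auto simp: powr_realpow)
      moreover have "x \<in> cball 0 (2 ^ Suc k)" using 2 powr_realpow[of 2 "Suc k"] by simp
      ultimately show ?thesis using True by (auto intro!: ennreal_leI)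
    qed
    also have "\<dots> \<le> (\<Sum>k. ennreal ((2 ^ k) powr - (real CARD('n) + a)) * indicator (cball 0 (2 ^ Suc k)) x)"
      by (rule ennreal_le_suminf)
    finally show ?thesis .
  next
    case False
    then have "indicator {x. 1 < norm x} x * norm x powr - (real CARD('n) + a) = 0" by auto
    then show ?thesis by (simp only: ennreal_0 zero_le)
  qed
next
  show "0 \<le> (2::real) ^ Suc k" for k by (rule zero_le_power) simp
next
  show "0 \<le> (2 ^ k) powr - (real CARD('n) + a)" for k by (rule powr_ge_zero)
qed

lemma nn_integral_powr_inside:
  assumes "b > 0"
  shows "(\<integral>\<^sup>+x. ennreal (indicator {x. norm x \<le> 1} x * norm x powr (b - real CARD('n))) \<partial>(lborel :: (real^'n::finite) measure)) < \<infinity>"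
\<comment> \<open>The exponent is split on the shell between radii
  \<open>2 powr - real (Suc k)\<close> and \<open>2 powr - real k\<close>: its part minus the
  dimension is estimated at the inner radius, its part \<open>b\<close> at the outer one. This works
  for either sign of the whole exponent and leaves the ratio \<open>2 powr (-b)\<close>.\<close>
proof (rule nn_integral_dyadic[where c="\<lambda>k. 2 powr (real (Suc k) * real CARD('n)) * 2 powr (- (real k * b))" and R="\<lambda>k. 2 powr (- real k)"])
  show "summable (\<lambda>k. 2 powr (real (Suc k) * real CARD('n)) * 2 powr - (real k * b) * (2 powr - real k) ^ CARD('n))"
  proof -
    have "2 powr (real (Suc k) * real CARD('n)) * 2 powr - (real k * b) * (2 powr - real k) ^ CARD('n)
      = 2 ^ CARD('n) * (2 powr (-b)) ^ k" for k :: nat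
    proof -
      have 1: "2 powr (real (Suc k) * real CARD('n)) = 2 ^ CARD('n) * 2 powr (real k * real CARD('n))"
        by (simp add: distrib_right powr_add powr_realpow)
      have 2: "(2 powr - real k) ^ CARD('n) = 2 powr (- (real k * real CARD('n)))"
        using powr_realpow[of "2 powr - real k" "CARD('n)"] powr_powr[of 2 "- real k" "real CARD('n)"] by simp
      have 3: "(2 powr (-b)) ^ k = 2 powr (- (real k * b))"
        using powr_realpow[of "2 powr - b" k] powr_powr[of 2 "- b" "real k"] by (simp add: mult.commute)
      have 4: "2 powr (- (real k * real CARD('n))) * 2 powr (real k * real CARD('n)) = 1"
        by (simp flip: powr_add)
      show ?thesis unfolding 1 2 3 using 4 by (simp add: mult_ac)
    qed
    moreover have "summable (\<lambda>k. 2 ^ CARD('n) * (2 powr (-b)) ^ k)"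
      using assms by (intro summable_mult summable_geometric) (simp add: powr_less_one)
    ultimately show ?thesis by (simp only:)
  qed
  fix x :: "real^'n"
  show "ennreal (indicator {x. norm x \<le> 1} x * norm x powr (b - real CARD('n)))
    \<le> (\<Sum>k. ennreal (2 powr (real (Suc k) * real CARD('n)) * 2 powr - (real k * b)) * indicator (cball 0 (2 powr - real k)) x)"
  proof (cases "norm x \<le> 1 \<and> x \<noteq> 0")
    case True
    define k where "k = nat \<lfloor>- log 2 (norm x)\<rfloor>"
    have l: "- log 2 (norm x) \<ge> 0" using True by simp
    have 1: "norm x \<le> 2 powr (- real k)" using True l unfolding k_def
      by (subst le_powr_iff) (auto, linarith)
    have 2: "2 powr (- real (Suc k)) \<le> norm x" using True l unfolding k_def
      by (subst powr_le_iff) (auto, linarith)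
    have 3: "norm x powr (b - real CARD('n)) \<le> 2 powr (real (Suc k) * real CARD('n)) * 2 powr - (real k * b)"
    proof -
      have "norm x powr (b - real CARD('n)) = norm x powr (- real CARD('n)) * norm x powr b"
        using True by (simp flip: powr_add)
      also have "\<dots> \<le> (2 powr (- real (Suc k))) powr (- real CARD('n)) * (2 powr (- real k)) powr b"
        using 1 2 True assms by (intro mult_mono powr_mono2' powr_mono2) auto
      also have "\<dots> = 2 powr (real (Suc k) * real CARD('n)) * 2 powr - (real k * b)"
        unfolding powr_powr by (simp add: algebra_simps)
      finally show ?thesis .
    qed
    have "ennreal (indicator {x. norm x \<le> 1} x * norm x powr (b - real CARD('n)))
       \<le> ennreal (2 powr (real (Suc k) * real CARD('n)) * 2 powr - (real k * b)) * indicator (cball 0 (2 powr - real k)) x"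
      using 1 3 True by (simp add: ennreal_leI)
    also have "\<dots> \<le> (\<Sum>k. ennreal (2 powr (real (Suc k) * real CARD('n)) * 2 powr - (real k * b)) * indicator (cball 0 (2 powr - real k)) x)"
      by (rule ennreal_le_suminf)
    finally show ?thesis .
  next
    \<comment> \<open>The point is outside the unit ball or is the origin, where
      \<open>0 powr c\<close> is 0 by convention.\<close>
    case False
    then have "indicator {x. norm x \<le> 1} x * norm x powr (b - real CARD('n)) = 0" by auto
    then show ?thesis by (simp only: ennreal_0 zero_le)
  qed
next
  show "0 \<le> (2::real) powr - real k" for k by (rule powr_ge_zero)
next
  show "0 \<le> 2 powr (real (Suc k) * real CARD('n)) * 2 powr - (real k * b)" for k
    by (intro mult_nonneg_nonneg powr_ge_zero)
qed

text \<open>The integrable majorant of Schwartz functions: its exponent is the first integer beyond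
  the dimension.\<close>

definition dec :: "real^'n::finite \<Rightarrow> real" where
  "dec x = 1 / (1 + norm x) ^ (CARD('n) + 1)"

lemma dec_nonneg: "0 \<le> dec x" by (simp add: dec_def)

lemma dec_measurable[measurable]: "dec \<in> borel_measurable borel"
  unfolding dec_def[abs_def] by measurable

lemma integrable_dec: "integrable lborel (dec :: real^'n::finite \<Rightarrow> real)"
proof (rule integrableI_bounded)
  have "(\<integral>\<^sup>+x. ennreal (norm (dec x)) \<partial>(lborel :: (real^'n) measure)) \<le>
     (\<integral>\<^sup>+x. indicator (cball 0 1) x + ennreal (indicator {x. 1 < norm x} x * norm x powr (- (real CARD('n) + 1))) \<partial>(lborel :: (real^'n) measure))"
  proof (rule nn_integral_mono)
    fix x :: "real^'n"
    show "ennreal (norm (dec x)) \<le> indicator (cball 0 1) x + ennreal (indicator {x. 1 < norm x} x * norm x powr (- (real CARD('n) + 1)))"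
    proof (cases "1 < norm x")
      case True
      have "dec x \<le> 1 / norm x ^ (CARD('n) + 1)" unfolding dec_def
        using True by (intro divide_left_mono power_mono mult_pos_pos zero_less_power) auto
      also have "\<dots> = norm x powr (- (real CARD('n) + 1))"
      proof -
        have "norm x powr (real CARD('n) + 1) = norm x ^ (CARD('n) + 1)"
          using True powr_realpow[of "norm x" "CARD('n) + 1"]
          less_trans[OF zero_less_one True] by (simp add: add.commute del: zero_less_norm_iff)
        then show ?thesis unfolding powr_minus by (simp add: inverse_eq_divide)
      qed
      finally show ?thesis using True by (auto simp: dec_nonneg ennreal_leI)
    next
      case False
      have "dec x \<le> 1" unfolding dec_def
        using one_le_power[of "1 + norm x" "CARD('n) + 1"] by (intro divide_le_eq_1[THEN iffD2]) auto
      then show ?thesis using False by (simp add: dec_nonneg ennreal_le_1)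
    qed
  qed
  also have "\<dots> = (\<integral>\<^sup>+x. indicator (cball 0 1) (x::real^'n) \<partial>lborel) + (\<integral>\<^sup>+x. ennreal (indicator {x. 1 < norm x} x * norm x powr (- (real CARD('n) + 1))) \<partial>(lborel :: (real^'n) measure))"
    by (rule nn_integral_add) (auto intro!: borel_measurable_indicator borel_closed)
  also have "\<dots> < \<infinity>"
    using nn_integral_powr_outside[of 1, where 'n='n] by (simp add: emeasure_lborel_cball)
  finally show "(\<integral>\<^sup>+x. ennreal (norm (dec x)) \<partial>(lborel :: (real^'n) measure)) < \<infinity>" .
qed measurable

lemma schwartz_le_dec:
  assumes "schwartz (f :: real^'n::finite \<Rightarrow> complex)"
  shows "\<exists>C\<ge>0. \<forall>x. norm (f x) \<le> C * dec x"
proof -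
  obtain C where C: "C \<ge> 0" "\<forall>x. (1 + norm x) ^ (CARD('n) + 1) * norm (f x) \<le> C"
    using schwartz_decay_strong[OF assms] by blast
  have "norm (f x) \<le> C * dec x" for x
  proof -
    have "0 < (1 + norm x) ^ (CARD('n) + 1)" by (intro zero_less_power add_pos_nonneg) auto
    then show ?thesis using C(2)[rule_format, of x] unfolding dec_def
      by (simp add: pos_le_divide_eq mult.commute del: power_Suc)
  qed
  then show ?thesis using C(1) by blast
qed

lemma schwartz_integrable:
  assumes "schwartz f"
  shows "integrable lborel f"
proof -
  obtain C where C: "C \<ge> 0" "\<forall>x. norm (f x) \<le> C * dec x" using schwartz_le_dec[OF assms] by blast
  note [measurable] = schwartz_measurable[OF assms]
  have "integrable lborel (\<lambda>x. C * dec x)" by (rule integrable_mult_right[OF integrable_dec])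
  then show ?thesis by (rule Bochner_Integration.integrable_bound) (use C in \<open>auto simp: dec_nonneg\<close>)
qed

section \<open>Derivatives and decay of Fourier transforms of Schwartz functions\<close>

section \<open>The Fourier transform of Schwartz functions\<close>

lemma fourier_cis: "fourier f xi = (LINT x|lborel. cis (- 2 * pi * (x \<bullet> xi)) * f x)"
  unfolding fourier_def by (simp add: cis_conv_exp mult_ac)

lemma inv_fourier_cis: "inv_fourier f xi = (LINT x|lborel. cis (2 * pi * (x \<bullet> xi)) * f x)"
  unfolding inv_fourier_def by (simp add: cis_conv_exp mult_ac inner_commute)

lemma inv_fourier_eq: "inv_fourier f xi = fourier f (- xi)"
  unfolding fourier_cis inv_fourier_cis by simp

lemma cis_measurable[measurable (raw)]: "f \<in> borel_measurable M \<Longrightarrow> (\<lambda>x. cis (f x)) \<in> borel_measurable M"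
  by (rule borel_measurable_continuous_on[OF _ ]) (auto intro!: continuous_intros simp: cis_conv_exp)

lemma integrable_cis_mult:
  assumes "integrable lborel f" "g \<in> borel_measurable borel"
  shows "integrable lborel (\<lambda>x. cis (g x) * f x)"
proof -
  have [measurable]: "f \<in> borel_measurable borel" "g \<in> borel_measurable borel" using assms by auto
  show ?thesis
    by (rule Bochner_Integration.integrable_bound[OF assms(1)]) (auto simp: norm_mult)
qed

lemma norm_fourier_le: "norm (fourier f xi) \<le> (LINT x|lborel. norm (f x))"
  unfolding fourier_cis by (rule order.trans[OF integral_norm_bound]) (simp add: norm_mult)

lemma fourier_cmult: "fourier (\<lambda>x. c * f x) xi = c * fourier f xi"
  unfolding fourier_cis by (simp add: mult.left_commute[of _ c])

lemma fourier_add: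
  "integrable lborel f \<Longrightarrow> integrable lborel g \<Longrightarrow> fourier (\<lambda>x. f x + g x) xi = fourier f xi + fourier g xi"
  unfolding fourier_cis by (simp add: distrib_left integrable_cis_mult)

lemma has_derivativeI_quadratic:
  fixes f :: "'a::real_normed_vector \<Rightarrow> 'b::real_normed_vector"
  assumes "bounded_linear D" and le: "\<And>h. norm (f (x + h) - f x - D h) \<le> K * (norm h)\<^sup>2"
  shows "(f has_derivative D) (at x)"
  unfolding has_derivative_at
proof (intro conjI assms(1))
  have "((\<lambda>h. K * norm h) \<longlongrightarrow> 0) (at (0::'a))"
    by (auto intro!: tendsto_eq_intros)
  then show "(\<lambda>h. norm (f (x + h) - f x - D h) / norm h) \<midarrow>0\<rightarrow> 0"
  proof (rule Lim_null_comparison[rotated])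
    show "\<forall>\<^sub>F h in at 0. norm (norm (f (x + h) - f x - D h) / norm h) \<le> K * norm h"
      using le by (auto simp: eventually_at_filter divide_le_eq power2_eq_square mult.assoc)
  qed
qed

lemma norm_cis_minus_linear: "norm (cis t - 1 - \<i> * of_real t) \<le> t\<^sup>2 / 2"
  using iexp_approx1[of t 1] by (simp add: cis_conv_exp algebra_simps power2_eq_square numeral_2_eq_2)

lemma schwartz_coord_mult: "schwartz f \<Longrightarrow> schwartz (\<lambda>x. of_real (x $ i) * f x)"
  by (rule schwartz_slow_mult[OF slow.coord])

lemma integrable_norm_square_schwartz:
  assumes "schwartz f"
  shows "integrable lborel (\<lambda>x. (norm x)\<^sup>2 * norm (f x))"
proof -
  have "integrable lborel (\<lambda>x. \<Sum>i\<in>UNIV. norm (of_real (x $ i) * (of_real (x $ i) * f x)))"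
    by (intro Bochner_Integration.integrable_sum integrable_norm schwartz_integrable schwartz_coord_mult assms)
  moreover have "(\<Sum>i\<in>UNIV. norm (of_real (x $ i) * (of_real (x $ i) * f x))) = (norm x)\<^sup>2 * norm (f x)" for x
    by (simp add: norm_mult norm_vec_def L2_set_def sum_nonneg sum_distrib_right power2_eq_square
        mult.assoc[symmetric] flip: abs_mult)
  ultimately show ?thesis by simp
qed

text \<open>The first-order Taylor remainder of the character is at most half the square of the
  phase increment \<open>q\<close>, hence at most 2 pi^2 |x|^2 |h|^2. The second moment of f is
  finite, so the remainder of the transform is quadratic in h.\<close>

lemma fourier_has_derivative:
  assumes f: "schwartz (f :: real^'n::finite \<Rightarrow> complex)"
  shows "(fourier f has_derivative (\<lambda>h. \<Sum>i\<in>UNIV. (h $ i) *\<^sub>R fourier (\<lambda>x. - 2 * pi * \<i> * (of_real (x $ i) * f x)) xi)) (at xi)"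
    (is "(_ has_derivative ?D) _")
proof (rule has_derivativeI_quadratic)
  show "bounded_linear ?D"
    by (intro bounded_linear_sum bounded_linear_scaleR_const bounded_linear_vec_nth)
  fix h :: "real^'n"
  define q where "q x = - 2 * pi * (x \<bullet> h)" for x
  have int: "integrable lborel f" using schwartz_integrable[OF f] .
  have intc: "integrable lborel (\<lambda>x. of_real (x $ i) * f x)" for i
    by (intro schwartz_integrable schwartz_coord_mult f)
  have D: "?D h = (LINT x|lborel. cis (- 2 * pi * (x \<bullet> xi)) * (\<i> * of_real (q x)) * f x)"
  proof -
    have "?D h = (\<Sum>i\<in>UNIV. LINT x|lborel. (h $ i) *\<^sub>R (cis (- 2 * pi * (x \<bullet> xi)) * (- 2 * pi * \<i> * (of_real (x $ i) * f x))))"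
      unfolding fourier_cis by simp
    also have "\<dots> = (LINT x|lborel. (\<Sum>i\<in>UNIV. (h $ i) *\<^sub>R (cis (- 2 * pi * (x \<bullet> xi)) * (- 2 * pi * \<i> * (of_real (x $ i) * f x)))))"
      by (rule Bochner_Integration.integral_sum[symmetric])
        (intro integrable_scaleR_right integrable_cis_mult integrable_mult_right intc, measurable)
    also have "\<dots> = (LINT x|lborel. cis (- 2 * pi * (x \<bullet> xi)) * (\<i> * of_real (q x)) * f x)"
    proof (rule Bochner_Integration.integral_cong[OF refl])
      fix x
      have "(\<Sum>i\<in>UNIV. (h $ i) *\<^sub>R (cis (- 2 * pi * (x \<bullet> xi)) * (- 2 * pi * \<i> * (of_real (x $ i) * f x))))
        = cis (- 2 * pi * (x \<bullet> xi)) * \<i> * (-2 * pi) * f x * of_real (\<Sum>i\<in>UNIV. h $ i * x $ i)"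
        by (simp add: sum_distrib_left scaleR_conv_of_real sum_negf mult_ac)
      also have "(\<Sum>i\<in>UNIV. h $ i * x $ i) = x \<bullet> h" by (simp add: inner_vec_def mult.commute)
      finally show "(\<Sum>i\<in>UNIV. (h $ i) *\<^sub>R (cis (- 2 * pi * (x \<bullet> xi)) * (- 2 * pi * \<i> * (of_real (x $ i) * f x))))
        = cis (- 2 * pi * (x \<bullet> xi)) * (\<i> * of_real (q x)) * f x" by (simp add: q_def mult_ac)
    qed
    finally show ?thesis .
  qed
  have intq: "integrable lborel (\<lambda>x. cis (- 2 * pi * (x \<bullet> xi)) * (\<i> * of_real (q x)) * f x)"
  proof -
    have "integrable lborel (\<lambda>x. \<Sum>i\<in>UNIV. (-2*pi*h$i) *\<^sub>R (cis (- 2 * pi * (x \<bullet> xi)) * (\<i> * (of_real (x $ i) * f x))))"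
      by (intro Bochner_Integration.integrable_sum integrable_scaleR_right integrable_cis_mult integrable_mult_right intc) measurable
    also have "(\<lambda>x. \<Sum>i\<in>UNIV. (-2*pi*h$i) *\<^sub>R (cis (- 2 * pi * (x \<bullet> xi)) * (\<i> * (of_real (x $ i) * f x)))) =
      (\<lambda>x. cis (- 2 * pi * (x \<bullet> xi)) * (\<i> * of_real (q x)) * f x)"
      by (simp add: q_def inner_vec_def sum_distrib_left sum_distrib_right scaleR_conv_of_real mult_ac fun_eq_iff sum_negf)
    finally show ?thesis .
  qed
  have "fourier f (xi + h) - fourier f xi - ?D h =
    (LINT x|lborel. cis (- 2 * pi * (x \<bullet> (xi + h))) * f x - cis (- 2 * pi * (x \<bullet> xi)) * f x
       - cis (- 2 * pi * (x \<bullet> xi)) * (\<i> * of_real (q x)) * f x)"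
    unfolding D unfolding fourier_cis
    by (subst Bochner_Integration.integral_diff[OF _ intq], intro Bochner_Integration.integrable_diff integrable_cis_mult int)
      (auto intro!: Bochner_Integration.integral_diff[symmetric] integrable_cis_mult int)
  also have "\<dots> = (LINT x|lborel. cis (- 2 * pi * (x \<bullet> xi)) * (cis (q x) - 1 - \<i> * of_real (q x)) * f x)"
  proof (rule Bochner_Integration.integral_cong[OF refl])
    fix x
    have "cis (- 2 * pi * (x \<bullet> (xi + h))) = cis (- 2 * pi * (x \<bullet> xi)) * cis (q x)"
      unfolding cis_mult q_def by (simp add: inner_add_right distrib_left)
    then show "cis (- 2 * pi * (x \<bullet> (xi + h))) * f x - cis (- 2 * pi * (x \<bullet> xi)) * f x
       - cis (- 2 * pi * (x \<bullet> xi)) * (\<i> * of_real (q x)) * f x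
       = cis (- 2 * pi * (x \<bullet> xi)) * (cis (q x) - 1 - \<i> * of_real (q x)) * f x"
      by (simp only:) (simp add: algebra_simps)
  qed
  also have "norm \<dots> \<le> (LINT x|lborel. 2 * pi\<^sup>2 * (norm h)\<^sup>2 * ((norm x)\<^sup>2 * norm (f x)))"
  proof (rule order.trans[OF integral_norm_bound integral_mono'])
    show "integrable lborel (\<lambda>x. 2 * pi\<^sup>2 * (norm h)\<^sup>2 * ((norm x)\<^sup>2 * norm (f x)))"
      by (intro integrable_mult_right integrable_norm_square_schwartz f)
    fix x
    have "(q x)\<^sup>2 \<le> (2 * pi * (norm x * norm h))\<^sup>2"
      unfolding q_def using Cauchy_Schwarz_ineq2[of x h]
      by (intro abs_le_square_iff[THEN iffD1]) (simp add: abs_mult)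
    then have "norm (cis (q x) - 1 - \<i> * of_real (q x)) \<le> 2 * pi\<^sup>2 * ((norm h)\<^sup>2 * (norm x)\<^sup>2)"
      using norm_cis_minus_linear[of "q x"] by (simp add: power_mult_distrib mult_ac)
    then show "norm (cis (- 2 * pi * (x \<bullet> xi)) * (cis (q x) - 1 - \<i> * of_real (q x)) * f x) \<le> 2 * pi\<^sup>2 * (norm h)\<^sup>2 * ((norm x)\<^sup>2 * norm (f x))"
      by (simp add: norm_mult mult_right_mono flip: mult.assoc)
  qed auto
  also have "\<dots> = (2 * pi\<^sup>2 * (LINT x|lborel. (norm x)\<^sup>2 * norm (f x))) * (norm h)\<^sup>2"
    by (subst integral_mult_right_zero) (simp only: mult_ac)
  finally show "norm (fourier f (xi + h) - fourier f xi - ?D h) \<le> (2 * pi\<^sup>2 * (LINT x|lborel. (norm x)\<^sup>2 * norm (f x))) * (norm h)\<^sup>2" .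
qed

lemma partial_fourier:
  assumes "schwartz f"
  shows "partial i (fourier f) = fourier (\<lambda>x. - 2 * pi * \<i> * (of_real (x $ i) * f x))"
proof
  fix xi
  have "(\<Sum>j\<in>UNIV. (axis i 1 $ j) *\<^sub>R c j) = (c i :: complex)" for c
    by (simp add: axis_def if_distrib[where f="\<lambda>a. a *\<^sub>R _"] cong: if_cong)
  then show "partial i (fourier f) xi = fourier (\<lambda>x. - 2 * pi * \<i> * (of_real (x $ i) * f x)) xi"
    by (subst partial_eq[OF fourier_has_derivative[OF assms]])
qed

lemma dec_shift:
  assumes "norm h \<le> 1"
  shows "dec (x + h) \<le> 2 ^ (CARD('n) + 1) * dec (x::real^'n::finite)"
proof -
  have "1 + norm x \<le> 2 * (1 + norm (x + h))"
    using norm_triangle_ineq4[of "x + h" h] assms by (simp add: algebra_simps) (smt (verit) norm_ge_zero)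
  then have "(1 + norm x) ^ (CARD('n) + 1) \<le> 2 ^ (CARD('n) + 1) * (1 + norm (x + h)) ^ (CARD('n) + 1)"
    by (subst power_mult_distrib[symmetric]) (intro power_mono, auto)
  then show ?thesis unfolding dec_def
    by (simp add: field_simps add_pos_nonneg del: power_Suc)
qed

lemma partial_directional:
  assumes "f differentiable at (x + t *\<^sub>R axis i 1)"
  shows "((\<lambda>t. f (x + t *\<^sub>R axis i 1)) has_vector_derivative partial i f (x + t *\<^sub>R axis i 1)) (at t)"
proof -
  have "((\<lambda>t. x + t *\<^sub>R axis i 1) has_derivative (\<lambda>h. h *\<^sub>R axis i 1)) (at t)"
    by (auto intro!: derivative_eq_intros)
  from has_derivative_compose[OF this has_derivative_frechet[OF assms]]
  have "((\<lambda>t. f (x + t *\<^sub>R axis i 1)) has_derivative (\<lambda>h. frechet_derivative f (at (x + t *\<^sub>R axis i 1)) (h *\<^sub>R axis i 1))) (at t)" .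
  moreover have "frechet_derivative f (at (x + t *\<^sub>R axis i 1)) (h *\<^sub>R axis i 1) = h *\<^sub>R partial i f (x + t *\<^sub>R axis i 1)" for h
    unfolding partial_def using linear_frechet_derivative[OF assms] by (simp add: linear_cmul)
  ultimately show ?thesis by (simp add: has_vector_derivative_def)
qed

lemma lborel_integral_shift:
  fixes f :: "real^'n::finite \<Rightarrow> 'b::{banach, second_countable_topology}"
  assumes [measurable]: "f \<in> borel_measurable borel"
  shows "(LINT x|lborel. f (x + a)) = (LINT x|lborel. f x)"
proof -
  have "(LINT x|lborel. f x) = (LINT x|distr lborel borel ((+) a). f x)" by (simp add: lborel_distr_plus)
  also have "\<dots> = (LINT x|lborel. f (a + x))" by (rule integral_distr) auto
  finally show ?thesis by (simp add: add.commute)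
qed

lemma integrable_shift:
  fixes f :: "real^'n::finite \<Rightarrow> 'b::{banach, second_countable_topology}"
  assumes "integrable lborel f"
  shows "integrable lborel (\<lambda>x. f (x + a))"
proof -
  have [measurable]: "f \<in> borel_measurable borel" using assms by auto
  have "integrable (distr lborel borel ((+) a)) f" using assms by (simp add: lborel_distr_plus)
  then show ?thesis by (subst (asm) integrable_distr_eq) (auto simp: add.commute)
qed

text \<open>By translation invariance every difference quotient of f along an axis has integral 0.
  The quotients converge to the partial derivative under an integrable majorant, so its integral is
  0 as well.\<close>

lemma integral_partial_zero:
  assumes f: "schwartz (f :: real^'n::finite \<Rightarrow> complex)"
  shows "(LINT x|lborel. partial i f x) = 0"
proof -
  define e where "e = (axis i 1 :: real^'n)"
  \<comment> \<open>Step sizes of at most 1 let \<open>dec_shift\<close> bound all difference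
    quotients by one multiple of \<open>dec\<close>.\<close>
  define t where "t k = 1 / real (Suc k)" for k
  have t: "0 < t k" "t k \<le> 1" for k unfolding t_def by auto
  note [measurable] = schwartz_measurable[OF f] schwartz_measurable[OF schwartz_partial[OF f]]
  obtain C where C: "C \<ge> 0" "\<forall>x. norm (partial i f x) \<le> C * dec x"
    using schwartz_le_dec[OF schwartz_partial[OF f]] by blast
  have "(\<lambda>k. LINT x|lborel. (f (x + t k *\<^sub>R e) - f x) /\<^sub>R t k) \<longlonglongrightarrow> (LINT x|lborel. partial i f x)"
  proof (rule integral_dominated_convergence)
    show "integrable lborel (\<lambda>x. C * (2 ^ (CARD('n) + 1) * dec (x::real^'n)))"
      by (intro integrable_mult_right integrable_dec)
    show "AE x in lborel. (\<lambda>k. (f (x + t k *\<^sub>R e) - f x) /\<^sub>R t k) \<longlonglongrightarrow> partial i f x"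
    proof (rule AE_I2)
      fix x :: "real^'n"
      have "((\<lambda>s. f (x + s *\<^sub>R e)) has_vector_derivative partial i f (x + 0 *\<^sub>R e)) (at 0)"
        unfolding e_def by (rule partial_directional[OF schwartz_differentiable[OF f]])
      then have "(\<lambda>s. norm (f (x + s *\<^sub>R e) - f x - s *\<^sub>R partial i f x) / norm s) \<midarrow>0\<rightarrow> 0"
        by (simp add: has_vector_derivative_def has_derivative_at)
      then have "(\<lambda>s. norm ((f (x + s *\<^sub>R e) - f x) /\<^sub>R s - partial i f x)) \<midarrow>0\<rightarrow> 0"
      proof (rule Lim_transform_eventually)
        have "norm (f (x + s *\<^sub>R e) - f x - s *\<^sub>R partial i f x) / norm s = norm ((f (x + s *\<^sub>R e) - f x) /\<^sub>R s - partial i f x)"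
          if "s \<noteq> 0" for s
        proof -
          have "(f (x + s *\<^sub>R e) - f x) /\<^sub>R s - partial i f x = (f (x + s *\<^sub>R e) - f x - s *\<^sub>R partial i f x) /\<^sub>R s"
            using that by (simp add: scaleR_diff_right)
          then show ?thesis by (simp add: divide_inverse mult.commute)
        qed
        then show "\<forall>\<^sub>F s in at 0. norm (f (x + s *\<^sub>R e) - f x - s *\<^sub>R partial i f x) / norm s = norm ((f (x + s *\<^sub>R e) - f x) /\<^sub>R s - partial i f x)"
          by (auto simp: eventually_at_filter)
      qed
      then have "(\<lambda>s. (f (x + s *\<^sub>R e) - f x) /\<^sub>R s) \<midarrow>0\<rightarrow> partial i f x"
        by (simp only: tendsto_norm_zero_iff LIM_zero_iff)
      moreover have "filterlim t (at 0) sequentially"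
        unfolding t_def filterlim_at using LIMSEQ_inverse_real_of_nat by (auto simp: inverse_eq_divide)
      ultimately show "(\<lambda>k. (f (x + t k *\<^sub>R e) - f x) /\<^sub>R t k) \<longlonglongrightarrow> partial i f x"
        by (rule filterlim_compose)
    qed
    show "AE x in lborel. norm ((f (x + t k *\<^sub>R e) - f x) /\<^sub>R t k) \<le> C * (2 ^ (CARD('n) + 1) * dec x)" for k
    proof (rule AE_I2)
      fix x :: "real^'n"
      let ?B = "C * (2 ^ (CARD('n) + 1) * dec x)"
      have "norm (f (x + t k *\<^sub>R e) - f (x + 0 *\<^sub>R e)) \<le> ?B * norm (t k - 0)"
      proof (rule differentiable_bound[where S="{0..t k}" and f="\<lambda>s. f (x + s *\<^sub>R e)" and f'="\<lambda>s h. h *\<^sub>R partial i f (x + s *\<^sub>R e)"])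
        fix s assume s: "s \<in> {0..t k}"
        show "((\<lambda>s. f (x + s *\<^sub>R e)) has_derivative (\<lambda>h. h *\<^sub>R partial i f (x + s *\<^sub>R e))) (at s within {0..t k})"
          using partial_directional[OF schwartz_differentiable[OF f], where x=x and t=s and i=i]
          unfolding e_def has_vector_derivative_def by (rule has_derivative_at_withinI)
        have "norm (s *\<^sub>R e) \<le> 1" using s t(2)[of k] by (simp add: e_def)
        then have "norm (partial i f (x + s *\<^sub>R e)) \<le> ?B"
          using C(2)[rule_format, of "x + s *\<^sub>R e"] mult_left_mono[OF dec_shift[of "s *\<^sub>R e" x] C(1)] by linarith
        then show "onorm (\<lambda>h. h *\<^sub>R partial i f (x + s *\<^sub>R e)) \<le> ?B"
          by (intro onorm_le) (simp add: mult.commute mult_left_mono)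
      qed (use t[of k] in auto)
      then show "norm ((f (x + t k *\<^sub>R e) - f x) /\<^sub>R t k) \<le> ?B"
        using t(1)[of k] by (simp add: pos_divide_le_eq divide_inverse_commute[symmetric] mult.commute del: scaleR_right_diff_distrib)
    qed
  qed measurable
  moreover have "(LINT x|lborel. (f (x + t k *\<^sub>R e) - f x) /\<^sub>R t k) = 0" for k
    using schwartz_integrable[OF f] by (simp add: integrable_shift lborel_integral_shift)
  ultimately have "(\<lambda>k. 0) \<longlonglongrightarrow> (LINT x|lborel. partial i f x)" by (simp only:)
  then show ?thesis by (simp add: LIMSEQ_const_iff)
qed

text \<open>Integration by parts: the derivative of f times the character \<open>w\<close> has
  integral 0.\<close>

lemma fourier_partial:
  assumes f: "schwartz f"
  shows "fourier (partial i f) xi = 2 * pi * \<i> * of_real (xi $ i) * fourier f xi"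
proof -
  define w where "w x = cis (((-2 * pi) *\<^sub>R xi) \<bullet> x)" for x :: "real^'a"
  have w: "w x = cis (- 2 * pi * (x \<bullet> xi))" for x unfolding w_def by (simp add: inner_commute)
  have sw: "slow w" unfolding w_def[abs_def] by (rule slow.wave)
  have pw: "partial i w x = - 2 * pi * \<i> * of_real (xi $ i) * w x" for x
    unfolding w_def[abs_def] by (subst partial_eq[OF has_derivative_wave]) (simp add: inner_axis_1)
  have "0 = (LINT x|lborel. partial i (\<lambda>x. w x * f x) x)"
    using integral_partial_zero[OF schwartz_slow_mult[OF sw f]] by simp
  also have "\<dots> = (LINT x|lborel. w x * partial i f x + (- 2 * pi * \<i> * of_real (xi $ i)) * (w x * f x))"
    by (intro Bochner_Integration.integral_cong refl)
      (simp only: partial_mult[OF slow_differentiable[OF sw] schwartz_differentiable[OF f]] pw mult.assoc)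
  also have "\<dots> = fourier (partial i f) xi + (- 2 * pi * \<i> * of_real (xi $ i)) * fourier f xi"
    unfolding fourier_cis w[symmetric]
    by (subst Bochner_Integration.integral_add)
      (auto intro!: schwartz_integrable schwartz_slow_mult sw f schwartz_partial integrable_mult_right)
  finally show ?thesis by (simp add: algebra_simps eq_neg_iff_add_eq_0)
qed

text \<open>The transforms of Schwartz functions are closed under partial derivatives, since
  differentiation corresponds to multiplying f by a coordinate. For decay, each power of the norm is
  paid for by one derivative of f, so the induction on the power runs over all f at once.\<close>

lemma schwartz_fourier:
  assumes "schwartz f"
  shows "schwartz (fourier f)"
proof (rule schwartzI[of _ "{fourier f | f. schwartz f}"])
  show "fourier f \<in> {fourier f | f. schwartz f}" using assms by blast
  fix g assume "g \<in> {fourier f | f. schwartz f}"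
  then obtain f where f: "schwartz f" and g: "g = fourier f" by blast
  show "g differentiable at x" for x using fourier_has_derivative[OF f] unfolding g differentiable_def by blast
  show "partial i g \<in> {fourier f | f. schwartz f}" for i
    unfolding g partial_fourier[OF f] using schwartz_cmult[OF schwartz_coord_mult[OF f]] by blast
  have "schwartz f \<Longrightarrow> \<exists>C. \<forall>x. norm x ^ k * norm (fourier f x) \<le> C" for f k
  proof (induction k arbitrary: f)
    case 0
    show ?case using norm_fourier_le[of f] by auto
  next
    case (Suc k)
    have "\<forall>i. \<exists>C. \<forall>x. norm x ^ k * norm (fourier (partial i f) x) \<le> C"
      using Suc.IH[OF schwartz_partial[OF Suc.prems]] by blast
    then obtain C where C: "\<And>i x. norm x ^ k * norm (fourier (partial i f) x) \<le> C i" by metis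
    have "norm x ^ Suc k * norm (fourier f x) \<le> (\<Sum>i\<in>UNIV. C i)" for x
    proof -
      have "norm x ^ Suc k * norm (fourier f x) \<le> (\<Sum>i\<in>UNIV. \<bar>x $ i\<bar>) * (norm x ^ k * norm (fourier f x))"
        using norm_le_l1_cart[of x] by (simp add: mult.assoc mult_right_mono)
      also have "\<dots> = (\<Sum>i\<in>UNIV. norm x ^ k * (\<bar>x $ i\<bar> * norm (fourier f x)))"
        by (simp add: sum_distrib_right sum_distrib_left mult_ac)
      also have "\<dots> \<le> (\<Sum>i\<in>UNIV. C i)"
      proof (rule sum_mono)
        fix i
        have "\<bar>x $ i\<bar> * norm (fourier f x) \<le> norm (fourier (partial i f) x)"
          unfolding fourier_partial[OF Suc.prems] using pi_gt3 mult_right_mono[of 1 "2 * pi" "\<bar>x $ i\<bar> * norm (fourier f x)"]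
          by (simp add: norm_mult abs_mult mult_ac)
        then have "norm x ^ k * (\<bar>x $ i\<bar> * norm (fourier f x)) \<le> norm x ^ k * norm (fourier (partial i f) x)"
          by (intro mult_left_mono) auto
        then show "norm x ^ k * (\<bar>x $ i\<bar> * norm (fourier f x)) \<le> C i" using C order.trans by blast
      qed
      finally show ?thesis .
    qed
    then show ?case by blast
  qed
  then show "\<exists>C. \<forall>x. norm x ^ k * norm (g x) \<le> C" for k unfolding g using f by blast
qed

lemma fourier_multiplication_formula:
  assumes "integrable lborel f" "integrable lborel g"
  shows "(LINT x|lborel. fourier f x * g x) = (LINT x|lborel. f x * fourier g x)"
proof -
  have [measurable]: "f \<in> borel_measurable borel" "g \<in> borel_measurable borel" using assms by auto
  have int: "integrable (lborel \<Otimes>\<^sub>M lborel) (\<lambda>(x, y). cis (- 2 * pi * (x \<bullet> y)) * f y * g x)"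
  proof (rule lborel_pair.Fubini_integrable)
    have "integrable lborel (\<lambda>x. (LINT y|lborel. norm (f y)) * norm (g x))"
      by (intro integrable_mult_right integrable_norm assms)
    then show "integrable lborel (\<lambda>x. LINT y|lborel. norm (case (x, y) of (x, y) \<Rightarrow> cis (- 2 * pi * (x \<bullet> y)) * f y * g x))"
      by (simp add: norm_mult)
    show "AE x in lborel. integrable lborel (\<lambda>y. case (x, y) of (x, y) \<Rightarrow> cis (- 2 * pi * (x \<bullet> y)) * f y * g x)"
      by (auto intro!: integrable_mult_left integrable_cis_mult assms)
  qed measurable
  have "(LINT x|lborel. fourier f x * g x) = (LINT x|lborel. LINT y|lborel. cis (- 2 * pi * (x \<bullet> y)) * f y * g x)"
    unfolding fourier_cis by (simp add: inner_commute)
  also have "\<dots> = (LINT y|lborel. LINT x|lborel. cis (- 2 * pi * (x \<bullet> y)) * f y * g x)"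
    using lborel_pair.Fubini_integral[OF int] by simp
  also have "\<dots> = (LINT y|lborel. f y * fourier g y)"
    unfolding fourier_cis by (simp add: mult_ac flip: integral_mult_right_zero)
  finally show ?thesis .
qed

section \<open>Gaussians, Fourier inversion and separation of functions by test functions\<close>

section \<open>Gaussians and Fourier inversion\<close>

definition gauss :: "real^'n::finite \<Rightarrow> real" where
  "gauss x = exp (- pi * (norm x)\<^sup>2)"

lemma gauss_pos: "0 < gauss x" by (simp add: gauss_def)

lemma gauss_le_1: "gauss x \<le> 1" by (simp add: gauss_def)

lemma gauss_measurable[measurable]: "gauss \<in> borel_measurable borel"
  unfolding gauss_def[abs_def] by measurable

lemma continuous_on_gauss: "continuous_on UNIV gauss"
  unfolding gauss_def[abs_def] by (intro continuous_intros)

text \<open>With u = |x - b| the polynomial is absorbed in exp(m u), and m u - a u^2 is at most m^2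
  / (4 a) by completing the square.\<close>

lemma polynomial_times_gaussian_bounded:
  fixes b :: "'a::real_normed_vector"
  assumes "a > 0"
  shows "\<exists>C. \<forall>x. (1 + norm x) ^ m * exp (- a * (norm (x - b))\<^sup>2) \<le> C"
proof (intro exI allI)
  fix x
  let ?u = "norm (x - b)"
  have "1 + norm x \<le> (1 + norm b) * (1 + ?u)"
    using norm_triangle_ineq[of "x - b" b] mult_nonneg_nonneg[OF norm_ge_zero[of b] norm_ge_zero[of "x - b"]]
    by (simp only: distrib_left distrib_right mult_1 mult_1_right diff_add_cancel)
  also have "1 + ?u \<le> exp ?u" by (rule exp_ge_add_one_self)
  finally have 1: "1 + norm x \<le> (1 + norm b) * exp ?u" by (simp add: mult_left_mono)
  have "(1 + norm x) ^ m * exp (- a * ?u\<^sup>2) \<le> ((1 + norm b) * exp ?u) ^ m * exp (- a * ?u\<^sup>2)"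
    by (intro mult_right_mono power_mono 1) auto
  also have "\<dots> = (1 + norm b) ^ m * exp (m * ?u - a * ?u\<^sup>2)"
    by (simp add: power_mult_distrib exp_diff exp_minus divide_inverse flip: exp_of_nat_mult)
  also have "\<dots> \<le> (1 + norm b) ^ m * exp ((real m)\<^sup>2 / (4 * a))"
  proof -
    have "0 \<le> (m - 2 * a * ?u)\<^sup>2" by simp
    then have "m * ?u - a * ?u\<^sup>2 \<le> (real m)\<^sup>2 / (4 * a)"
      using assms by (simp add: field_simps power2_eq_square)
    then show ?thesis by (intro mult_left_mono) auto
  qed
  finally show "(1 + norm x) ^ m * exp (- a * ?u\<^sup>2) \<le> (1 + norm b) ^ m * exp ((real m)\<^sup>2 / (4 * a))" .
qed

lemma has_derivative_gaussian:
  "((\<lambda>x::real^'n::finite. complex_of_real (exp (- a * (norm (x - b))\<^sup>2))) has_derivative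
    (\<lambda>h. of_real (- 2 * a * ((x - b) \<bullet> h)) * of_real (exp (- a * (norm (x - b))\<^sup>2)))) (at x)"
proof -
  have "((\<lambda>x::real^'n. - a * ((x - b) \<bullet> (x - b))) has_derivative (\<lambda>h. - 2 * a * ((x - b) \<bullet> h))) (at x)"
    by (auto intro!: derivative_eq_intros simp: inner_commute)
  from has_derivative_exp[OF this]
  have "((\<lambda>x::real^'n. exp (- a * ((x - b) \<bullet> (x - b)))) has_derivative (\<lambda>h. exp (- a * ((x - b) \<bullet> (x - b))) * (- 2 * a * ((x - b) \<bullet> h)))) (at x)"
    by (rule has_derivative_eq_rhs) (simp add: mult_ac fun_eq_iff)
  from has_derivative_of_real[OF this] show ?thesis
    by (simp add: power2_norm_eq_inner mult_ac)
qed

lemma schwartz_gaussian: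
  assumes "a > 0"
  shows "schwartz (\<lambda>x::real^'n::finite. complex_of_real (exp (- a * (norm (x - b))\<^sup>2)))" (is "schwartz ?g")
proof (rule schwartzI[of _ "{\<lambda>x. p x * ?g x | p. slow p}"])
  have dg: "?g differentiable at x" for x using has_derivative_gaussian unfolding differentiable_def by fast
  have pg: "partial i ?g = (\<lambda>x. (of_real (- 2 * a) * (of_real (x $ i) + of_real (- b $ i))) * ?g x)" for i
    by (rule ext, subst partial_eq, rule has_derivative_gaussian) (simp add: inner_axis_1 algebra_simps)
  show "?g \<in> {\<lambda>x. p x * ?g x | p. slow p}" using slow.const[of 1] by force
  fix h assume "h \<in> {\<lambda>x. p x * ?g x | p. slow p}"
  then obtain p where p: "slow p" and h: "h = (\<lambda>x. p x * ?g x)" by blast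
  show "h differentiable at x" for x unfolding h by (intro differentiable_mult dg slow_differentiable p)
  show "partial i h \<in> {\<lambda>x. p x * ?g x | p. slow p}" for i
  proof -
    have "partial i h = (\<lambda>x. (p x * (of_real (- 2 * a) * (of_real (x $ i) + of_real (- b $ i))) + partial i p x) * ?g x)"
    proof
      fix x
      have "partial i h x = p x * partial i ?g x + partial i p x * ?g x"
        unfolding h by (rule partial_mult[OF slow_differentiable[OF p] dg])
      then show "partial i h x = (p x * (of_real (- 2 * a) * (of_real (x $ i) + of_real (- b $ i))) + partial i p x) * ?g x"
        unfolding pg by (simp only: distrib_right mult.assoc)
    qed
    moreover have "slow (\<lambda>x. p x * (of_real (- 2 * a) * (of_real (x $ i) + of_real (- b $ i))) + partial i p x)"
      by (intro slow.add slow.mult p slow_partial slow.const slow.coord)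
    ultimately show ?thesis by (intro CollectI exI conjI)
  qed
  fix k
  obtain C m where C: "\<forall>x. norm (p x) \<le> C * (1 + norm x) ^ m" using slow_bound[OF p] by blast
  have C0: "C \<ge> 0" using C[rule_format, of 0] order.trans[OF norm_ge_zero[of "p 0"]] by simp
  obtain D where D: "\<And>x. (1 + norm x) ^ (k + m) * exp (- a * (norm (x - b))\<^sup>2) \<le> D"
    using polynomial_times_gaussian_bounded[OF assms] by metis
  have "norm x ^ k * norm (h x) \<le> C * D" for x
  proof -
    have "norm x ^ k * norm (h x) \<le> (1 + norm x) ^ k * ((C * (1 + norm x) ^ m) * exp (- a * (norm (x - b))\<^sup>2))"
      unfolding h norm_mult using C by (intro mult_mono power_mono) (auto simp: C0)
    also have "\<dots> = C * ((1 + norm x) ^ (k + m) * exp (- a * (norm (x - b))\<^sup>2))" by (simp add: power_add mult_ac)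
    also have "\<dots> \<le> C * D" by (intro mult_left_mono D C0)
    finally show ?thesis .
  qed
  then show "\<exists>C. \<forall>x. norm x ^ k * norm (h x) \<le> C" by blast
qed

lemma schwartz_gauss: "schwartz (\<lambda>x. complex_of_real (gauss x))"
  using schwartz_gaussian[of pi 0] by (simp add: gauss_def[abs_def])

lemma integrable_gauss: "integrable lborel gauss"
  using integrable_norm[OF schwartz_integrable[OF schwartz_gauss]] by (simp add: abs_of_pos gauss_pos)

lemma integral_gauss: "(LINT x|lborel. gauss (x::real^'n::finite)) = 1"
proof -
  \<comment> \<open>The standard deviation for which the centred normal density is exp(- pi t^2), so
    that the total mass 1 is known in dimension one.\<close>
  define \<sigma> where "\<sigma> = 1 / sqrt (2 * pi)"
  have \<sigma>: "\<sigma> > 0" by (simp add: \<sigma>_def)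
  have s2: "2 * \<sigma>\<^sup>2 = 1 / pi" by (simp add: \<sigma>_def power_divide)
  have nd: "normal_density 0 \<sigma> t = exp (- pi * t\<^sup>2)" for t
    unfolding normal_density_def using pi_gt_zero by (simp add: s2 \<sigma>_def power_divide)
  have 1: "(\<integral>\<^sup>+t. ennreal (exp (- pi * t\<^sup>2)) \<partial>lborel) = 1"
    using nn_integral_eq_integral[OF integrable_normal_density[OF \<sigma>, of 0]] integral_normal_density[OF \<sigma>, of 0]
    by (simp add: nd)
  have "(\<integral>\<^sup>+x. ennreal (gauss (x::real^'n)) \<partial>lborel) = (\<integral>\<^sup>+x. (\<Prod>b\<in>Basis. ennreal (exp (- pi * (x \<bullet> b)\<^sup>2))) \<partial>(lborel::(real^'n) measure))"
  proof (rule nn_integral_cong)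
    fix x :: "real^'n"
    have "(norm x)\<^sup>2 = (\<Sum>b\<in>Basis. (x \<bullet> b)\<^sup>2)"
      unfolding power2_norm_eq_inner by (subst euclidean_inner) (simp add: power2_eq_square)
    then show "ennreal (gauss x) = (\<Prod>b\<in>Basis. ennreal (exp (- pi * (x \<bullet> b)\<^sup>2)))"
      by (simp add: gauss_def prod_ennreal exp_sum[symmetric] sum_distrib_left sum_negf)
  qed
  also have "\<dots> = (\<Prod>b\<in>(Basis::(real^'n) set). \<integral>\<^sup>+t. ennreal (exp (- pi * t\<^sup>2)) \<partial>lborel)"
    by (rule nn_integral_lborel_prod) auto
  finally have "(\<integral>\<^sup>+x. ennreal (gauss (x::real^'n)) \<partial>lborel) = 1" by (simp only: 1 prod.neutral_const)
  then show ?thesis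
    by (subst integral_eq_nn_integral) (auto simp: less_imp_le[OF gauss_pos])
qed

lemma partial_times_const_zero:
  fixes f :: "real^'n::finite \<Rightarrow> complex"
  assumes "\<And>x. f differentiable at x" "\<And>i x. partial i f x = 0"
  shows "f x = f 0"
proof (rule has_derivative_zero_constant[of UNIV, simplified, THEN exE])
  show "(f has_derivative (\<lambda>h. 0)) (at x)" for x
    using has_derivative_partial[OF assms(1), of x] by (simp add: assms(2))
qed auto

text \<open>The Gaussian and its transform satisfy the same first-order system: the gradient at x is
  - 2 pi x times the value. The transform times the reciprocal Gaussian therefore has zero gradient,
  and its value at 0 is the total mass 1.\<close>

lemma fourier_gauss: "fourier (\<lambda>x. complex_of_real (gauss x)) xi = gauss (xi::real^'n::finite)"
proof -
  let ?G = "\<lambda>x::real^'n. complex_of_real (gauss x)"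
  let ?E = "\<lambda>x::real^'n. complex_of_real (exp (pi * (norm x)\<^sup>2))"
  have hE: "(?E has_derivative (\<lambda>h. of_real (2 * pi * (x \<bullet> h)) * ?E x)) (at x)" for x
    using has_derivative_gaussian[of "-pi" 0 x] by simp
  have pG: "partial i ?G x = - 2 * pi * of_real (x $ i) * ?G x" for i x
    using partial_eq[OF has_derivative_gaussian[of pi 0 x], of i] by (simp add: inner_axis_1 gauss_def)
  have pF: "partial i (fourier ?G) x = - 2 * pi * of_real (x $ i) * fourier ?G x" for i x
  proof -
    have "(\<lambda>x. - 2 * pi * \<i> * (of_real (x $ i) * ?G x)) = (\<lambda>x. \<i> * partial i ?G x)"
      by (simp add: pG fun_eq_iff)
    then have "partial i (fourier ?G) x = \<i> * fourier (partial i ?G) x"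
      unfolding partial_fourier[OF schwartz_gauss] by (simp only: fourier_cmult)
    also have "\<dots> = - 2 * pi * of_real (x $ i) * fourier ?G x"
      unfolding fourier_partial[OF schwartz_gauss] by (simp add: algebra_simps)
    finally show ?thesis .
  qed
  have pE: "partial i ?E x = 2 * pi * of_real (x $ i) * ?E x" for i x
    using partial_eq[OF hE, of i x] by (simp add: inner_axis_1)
  have dE: "?E differentiable at x" for x
    using hE unfolding differentiable_def by fast
  have dF: "fourier ?G differentiable at x" for x
    using fourier_has_derivative[OF schwartz_gauss] unfolding differentiable_def by fast
  have "fourier ?G xi * ?E xi = fourier ?G 0 * ?E 0"
    by (rule partial_times_const_zero)
      (auto intro!: differentiable_mult dE dF simp: partial_mult[OF dF dE] pF pE)
  also have "fourier ?G 0 = 1" by (simp add: fourier_cis integral_gauss)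
  finally have "fourier ?G xi * of_real (exp (pi * (norm xi)\<^sup>2)) = 1" by simp
  then have "fourier ?G xi = 1 / of_real (exp (pi * (norm xi)\<^sup>2))"
    by (simp add: eq_divide_eq)
  then show ?thesis by (simp add: gauss_def exp_minus inverse_eq_divide)
qed

lemma lborel_integral_affine:
  fixes f :: "real^'n::finite \<Rightarrow> 'b::{banach, second_countable_topology}"
  assumes "c > 0" and [measurable]: "f \<in> borel_measurable borel"
  shows "(LINT x|lborel. f x) = c ^ CARD('n) *\<^sub>R (LINT z|lborel. f (a + c *\<^sub>R z))"
proof -
  have "(LINT x|lborel. f x) = (LINT x|density (distr lborel borel (\<lambda>x. a + c *\<^sub>R x)) (\<lambda>_. ennreal (\<bar>c\<bar> ^ DIM(real^'n))). f x)"
    using lborel_affine[of c a] assms(1) by simp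
  also have "\<dots> = (LINT x|distr lborel borel (\<lambda>x. a + c *\<^sub>R x). (\<bar>c\<bar> ^ DIM(real^'n)) *\<^sub>R f x)"
    by (rule integral_density) auto
  also have "\<dots> = (LINT x|lborel. (\<bar>c\<bar> ^ DIM(real^'n)) *\<^sub>R f (a + c *\<^sub>R x))"
    by (rule integral_distr) auto
  finally show ?thesis using assms(1) by simp
qed

text \<open>Convolution of bounded continuous functions with shrinking Gaussians, after substitution.\<close>

lemma gauss_convolution_tendsto:
  fixes \<psi> :: "real^'n::finite \<Rightarrow> complex"
  assumes cont: "continuous_on UNIV \<psi>" and bdd: "\<And>x. norm (\<psi> x) \<le> B"
    and t: "t \<longlonglongrightarrow> 0"
  shows "(\<lambda>k. LINT z|lborel. gauss z *\<^sub>R \<psi> (x + t k *\<^sub>R z)) \<longlonglongrightarrow> \<psi> x"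
proof -
  have [measurable]: "\<psi> \<in> borel_measurable borel" using cont by (rule borel_measurable_continuous_onI)
  have "(\<lambda>k. LINT z|lborel. gauss z *\<^sub>R \<psi> (x + t k *\<^sub>R z)) \<longlonglongrightarrow> (LINT z|lborel. gauss (z::real^'n) *\<^sub>R \<psi> x)"
  proof (rule integral_dominated_convergence)
    show "integrable lborel (\<lambda>z::real^'n. gauss z * B)" by (intro integrable_mult_left integrable_gauss)
    show "AE z in lborel. (\<lambda>k. gauss z *\<^sub>R \<psi> (x + t k *\<^sub>R z)) \<longlonglongrightarrow> gauss z *\<^sub>R \<psi> x"
    proof (rule AE_I2)
      fix z
      have "(\<lambda>k. x + t k *\<^sub>R z) \<longlonglongrightarrow> x + 0 *\<^sub>R z" by (intro tendsto_intros t)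
      then show "(\<lambda>k. gauss z *\<^sub>R \<psi> (x + t k *\<^sub>R z)) \<longlonglongrightarrow> gauss z *\<^sub>R \<psi> x"
        using cont by (intro tendsto_intros continuous_on_tendsto_compose[of UNIV \<psi>]) auto
    qed
    show "AE z in lborel. norm (gauss z *\<^sub>R \<psi> (x + t k *\<^sub>R z)) \<le> gauss z * B" for k
      using bdd by (auto simp: less_imp_le[OF gauss_pos] abs_of_pos[OF gauss_pos] intro!: mult_left_mono)
  qed measurable
  then show ?thesis using integral_gauss integrable_gauss by (simp add: integral_gauss[where 'n='n] integrable_gauss)
qed

lemma fourier_gauss_scaled:
  fixes xi :: "real^'n::finite"
  assumes "t > 0"
  shows "fourier (\<lambda>x. complex_of_real (gauss (t *\<^sub>R x))) xi = of_real (gauss (xi /\<^sub>R t) / t ^ CARD('n))"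
proof -
  have "fourier (\<lambda>x. complex_of_real (gauss x)) (xi /\<^sub>R t) = of_real (t ^ CARD('n)) * fourier (\<lambda>x. complex_of_real (gauss (t *\<^sub>R x))) xi"
  proof -
    have i: "(t *\<^sub>R z) \<bullet> (xi /\<^sub>R t) = z \<bullet> xi" for z using assms by simp
    have "(LINT x|lborel. cis (- 2 * pi * (x \<bullet> (xi /\<^sub>R t))) * complex_of_real (gauss x))
      = t ^ CARD('n) *\<^sub>R (LINT z|lborel. cis (- 2 * pi * ((0 + t *\<^sub>R z) \<bullet> (xi /\<^sub>R t))) * complex_of_real (gauss (0 + t *\<^sub>R z)))"
      by (rule lborel_integral_affine[OF assms]) measurable
    then show ?thesis unfolding fourier_cis by (simp only: add_0_left i scaleR_conv_of_real[where 'a=complex])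
  qed
  then show ?thesis unfolding fourier_gauss using assms by (simp add: field_simps)
qed

text \<open>A modulated Gaussian \<open>w k\<close> regularises the inversion integral. By the
  multiplication formula the regularised integral is a Gaussian average of f around x at scale
  \<open>t k\<close>, which tends to f x; by dominated convergence it also tends to the inversion
  integral.\<close>

lemma fourier_inversion:
  fixes f :: "real^'n::finite \<Rightarrow> complex"
  assumes f: "schwartz f"
  shows "inv_fourier (fourier f) x = f x"
proof -
  define t where "t k = 1 / real (Suc k)" for k
  have t: "t k > 0" for k by (simp add: t_def)
  have t0: "t \<longlonglongrightarrow> 0" unfolding t_def using LIMSEQ_inverse_real_of_nat by (simp add: inverse_eq_divide)
  have [measurable]: "f \<in> borel_measurable borel" "fourier f \<in> borel_measurable borel"
    using f schwartz_fourier schwartz_measurable by blast+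
  obtain B where B: "\<And>x. norm (f x) \<le> B" using schwartz_decay[OF f, of 0] by auto
  have int: "integrable lborel (fourier f)" by (intro schwartz_integrable schwartz_fourier f)
  define w where "w k xi = cis (2 * pi * (x \<bullet> xi)) * complex_of_real (gauss (t k *\<^sub>R xi))" for k xi
  have intg: "integrable lborel (\<lambda>xi::real^'n. complex_of_real (gauss (t k *\<^sub>R xi)))" for k
  proof -
    have "schwartz (\<lambda>xi. complex_of_real (exp (- (pi * (t k)\<^sup>2) * (norm (xi - (0::real^'n)))\<^sup>2)))"
      using t[of k] by (intro schwartz_gaussian) auto
    from schwartz_integrable[OF this] show ?thesis
      by (simp add: gauss_def power_mult_distrib mult.assoc)
  qed
  have intw: "integrable lborel (w k)" for k
    unfolding w_def[abs_def] by (intro integrable_cis_mult intg) measurable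
  have Fw: "fourier (w k) y = of_real (gauss ((y - x) /\<^sub>R t k) / t k ^ CARD('n))" for k y
  proof -
    have "cis (- 2 * pi * (z \<bullet> y)) * w k z = cis (- 2 * pi * (z \<bullet> (y - x))) * of_real (gauss (t k *\<^sub>R z))" for z
    proof -
      have "- 2 * pi * (z \<bullet> y) + 2 * pi * (x \<bullet> z) = - 2 * pi * (z \<bullet> (y - x))"
        by (simp add: inner_diff_right inner_commute[of x z] right_diff_distrib)
      then show ?thesis unfolding w_def mult.assoc[symmetric] cis_mult by simp
    qed
    then show ?thesis unfolding fourier_gauss_scaled[OF t, symmetric] fourier_cis by simp
  qed
  have L: "(LINT xi|lborel. fourier f xi * w k xi) = (LINT z|lborel. gauss z *\<^sub>R f (x + t k *\<^sub>R z))" for k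
  proof -
    have "(LINT xi|lborel. fourier f xi * w k xi) = (LINT y|lborel. f y * of_real (gauss ((y - x) /\<^sub>R t k) / t k ^ CARD('n)))"
      using fourier_multiplication_formula[OF schwartz_integrable[OF f] intw] by (simp add: Fw)
    also have "\<dots> = (LINT z|lborel. t k ^ CARD('n) *\<^sub>R (f (x + t k *\<^sub>R z) * of_real (gauss z / t k ^ CARD('n))))"
      by (subst lborel_integral_affine[OF t[of k], where a=x]) (use t[of k] in auto)
    also have "\<dots> = (LINT z|lborel. gauss z *\<^sub>R f (x + t k *\<^sub>R z))"
      using t[of k] by (intro Bochner_Integration.integral_cong refl) (simp add: scaleR_conv_of_real[where 'a=complex])
    finally show ?thesis .
  qed
  have "(\<lambda>k. LINT xi|lborel. fourier f xi * w k xi) \<longlonglongrightarrow> (LINT xi|lborel. fourier f xi * (cis (2 * pi * (x \<bullet> xi)) * 1))"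
  proof (rule integral_dominated_convergence)
    show "integrable lborel (\<lambda>xi. norm (fourier f xi))" using int by (rule integrable_norm)
    show "AE xi in lborel. (\<lambda>k. fourier f xi * w k xi) \<longlonglongrightarrow> fourier f xi * (cis (2 * pi * (x \<bullet> xi)) * 1)"
    proof (rule AE_I2)
      fix xi :: "real^'n"
      have "(\<lambda>k. t k *\<^sub>R xi) \<longlonglongrightarrow> 0 *\<^sub>R xi" by (intro tendsto_intros t0)
      then have "(\<lambda>k. gauss (t k *\<^sub>R xi)) \<longlonglongrightarrow> gauss (0 *\<^sub>R xi)"
        by (rule continuous_on_tendsto_compose[OF continuous_on_gauss]) auto
      then have "(\<lambda>k. complex_of_real (gauss (t k *\<^sub>R xi))) \<longlonglongrightarrow> 1"
        using tendsto_of_real by (fastforce simp: gauss_def)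
      then show "(\<lambda>k. fourier f xi * w k xi) \<longlonglongrightarrow> fourier f xi * (cis (2 * pi * (x \<bullet> xi)) * 1)"
        unfolding w_def by (intro tendsto_intros)
    qed
    show "AE xi in lborel. norm (fourier f xi * w k xi) \<le> norm (fourier f xi)" for k
      unfolding w_def using gauss_le_1 by (intro AE_I2) (simp add: norm_mult abs_of_pos[OF gauss_pos] mult_left_le[OF gauss_le_1 norm_ge_zero])
  qed (auto simp: w_def[abs_def])
  then have "(\<lambda>k. LINT z|lborel. gauss z *\<^sub>R f (x + t k *\<^sub>R z)) \<longlonglongrightarrow> inv_fourier (fourier f) x"
    unfolding L inv_fourier_cis by (simp add: mult.commute inner_commute)
  moreover have "(\<lambda>k. LINT z|lborel. gauss z *\<^sub>R f (x + t k *\<^sub>R z)) \<longlonglongrightarrow> f x"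
    by (rule gauss_convolution_tendsto[OF schwartz_continuous[OF f] B t0])
  ultimately show ?thesis by (rule LIMSEQ_unique)
qed

lemma fourier_reflect: "fourier (\<lambda>x. f (- x)) xi = fourier f (- xi :: real^'n::finite)"
proof -
  have d: "(lborel :: (real^'n) measure) = distr lborel borel uminus"
    using lborel_affine[of "-1" "0::real^'n"] by (simp add: density_1)
  have "(LINT x|lborel. g (- x)) = (LINT x|lborel. g x)" for g :: "real^'n \<Rightarrow> complex"
  proof (cases "g \<in> borel_measurable borel")
    case True
    then show ?thesis by (subst (2) d, subst integral_distr) auto
  next
    \<comment> \<open>For a nonmeasurable function both integrals are 0 by the convention for
      nonintegrable functions, so the reflection identity holds for all functions.\<close>
    case False
    have "\<not> (\<lambda>x. g (- x)) \<in> borel_measurable borel"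
    proof
      assume "(\<lambda>x. g (- x)) \<in> borel_measurable borel"
      from measurable_compose[OF _ this, of uminus borel] have "g \<in> borel_measurable borel" by simp
      then show False using False by simp
    qed
    then have "\<not> integrable lborel (\<lambda>x. g (- x))" "\<not> integrable lborel g" using False by auto
    then show ?thesis by (simp add: not_integrable_integral_eq)
  qed
  from this[of "\<lambda>x. cis (- 2 * pi * (x \<bullet> (- xi))) * f x"] show ?thesis
    unfolding fourier_cis by simp
qed

lemma schwartz_reflect:
  assumes "schwartz f"
  shows "schwartz (\<lambda>x. f (- x))"
proof (rule schwartzI[of _ "{\<lambda>x. f (- x) | f. schwartz f}"])
  have D: "((\<lambda>x. g (- x)) has_derivative (\<lambda>h. frechet_derivative g (at (- x)) (- h))) (at x)" if "schwartz g" for g and x :: "real^'a"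
    by (rule has_derivative_compose[OF has_derivative_minus[OF has_derivative_ident] has_derivative_frechet[OF schwartz_differentiable[OF that]]])
  show "(\<lambda>x. f (- x)) \<in> {\<lambda>x. f (- x) | f. schwartz f}" using assms by blast
  fix g :: "real^'a \<Rightarrow> complex" assume "g \<in> {\<lambda>x. f (- x) | f. schwartz f}"
  then obtain f where f: "schwartz f" and g: "g = (\<lambda>x. f (- x))" by blast
  show "g differentiable at x" for x using D[OF f] unfolding g differentiable_def by blast
  show "partial i g \<in> {\<lambda>x. f (- x) | f. schwartz f}" for i
  proof -
    have "partial i g = (\<lambda>x. (-1) * partial i f (- x))" unfolding g
      by (rule ext, subst partial_eq, rule D[OF f])
        (use linear_frechet_derivative[OF schwartz_differentiable[OF f]] in \<open>simp add: partial_def linear_neg\<close>)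
    then show ?thesis using schwartz_cmult[OF schwartz_partial[OF f], of "-1"]
      by (intro CollectI exI[of _ "\<lambda>x. (-1) * partial i f x"] conjI)
  qed
  fix k
  obtain C where "\<forall>x. norm x ^ k * norm (f x) \<le> C" using schwartz_decay[OF f] by blast
  then have "\<forall>x. norm x ^ k * norm (g x) \<le> C" unfolding g by (metis norm_minus_cancel)
  then show "\<exists>C. \<forall>x. norm x ^ k * norm (g x) \<le> C" by blast
qed

text \<open>Smoothing an arbitrary \<open>\<psi>\<close> by Gaussians and letting the width tend to zero shows that Gaussians
  alone separate integrable functions.\<close>

lemma measurable_ident_lebesgue: "(\<lambda>x. x) \<in> lebesgue \<rightarrow>\<^sub>M borel"
  by (rule measurable_completion) simp

lemma borel_measurable_lebesgueI: "f \<in> M \<rightarrow>\<^sub>M N \<Longrightarrow> sets M = sets borel \<Longrightarrow> f \<in> lebesgue \<rightarrow>\<^sub>M N"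
  by (rule measurable_completion) (simp cong: measurable_cong_sets)

lemma sigma_finite_lebesgue: "sigma_finite_measure (lebesgue :: 'a::euclidean_space measure)"
proof
  obtain A where "countable A" "A \<subseteq> sets (lborel::'a measure)" "\<Union>A = space (lborel::'a measure)" "\<forall>a\<in>A. emeasure lborel a \<noteq> \<infinity>"
    using lborel.sigma_finite_countable by blast
  then show "\<exists>A. countable A \<and> A \<subseteq> sets (lebesgue::'a measure) \<and> \<Union>A = space (lebesgue::'a measure) \<and> (\<forall>a\<in>A. emeasure lebesgue a \<noteq> \<infinity>)"
    by (intro exI[of _ A]) auto
qed

text \<open>Orthogonality spreads from Gaussians to bounded continuous integrable functions
  (\<open>cont0\<close>), by cutoffs to closed sets (\<open>closed0\<close>), by a Dynkin argument
  to Borel sets (\<open>borel0\<close>) and, up to null sets, to Lebesgue sets. A density whose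
  integral over every set vanishes is 0 almost everywhere.\<close>

lemma zero_if_orthogonal_to_schwartz:
  fixes g :: "real^'n::finite \<Rightarrow> complex"
  assumes [measurable]: "g \<in> borel_measurable lebesgue"
    and int: "\<And>\<phi>. schwartz \<phi> \<Longrightarrow> integrable lebesgue (\<lambda>x. g x * \<phi> x)"
    and zero: "\<And>\<phi>. schwartz \<phi> \<Longrightarrow> (LINT x|lebesgue. g x * \<phi> x) = 0"
  shows "AE x in lebesgue. g x = 0"
proof -
  note [measurable] = measurable_ident_lebesgue
  interpret L: sigma_finite_measure "lebesgue :: (real^'n) measure"
    by (rule sigma_finite_lebesgue)
  interpret P: pair_sigma_finite "lebesgue :: (real^'n) measure" "lborel :: (real^'n) measure" ..
  \<comment> \<open>\<open>g\<close> itself need not be integrable, but its product with a test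
    function is.\<close>
  define h where "h x = g x * of_real (gauss x)" for x
  have [measurable]: "h \<in> borel_measurable lebesgue" unfolding h_def[abs_def] by measurable
  have inth: "integrable lebesgue h" unfolding h_def[abs_def] by (intro int schwartz_gauss)
  define t where "t k = 1 / real (Suc k)" for k
  have t: "t k > 0" for k by (simp add: t_def)
  have t0: "t \<longlonglongrightarrow> 0" unfolding t_def using LIMSEQ_inverse_real_of_nat by (simp add: inverse_eq_divide)
  have hK: "(LINT x|lebesgue. h x * of_real (gauss ((b - x) /\<^sub>R c))) = 0" if "c > 0" for b c
  proof -
    \<comment> \<open>Completing the square: the product of the two Gaussians is \<open>e\<close>
      times a Gaussian of rate \<open>a\<close> centred at \<open>d\<close>, hence again a test
      function up to a constant.\<close>
    define a where "a = pi + pi / c\<^sup>2"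
    have a: "a > 0" using that by (simp add: a_def add_pos_nonneg)
    define d where "d = (pi / (c\<^sup>2 * a)) *\<^sub>R b"
    define e where "e = exp (a * (norm d)\<^sup>2 - pi * (norm b)\<^sup>2 / c\<^sup>2)"
    have "gauss x * gauss ((b - x) /\<^sub>R c) = e * exp (- a * (norm (x - d))\<^sup>2)" for x
    proof -
      have ad: "a * (x \<bullet> d) = pi / c\<^sup>2 * (x \<bullet> b)" using a that unfolding d_def by simp
      have 1: "(norm ((b - x) /\<^sub>R c))\<^sup>2 = (norm (b - x))\<^sup>2 / c\<^sup>2"
        using that by (simp add: power_mult_distrib power_divide divide_inverse mult.commute power_inverse)
      have 2: "(norm (b - x))\<^sup>2 = (norm b)\<^sup>2 - 2 * (x \<bullet> b) + (norm x)\<^sup>2"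
        by (simp add: power2_norm_eq_inner inner_diff_left inner_diff_right inner_commute)
      have 3: "(norm (x - d))\<^sup>2 = (norm x)\<^sup>2 - 2 * (x \<bullet> d) + (norm d)\<^sup>2"
        by (simp add: power2_norm_eq_inner inner_diff_left inner_diff_right inner_commute)
      have 4: "- a * ((norm x)\<^sup>2 - 2 * (x \<bullet> d) + (norm d)\<^sup>2) = - (a * (norm x)\<^sup>2) + 2 * (a * (x \<bullet> d)) - a * (norm d)\<^sup>2"
        by (simp add: algebra_simps)
      have "- pi * (norm x)\<^sup>2 + - pi * (norm ((b - x) /\<^sub>R c))\<^sup>2
        = (a * (norm d)\<^sup>2 - pi * (norm b)\<^sup>2 / c\<^sup>2) + - a * (norm (x - d))\<^sup>2"
        unfolding 1 2 3 4 ad by (simp add: a_def algebra_simps add_divide_distrib diff_divide_distrib)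
      then show ?thesis unfolding gauss_def e_def by (simp only: flip: exp_add)
    qed
    then have "h x * of_real (gauss ((b - x) /\<^sub>R c)) = g x * (of_real e * of_real (exp (- a * (norm (x - d))\<^sup>2)))" for x
      unfolding h_def mult.assoc by (simp only: flip: of_real_mult)
    then show ?thesis using zero[OF schwartz_cmult[OF schwartz_gaussian[OF a, of d], of "of_real e"]] by simp
  qed
  have cont0: "(LINT x|lebesgue. h x * \<psi> x) = 0"
    if cont: "continuous_on UNIV \<psi>" and bdd: "\<And>x. norm (\<psi> x) \<le> B" and supp: "integrable lborel \<psi>" for \<psi> B
  proof -
    have [measurable]: "\<psi> \<in> borel_measurable borel" using cont by (rule borel_measurable_continuous_onI)
    have "(\<lambda>k. LINT x|lebesgue. h x * (LINT z|lborel. gauss z *\<^sub>R \<psi> (x + t k *\<^sub>R z))) \<longlonglongrightarrow> (LINT x|lebesgue. h x * \<psi> x)"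
    proof (rule integral_dominated_convergence)
      show "integrable lebesgue (\<lambda>x. norm (h x) * B)" by (intro integrable_mult_left integrable_norm inth)
      show "AE x in lebesgue. (\<lambda>k. h x * (LINT z|lborel. gauss z *\<^sub>R \<psi> (x + t k *\<^sub>R z))) \<longlonglongrightarrow> h x * \<psi> x"
        by (intro AE_I2 tendsto_intros gauss_convolution_tendsto[OF cont bdd t0])
      fix k
      have "norm (LINT z|lborel. gauss z *\<^sub>R \<psi> (x + t k *\<^sub>R z)) \<le> B" for x
      proof -
        have "norm (LINT z|lborel. gauss z *\<^sub>R \<psi> (x + t k *\<^sub>R z)) \<le> (LINT z|lborel. gauss (z::real^'n) * B)"
          using bdd by (intro order.trans[OF integral_norm_bound integral_mono'] integrable_mult_left integrable_gauss)
            (auto simp: abs_of_pos[OF gauss_pos] less_imp_le[OF gauss_pos] intro!: mult_left_mono mult_nonneg_nonneg order.trans[OF norm_ge_zero bdd])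
        then show ?thesis using integral_gauss[where 'n='n] by simp
      qed
      then show "AE x in lebesgue. norm (h x * (LINT z|lborel. gauss z *\<^sub>R \<psi> (x + t k *\<^sub>R z))) \<le> norm (h x) * B"
        by (intro AE_I2) (simp add: norm_mult mult_left_mono)
    next
      fix k
      have "(\<lambda>x. LINT z|lborel. gauss z *\<^sub>R \<psi> (x + t k *\<^sub>R z)) \<in> borel_measurable borel" by measurable
      then have [measurable]: "(\<lambda>x. LINT z|lborel. gauss z *\<^sub>R \<psi> (x + t k *\<^sub>R z)) \<in> borel_measurable lebesgue"
        by (rule borel_measurable_lebesgueI[of _ borel]) auto
      show "(\<lambda>x. h x * (LINT z|lborel. gauss z *\<^sub>R \<psi> (x + t k *\<^sub>R z))) \<in> borel_measurable lebesgue" by measurable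
    next
      have [measurable]: "\<psi> \<in> borel_measurable lebesgue"
        by (rule borel_measurable_lebesgueI[of _ borel]) auto
      show "(\<lambda>x. h x * \<psi> x) \<in> borel_measurable lebesgue" by measurable
    qed
    moreover have "(LINT x|lebesgue. h x * (LINT z|lborel. gauss z *\<^sub>R \<psi> (x + t k *\<^sub>R z))) = 0" for k
    proof -
      let ?c = "1 / t k ^ CARD('n)"
      \<comment> \<open>The substitution exhibits the smoothed function as a superposition of
        Gaussians centred at b, each of them orthogonal to h by \<open>hK\<close>.\<close>
      have "(LINT z|lborel. gauss z *\<^sub>R \<psi> (x + t k *\<^sub>R z)) = ?c *\<^sub>R (LINT b|lborel. gauss ((b - x) /\<^sub>R t k) *\<^sub>R \<psi> b)" for x
        by (subst lborel_integral_affine[OF t[of k], where a=x]) (use t[of k] in auto)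
      then have "(LINT x|lebesgue. h x * (LINT z|lborel. gauss z *\<^sub>R \<psi> (x + t k *\<^sub>R z)))
        = ?c *\<^sub>R (LINT x|lebesgue. LINT b|lborel. h x * (gauss ((b - x) /\<^sub>R t k) *\<^sub>R \<psi> b))"
        by (simp only: mult_scaleR_right[of "h _" ?c] integral_scaleR_right integral_mult_right_zero)
      also have "(LINT x|lebesgue. LINT b|lborel. h x * (gauss ((b - x) /\<^sub>R t k) *\<^sub>R \<psi> b))
        = (LINT b|lborel. LINT x|lebesgue. h x * (gauss ((b - x) /\<^sub>R t k) *\<^sub>R \<psi> b))"
      proof (rule P.Fubini_integral[symmetric])
        have fm: "fst \<in> lebesgue \<Otimes>\<^sub>M lborel \<rightarrow>\<^sub>M (borel :: (real^'n) measure)"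
          by (rule measurable_compose[OF measurable_fst]) (rule measurable_completion, simp)
        have [measurable]: "(\<lambda>p. gauss ((snd p - fst p) /\<^sub>R t k)) \<in> borel_measurable (lebesgue \<Otimes>\<^sub>M lborel)"
          using fm by measurable
        show "integrable (lebesgue \<Otimes>\<^sub>M lborel) (\<lambda>(x, b). h x * (gauss ((b - x) /\<^sub>R t k) *\<^sub>R \<psi> b))"
        proof (rule Bochner_Integration.integrable_bound)
          show "integrable (lebesgue \<Otimes>\<^sub>M lborel) (\<lambda>(x, b). h x * \<psi> b)"
          proof (rule P.Fubini_integrable)
            show "integrable lebesgue (\<lambda>x. LINT b|lborel. norm (case (x, b) of (x, b) \<Rightarrow> h x * \<psi> b))"
              by (simp add: norm_mult integrable_norm inth)
          qed (auto intro: supp)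
          show "AE p in lebesgue \<Otimes>\<^sub>M lborel. norm (case p of (x, b) \<Rightarrow> h x * (gauss ((b - x) /\<^sub>R t k) *\<^sub>R \<psi> b)) \<le> norm (case p of (x, b) \<Rightarrow> h x * \<psi> b)"
            by (auto simp: norm_mult abs_of_pos[OF gauss_pos] gauss_le_1 mult_left_le_one_le less_imp_le[OF gauss_pos] intro!: mult_left_mono)
        qed (simp add: case_prod_beta)
      qed
      also have "\<dots> = (LINT b|lborel. (LINT x|lebesgue. h x * of_real (gauss ((b - x) /\<^sub>R t k))) * \<psi> b)"
        by (intro Bochner_Integration.integral_cong refl)
          (simp add: scaleR_conv_of_real[where 'a=complex] mult.assoc flip: integral_mult_left_zero)
      also have "\<dots> = 0" by (simp add: hK[OF t])
      finally show ?thesis by simp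
    qed
    ultimately show ?thesis by (simp add: LIMSEQ_const_iff)
  qed
  \<comment> \<open>A second Gaussian factor: the cutoffs of a closed set need not be integrable,
    but their products with a Gaussian are, and this factor survives in the limit.\<close>
  define g' where "g' x = h x * of_real (gauss x)" for x
  have [measurable]: "g' \<in> borel_measurable lebesgue" unfolding g'_def[abs_def] by measurable
  have intg: "integrable lebesgue g'"
    by (rule Bochner_Integration.integrable_bound[OF inth])
      (auto simp: g'_def norm_mult abs_of_pos[OF gauss_pos] gauss_le_1 mult_left_le)
  have closed0: "(LINT x|lebesgue. indicator C x *\<^sub>R g' x) = 0" if C: "closed C" for C
  \<comment> \<open>The distance to the empty set is 0 by convention, so there the cutoffs would
    equal 1 everywhere instead of tending to 0.\<close>
  proof (cases "C = {}")
    case False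
    define \<psi> where "\<psi> k x = complex_of_real (max 0 (1 - real k * infdist x C) * gauss x)" for k x
    have cpsi: "continuous_on UNIV (\<psi> k)" for k
      unfolding \<psi>_def[abs_def] gauss_def by (intro continuous_intros)
    have gpsi: "norm (\<psi> k x) \<le> gauss x" for k x
      unfolding \<psi>_def norm_of_real abs_mult abs_of_pos[OF gauss_pos]
      using less_imp_le[OF gauss_pos[of x]] by (intro mult_left_le_one_le) (auto simp: infdist_nonneg)
    have ipsi: "integrable lborel (\<psi> k)" for k
    proof (rule Bochner_Integration.integrable_bound[OF integrable_gauss])
      show "\<psi> k \<in> borel_measurable lborel" using borel_measurable_continuous_onI[OF cpsi] by simp
      show "AE x in lborel. norm (\<psi> k x) \<le> norm (gauss x)" using order.trans[OF gpsi abs_ge_self] by (intro AE_I2) simp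
    qed
    have "(\<lambda>k. LINT x|lebesgue. h x * \<psi> (Suc k) x) \<longlonglongrightarrow> (LINT x|lebesgue. indicator C x *\<^sub>R g' x)"
    proof (rule integral_dominated_convergence)
      show "integrable lebesgue (\<lambda>x. norm (h x))" by (intro integrable_norm inth)
      show "AE x in lebesgue. norm (h x * \<psi> (Suc k) x) \<le> norm (h x)" for k
        using order.trans[OF gpsi gauss_le_1] by (intro AE_I2) (simp add: norm_mult mult_left_le)
      show "AE x in lebesgue. (\<lambda>k. h x * \<psi> (Suc k) x) \<longlonglongrightarrow> indicator C x *\<^sub>R g' x"
      proof (intro AE_I2)
        fix x
        show "(\<lambda>k. h x * \<psi> (Suc k) x) \<longlonglongrightarrow> indicator C x *\<^sub>R g' x"
        proof (cases "x \<in> C")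
          case True
          then show ?thesis by (simp add: \<psi>_def g'_def)
        next
          case F: False
          then have d: "infdist x C > 0"
            using in_closed_iff_infdist_zero[OF C False] infdist_nonneg[of x C] by fastforce
          obtain K where K: "1 < real K * infdist x C" using reals_Archimedean3[OF d] by blast
          have "\<psi> (Suc k) x = 0" if "k \<ge> K" for k
          proof -
            have "real K * infdist x C \<le> real (Suc k) * infdist x C" using that d by (intro mult_right_mono) auto
            then show ?thesis using K unfolding \<psi>_def by simp
          qed
          then have "\<forall>\<^sub>F k in sequentially. h x * \<psi> (Suc k) x = 0" by (auto simp: eventually_sequentially)
          then show ?thesis using F by (simp add: tendsto_eventually)
        qed
      qed
      have "C \<in> sets lebesgue" using C by (simp add: borel_closed)
      then show "(\<lambda>x. indicator C x *\<^sub>R g' x) \<in> borel_measurable lebesgue" by measurable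
      fix k
      have [measurable]: "\<psi> (Suc k) \<in> borel_measurable lebesgue"
        using borel_measurable_continuous_onI[OF cpsi] by (rule borel_measurable_lebesgueI[of _ borel]) auto
      show "(\<lambda>x. h x * \<psi> (Suc k) x) \<in> borel_measurable lebesgue" by measurable
    qed
    moreover have "(LINT x|lebesgue. h x * \<psi> (Suc k) x) = 0" for k
      by (rule cont0[OF cpsi order.trans[OF gpsi gauss_le_1] ipsi])
    ultimately show ?thesis by (simp add: LIMSEQ_const_iff)
  qed simp
  have intS: "integrable lebesgue (\<lambda>x. indicator S x *\<^sub>R g' x)" if "S \<in> sets borel" for S
    using that by (intro integrable_mult_indicator intg) auto
  have borel0: "(LINT x|lebesgue. indicator S x *\<^sub>R g' x) = 0" if S: "S \<in> sets borel" for S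
  proof -
    have "Int_stable (Collect (closed :: (real^'n) set \<Rightarrow> bool))" by (auto simp: Int_stable_def)
    moreover have "Collect closed \<subseteq> Pow (UNIV :: (real^'n) set)" by simp
    moreover have "S \<in> sigma_sets UNIV (Collect closed)" using S by (simp add: borel_eq_closed)
    ultimately show ?thesis
    proof (induction rule: sigma_sets_induct_disjoint)
      case (basic A) then show ?case using closed0 by simp
    next
      case empty show ?case by simp
    next
      case (compl A)
      have A: "A \<in> sets borel" using compl(1) by (simp add: borel_eq_closed)
      have "indicator (UNIV - A) x *\<^sub>R g' x = indicator UNIV x *\<^sub>R g' x - indicator A x *\<^sub>R g' x" for x
        by (simp add: indicator_def)
      then show ?case using compl(2) closed0[of UNIV] intS[OF A] intg by simp
    next
      case (union A)
      have A: "A i \<in> sets borel" for i using union(2) by (auto simp: borel_eq_closed)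
      have "(LINT x:(\<Union>i. A i)|lebesgue. g' x) = (\<Sum>i. LINT x:A i|lebesgue. g' x)"
        using A union(1) intS[of "\<Union>i. A i"]
        by (intro lebesgue_integral_countable_add) (auto simp: disjoint_family_on_def set_integrable_def)
      then show ?case using union(3) by (simp add: set_lebesgue_integral_def)
    qed
  qed
  have "(LINT x|lebesgue. indicator A x *\<^sub>R g' x) = 0" if A: "A \<in> sets lebesgue" for A
  proof -
    obtain S N N' where S: "S \<in> sets borel" and N: "N' \<in> null_sets lborel" "N \<subseteq> N'" and AS: "A = S \<union> N"
      using A by (auto elim: sets_completionE)
    have "AE x in lebesgue. x \<notin> N'" using N(1) by (intro AE_completion AE_not_in)
    then have "AE x in lebesgue. indicator A x *\<^sub>R g' x = indicator S x *\<^sub>R g' x"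
      by eventually_elim (use N(2) AS in \<open>auto simp: indicator_def\<close>)
    moreover have "(\<lambda>x. indicator A x *\<^sub>R g' x) \<in> borel_measurable lebesgue" "(\<lambda>x. indicator S x *\<^sub>R g' x) \<in> borel_measurable lebesgue"
      using A S by measurable
    ultimately show ?thesis using borel0[OF S] by (subst integral_cong_AE)
  qed
  then have "AE x in lebesgue. g' x = 0"
    by (intro L.density_zero[OF intg]) (simp add: set_lebesgue_integral_def)
  then show ?thesis unfolding g'_def h_def by (simp add: less_imp_neq[OF gauss_pos, symmetric])
qed

section \<open>The real Hilbert space of square integrable fields modulo null sets\<close>

section \<open>The Hilbert space of square integrable fields\<close>

lemma L2_measurable[measurable_dest]: "u \<in> L2 \<Longrightarrow> u \<in> borel_measurable lebesgue"
  by (simp add: L2_def)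

lemma L2_integrable: "u \<in> L2 \<Longrightarrow> integrable lebesgue (\<lambda>x. (norm (u x))\<^sup>2)"
  by (simp add: L2_def)

lemma L2I:
  assumes "u \<in> borel_measurable lebesgue" "integrable lebesgue g" "\<And>x. (norm (u x))\<^sup>2 \<le> g x"
  shows "u \<in> L2"
  unfolding L2_def
proof (intro CollectI conjI assms(1))
  note [measurable] = assms(1)
  show "integrable lebesgue (\<lambda>x. (norm (u x))\<^sup>2)"
    by (rule Bochner_Integration.integrable_bound[OF assms(2)]) (use assms(3) in \<open>auto intro!: AE_I2 order.trans[OF assms(3)]\<close>)
qed

lemma L2_zero: "(\<lambda>x. 0) \<in> L2"
  by (simp add: L2_def)

lemma L2_scaleR: "u \<in> L2 \<Longrightarrow> (\<lambda>x. c *\<^sub>R u x) \<in> L2"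
  by (auto simp: L2_def power_mult_distrib intro!: borel_measurable_scaleR)

lemma norm_add_sq_le: "(norm (a + b))\<^sup>2 \<le> 2 * (norm a)\<^sup>2 + 2 * (norm b)\<^sup>2"
  for a b :: "'a::real_normed_vector"
proof -
  have "(norm (a + b))\<^sup>2 \<le> (norm a + norm b)\<^sup>2" by (intro power_mono norm_triangle_ineq) auto
  also have "\<dots> \<le> 2 * (norm a)\<^sup>2 + 2 * (norm b)\<^sup>2"
    using zero_le_power2[of "norm a - norm b"] by (simp add: power2_sum power2_diff)
  finally show ?thesis .
qed

lemma L2_add: "u \<in> L2 \<Longrightarrow> v \<in> L2 \<Longrightarrow> (\<lambda>x. u x + v x) \<in> L2"
  by (rule L2I[where g="\<lambda>x. 2 * (norm (u x))\<^sup>2 + 2 * (norm (v x))\<^sup>2"])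
    (auto intro!: norm_add_sq_le L2_integrable dest: L2_measurable)

lemma L2_uminus: "u \<in> L2 \<Longrightarrow> (\<lambda>x. - u x) \<in> L2"
  using L2_scaleR[of u "-1"] by simp

lemma L2_diff: "u \<in> L2 \<Longrightarrow> v \<in> L2 \<Longrightarrow> (\<lambda>x. u x - v x) \<in> L2"
  using L2_add[OF _ L2_uminus] by fastforce

lemma L2_integrable_inner:
  assumes "u \<in> L2" "v \<in> L2"
  shows "integrable lebesgue (\<lambda>x. u x \<bullet> v x)"
proof (rule Bochner_Integration.integrable_bound)
  note [measurable] = assms[THEN L2_measurable]
  show "integrable lebesgue (\<lambda>x. (norm (u x))\<^sup>2 + (norm (v x))\<^sup>2)"
    using assms by (intro Bochner_Integration.integrable_add L2_integrable)
  show "(\<lambda>x. u x \<bullet> v x) \<in> borel_measurable lebesgue" by measurable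
  show "AE x in lebesgue. norm (u x \<bullet> v x) \<le> norm ((norm (u x))\<^sup>2 + (norm (v x))\<^sup>2)"
  proof (rule AE_I2)
    fix x
    have "\<bar>u x \<bullet> v x\<bar> \<le> norm (u x) * norm (v x)" by (rule Cauchy_Schwarz_ineq2)
    also have "\<dots> \<le> (norm (u x))\<^sup>2 + (norm (v x))\<^sup>2"
      using zero_le_power2[of "norm (u x) - norm (v x)"] mult_nonneg_nonneg[OF norm_ge_zero norm_ge_zero, of "u x" "v x"]
      unfolding power2_diff by linarith
    finally show "norm (u x \<bullet> v x) \<le> norm ((norm (u x))\<^sup>2 + (norm (v x))\<^sup>2)" by simp
  qed
qed

lemma L2_cong_AE:
  assumes "u \<in> L2" "v \<in> borel_measurable lebesgue" "AE x in lebesgue. u x = v x"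
  shows "v \<in> L2"
  unfolding L2_def
proof (intro CollectI conjI assms(2))
  show "integrable lebesgue (\<lambda>x. (norm (v x))\<^sup>2)"
    using assms L2_measurable[OF assms(1)] L2_integrable[OF assms(1)]
    by (subst integrable_cong_AE[of _ _ "\<lambda>x. (norm (u x))\<^sup>2"]) auto
qed

lemma measurable_cong_AE_lebesgue:
  fixes f :: "'a::euclidean_space \<Rightarrow> 'b::topological_space"
  assumes f: "f \<in> borel_measurable lebesgue" and ae: "AE x in lebesgue. f x = g x"
  shows "g \<in> borel_measurable lebesgue"
proof (rule measurableI)
  obtain N where N: "N \<in> null_sets lebesgue" "{x \<in> space lebesgue. f x \<noteq> g x} \<subseteq> N"
    using ae unfolding eventually_ae_filter by blast
  fix A :: "'b set" assume A: "A \<in> sets borel"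
  have fg: "f x = g x" if "x \<notin> N" for x using N(2) that by auto
  have eq: "g -` A \<inter> space lebesgue = (f -` A \<inter> space lebesgue - N) \<union> (g -` A \<inter> N)"
    using fg by auto
  have "g -` A \<inter> N \<in> sets lebesgue"
    using N(1) by (meson Int_lower2 completion.complete2 null_setsD2)
  then show "g -` A \<inter> space lebesgue \<in> sets lebesgue"
    unfolding eq using measurable_sets[OF f A] N(1) by auto
qed auto

definition L2_eq :: "'n::finite field \<Rightarrow> 'n field \<Rightarrow> bool" where
  "L2_eq u v \<longleftrightarrow> u \<in> L2 \<and> v \<in> L2 \<and> (AE x in lebesgue. u x = v x)"

\<comment> \<open>The quotient is partial because fields outside \<open>L2\<close> have no class. As
  a type, the space can be an instance of inner product and Banach spaces, so that the general
  theory of derivatives and uniform limits applies to curves in it.\<close>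
quotient_type 'n Lt = "'n::finite field" / partial: L2_eq
  morphisms rep cls
proof (rule part_equivpI)
  show "\<exists>u :: 'n field. L2_eq u u" using L2_zero by (auto simp: L2_eq_def)
  show "symp (L2_eq :: 'n field \<Rightarrow> _)" by (auto simp: symp_def L2_eq_def)
  show "transp (L2_eq :: 'n field \<Rightarrow> _)" unfolding transp_def L2_eq_def by (auto elim: AE_mp)
qed

lemma rep_L2[simp]: "rep X \<in> L2"
  using Quotient_rep_reflp[OF Quotient_Lt, of X] by (simp add: L2_eq_def)

lemma cls_rep[simp]: "cls (rep X) = X"
  by (rule Quotient_abs_rep[OF Quotient_Lt])

lemma cls_eqI: "u \<in> L2 \<Longrightarrow> v \<in> L2 \<Longrightarrow> AE x in lebesgue. u x = v x \<Longrightarrow> cls u = cls v"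
  using Quotient_rel_abs[OF Quotient_Lt, of u v] by (simp add: L2_eq_def)

lemma cls_eqD: "u \<in> L2 \<Longrightarrow> v \<in> L2 \<Longrightarrow> cls u = cls v \<Longrightarrow> AE x in lebesgue. u x = v x"
  using Quotient_rel[OF Quotient_Lt, of u v] by (simp add: L2_eq_def)

lemma rep_cls: "u \<in> L2 \<Longrightarrow> AE x in lebesgue. rep (cls u) x = u x"
  by (rule cls_eqD) auto

lemma Lt_eqI: "AE x in lebesgue. rep X x = rep Y x \<Longrightarrow> X = Y"
  using cls_eqI[of "rep X" "rep Y"] by simp

instantiation Lt :: (finite) real_vector
begin

lift_definition zero_Lt :: "'a Lt" is "\<lambda>x. 0"
  by (simp add: L2_eq_def L2_zero)

lift_definition plus_Lt :: "'a Lt \<Rightarrow> 'a Lt \<Rightarrow> 'a Lt" is "\<lambda>u v x. u x + v x"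
  by (auto simp: L2_eq_def L2_add)

lift_definition minus_Lt :: "'a Lt \<Rightarrow> 'a Lt \<Rightarrow> 'a Lt" is "\<lambda>u v x. u x - v x"
  by (auto simp: L2_eq_def L2_diff)

lift_definition uminus_Lt :: "'a Lt \<Rightarrow> 'a Lt" is "\<lambda>u x. - u x"
  by (auto simp: L2_eq_def L2_uminus)

lift_definition scaleR_Lt :: "real \<Rightarrow> 'a Lt \<Rightarrow> 'a Lt" is "\<lambda>c u x. c *\<^sub>R u x"
  by (auto simp: L2_eq_def L2_scaleR)

instance
proof
  fix X Y Z :: "'a Lt" and a b :: real
  show "X + Y + Z = X + (Y + Z)" by transfer (auto simp: L2_eq_def L2_add add.assoc)
  show "X + Y = Y + X" by transfer (auto simp: L2_eq_def L2_add add.commute)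
  show "0 + X = X" by transfer (auto simp: L2_eq_def)
  show "- X + X = 0" by transfer (auto simp: L2_eq_def L2_zero)
  show "X - Y = X + - Y" by transfer (auto simp: L2_eq_def L2_diff)
  show "a *\<^sub>R (X + Y) = a *\<^sub>R X + a *\<^sub>R Y" by transfer (auto simp: L2_eq_def L2_add L2_scaleR scaleR_add_right)
  show "(a + b) *\<^sub>R X = a *\<^sub>R X + b *\<^sub>R X" by transfer (auto simp: L2_eq_def L2_add L2_scaleR scaleR_add_left)
  show "a *\<^sub>R b *\<^sub>R X = (a * b) *\<^sub>R X" by transfer (auto simp: L2_eq_def L2_scaleR)
  show "1 *\<^sub>R X = X" by transfer (auto simp: L2_eq_def)
qed

end

instantiation Lt :: (finite) real_inner
begin

lift_definition inner_Lt :: "'a Lt \<Rightarrow> 'a Lt \<Rightarrow> real" is "\<lambda>u v. LINT x|lebesgue. u x \<bullet> v x"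
  unfolding L2_eq_def by (rule integral_cong_AE) (auto dest: L2_measurable)

definition norm_Lt :: "'a Lt \<Rightarrow> real" where "norm_Lt X = sqrt (inner X X)"
definition sgn_Lt :: "'a Lt \<Rightarrow> 'a Lt" where "sgn_Lt X = X /\<^sub>R norm X"
definition dist_Lt :: "'a Lt \<Rightarrow> 'a Lt \<Rightarrow> real" where "dist_Lt X Y = norm (X - Y)"
definition uniformity_Lt :: "('a Lt \<times> 'a Lt) filter" where
  [code del]: "uniformity_Lt = (INF e\<in>{0<..}. principal {(x, y). dist x y < e})"
definition open_Lt :: "'a Lt set \<Rightarrow> bool" where
  [code del]: "open_Lt U \<longleftrightarrow> (\<forall>x\<in>U. eventually (\<lambda>(x', y). x' = x \<longrightarrow> y \<in> U) uniformity)"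

instance
proof
  fix X Y Z :: "'a Lt" and a :: real
  show "sgn X = X /\<^sub>R norm X" by (rule sgn_Lt_def)
  show "dist X Y = norm (X - Y)" by (rule dist_Lt_def)
  show "(uniformity :: ('a Lt \<times> 'a Lt) filter) = (INF e\<in>{0<..}. principal {(x, y). dist x y < e})"
    by (rule uniformity_Lt_def)
  show "open U \<longleftrightarrow> (\<forall>x\<in>U. eventually (\<lambda>(x', y). x' = x \<longrightarrow> y \<in> U) uniformity)" for U :: "'a Lt set"
    by (rule open_Lt_def)
  show "inner X Y = inner Y X" by transfer (simp add: inner_commute)
  show "inner (X + Y) Z = inner X Z + inner Y Z"
    by transfer (simp add: L2_eq_def inner_add_left L2_integrable_inner)
  show "inner (a *\<^sub>R X) Y = a * inner X Y" by transfer simp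
  show "0 \<le> inner X X" by transfer simp
  show "inner X X = 0 \<longleftrightarrow> X = 0"
  proof transfer
    fix u :: "'a field" assume "L2_eq u u"
    then have u: "u \<in> L2" by (simp add: L2_eq_def)
    have "(LINT x|lebesgue. u x \<bullet> u x) = 0 \<longleftrightarrow> (AE x in lebesgue. u x \<bullet> u x = 0)"
      by (rule integral_nonneg_eq_0_iff_AE) (auto intro: L2_integrable_inner u)
    then show "((LINT x|lebesgue. u x \<bullet> u x) = 0) = L2_eq u (\<lambda>x. 0)"
      using u by (simp add: L2_eq_def L2_zero)
  qed
  show "norm X = sqrt (inner X X)" by (rule norm_Lt_def)
qed

end

lemma cls_add: "u \<in> L2 \<Longrightarrow> v \<in> L2 \<Longrightarrow> cls (\<lambda>x. u x + v x) = cls u + cls v"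
  by (rule plus_Lt.abs_eq[symmetric]) (auto simp: L2_eq_def)

lemma cls_diff: "u \<in> L2 \<Longrightarrow> v \<in> L2 \<Longrightarrow> cls (\<lambda>x. u x - v x) = cls u - cls v"
  by (rule minus_Lt.abs_eq[symmetric]) (auto simp: L2_eq_def)

lemma cls_scaleR: "u \<in> L2 \<Longrightarrow> cls (\<lambda>x. c *\<^sub>R u x) = c *\<^sub>R cls u"
  by (rule scaleR_Lt.abs_eq[symmetric]) (auto simp: L2_eq_def)

lemma cls_zero: "cls (\<lambda>x. 0) = 0"
  by (simp add: zero_Lt_def)

lemma inner_cls: "u \<in> L2 \<Longrightarrow> v \<in> L2 \<Longrightarrow> inner (cls u) (cls v) = (LINT x|lebesgue. u x \<bullet> v x)"
  by (rule inner_Lt.abs_eq) (auto simp: L2_eq_def)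

lemma norm_cls: "u \<in> L2 \<Longrightarrow> norm (cls u) = L2_norm u"
  by (simp add: norm_eq_sqrt_inner inner_cls L2_norm_def power2_norm_eq_inner)

lemma inner_rep: "inner X Y = (LINT x|lebesgue. rep X x \<bullet> rep Y x)"
  using inner_cls[of "rep X" "rep Y"] by simp

lemma norm_sq_rep: "(norm X)\<^sup>2 = (LINT x|lebesgue. (norm (rep X x))\<^sup>2)"
  by (simp add: power2_norm_eq_inner inner_rep)

lemma rep_add: "AE x in lebesgue. rep (X + Y) x = rep X x + rep Y x"
  using rep_cls[OF L2_add[of "rep X" "rep Y"]] by (simp add: cls_add)

lemma rep_diff: "AE x in lebesgue. rep (X - Y) x = rep X x - rep Y x"
  using rep_cls[OF L2_diff[of "rep X" "rep Y"]] by (simp add: cls_diff)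

lemma rep_scaleR: "AE x in lebesgue. rep (c *\<^sub>R X) x = c *\<^sub>R rep X x"
  using rep_cls[OF L2_scaleR[of "rep X" c]] by (simp add: cls_scaleR)

lemma nn_integral_rep: "(\<integral>\<^sup>+x. ennreal ((norm (rep X x))\<^sup>2) \<partial>lebesgue) = ennreal ((norm X)\<^sup>2)"
  unfolding norm_sq_rep by (rule nn_integral_eq_integral) (auto intro: L2_integrable)

lemma nn_integral_rep_diff:
  "(\<integral>\<^sup>+x. ennreal ((norm (rep X x - rep Y x))\<^sup>2) \<partial>lebesgue) = ennreal ((norm (X - Y))\<^sup>2)"
  unfolding nn_integral_rep[symmetric]
  using rep_diff[of X Y] by (intro nn_integral_cong_AE) (auto elim!: eventually_mono)

lemma L2_nn_integralI:
  assumes [measurable]: "u \<in> borel_measurable lebesgue" and "(\<integral>\<^sup>+x. ennreal ((norm (u x))\<^sup>2) \<partial>lebesgue) < \<infinity>"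
  shows "u \<in> L2"
  using assms(2) by (auto simp: L2_def intro!: integrableI_bounded)

lemma half_power_sq: "((1/2) ^ k)\<^sup>2 = (1/4 :: real) ^ k"
  by (simp add: power2_eq_square flip: power_mult_distrib)

text \<open>Riesz-Fischer: along a rapidly Cauchy subsequence the squared increments, weighted by
  \<open>2 ^ k\<close>, have an integrable sum. This forces geometric decay of the increments at
  almost every point, hence pointwise convergence, and Fatou's lemma shows that the pointwise limit
  is the limit in norm.\<close>

instance Lt :: (finite) complete_space
proof
  fix X :: "nat \<Rightarrow> 'a Lt" assume "Cauchy X"
  then have "\<forall>k. \<exists>N. \<forall>m\<ge>N. \<forall>n\<ge>N. norm (X m - X n) < (1/2) ^ k"
    by (auto simp: Cauchy_iff)
  then obtain N where N: "\<And>k m n. N k \<le> m \<Longrightarrow> N k \<le> n \<Longrightarrow> norm (X m - X n) < (1/2) ^ k" by metis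
  \<comment> \<open>Partial sums of the thresholds dominate every earlier threshold, so
    \<open>r j\<close> is large enough for each index up to j.\<close>
  define r where "r k = (\<Sum>i\<le>k. N i)" for k
  have rN: "N k \<le> r j" if "k \<le> j" for k j
    unfolding r_def using that by (intro member_le_sum) auto
  define u where "u k = rep (X (r k))" for k
  have [measurable]: "u k \<in> borel_measurable lebesgue" for k unfolding u_def by (rule L2_measurable) simp
  have le: "(\<integral>\<^sup>+x. ennreal ((norm (u j x - u k x))\<^sup>2) \<partial>lebesgue) \<le> ennreal ((1/4) ^ k)" if "k \<le> j" for k j
  proof -
    have "(norm (X (r j) - X (r k)))\<^sup>2 \<le> ((1/2) ^ k)\<^sup>2"
      using N[OF rN[OF that] rN[OF order.refl]] by (intro power_mono) auto
    then show ?thesis unfolding u_def nn_integral_rep_diff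
      by (intro ennreal_leI) (simp only: half_power_sq)
  qed
  have "(\<integral>\<^sup>+x. (\<Sum>k. ennreal (2 ^ k) * ennreal ((norm (u (Suc k) x - u k x))\<^sup>2)) \<partial>lebesgue)
    = (\<Sum>k. \<integral>\<^sup>+x. ennreal (2 ^ k) * ennreal ((norm (u (Suc k) x - u k x))\<^sup>2) \<partial>lebesgue)"
    by (rule nn_integral_suminf) measurable
  also have "\<dots> \<le> (\<Sum>k. ennreal ((1/2) ^ k))"
  proof (rule suminf_le)
    fix k
    have "(\<integral>\<^sup>+x. ennreal (2 ^ k) * ennreal ((norm (u (Suc k) x - u k x))\<^sup>2) \<partial>lebesgue)
      = ennreal (2 ^ k) * (\<integral>\<^sup>+x. ennreal ((norm (u (Suc k) x - u k x))\<^sup>2) \<partial>lebesgue)"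
      by (rule nn_integral_cmult) measurable
    also have "\<dots> \<le> ennreal (2 ^ k) * ennreal ((1/4) ^ k)" by (intro mult_left_mono le) auto
    also have "\<dots> = ennreal ((1/2) ^ k)"
      by (simp add: power_mult_distrib[symmetric] flip: ennreal_mult)
    finally show "(\<integral>\<^sup>+x. ennreal (2 ^ k) * ennreal ((norm (u (Suc k) x - u k x))\<^sup>2) \<partial>lebesgue) \<le> ennreal ((1/2) ^ k)" .
  qed auto
  also have "\<dots> < \<infinity>" by (subst suminf_ennreal2) (auto intro!: summable_geometric)
  finally have fin: "(\<integral>\<^sup>+x. (\<Sum>k. ennreal (2 ^ k) * ennreal ((norm (u (Suc k) x - u k x))\<^sup>2)) \<partial>lebesgue) \<noteq> \<infinity>" by simp
  have "AE x in lebesgue. (\<Sum>k. ennreal (2 ^ k) * ennreal ((norm (u (Suc k) x - u k x))\<^sup>2)) \<noteq> \<infinity>"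
    by (rule nn_integral_PInf_AE[OF _ fin]) measurable
  then have conv: "AE x in lebesgue. convergent (\<lambda>k. u k x)"
  proof (rule AE_mp, intro AE_I2 impI)
    fix x assume ne: "(\<Sum>k. ennreal (2 ^ k) * ennreal ((norm (u (Suc k) x - u k x))\<^sup>2)) \<noteq> \<infinity>"
    define S where "S = enn2real (\<Sum>k. ennreal (2 ^ k) * ennreal ((norm (u (Suc k) x - u k x))\<^sup>2))"
    have S: "(\<Sum>k. ennreal (2 ^ k) * ennreal ((norm (u (Suc k) x - u k x))\<^sup>2)) = ennreal S"
      using ne unfolding S_def by (simp add: less_top)
    have S0: "S \<ge> 0" unfolding S_def by simp
    have "norm (u (Suc k) x - u k x) \<le> sqrt S * sqrt (1/2) ^ k" for k
    proof -
      have "ennreal (2 ^ k * (norm (u (Suc k) x - u k x))\<^sup>2) \<le> ennreal S"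
        unfolding S[symmetric] using ennreal_le_suminf[of "\<lambda>k. ennreal (2 ^ k) * ennreal ((norm (u (Suc k) x - u k x))\<^sup>2)" k]
        by (simp add: ennreal_mult)
      then have "2 ^ k * (norm (u (Suc k) x - u k x))\<^sup>2 \<le> S" using S0 by simp
      then have "(norm (u (Suc k) x - u k x))\<^sup>2 \<le> S * (1/2) ^ k" by (simp add: power_divide field_simps)
      then have "norm (u (Suc k) x - u k x) \<le> sqrt (S * (1/2) ^ k)" by (simp add: real_le_rsqrt)
      then show ?thesis by (simp add: real_sqrt_mult real_sqrt_power)
    qed
    then have "summable (\<lambda>k. u (Suc k) x - u k x)"
    proof (rule summable_comparison_test'[rotated, where N=0])
      show "summable (\<lambda>k. sqrt S * sqrt (1/2) ^ k)"
        by (intro summable_mult summable_geometric) (simp add: real_sqrt_divide)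
    qed
    then have "convergent (\<lambda>n. \<Sum>k<n. u (Suc k) x - u k x)" by (simp add: summable_iff_convergent)
    then have "convergent (\<lambda>n. u n x - u 0 x)" by (simp only: sum_lessThan_telescope[of "\<lambda>k. u k x"])
    then have "convergent (\<lambda>n. (u n x - u 0 x) + u 0 x)" by (intro convergent_add convergent_const)
    then show "convergent (\<lambda>k. u k x)" by simp
  qed
  define U where "U x = lim (\<lambda>k. u k x)" for x
  have [measurable]: "U \<in> borel_measurable lebesgue"
    unfolding U_def[abs_def] by (rule borel_measurable_lim_metric) measurable
  have Ule: "(\<integral>\<^sup>+x. ennreal ((norm (U x - u k x))\<^sup>2) \<partial>lebesgue) \<le> ennreal ((1/4) ^ k)" for k
  proof -
    have "(\<integral>\<^sup>+x. ennreal ((norm (U x - u k x))\<^sup>2) \<partial>lebesgue) = (\<integral>\<^sup>+x. liminf (\<lambda>j. ennreal ((norm (u j x - u k x))\<^sup>2)) \<partial>lebesgue)"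
    proof (rule nn_integral_cong_AE, use conv in eventually_elim)
      fix x assume "convergent (\<lambda>k. u k x)"
      then have "(\<lambda>j. u j x) \<longlonglongrightarrow> U x" unfolding U_def by (simp add: convergent_LIMSEQ_iff)
      then have "(\<lambda>j. ennreal ((norm (u j x - u k x))\<^sup>2)) \<longlonglongrightarrow> ennreal ((norm (U x - u k x))\<^sup>2)"
        by (intro tendsto_intros)
      then show "ennreal ((norm (U x - u k x))\<^sup>2) = liminf (\<lambda>j. ennreal ((norm (u j x - u k x))\<^sup>2))"
        by (intro lim_imp_Liminf[symmetric]) simp_all
    qed
    also have "\<dots> \<le> liminf (\<lambda>j. \<integral>\<^sup>+x. ennreal ((norm (u j x - u k x))\<^sup>2) \<partial>lebesgue)"
      by (rule nn_integral_liminf) measurable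
    also have "\<dots> \<le> liminf (\<lambda>j. ennreal ((1/4) ^ k))"
      by (rule Liminf_mono) (use le in \<open>auto simp: eventually_sequentially\<close>)
    finally show ?thesis by (simp add: Liminf_const)
  qed
  have "(\<lambda>x. U x - u 0 x) \<in> L2" by (rule L2_nn_integralI) (use Ule[of 0] in \<open>auto simp: le_less_trans\<close>)
  then have "(\<lambda>x. (U x - u 0 x) + u 0 x) \<in> L2" by (rule L2_add) (simp add: u_def)
  then have U: "U \<in> L2" by simp
  have nU: "norm (cls U - X (r k)) \<le> (1/2) ^ k" for k
  proof -
    have "ennreal ((norm (cls U - X (r k)))\<^sup>2) = (\<integral>\<^sup>+x. ennreal ((norm (U x - u k x))\<^sup>2) \<partial>lebesgue)"
      unfolding nn_integral_rep_diff[symmetric] u_def using rep_cls[OF U]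
      by (intro nn_integral_cong_AE) (auto elim!: eventually_mono)
    also have "\<dots> \<le> ennreal ((1/4) ^ k)" by (rule Ule)
    finally have "(norm (cls U - X (r k)))\<^sup>2 \<le> ((1/2) ^ k)\<^sup>2"
      by (simp add: half_power_sq)
    then show ?thesis by (rule power2_le_imp_le) simp
  qed
  have "X \<longlonglongrightarrow> cls U"
  proof (rule LIMSEQ_I)
    fix e :: real assume "e > 0"
    then obtain k where k: "(1/2) ^ k < e / 2" using real_arch_pow_inv[of "e/2" "1/2"] by auto
    have "norm (X n - cls U) < e" if "n \<ge> N k" for n
    proof -
      have "norm (X n - cls U) \<le> norm (X n - X (r k)) + norm (cls U - X (r k))"
        using norm_triangle_ineq4[of "X n - X (r k)" "cls U - X (r k)"] by simp
      then show ?thesis using N[OF that rN[OF order.refl]] nU[of k] k by linarith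
    qed
    then show "\<exists>no. \<forall>n\<ge>no. norm (X n - cls U) < e" by blast
  qed
  then show "convergent X" by (auto simp: convergent_def)
qed

instance Lt :: (finite) banach ..

section \<open>Multiplication operators with matrix symbols and their truncations\<close>

section \<open>Multiplication operators\<close>

text \<open>Measurability is required of the action on measurable fields and not of matrix entries;
  in this form it passes directly to sums and compositions.\<close>

definition multiplier :: "(real^'n::finite \<Rightarrow> real^'n \<Rightarrow> real^'n) \<Rightarrow> bool" where
  "multiplier m \<longleftrightarrow> (\<forall>xi. linear (m xi)) \<and>
     (\<forall>u\<in>borel_measurable lebesgue. (\<lambda>xi. m xi (u xi)) \<in> borel_measurable lebesgue)"

text \<open>The value is meaningful only for arguments in \<open>mdom m\<close>; elsewhere
  \<open>cls\<close> is applied to a function outside \<open>L2\<close>.\<close>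

definition mop :: "(real^'n::finite \<Rightarrow> real^'n \<Rightarrow> real^'n) \<Rightarrow> 'n Lt \<Rightarrow> 'n Lt" where
  "mop m X = cls (\<lambda>xi. m xi (rep X xi))"

definition mdom :: "(real^'n::finite \<Rightarrow> real^'n \<Rightarrow> real^'n) \<Rightarrow> 'n Lt set" where
  "mdom m = {X. (\<lambda>xi. m xi (rep X xi)) \<in> L2}"

lemma multiplierD:
  assumes "multiplier m"
  shows "linear (m xi)" "u \<in> borel_measurable lebesgue \<Longrightarrow> (\<lambda>xi. m xi (u xi)) \<in> borel_measurable lebesgue"
  using assms by (auto simp: multiplier_def)

lemma multiplier_rep: "multiplier m \<Longrightarrow> (\<lambda>xi. m xi (rep X xi)) \<in> borel_measurable lebesgue"
  by (rule multiplierD(2)[OF _ L2_measurable[OF rep_L2]])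

lemma multiplier_scalar:
  assumes [measurable]: "w \<in> borel_measurable lebesgue"
  shows "multiplier (\<lambda>xi v. w xi *\<^sub>R v)"
  unfolding multiplier_def by (auto intro!: linearI simp: scaleR_add_right borel_measurable_scaleR assms)

lemma multiplier_compose: "multiplier m \<Longrightarrow> multiplier m' \<Longrightarrow> multiplier (\<lambda>xi v. m' xi (m xi v))"
  unfolding multiplier_def by (auto intro: linear_compose[unfolded o_def])

lemma multiplier_add: "multiplier m \<Longrightarrow> multiplier m' \<Longrightarrow> multiplier (\<lambda>xi v. m xi v + m' xi v)"
  unfolding multiplier_def by (auto intro: linear_compose_add intro!: borel_measurable_add)

lemma mdomI:
  assumes m: "multiplier m" and u: "u \<in> L2" and mu: "(\<lambda>xi. m xi (u xi)) \<in> L2"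
  shows "cls u \<in> mdom m" "mop m (cls u) = cls (\<lambda>xi. m xi (u xi))"
proof -
  have ae: "AE xi in lebesgue. m xi (u xi) = m xi (rep (cls u) xi)"
    using rep_cls[OF u] by (auto elim!: eventually_mono)
  then have r: "(\<lambda>xi. m xi (rep (cls u) xi)) \<in> L2"
    by (rule L2_cong_AE[OF mu multiplier_rep[OF m]])
  then show "cls u \<in> mdom m" by (simp add: mdom_def)
  show "mop m (cls u) = cls (\<lambda>xi. m xi (u xi))"
    unfolding mop_def using ae by (intro cls_eqI r mu) auto
qed

lemma mdomI_AE:
  assumes "multiplier m" "AE xi in lebesgue. rep Y xi = m xi (rep X xi)"
  shows "X \<in> mdom m" "mop m X = Y"
proof -
  have "(\<lambda>xi. m xi (rep X xi)) \<in> L2" by (rule L2_cong_AE[OF rep_L2 multiplier_rep[OF assms(1)] assms(2)])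
  then show "X \<in> mdom m" "mop m X = Y"
    using cls_eqI[of "rep Y" "\<lambda>xi. m xi (rep X xi)"] assms(2) by (auto simp: mdom_def mop_def)
qed

lemma rep_mop: "X \<in> mdom m \<Longrightarrow> AE xi in lebesgue. rep (mop m X) xi = m xi (rep X xi)"
  unfolding mdom_def mop_def by (auto intro: rep_cls)

lemma mop_add:
  assumes "multiplier m" "X \<in> mdom m" "Y \<in> mdom m"
  shows "X + Y \<in> mdom m" "mop m (X + Y) = mop m X + mop m Y"
proof -
  have "AE xi in lebesgue. rep (mop m X + mop m Y) xi = m xi (rep (X + Y) xi)"
    using rep_add[of "mop m X" "mop m Y"] rep_add[of X Y] rep_mop[OF assms(2)] rep_mop[OF assms(3)]
    by eventually_elim (simp add: linear_add[OF multiplierD(1)[OF assms(1)]])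
  from mdomI_AE[OF assms(1) this] show "X + Y \<in> mdom m" "mop m (X + Y) = mop m X + mop m Y" by auto
qed

lemma mop_scaleR:
  assumes "multiplier m" "X \<in> mdom m"
  shows "c *\<^sub>R X \<in> mdom m" "mop m (c *\<^sub>R X) = c *\<^sub>R mop m X"
proof -
  have "AE xi in lebesgue. rep (c *\<^sub>R mop m X) xi = m xi (rep (c *\<^sub>R X) xi)"
    using rep_scaleR[of c "mop m X"] rep_scaleR[of c X] rep_mop[OF assms(2)]
    by eventually_elim (simp add: linear_cmul[OF multiplierD(1)[OF assms(1)]])
  from mdomI_AE[OF assms(1) this] show "c *\<^sub>R X \<in> mdom m" "mop m (c *\<^sub>R X) = c *\<^sub>R mop m X" by auto
qed

lemma mop_diff:
  assumes "multiplier m" "X \<in> mdom m" "Y \<in> mdom m"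
  shows "X - Y \<in> mdom m" "mop m (X - Y) = mop m X - mop m Y"
  using mop_add[OF assms(1,2) mop_scaleR(1)[OF assms(1,3), of "-1"]] mop_scaleR(2)[OF assms(1,3), of "-1"] by auto

text \<open>Pointwise domination of symbols yields an inclusion of domains together with a norm
  inequality. The operator norm inequalities for the wave equation are derived from symbols in this
  way.\<close>

lemma mop_dominated:
  assumes m: "X \<in> mdom m" "multiplier m'"
    and le: "\<And>xi v. norm (m' xi v) \<le> K * norm (m xi v)" and K: "K \<ge> 0"
  shows "X \<in> mdom m'" "norm (mop m' X) \<le> K * norm (mop m X)"
proof -
  have sq: "(norm (m' xi v))\<^sup>2 \<le> K\<^sup>2 * (norm (m xi v))\<^sup>2" for xi v
    using power_mono[OF le[of xi v] norm_ge_zero, of 2] by (simp add: power_mult_distrib)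
  have mL: "(\<lambda>xi. m xi (rep X xi)) \<in> L2" using m(1) by (simp add: mdom_def)
  have L: "(\<lambda>xi. m' xi (rep X xi)) \<in> L2"
    by (rule L2I[OF multiplier_rep[OF m(2)], of "\<lambda>xi. K\<^sup>2 * (norm (m xi (rep X xi)))\<^sup>2"])
      (auto intro!: integrable_mult_right L2_integrable mL sq)
  then show "X \<in> mdom m'" by (simp add: mdom_def)
  have "(norm (mop m' X))\<^sup>2 = (LINT xi|lebesgue. (norm (m' xi (rep X xi)))\<^sup>2)"
    using L by (simp add: mop_def norm_cls L2_norm_def)
  also have "\<dots> \<le> (LINT xi|lebesgue. K\<^sup>2 * (norm (m xi (rep X xi)))\<^sup>2)"
    by (intro integral_mono integrable_mult_right L2_integrable mL L sq)
  also have "\<dots> = (K * norm (mop m X))\<^sup>2"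
    using mL by (simp add: mop_def norm_cls L2_norm_def power_mult_distrib)
  finally show "norm (mop m' X) \<le> K * norm (mop m X)"
    by (rule power2_le_imp_le) (simp add: K)
qed

lemma mop_id: "X \<in> mdom (\<lambda>xi v. v)" "mop (\<lambda>xi v. v) X = X"
  by (simp_all add: mdom_def mop_def)

lemma mop_bounded:
  assumes "multiplier m" "\<And>xi v. norm (m xi v) \<le> K * norm v" "K \<ge> 0"
  shows "X \<in> mdom m" "norm (mop m X) \<le> K * norm X" "bounded_linear (mop m)"
proof -
  have 1: "X \<in> mdom m" "norm (mop m X) \<le> K * norm X" for X
    using mop_dominated[OF mop_id(1) assms, of X] by (simp_all add: mop_id)
  show "X \<in> mdom m" "norm (mop m X) \<le> K * norm X" by (fact 1)+
  show "bounded_linear (mop m)"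
    using assms(1) 1 by (intro bounded_linear_intro[where K=K]) (auto simp: mop_add mop_scaleR mult.commute)
qed

lemma mop_mop:
  assumes "multiplier m'" "multiplier m" "X \<in> mdom m" "mop m X \<in> mdom m'"
  shows "X \<in> mdom (\<lambda>xi v. m' xi (m xi v))" "mop (\<lambda>xi v. m' xi (m xi v)) X = mop m' (mop m X)"
proof -
  have "AE xi in lebesgue. rep (mop m' (mop m X)) xi = m' xi (m xi (rep X xi))"
    using rep_mop[OF assms(3)] rep_mop[OF assms(4)] by eventually_elim simp
  from mdomI_AE[OF multiplier_compose[OF assms(2,1)] this]
  show "X \<in> mdom (\<lambda>xi v. m' xi (m xi v))" "mop (\<lambda>xi v. m' xi (m xi v)) X = mop m' (mop m X)" by auto
qed

lemma inner_mop: "X \<in> mdom m \<Longrightarrow> inner (mop m X) Y = (LINT xi|lebesgue. m xi (rep X xi) \<bullet> rep Y xi)"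
  using inner_cls[of "\<lambda>xi. m xi (rep X xi)" "rep Y"] by (simp add: mdom_def mop_def)

lemma norm_mop_sq: "X \<in> mdom m \<Longrightarrow> (norm (mop m X))\<^sup>2 = (LINT xi|lebesgue. (norm (m xi (rep X xi)))\<^sup>2)"
  by (simp add: mdom_def mop_def norm_cls L2_norm_def)

lemma mop_symmetric:
  assumes "X \<in> mdom m" "Y \<in> mdom m" "\<And>xi v w. m xi v \<bullet> w = v \<bullet> m xi w"
  shows "inner (mop m X) Y = inner X (mop m Y)"
  unfolding inner_mop[OF assms(1)] inner_commute[of X] inner_mop[OF assms(2)]
  using assms(3) by (intro Bochner_Integration.integral_cong refl) (metis inner_commute)

lemma mop_nonneg:
  assumes "X \<in> mdom m" "\<And>xi v. 0 \<le> m xi v \<bullet> v"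
  shows "0 \<le> inner (mop m X) X"
  unfolding inner_mop[OF assms(1)] using assms(2) by simp

lemma norm_mop_form_le:
  assumes "X \<in> mdom w" "X \<in> mdom m" "\<And>xi v. (norm (w xi v))\<^sup>2 \<le> K * (m xi v \<bullet> v + (norm v)\<^sup>2)"
  shows "(norm (mop w X))\<^sup>2 \<le> K * (inner (mop m X) X + (norm X)\<^sup>2)"
proof -
  have L: "(\<lambda>xi. w xi (rep X xi)) \<in> L2" "(\<lambda>xi. m xi (rep X xi)) \<in> L2" using assms by (auto simp: mdom_def)
  have "(norm (mop w X))\<^sup>2 \<le> (LINT xi|lebesgue. K * (m xi (rep X xi) \<bullet> rep X xi + (norm (rep X xi))\<^sup>2))"
    unfolding norm_mop_sq[OF assms(1)]
    by (intro integral_mono integrable_mult_right Bochner_Integration.integrable_add L2_integrable L L2_integrable_inner rep_L2 assms(3))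
  also have "\<dots> = K * (inner (mop m X) X + (norm X)\<^sup>2)"
    unfolding inner_mop[OF assms(2)] norm_sq_rep
    by (simp add: Bochner_Integration.integral_add L2_integrable L2_integrable_inner L)
  finally show ?thesis .
qed

lemma form_le_norm_mop:
  assumes "X \<in> mdom w" "X \<in> mdom m" "\<And>xi v. m xi v \<bullet> v \<le> K * (norm (w xi v))\<^sup>2"
  shows "inner (mop m X) X \<le> K * (norm (mop w X))\<^sup>2"
proof -
  have L: "(\<lambda>xi. w xi (rep X xi)) \<in> L2" "(\<lambda>xi. m xi (rep X xi)) \<in> L2" using assms by (auto simp: mdom_def)
  have "inner (mop m X) X \<le> (LINT xi|lebesgue. K * (norm (w xi (rep X xi)))\<^sup>2)"
    unfolding inner_mop[OF assms(2)]
    by (intro integral_mono integrable_mult_right L2_integrable L L2_integrable_inner rep_L2 assms(3))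
  then show ?thesis by (simp add: norm_mop_sq[OF assms(1)])
qed

text \<open>Restriction to a ball of frequencies, which turns a symbol of polynomial growth into a
  bounded operator.\<close>

definition band :: "nat \<Rightarrow> (real^'n::finite \<Rightarrow> real^'n \<Rightarrow> real^'n) \<Rightarrow> real^'n \<Rightarrow> real^'n \<Rightarrow> real^'n" where
  "band k m xi v = indicator (cball 0 (real k)) xi *\<^sub>R m xi v"

lemma multiplier_band:
  assumes "multiplier m"
  shows "multiplier (band k m)"
proof -
  have "multiplier (\<lambda>xi v. indicator (cball 0 (real k)) xi *\<^sub>R m xi v)"
    by (rule multiplier_compose[OF assms multiplier_scalar]) (intro borel_measurable_indicator, simp)
  then show ?thesis by (simp add: band_def[abs_def])
qed

lemma band_le: "norm (band k m xi v) \<le> norm (m xi v)"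
  by (simp add: band_def indicator_def)

lemma mop_band_tendsto:
  assumes m: "multiplier m" and X: "X \<in> mdom m"
  shows "(\<lambda>k. mop (band k m) X) \<longlonglongrightarrow> mop m X"
proof -
  have L: "(\<lambda>xi. m xi (rep X xi)) \<in> L2" using X by (simp add: mdom_def)
  have Xk: "X \<in> mdom (band k m)" for k
    by (rule mop_dominated(1)[OF X multiplier_band[OF m], where K=1]) (simp_all add: band_le)
  have "(\<lambda>k. LINT xi|lebesgue. (norm (m xi (rep X xi) - band k m xi (rep X xi)))\<^sup>2) \<longlonglongrightarrow> (LINT (xi::real^'a)|lebesgue. (0::real))"
  proof (rule integral_dominated_convergence[where w="\<lambda>xi. (norm (m xi (rep X xi)))\<^sup>2"])
    show "AE xi in lebesgue. (\<lambda>k. (norm (m xi (rep X xi) - band k m xi (rep X xi)))\<^sup>2) \<longlonglongrightarrow> 0"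
    proof (rule AE_I2)
      fix xi :: "real^'a"
      obtain K where K: "norm xi \<le> real K" using real_arch_simple by blast
      have "\<forall>\<^sub>F k in sequentially. (norm (m xi (rep X xi) - band k m xi (rep X xi)))\<^sup>2 = 0"
        unfolding eventually_sequentially by (intro exI[of _ K]) (use K in \<open>auto simp: band_def\<close>)
      then show "(\<lambda>k. (norm (m xi (rep X xi) - band k m xi (rep X xi)))\<^sup>2) \<longlonglongrightarrow> 0" by (rule tendsto_eventually)
    qed
    show "AE xi in lebesgue. norm ((norm (m xi (rep X xi) - band k m xi (rep X xi)))\<^sup>2) \<le> (norm (m xi (rep X xi)))\<^sup>2" for k
      by (intro AE_I2) (simp add: band_def indicator_def)
    show "(\<lambda>xi. (norm (m xi (rep X xi) - band k m xi (rep X xi)))\<^sup>2) \<in> borel_measurable lebesgue" for k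
      using L Xk[of k] by (intro borel_measurable_power borel_measurable_norm borel_measurable_diff L2_measurable) (auto simp: mdom_def)
  qed (auto intro: L2_integrable L)
  moreover have "(LINT xi|lebesgue. (norm (m xi (rep X xi) - band k m xi (rep X xi)))\<^sup>2) = (norm (mop m X - mop (band k m) X))\<^sup>2" for k
  proof -
    have "mop m X - mop (band k m) X = cls (\<lambda>xi. m xi (rep X xi) - band k m xi (rep X xi))"
      unfolding mop_def using L Xk[of k] by (subst cls_diff) (auto simp: mdom_def)
    moreover have "(\<lambda>xi. m xi (rep X xi) - band k m xi (rep X xi)) \<in> L2"
      using L Xk[of k] by (intro L2_diff) (auto simp: mdom_def)
    ultimately show ?thesis by (simp add: norm_cls L2_norm_def)
  qed
  ultimately have "(\<lambda>k. (norm (mop m X - mop (band k m) X))\<^sup>2) \<longlonglongrightarrow> 0" by simp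
  then have "(\<lambda>k. norm (mop m X - mop (band k m) X)) \<longlonglongrightarrow> 0"
    using tendsto_real_sqrt by fastforce
  then have "(\<lambda>k. norm (mop (band k m) X - mop m X)) \<longlonglongrightarrow> 0" by (simp add: norm_minus_commute)
  then show ?thesis by (simp only: tendsto_norm_zero_iff LIM_zero_iff)
qed

text \<open>A closed graph statement: membership in the domain can be read off the band-off operators.\<close>

lemma mop_band_convergent:
  assumes m: "multiplier m" and bd: "\<And>k xi v. norm (band k m xi v) \<le> K k * norm v"
    and lim: "(\<lambda>k. mop (band k m) X) \<longlonglongrightarrow> Y"
  shows "X \<in> mdom m" "mop m X = Y"
proof -
  \<comment> \<open>The bound is evaluated at a unit vector to see that its constant is
    nonnegative.\<close>
  have K: "K k \<ge> 0" for k using order.trans[OF norm_ge_zero bd[of k _ "axis undefined 1"]] by (simp add: zero_le_mult_iff)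
  have Xk: "X \<in> mdom (band k m)" for k by (rule mop_bounded(1)[OF multiplier_band[OF m] bd K])
  have P: "multiplier (band j (\<lambda>xi v. v))" for j
    by (rule multiplier_band) (simp add: multiplier_def linear_id[unfolded id_def])
  have P1: "norm (band j (\<lambda>xi v. v) xi v) \<le> 1 * norm v" for j xi v using band_le[of j "\<lambda>xi v. v" xi v] by simp
  \<comment> \<open>On the ball of radius j the truncations beyond j no longer change, so
    restricting the limit to that ball compares \<open>Y\<close> with \<open>m\<close> applied to
    \<open>X\<close>; the balls exhaust the space.\<close>
  have "AE xi in lebesgue. band j (\<lambda>xi v. v) xi (rep Y xi) = band j m xi (rep X xi)" for j
  proof -
    have "(\<lambda>k. mop (band j (\<lambda>xi v. v)) (mop (band k m) X)) \<longlonglongrightarrow> mop (band j (\<lambda>xi v. v)) Y"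
      by (rule bounded_linear.tendsto[OF mop_bounded(3)[OF P P1] lim]) simp
    moreover have "\<forall>\<^sub>F k in sequentially. mop (band j (\<lambda>xi v. v)) (mop (band k m) X) = mop (band j m) X"
      unfolding eventually_sequentially
    proof (intro exI[of _ j] allI impI)
      fix k assume "j \<le> k"
      then have "band j (\<lambda>xi v. v) xi (band k m xi v) = band j m xi v" for xi v
        by (auto simp: band_def indicator_def)
      then show "mop (band j (\<lambda>xi v. v)) (mop (band k m) X) = mop (band j m) X"
        using mop_mop(2)[OF P[of j] multiplier_band[OF m, of k] Xk[of k] mop_bounded(1)[OF P P1]] by simp
    qed
    ultimately have "mop (band j (\<lambda>xi v. v)) Y = mop (band j m) X"
      by (metis LIMSEQ_unique tendsto_eventually)
    then have "AE xi in lebesgue. rep (mop (band j (\<lambda>xi v. v)) Y) xi = rep (mop (band j m) X) xi" by simp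
    then show ?thesis using rep_mop[OF mop_bounded(1)[where X=Y, OF P[of j] P1 zero_le_one]] rep_mop[OF Xk[of j]]
      by eventually_elim simp
  qed
  then have "AE xi in lebesgue. \<forall>j. band j (\<lambda>xi v. v) xi (rep Y xi) = band j m xi (rep X xi)"
    by (simp add: AE_all_countable)
  then have "AE xi in lebesgue. rep Y xi = m xi (rep X xi)"
  proof (rule AE_mp, intro AE_I2 impI)
    fix xi assume a: "\<forall>j. band j (\<lambda>xi v. v) xi (rep Y xi) = band j m xi (rep X xi)"
    obtain j where "norm xi \<le> real j" using real_arch_simple by blast
    then show "rep Y xi = m xi (rep X xi)" using a[rule_format, of j] by (simp add: band_def)
  qed
  from mdomI_AE[OF m this] show "X \<in> mdom m" "mop m X = Y" by auto
qed

section \<open>Density of a subspace with trivial orthogonal complement\<close>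

section \<open>Density in Hilbert spaces\<close>

abbreviation vderiv :: "real \<Rightarrow> (real \<Rightarrow> 'h::real_normed_vector) \<Rightarrow> 'h \<Rightarrow> real \<Rightarrow> bool" where
  "vderiv T y y' t \<equiv> (y has_vector_derivative y') (at t within {0..T})"

text \<open>A minimising sequence for the distance from x to S is Cauchy by the parallelogram
  identity. The difference of x and its limit is orthogonal to S, hence 0, so the sequence converges
  to x itself.\<close>

lemma dense_if_orthogonal_trivial:
  fixes S :: "'h::{real_inner, complete_space} set"
  assumes S: "subspace S" and triv: "\<And>x. (\<And>s. s \<in> S \<Longrightarrow> inner x s = 0) \<Longrightarrow> x = 0"
  shows "\<exists>s. (\<forall>k::nat. s k \<in> S) \<and> s \<longlonglongrightarrow> x"
proof -
  define D where "D = Inf ((\<lambda>s. (norm (x - s))\<^sup>2) ` S)"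
  have ne: "(\<lambda>s. (norm (x - s))\<^sup>2) ` S \<noteq> {}" using subspace_0[OF S] by blast
  have bb: "bdd_below ((\<lambda>s. (norm (x - s))\<^sup>2) ` S)" by (rule bdd_belowI[of _ 0]) auto
  have D: "D \<le> (norm (x - s))\<^sup>2" if "s \<in> S" for s
    unfolding D_def using that by (intro cInf_lower bb) auto
  have "\<exists>s\<in>S. (norm (x - s))\<^sup>2 < D + 1 / real (Suc k)" for k
    using cInf_lessD[OF ne, of "D + 1 / real (Suc k)"] by (auto simp: D_def)
  then obtain s where sS: "\<And>k. s k \<in> S" and sD: "\<And>k. (norm (x - s k))\<^sup>2 < D + 1 / real (Suc k)" by metis
  have par: "(norm (s j - s k))\<^sup>2 \<le> 2 / real (Suc j) + 2 / real (Suc k)" for j k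
  proof -
    have "D \<le> (norm (x - (1/2) *\<^sub>R (s j + s k)))\<^sup>2"
      by (intro D subspace_scale subspace_add S sS)
    moreover have "(norm (s j - s k))\<^sup>2 = 2 * (norm (x - s j))\<^sup>2 + 2 * (norm (x - s k))\<^sup>2 - 4 * (norm (x - (1/2) *\<^sub>R (s j + s k)))\<^sup>2"
      unfolding power2_norm_eq_inner by (simp add: inner_simps inner_commute algebra_simps)
    ultimately show ?thesis using sD[of j] sD[of k] by linarith
  qed
  have "Cauchy s"
  proof (rule CauchyI)
    fix e :: real assume e: "e > 0"
    obtain N where N: "4 / e\<^sup>2 < real N" using reals_Archimedean2 by blast
    have "norm (s j - s k) < e" if "j \<ge> N" "k \<ge> N" for j k
    proof -
      have NS: "4 / e\<^sup>2 < real (Suc i)" if "i \<ge> N" for i using N that by linarith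
      have *: "2 / real (Suc i) < e\<^sup>2 / 2" if "i \<ge> N" for i
        using NS[OF that] e by (simp add: field_simps del: of_nat_Suc)
      have "(norm (s j - s k))\<^sup>2 < e\<^sup>2" using par[of j k] *[OF that(1)] *[OF that(2)] by linarith
      then show ?thesis using e by (simp add: power_less_imp_less_base)
    qed
    then show "\<exists>M. \<forall>m\<ge>M. \<forall>n\<ge>M. norm (s m - s n) < e" by blast
  qed
  then obtain p where p: "s \<longlonglongrightarrow> p" using Cauchy_convergent convergent_def by blast
  have px: "(norm (x - p))\<^sup>2 \<le> D"
  proof (rule LIMSEQ_le)
    show "(\<lambda>k. (norm (x - s k))\<^sup>2) \<longlonglongrightarrow> (norm (x - p))\<^sup>2" by (intro tendsto_intros p)
    have "(\<lambda>k. D + 1 / real (Suc k)) \<longlonglongrightarrow> D + 0"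
      using LIMSEQ_inverse_real_of_nat by (intro tendsto_add tendsto_const) (simp add: inverse_eq_divide)
    then show "(\<lambda>k. D + 1 / real (Suc k)) \<longlonglongrightarrow> D" by simp
  qed (use sD less_imp_le in blast)
  have "x - p = 0"
  proof (rule triv)
    fix a assume a: "a \<in> S"
    have ge: "(norm (x - p))\<^sup>2 \<le> (norm (x - p - t *\<^sub>R a))\<^sup>2" for t
    proof -
      have "D \<le> (norm (x - (p + t *\<^sub>R a)))\<^sup>2"
      proof (rule LIMSEQ_le_const)
        show "(\<lambda>k. (norm (x - (s k + t *\<^sub>R a)))\<^sup>2) \<longlonglongrightarrow> (norm (x - (p + t *\<^sub>R a)))\<^sup>2" by (intro tendsto_intros p)
        show "\<exists>N. \<forall>n\<ge>N. D \<le> (norm (x - (s n + t *\<^sub>R a)))\<^sup>2"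
          by (intro exI allI impI D subspace_add subspace_scale S sS a)
      qed
      from order.trans[OF px this] show ?thesis by (simp add: diff_diff_eq)
    qed
    show "inner (x - p) a = 0"
    proof (cases "a = 0")
      case False
      \<comment> \<open>The minimiser of the quadratic polynomial t -> |x - p - t a|^2; there the
        square has dropped by the square of \<open>inner (x - p) a\<close> divided by
        \<open>inner a a\<close>.\<close>
      define t where "t = inner (x - p) a / inner a a"
      have "(norm (x - p - t *\<^sub>R a))\<^sup>2 = (norm (x - p))\<^sup>2 - 2 * t * inner (x - p) a + t * t * inner a a"
        unfolding power2_norm_eq_inner by (simp add: inner_diff_left inner_diff_right inner_commute algebra_simps)
      also have "\<dots> = (norm (x - p))\<^sup>2 - (inner (x - p) a)\<^sup>2 / inner a a"
        using False unfolding t_def by (simp add: power2_eq_square)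
      finally have "(inner (x - p) a)\<^sup>2 / inner a a \<le> 0" using ge[of t] by simp
      moreover have "inner a a > 0" using False by simp
      ultimately have "(inner (x - p) a)\<^sup>2 \<le> 0" by (simp add: divide_le_0_iff)
      then show ?thesis by simp
    qed simp
  qed
  then show ?thesis using sS p by auto
qed

section \<open>Linear evolution with bounded operators: Picard iteration and energy
  estimates\<close>

section \<open>Linear differential equations with bounded operators\<close>

lemma has_vector_derivative_uniform_limit:
  fixes Y Y' :: "nat \<Rightarrow> real \<Rightarrow> 'h::banach"
  assumes d: "\<And>k t. t \<in> {0..T} \<Longrightarrow> vderiv T (Y k) (Y' k t) t"
    and u: "uniform_limit {0..T} Y' Z sequentially"
    and l: "\<And>t. t \<in> {0..T} \<Longrightarrow> (\<lambda>k. Y k t) \<longlonglongrightarrow> L t" and t: "t \<in> {0..T}"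
  shows "vderiv T L (Z t) t"
proof -
  have "\<exists>g. \<forall>t\<in>{0..T}. (\<lambda>n. Y n t) \<longlonglongrightarrow> g t \<and> (g has_derivative (\<lambda>h. h *\<^sub>R Z t)) (at t within {0..T})"
  proof (rule has_derivative_sequence)
    show "(Y n has_derivative (\<lambda>h. h *\<^sub>R Y' n t)) (at t within {0..T})" if "t \<in> {0..T}" for n t
      using d[OF that] by (simp add: has_vector_derivative_def)
    show "(\<lambda>n. Y n t) \<longlonglongrightarrow> L t" by (rule l[OF t])
    show "\<forall>\<^sub>F n in sequentially. \<forall>t\<in>{0..T}. \<forall>h. norm (h *\<^sub>R Y' n t - h *\<^sub>R Z t) \<le> e * norm h" if "e > 0" for e
    proof -
      have "\<forall>\<^sub>F n in sequentially. \<forall>t\<in>{0..T}. dist (Y' n t) (Z t) < e"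
        using u that by (auto simp: uniform_limit_iff)
      then show ?thesis
      proof eventually_elim
        case (elim n)
        then show ?case
          by (auto simp: dist_norm scaleR_diff_right[symmetric] mult.commute[of e] simp del: scaleR_diff_right intro!: mult_left_mono intro: less_imp_le)
      qed
    qed
  qed (use t in auto)
  then obtain g where g: "\<And>t. t \<in> {0..T} \<Longrightarrow> (\<lambda>n. Y n t) \<longlonglongrightarrow> g t"
    and dg: "\<And>t. t \<in> {0..T} \<Longrightarrow> (g has_derivative (\<lambda>h. h *\<^sub>R Z t)) (at t within {0..T})" by blast
  have "g s = L s" if "s \<in> {0..T}" for s using LIMSEQ_unique[OF g[OF that] l[OF that]] .
  then show ?thesis unfolding has_vector_derivative_def
    using has_derivative_transform[OF t _ dg[OF t], of L] by simp
qed

text \<open>The iteration converges on all of [0, T] at once when increments are measured against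
  exp(2 K t): the integral of K exp(2 K s) from 0 to t is less than half of exp(2 K t), so each step
  halves the weighted bound.\<close>

lemma picard_linear:
  fixes G :: "'h::banach \<Rightarrow> 'h"
  assumes G: "bounded_linear G" and F: "continuous_on {0..T} F" and T: "0 \<le> T"
  shows "\<exists>X. X 0 = X0 \<and> (\<forall>t\<in>{0..T}. vderiv T X (G (X t) + F t) t)"
proof -
  interpret G: bounded_linear G by (rule G)
  obtain K where K: "K > 0" "\<And>x. norm (G x) \<le> norm x * K" using G.pos_bounded by blast
  define X where "X = rec_nat (\<lambda>t. X0) (\<lambda>n Y t. X0 + integral {0..t} (\<lambda>s. G (Y s) + F s))"
  have X_0: "X 0 = (\<lambda>t. X0)" and X_Suc: "X (Suc n) = (\<lambda>t. X0 + integral {0..t} (\<lambda>s. G (X n s) + F s))" for n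
    by (simp_all add: X_def)
  have cX: "continuous_on {0..T} (X n)" and
    dX: "\<And>t. t \<in> {0..T} \<Longrightarrow> vderiv T (X (Suc n)) (G (X n t) + F t) t" for n
  proof (induction n)
    have d: "vderiv T (X (Suc n)) (G (X n t) + F t) t"
      if c: "continuous_on {0..T} (X n)" and t: "t \<in> {0..T}" for n t
    proof -
      have "continuous_on {0..T} (\<lambda>s. G (X n s) + F s)"
        by (intro continuous_intros F G.continuous_on c)
      from integral_has_vector_derivative[OF this t] show ?thesis
        unfolding X_Suc by (auto intro!: derivative_eq_intros)
    qed
    case 0
    { case 1 show ?case by (simp add: X_0) }
    { case 2 show ?case using d[of 0] 2 by (simp add: X_0) }
    case (Suc n)
    have c: "continuous_on {0..T} (X (Suc n))"
      by (rule continuous_on_vector_derivative[OF Suc(2)])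
    { case 1 show ?case by (rule c) }
    { case 2 show ?case by (rule d[OF c 2]) }
  qed
  have X_init: "X n 0 = X0" for n by (cases n) (simp_all add: X_0 X_Suc)
  have "bounded ((\<lambda>t. X 1 t - X 0 t) ` {0..T})"
    by (intro compact_imp_bounded compact_continuous_image continuous_intros cX) auto
  then obtain C where C': "\<forall>y\<in>((\<lambda>t. X 1 t - X 0 t) ` {0..T}). norm y \<le> C" unfolding bounded_iff by blast
  have C: "norm (X 1 t - X 0 t) \<le> C" if "t \<in> {0..T}" for t using C' that by blast
  have C0: "C \<ge> 0" using order.trans[OF norm_ge_zero C[of 0]] T by simp
  have bd: "t \<in> {0..T} \<Longrightarrow> norm (X (Suc n) t - X n t) \<le> C * (1/2) ^ n * exp (2 * K * t)" for n t
  proof (induction n arbitrary: t)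
    case 0
    have "C * 1 \<le> C * exp (2 * K * t)" using 0 K C0 by (intro mult_left_mono) auto
    then show ?case using C[OF 0] by simp
  next
    case (Suc n)
    define D where "D s = X (Suc (Suc n)) s - X (Suc n) s" for s
    have dD: "(D has_vector_derivative G (X (Suc n) s - X n s)) (at s within {0..T})" if "s \<in> {0..T}" for s
      unfolding D_def using has_vector_derivative_diff[OF dX[OF that, of "Suc n"] dX[OF that, of n]] by (simp add: G.diff)
    show ?case
    proof (cases "t = 0")
      case True
      then show ?thesis using C0 by (simp add: X_init)
    next
      case False
      then have t: "0 < t" "t \<le> T" using Suc.prems by auto
      have "norm (D t - D 0) \<le> C * (1/2) ^ Suc n * exp (2 * K * t) - C * (1/2) ^ Suc n * exp (2 * K * 0)"
      proof (rule differentiable_bound_general[OF t(1)])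
        have "continuous_on {0..T} D" unfolding D_def by (intro continuous_intros cX)
        then show "continuous_on {0..t} D" by (rule continuous_on_subset) (use t in auto)
        show "continuous_on {0..t} (\<lambda>s. C * (1/2) ^ Suc n * exp (2 * K * s))" by (intro continuous_intros)
        fix s assume s: "0 < s" "s < t"
        have "(D has_vector_derivative G (X (Suc n) s - X n s)) (at s within {0..T})" using s t by (intro dD) auto
        then show "(D has_vector_derivative G (X (Suc n) s - X n s)) (at s)"
          using s t at_within_Icc_at[of 0 s T] by simp
        show "((\<lambda>s. C * (1/2) ^ Suc n * exp (2 * K * s)) has_vector_derivative C * (1/2) ^ n * exp (2 * K * s) * K) (at s)"
          unfolding has_real_derivative_iff_has_vector_derivative[symmetric]
          by (auto intro!: derivative_eq_intros)
        have "norm (G (X (Suc n) s - X n s)) \<le> norm (X (Suc n) s - X n s) * K" by (rule K(2))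
        also have "\<dots> \<le> C * (1/2) ^ n * exp (2 * K * s) * K"
          using s t K(1) by (intro mult_right_mono Suc.IH) auto
        finally show "norm (G (X (Suc n) s - X n s)) \<le> C * (1/2) ^ n * exp (2 * K * s) * K" .
      qed
      moreover have D0: "D 0 = 0" by (simp add: D_def X_init)
      moreover have "0 \<le> C * (1/2) ^ Suc n * exp (2 * K * 0)" using C0 by simp
      ultimately have "norm (D t) \<le> C * (1/2) ^ Suc n * exp (2 * K * t)" unfolding D0 diff_zero by linarith
      then show ?thesis by (simp only: D_def)
    qed
  qed
  define B where "B = C * exp (2 * K * T)"
  have bdB: "norm (X (Suc n) t - X n t) \<le> B * (1/2) ^ n" if "t \<in> {0..T}" for n t
  proof -
    have "C * (1/2) ^ n * exp (2 * K * t) \<le> C * (1/2) ^ n * exp (2 * K * T)"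
      using that K(1) C0 by (intro mult_left_mono) auto
    then show ?thesis using bd[OF that, of n] by (simp add: B_def mult_ac)
  qed
  have "uniform_limit {0..T} (\<lambda>n t. \<Sum>i<n. X (Suc i) t - X i t) (\<lambda>t. \<Sum>i. X (Suc i) t - X i t) sequentially"
    by (rule Weierstrass_m_test[OF bdB]) (auto intro!: summable_mult summable_geometric)
  moreover have "(\<Sum>i<n. X (Suc i) t - X i t) = X n t - X0" for n t
    using sum_lessThan_telescope[of "\<lambda>i. X i t" n] by (simp add: X_0)
  ultimately have S: "uniform_limit {0..T} (\<lambda>n t. X n t - X0) (\<lambda>t. \<Sum>i. X (Suc i) t - X i t) sequentially" by simp
  define Y where "Y t = X0 + (\<Sum>i. X (Suc i) t - X i t)" for t
  have Y: "uniform_limit {0..T} X Y sequentially"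
    using uniform_limit_add[OF uniform_limit_const S, of "\<lambda>t. X0"] by (simp add: Y_def[abs_def])
  have lim: "(\<lambda>n. X n t) \<longlonglongrightarrow> Y t" if "t \<in> {0..T}" for t by (rule tendsto_uniform_limitI[OF Y that])
  have "uniform_limit {0..T} (\<lambda>n t. G (X n t) + F t) (\<lambda>t. G (Y t) + F t) sequentially"
    by (intro uniform_limit_add uniform_limit_const G.uniform_limit Y)
  from has_vector_derivative_uniform_limit[OF dX this LIMSEQ_Suc[OF lim]]
  have "vderiv T Y (G (Y t) + F t) t" if "t \<in> {0..T}" for t using that by blast
  moreover have "Y 0 = X0" using LIMSEQ_unique[OF lim[of 0], of X0] T by (simp add: X_init)
  ultimately show ?thesis by blast
qed

lemma has_real_derivative_inner:
  fixes f g :: "real \<Rightarrow> 'h::real_inner"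
  assumes "(f has_vector_derivative f') (at t within S)" "(g has_vector_derivative g') (at t within S)"
  shows "((\<lambda>t. inner (f t) (g t)) has_real_derivative (inner (f t) g' + inner f' (g t))) (at t within S)"
  using bounded_bilinear.has_vector_derivative[OF bounded_bilinear_inner assms]
  by (simp add: has_real_derivative_iff_has_vector_derivative)

lemma nonincreasing_within:
  fixes \<phi> :: "real \<Rightarrow> real"
  assumes d: "\<And>s. s \<in> {0..T} \<Longrightarrow> (\<phi> has_real_derivative \<phi>' s) (at s within {0..T})"
    and neg: "\<And>s. s \<in> {0..T} \<Longrightarrow> \<phi>' s \<le> 0" and t: "t \<in> {0..T}"
  shows "\<phi> t \<le> \<phi> 0"
proof (cases "t = 0")
  case False
  then have t': "0 < t" using t by simp
  have "\<exists>s\<in>{0<..<t}. \<phi> t - \<phi> 0 = \<phi>' s * (t - 0)"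
  proof (rule mvt_simple[OF t'])
    fix s assume "0 \<le> s" "s \<le> t"
    then have "(\<phi> has_real_derivative \<phi>' s) (at s within {0..t})"
      using d[of s] t by (auto intro: has_field_derivative_subset)
    then show "(\<phi> has_derivative (*) (\<phi>' s)) (at s within {0..t})"
      by (simp add: has_field_derivative_def)
  qed
  then obtain s where s: "s \<in> {0<..<t}" "\<phi> t - \<phi> 0 = \<phi>' s * (t - 0)" by blast
  have "\<phi>' s * (t - 0) \<le> 0" using neg[of s] s(1) t t' by (intro mult_nonpos_nonneg) auto
  then show ?thesis using s(2) by linarith
qed simp

text \<open>The function \<open>e\<^sup>-\<^sup>t E(t) - \<gamma>\<^sup>2 t\<close> is nonincreasing, where \<open>E\<close> is the energy.\<close>

lemma energy_estimate:
  fixes y v g :: "real \<Rightarrow> 'h::real_inner"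
  assumes B: "bounded_linear B" and sym: "\<And>x z. inner (B x) z = inner x (B z)" and pos: "\<And>x. 0 \<le> inner (B x) x"
    and y: "\<And>t. t \<in> {0..T} \<Longrightarrow> vderiv T y (v t) t"
    and v: "\<And>t. t \<in> {0..T} \<Longrightarrow> vderiv T v (g t - B (y t)) t"
    and g: "\<And>t. t \<in> {0..T} \<Longrightarrow> norm (g t) \<le> \<gamma>" and t: "t \<in> {0..T}"
  shows "(norm (v t))\<^sup>2 + inner (B (y t)) (y t) \<le> exp T * ((norm (v 0))\<^sup>2 + inner (B (y 0)) (y 0) + T * \<gamma>\<^sup>2)"
proof -
  define E where "E t = inner (v t) (v t) + inner (B (y t)) (y t)" for t
  have dE: "(E has_real_derivative 2 * inner (g s) (v s)) (at s within {0..T})" if s: "s \<in> {0..T}" for s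
  proof -
    note dBy = bounded_linear.has_vector_derivative[OF B y[OF s]]
    have "(E has_real_derivative (inner (v s) (g s - B (y s)) + inner (g s - B (y s)) (v s)) + (inner (B (y s)) (v s) + inner (B (v s)) (y s))) (at s within {0..T})"
      unfolding E_def[abs_def]
      by (intro DERIV_add has_real_derivative_inner v[OF s] dBy y[OF s])
    moreover have "(inner (v s) (g s - B (y s)) + inner (g s - B (y s)) (v s)) + (inner (B (y s)) (v s) + inner (B (v s)) (y s)) = 2 * inner (g s) (v s)"
      using sym[of "v s" "y s"] by (simp add: inner_diff_left inner_diff_right inner_commute)
    ultimately show ?thesis by simp
  qed
  have "exp (- t) * E t - \<gamma>\<^sup>2 * t \<le> exp (- 0) * E 0 - \<gamma>\<^sup>2 * 0"
  proof (rule nonincreasing_within[OF _ _ t])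
    fix s assume s: "s \<in> {0..T}"
    show "((\<lambda>s. exp (- s) * E s - \<gamma>\<^sup>2 * s) has_real_derivative exp (- s) * (2 * inner (g s) (v s) - E s) - \<gamma>\<^sup>2) (at s within {0..T})"
      by (auto intro!: derivative_eq_intros dE[OF s] simp: algebra_simps)
    have "2 * inner (g s) (v s) - E s \<le> \<gamma>\<^sup>2"
    proof -
      have "0 \<le> inner (g s - v s) (g s - v s)" by simp
      then have "2 * inner (g s) (v s) \<le> inner (g s) (g s) + inner (v s) (v s)"
        by (simp add: inner_diff_left inner_diff_right inner_commute)
      moreover have "inner (g s) (g s) \<le> \<gamma>\<^sup>2" using power_mono[OF g[OF s] norm_ge_zero, of 2] by (simp add: power2_norm_eq_inner)
      ultimately show ?thesis unfolding E_def using pos[of "y s"] by linarith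
    qed
    then have "exp (- s) * (2 * inner (g s) (v s) - E s) \<le> exp (- s) * \<gamma>\<^sup>2" by (intro mult_left_mono) auto
    also have "\<dots> \<le> 1 * \<gamma>\<^sup>2" using s by (intro mult_right_mono) auto
    finally show "exp (- s) * (2 * inner (g s) (v s) - E s) - \<gamma>\<^sup>2 \<le> 0" by simp
  qed
  then have 1: "exp (- t) * E t \<le> E 0 + T * \<gamma>\<^sup>2"
    using t mult_right_mono[of t T "\<gamma>\<^sup>2"] by (simp add: mult.commute)
  have E0: "0 \<le> E 0 + T * \<gamma>\<^sup>2" unfolding E_def using pos[of "y 0"] t by simp
  have "E t = exp t * (exp (- t) * E t)" by (simp add: exp_minus)
  also have "\<dots> \<le> exp t * (E 0 + T * \<gamma>\<^sup>2)" by (intro mult_left_mono 1) auto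
  also have "\<dots> \<le> exp T * (E 0 + T * \<gamma>\<^sup>2)" using t by (intro mult_right_mono E0) auto
  finally show ?thesis by (simp add: E_def power2_norm_eq_inner add.assoc)
qed

lemma norm_growth:
  fixes y v :: "real \<Rightarrow> 'h::real_normed_vector"
  assumes y: "\<And>t. t \<in> {0..T} \<Longrightarrow> vderiv T y (v t) t"
    and v: "\<And>t. t \<in> {0..T} \<Longrightarrow> norm (v t) \<le> A" and t: "t \<in> {0..T}"
  shows "norm (y t) \<le> norm (y 0) + A * T"
proof -
  have A: "A \<ge> 0" using order.trans[OF norm_ge_zero v[OF t]] .
  have "norm (y t - y 0) \<le> A * norm (t - 0)"
  proof (rule differentiable_bound[where S="{0..T}" and f'="\<lambda>t h. h *\<^sub>R v t"])
    show "(y has_derivative (\<lambda>h. h *\<^sub>R v t)) (at t within {0..T})" if "t \<in> {0..T}" for t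
      using y[OF that] by (simp add: has_vector_derivative_def)
    show "onorm (\<lambda>h. h *\<^sub>R v t) \<le> A" if "t \<in> {0..T}" for t
      using v[OF that] by (intro onorm_le) (auto simp: mult.commute[of A] intro!: mult_left_mono)
  qed (use t in auto)
  also have "\<dots> \<le> A * T" using t A by (intro mult_left_mono) auto
  finally show ?thesis using norm_triangle_ineq2[of "y t" "y 0"] by linarith
qed

lemma wave_bounded_unique:
  fixes y v :: "real \<Rightarrow> 'h::real_inner"
  assumes B: "bounded_linear B" and sym: "\<And>x z. inner (B x) z = inner x (B z)" and pos: "\<And>x. 0 \<le> inner (B x) x"
    and y: "\<And>t. t \<in> {0..T} \<Longrightarrow> vderiv T y (v t) t"
    and v: "\<And>t. t \<in> {0..T} \<Longrightarrow> vderiv T v (- B (y t)) t"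
    and init: "y 0 = 0" "v 0 = 0" and t: "t \<in> {0..T}"
  shows "y t = 0" "v t = 0"
proof -
  have v0: "v s = 0" if "s \<in> {0..T}" for s
  proof -
    have "(norm (v s))\<^sup>2 + inner (B (y s)) (y s) \<le> 0"
      using energy_estimate[OF B sym pos y, of "\<lambda>_. 0" 0 s] v init that
      by (simp add: linear_0[OF bounded_linear.linear[OF B]])
    then have "(norm (v s))\<^sup>2 \<le> 0" using pos[of "y s"] by linarith
    then show ?thesis by simp
  qed
  then show "v t = 0" using t by blast
  show "y t = 0" using norm_growth[OF y, of 0 t] v0 init t by simp
qed

lemma wave_bounded_exists:
  fixes B :: "'h::banach \<Rightarrow> 'h"
  assumes B: "bounded_linear B" and g: "continuous_on {0..T} g" and T: "0 \<le> T"
  shows "\<exists>y v. y 0 = y0 \<and> v 0 = v0 \<and>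
    (\<forall>t\<in>{0..T}. vderiv T y (v t) t \<and>
       vderiv T v (g t - B (y t)) t)"
proof -
  interpret B: bounded_linear B by (rule B)
  have G: "bounded_linear (\<lambda>X. (snd X, - B (fst X)))"
    by (intro bounded_linear_Pair bounded_linear_snd bounded_linear_minus bounded_linear_compose[OF B bounded_linear_fst])
  have F: "continuous_on {0..T} (\<lambda>t. (0::'h, g t))" by (intro continuous_intros g)
  obtain X where X0: "X 0 = (y0, v0)"
    and X: "\<And>t. t \<in> {0..T} \<Longrightarrow> vderiv T X ((snd (X t), - B (fst (X t))) + (0, g t)) t"
    using picard_linear[OF G F T, of "(y0, v0)"] by blast
  have "vderiv T (\<lambda>t. fst (X t)) (snd (X t)) t"
    "vderiv T (\<lambda>t. snd (X t)) (g t - B (fst (X t))) t" if "t \<in> {0..T}" for t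
    using bounded_linear.has_vector_derivative[OF bounded_linear_fst X[OF that]]
      bounded_linear.has_vector_derivative[OF bounded_linear_snd X[OF that]] by simp_all
  then show ?thesis using X0 by (intro exI[of _ "\<lambda>t. fst (X t)"] exI[of _ "\<lambda>t. snd (X t)"]) auto
qed

section \<open>The abstract wave equation: uniform bounds, limit passage, uniqueness,
  conservation\<close>

section \<open>The abstract wave equation\<close>

text \<open>An unbounded nonnegative symmetric operator is presented through its bounded truncations \<open>N k\<close>
  to an increasing family of spectral subspaces, the ranges of \<open>P k\<close>. The domains of the operator and
  of its form are those of the weights \<open>W2\<close> and \<open>W1\<close>: a vector belongs to such a domain
  when the truncations converge.\<close>

locale truncated_operator =
  fixes P N W1 W2 :: "nat \<Rightarrow> 'h::{real_inner, banach} \<Rightarrow> 'h" and K :: real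
  assumes P: "bounded_linear (P k)" and N: "bounded_linear (N k)"
    and W1: "bounded_linear (W1 k)" and W2: "bounded_linear (W2 k)"
    and P_le: "norm (P k x) \<le> norm x" and P_lim: "(\<lambda>k. P k x) \<longlonglongrightarrow> x"
    and PP: "j \<le> k \<Longrightarrow> P j (P k x) = P j x" "j \<le> k \<Longrightarrow> P k (P j x) = P j x"
    and PN: "j \<le> k \<Longrightarrow> P j (N k x) = N j x" and NP: "j \<le> k \<Longrightarrow> N k (P j x) = N j x"
    and PW1: "j \<le> k \<Longrightarrow> P j (W1 k x) = W1 j x" and W1P: "j \<le> k \<Longrightarrow> W1 k (P j x) = W1 j x"
    and PW2: "j \<le> k \<Longrightarrow> P j (W2 k x) = W2 j x" and W2P: "j \<le> k \<Longrightarrow> W2 k (P j x) = W2 j x"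
    and N_sym: "inner (N k x) y = inner x (N k y)" and N_pos: "0 \<le> inner (N k x) x"
    and K: "1 \<le> K"
    and W1_le: "(norm (W1 k x))\<^sup>2 \<le> K * (inner (N k x) x + (norm x)\<^sup>2)"
    and N_form: "inner (N k x) x \<le> K * (norm (W1 k x))\<^sup>2"
    and W2_le: "norm (W2 k x) \<le> K * (norm (N k x) + norm x)"
    and N_le: "norm (N k x) \<le> K * norm (W2 k x)"
    and W12: "norm (W1 k x) \<le> K * norm (W2 k x)"
begin

lemmas P_diff = linear_diff[OF bounded_linear.linear[OF P]]
lemmas N_diff = linear_diff[OF bounded_linear.linear[OF N]]
lemmas W1_diff = linear_diff[OF bounded_linear.linear[OF W1]]
lemmas W2_diff = linear_diff[OF bounded_linear.linear[OF W2]]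

text \<open>The \<open>P k\<close> are contractions that converge pointwise, and the curve has
  compact image. Convergence on a finite e/3-net is uniform, and contractivity carries it to the
  whole curve.\<close>

lemma uniform_P:
  assumes f: "continuous_on {0..T::real} f" and e: "e > 0"
  shows "\<exists>J. \<forall>k\<ge>J. \<forall>t\<in>{0..T}. norm (P k (f t) - f t) < e"
proof -
  have "compact (f ` {0..T})" by (intro compact_continuous_image f) auto
  moreover have "e / 3 > 0" using e by simp
  ultimately obtain F where F: "finite F" "f ` {0..T} \<subseteq> (\<Union>x\<in>F. ball x (e / 3))"
    unfolding compact_eq_totally_bounded by blast
  have "\<forall>\<^sub>F k in sequentially. \<forall>x\<in>F. dist (P k x) x < e / 3"
    using F(1) e by (intro eventually_ball_finite ballI tendstoD[OF P_lim]) simp_all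
  then obtain J where J: "\<And>k x. J \<le> k \<Longrightarrow> x \<in> F \<Longrightarrow> norm (P k x - x) < e / 3"
    by (auto simp: eventually_sequentially dist_norm)
  have "norm (P k (f t) - f t) < e" if k: "J \<le> k" and t: "t \<in> {0..T}" for k t
  proof -
    have "f t \<in> (\<Union>x\<in>F. ball x (e / 3))" using F(2) t by blast
    then obtain x where x: "x \<in> F" "norm (x - f t) < e / 3" by (auto simp only: UN_iff mem_ball dist_norm)
    have "P k (f t) - f t = P k (f t - x) + (P k x - x) + (x - f t)"
      by (simp add: P_diff)
    then have "norm (P k (f t) - f t) \<le> norm (P k (f t - x)) + norm (P k x - x) + norm (x - f t)"
      using norm_triangle_ineq[of "P k (f t - x) + (P k x - x)" "x - f t"]
        norm_triangle_ineq[of "P k (f t - x)" "P k x - x"] by simp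
    then show ?thesis using P_le[of k "f t - x"] J[OF k x(1)] x(2) by (simp add: norm_minus_commute)
  qed
  then show ?thesis by blast
qed

lemma W_diff_Cauchy:
  assumes "convergent (\<lambda>k. W k x)" "e > 0"
  shows "\<exists>J. \<forall>j\<ge>J. \<forall>k\<ge>J. norm (W k x - W j x :: 'h) < e"
  using CauchyD[OF convergent_Cauchy[OF assms(1)] assms(2)] by blast

text \<open>The equation is first solved in the whole space. The parts of y and v outside the range
  of \<open>P k\<close> then solve the homogeneous equation with zero data, so they vanish.\<close>

lemma truncated_solution:
  assumes f: "continuous_on {0..T} f" and T: "0 \<le> T"
  shows "\<exists>y v. y 0 = P k u0 \<and> v 0 = P k v0 \<and> (\<forall>t\<in>{0..T}. P k (y t) = y t \<and> P k (v t) = v t \<and>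
     vderiv T y (v t) t \<and>
     vderiv T v (P k (f t) - N k (y t)) t)"
proof -
  have c: "continuous_on {0..T} (\<lambda>t. P k (f t))"
    by (rule bounded_linear.continuous_on[OF P f])
  obtain y v where init: "y 0 = P k u0" "v 0 = P k v0"
    and y: "\<And>t. t \<in> {0..T} \<Longrightarrow> vderiv T y (v t) t"
    and v: "\<And>t. t \<in> {0..T} \<Longrightarrow> vderiv T v (P k (f t) - N k (y t)) t"
    using wave_bounded_exists[OF N[of k] c T, of "P k u0" "P k v0"] by blast
  define z where "z t = y t - P k (y t)" for t
  define w where "w t = v t - P k (v t)" for t
  have z: "vderiv T z (w t) t" if "t \<in> {0..T}" for t
    unfolding z_def w_def by (intro has_vector_derivative_diff y that bounded_linear.has_vector_derivative[OF P])
  have w: "vderiv T w (- N k (z t)) t" if "t \<in> {0..T}" for t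
  proof -
    have "vderiv T w ((P k (f t) - N k (y t)) - P k (P k (f t) - N k (y t))) t"
      unfolding w_def by (intro has_vector_derivative_diff v that bounded_linear.has_vector_derivative[OF P])
    moreover have "(P k (f t) - N k (y t)) - P k (P k (f t) - N k (y t)) = - N k (z t)"
      unfolding z_def by (simp add: P_diff N_diff PP PN NP)
    ultimately show ?thesis by simp
  qed
  have "z 0 = 0" "w 0 = 0" by (simp_all add: z_def w_def init PP)
  from wave_bounded_unique[OF N N_sym N_pos z w this] have "z t = 0" "w t = 0" if "t \<in> {0..T}" for t
    using that by blast+
  then show ?thesis using init y v unfolding z_def w_def by (intro exI[of _ y] exI[of _ v]) simp
qed

text \<open>The energy of the difference of two truncated solutions, and that of its time derivative, are
  controlled by the truncation errors of the data.\<close>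

definition data_bound :: "real \<Rightarrow> real \<Rightarrow> bool" where
  "data_bound T A \<longleftrightarrow> 0 \<le> A \<and> (\<forall>k y v g g' \<eta>.
      (\<forall>t\<in>{0..T}. vderiv T y (v t) t \<and>
         vderiv T v (g t - N k (y t)) t \<and>
         vderiv T g (g' t) t \<and> norm (g t) \<le> \<eta> \<and> norm (g' t) \<le> \<eta>) \<longrightarrow>
      norm (y 0) \<le> \<eta> \<longrightarrow> norm (v 0) \<le> \<eta> \<longrightarrow> norm (W2 k (y 0)) \<le> \<eta> \<longrightarrow> norm (W1 k (v 0)) \<le> \<eta> \<longrightarrow>
      (\<forall>t\<in>{0..T}. norm (y t) \<le> A * \<eta> \<and> norm (v t) \<le> A * \<eta> \<and> norm (g t - N k (y t)) \<le> A * \<eta> \<and>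
        norm (W1 k (v t)) \<le> A * \<eta> \<and> norm (W2 k (y t)) \<le> A * \<eta>))"

text \<open>\<open>energy_estimate\<close> is applied twice, with constants independent of k: to (y,
  v) with forcing g and, after differentiating the equation in time, to (v, a) with forcing g',
  where a is the acceleration. The second application bounds a and the form of v, hence
  \<open>W1 k (v t)\<close>; then \<open>N k (y t) = g t - a t\<close> bounds
  \<open>W2 k (y t)\<close>.\<close>

lemma data_bound_exists:
  assumes T: "0 \<le> T"
  shows "\<exists>A. data_bound T A"
proof -
  \<comment> \<open>\<open>A1\<close> and \<open>A2\<close> come from the energies of (y, v) and (v,
    a), \<open>A3\<close> bounds \<open>W1 k (v t)\<close>, \<open>A4\<close> bounds
    \<open>W2 k (y t)\<close>, and \<open>1 + A1 * T\<close> bounds y by integration of v.\<close>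
  define A1 where "A1 = sqrt (exp T * (1 + K * K\<^sup>2 + T))"
  define A2 where "A2 = sqrt (exp T * ((1 + K)\<^sup>2 + K + T))"
  define A3 where "A3 = sqrt (K * (A2\<^sup>2 + A1\<^sup>2))"
  define A4 where "A4 = K * ((1 + A2) + (1 + A1 * T))"
  define A where "A = A1 + A2 + A3 + A4 + (1 + A1 * T)"
  have K0: "K \<ge> 0" using K by simp
  have p1: "0 \<le> exp T * (1 + K * K\<^sup>2 + T)" "0 \<le> exp T * ((1 + K)\<^sup>2 + K + T)" "0 \<le> K * (A2\<^sup>2 + A1\<^sup>2)"
    using K0 T by (auto intro!: mult_nonneg_nonneg add_nonneg_nonneg)
  have A1: "A1 \<ge> 0" "A1\<^sup>2 = exp T * (1 + K * K\<^sup>2 + T)" unfolding A1_def using p1(1) by simp_all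
  have A2: "A2 \<ge> 0" "A2\<^sup>2 = exp T * ((1 + K)\<^sup>2 + K + T)" unfolding A2_def using p1(2) by simp_all
  have A3: "A3 \<ge> 0" "A3\<^sup>2 = K * (A2\<^sup>2 + A1\<^sup>2)" unfolding A3_def using p1(3) by simp_all
  have A4: "A4 \<ge> 0" unfolding A4_def using A1(1) A2(1) K0 T by simp
  have A1T: "0 \<le> A1 * T" using A1(1) T by simp
  have A: "0 \<le> A" "A1 \<le> A" "A2 \<le> A" "A3 \<le> A" "A4 \<le> A" "1 + A1 * T \<le> A"
    unfolding A_def using A1(1) A2(1) A3(1) A4 A1T by linarith+
  have "data_bound T A" unfolding data_bound_def
  proof (intro conjI allI impI ballI A(1))
    fix k y v g g' \<eta> t
    assume H: "\<forall>t\<in>{0..T}. vderiv T y (v t) t \<and>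
         vderiv T v (g t - N k (y t)) t \<and>
         vderiv T g (g' t) t \<and> norm (g t) \<le> \<eta> \<and> norm (g' t) \<le> \<eta>"
      and y0: "norm (y 0) \<le> \<eta>" and v0: "norm (v 0) \<le> \<eta>" and W2y0: "norm (W2 k (y 0)) \<le> \<eta>"
      and W1v0: "norm (W1 k (v 0)) \<le> \<eta>" and t: "t \<in> {0..T}"
    have y: "vderiv T y (v t) t"
      and v: "vderiv T v (g t - N k (y t)) t"
      and g: "vderiv T g (g' t) t"
      and gle: "norm (g t) \<le> \<eta> \<and> norm (g' t) \<le> \<eta>" if "t \<in> {0..T}" for t
      using bspec[OF H that] by blast+
    have \<eta>: "\<eta> \<ge> 0" using y0 norm_ge_zero order.trans by blast
    define a where "a t = g t - N k (y t)" for t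
    have da: "vderiv T a (g' t - N k (v t)) t" if "t \<in> {0..T}" for t
      unfolding a_def by (intro has_vector_derivative_diff g that bounded_linear.has_vector_derivative[OF N] y)
    have va: "vderiv T v (a t) t" if "t \<in> {0..T}" for t
      unfolding a_def by (rule v[OF that])
    have z: "0 \<in> {0..T}" using T by simp
    have E1: "(norm (v t))\<^sup>2 \<le> (A1 * \<eta>)\<^sup>2" if t: "t \<in> {0..T}" for t
    proof -
      have "norm (W1 k (y 0)) \<le> K * \<eta>" using W12[of k "y 0"] mult_left_mono[OF W2y0 K0] by linarith
      from mult_left_mono[OF power_mono[OF this norm_ge_zero, of 2] K0]
      have "inner (N k (y 0)) (y 0) \<le> K * (K * \<eta>)\<^sup>2"
        using N_form[of k "y 0"] by linarith
      also have "K * (K * \<eta>)\<^sup>2 = K * K\<^sup>2 * \<eta>\<^sup>2" by (simp add: power_mult_distrib)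
      finally have "inner (N k (y 0)) (y 0) \<le> K * K\<^sup>2 * \<eta>\<^sup>2" .
      moreover have "(norm (v 0))\<^sup>2 \<le> \<eta>\<^sup>2" by (intro power_mono v0) simp
      ultimately have "(norm (v 0))\<^sup>2 + inner (N k (y 0)) (y 0) + T * \<eta>\<^sup>2 \<le> (1 + K * K\<^sup>2 + T) * \<eta>\<^sup>2"
        unfolding distrib_right by linarith
      note m = mult_left_mono[OF this exp_ge_zero[of T]]
      have "(norm (v t))\<^sup>2 + inner (N k (y t)) (y t) \<le> exp T * ((1 + K * K\<^sup>2 + T) * \<eta>\<^sup>2)"
        by (rule order.trans[OF energy_estimate[OF N N_sym N_pos y v, of \<eta> t] m]) (use gle t in auto)
      then show ?thesis using N_pos[of k "y t"] unfolding power_mult_distrib A1(2) mult.assoc by linarith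
    qed
    have E2: "(norm (a t))\<^sup>2 + inner (N k (v t)) (v t) \<le> (A2 * \<eta>)\<^sup>2"
    proof -
      have "norm (a 0) \<le> norm (g 0) + norm (N k (y 0))" unfolding a_def by (rule norm_triangle_ineq4)
      also have "\<dots> \<le> (1 + K) * \<eta>"
        using gle[OF z] N_le[of k "y 0"] mult_left_mono[OF W2y0 K0] by (simp add: distrib_right)
      finally have "(norm (a 0))\<^sup>2 \<le> ((1 + K) * \<eta>)\<^sup>2" by (intro power_mono) auto
      then have "(norm (a 0))\<^sup>2 \<le> (1 + K)\<^sup>2 * \<eta>\<^sup>2" by (simp only: power_mult_distrib)
      moreover have "inner (N k (v 0)) (v 0) \<le> K * \<eta>\<^sup>2"
        using N_form[of k "v 0"] mult_left_mono[OF power_mono[OF W1v0 norm_ge_zero, of 2] K0] by linarith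
      ultimately have "(norm (a 0))\<^sup>2 + inner (N k (v 0)) (v 0) + T * \<eta>\<^sup>2 \<le> ((1 + K)\<^sup>2 + K + T) * \<eta>\<^sup>2"
        unfolding distrib_right by linarith
      note m = mult_left_mono[OF this exp_ge_zero[of T]]
      have "(norm (a t))\<^sup>2 + inner (N k (v t)) (v t) \<le> exp T * (((1 + K)\<^sup>2 + K + T) * \<eta>\<^sup>2)"
        by (rule order.trans[OF energy_estimate[OF N N_sym N_pos va da, of \<eta> t] m]) (use gle t in auto)
      then show ?thesis unfolding power_mult_distrib A2(2) mult.assoc by linarith
    qed
    have vt: "norm (v t) \<le> A1 * \<eta>" if "t \<in> {0..T}" for t
      using power2_le_imp_le[OF E1[OF that]] A1(1) \<eta> by simp
    have at: "norm (a t) \<le> A2 * \<eta>"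
    proof (rule power2_le_imp_le)
      show "(norm (a t))\<^sup>2 \<le> (A2 * \<eta>)\<^sup>2" using E2 N_pos[of k "v t"] by linarith
    qed (use A2(1) \<eta> in simp)
    have yt: "norm (y t) \<le> (1 + A1 * T) * \<eta>"
      using norm_growth[OF y vt t] y0 by (simp add: algebra_simps)
    have W1t: "norm (W1 k (v t)) \<le> A3 * \<eta>"
    proof (rule power2_le_imp_le)
      have "(norm (W1 k (v t)))\<^sup>2 \<le> K * (inner (N k (v t)) (v t) + (norm (v t))\<^sup>2)" by (rule W1_le)
      also have "\<dots> \<le> K * ((A2 * \<eta>)\<^sup>2 + (A1 * \<eta>)\<^sup>2)"
      proof (intro mult_left_mono add_mono K0 E1 t)
        show "inner (N k (v t)) (v t) \<le> (A2 * \<eta>)\<^sup>2" using E2 zero_le_power2[of "norm (a t)"] by linarith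
      qed
      also have "\<dots> = (A3 * \<eta>)\<^sup>2" unfolding power_mult_distrib A3(2) by (simp add: algebra_simps)
      finally show "(norm (W1 k (v t)))\<^sup>2 \<le> (A3 * \<eta>)\<^sup>2" .
    qed (use A3(1) \<eta> in simp)
    have W2t: "norm (W2 k (y t)) \<le> A4 * \<eta>"
    proof -
      have "norm (N k (y t)) \<le> norm (g t) + norm (a t)"
        using norm_triangle_ineq4[of "g t" "a t"] by (simp add: a_def)
      then have "norm (N k (y t)) + norm (y t) \<le> ((1 + A2) + (1 + A1 * T)) * \<eta>"
        using gle[OF t] at yt by (simp add: distrib_right)
      from mult_left_mono[OF this K0] show ?thesis using W2_le[of k "y t"] unfolding A4_def by (simp add: mult.assoc)
    qed
    have mA: "c * \<eta> \<le> A * \<eta>" if "c \<le> A" for c using that \<eta> by (rule mult_right_mono)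
    show "norm (y t) \<le> A * \<eta>" by (rule order.trans[OF yt mA[OF A(6)]])
    show "norm (v t) \<le> A * \<eta>" by (rule order.trans[OF vt[OF t] mA[OF A(2)]])
    show "norm (g t - N k (y t)) \<le> A * \<eta>" using order.trans[OF at mA[OF A(3)]] by (simp only: a_def)
    show "norm (W1 k (v t)) \<le> A * \<eta>" by (rule order.trans[OF W1t mA[OF A(4)]])
    show "norm (W2 k (y t)) \<le> A * \<eta>" by (rule order.trans[OF W2t mA[OF A(5)]])
  qed
  then show ?thesis by blast
qed

text \<open>For j <= k the operators \<open>N j\<close> and \<open>N k\<close> agree on the range of
  \<open>P j\<close>, so the difference of two truncated solutions solves the k-th equation with the
  truncation errors of f, f', u0 and v0 as data. By \<open>data_bound\<close> the solutions, their
  velocities, their accelerations and the weighted versions are uniformly Cauchy; equation, initial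
  values and derivatives pass to the uniform limits.\<close>

theorem wave_exists:
  assumes T: "0 \<le> T" and f: "\<And>t. t \<in> {0..T} \<Longrightarrow> vderiv T f (f' t) t"
    and f': "continuous_on {0..T} f'"
    and u0: "convergent (\<lambda>k. W2 k u0)" and v0: "convergent (\<lambda>k. W1 k v0)"
  obtains u u1 u2 a a1 b where
    "u 0 = u0" "u1 0 = v0"
    "\<And>t. t \<in> {0..T} \<Longrightarrow> vderiv T u (u1 t) t"
    "\<And>t. t \<in> {0..T} \<Longrightarrow> vderiv T u1 (u2 t) t"
    "continuous_on {0..T} u2"
    "\<And>t. t \<in> {0..T} \<Longrightarrow> (\<lambda>k. N k (u t)) \<longlonglongrightarrow> f t - u2 t"
    "\<And>t. t \<in> {0..T} \<Longrightarrow> (\<lambda>k. W2 k (u t)) \<longlonglongrightarrow> b t" "continuous_on {0..T} b"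
    "\<And>t. t \<in> {0..T} \<Longrightarrow> (\<lambda>k. W1 k (u t)) \<longlonglongrightarrow> a t"
    "\<And>t. t \<in> {0..T} \<Longrightarrow> (\<lambda>k. W1 k (u1 t)) \<longlonglongrightarrow> a1 t"
    "\<And>t. t \<in> {0..T} \<Longrightarrow> vderiv T a (a1 t) t" "continuous_on {0..T} a1"
proof -
  have fc: "continuous_on {0..T} f" using f by (rule continuous_on_vector_derivative)
  define Q where "Q k y v \<longleftrightarrow> y 0 = P k u0 \<and> v 0 = P k v0 \<and> (\<forall>t\<in>{0..T}. P k (y t) = y t \<and> P k (v t) = v t \<and>
     vderiv T y (v t) t \<and>
     vderiv T v (P k (f t) - N k (y t)) t)" for k y v
  have "\<forall>k. \<exists>y v. Q k y v"
    using truncated_solution[OF fc T] unfolding Q_def by blast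
  then obtain y v where Q: "\<And>k. Q k (y k) (v k)" by metis
  have init: "y k 0 = P k u0" "v k 0 = P k v0" for k using Q[of k] by (auto simp: Q_def)
  have Py: "P k (y k t) = y k t" and Pv: "P k (v k t) = v k t"
    and dy: "vderiv T (y k) (v k t) t"
    and dv: "vderiv T (v k) (P k (f t) - N k (y k t)) t" if "t \<in> {0..T}" for k t
    using Q[of k] that by (auto simp: Q_def)
  have cy: "continuous_on {0..T} (y k)" "continuous_on {0..T} (v k)" for k
    using continuous_on_vector_derivative[OF dy] continuous_on_vector_derivative[OF dv] by auto
  obtain A where DB: "data_bound T A" using data_bound_exists[OF T] by blast
  then have A: "0 \<le> A" by (simp add: data_bound_def)
  note est = DB[unfolded data_bound_def, THEN conjunct2, rule_format]
  define acc where "acc k t = P k (f t) - N k (y k t)" for k t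
  have main: "\<exists>J. \<forall>j k t. J \<le> j \<longrightarrow> j \<le> k \<longrightarrow> t \<in> {0..T} \<longrightarrow>
      norm (y k t - y j t) < e \<and> norm (v k t - v j t) < e \<and> norm (acc k t - acc j t) < e \<and>
      norm (W1 k (v k t) - W1 j (v j t)) < e \<and> norm (W2 k (y k t) - W2 j (y j t)) < e" if e: "e > 0" for e
  proof -
    \<comment> \<open>The tolerance on the data for which the a priori bound yields at most e / 2;
      the summand 1 in the denominator covers A = 0.\<close>
    define \<eta> where "\<eta> = e / (A + 1) / 2"
    have \<eta>: "\<eta> > 0" unfolding \<eta>_def using e A by simp
    have "A * \<eta> \<le> (A + 1) * \<eta>" using \<eta> by (intro mult_right_mono) auto
    also have "\<dots> = e / 2"
    proof -
      have "A + 1 \<noteq> 0" using A by linarith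
      then show ?thesis unfolding \<eta>_def by (metis nonzero_mult_div_cancel_left times_divide_eq_right)
    qed
    finally have Ae: "A * \<eta> < e" using e by linarith
    have h: "\<eta> / 2 > 0" using \<eta> by simp
    obtain J1 where J1: "\<And>k t. J1 \<le> k \<Longrightarrow> t \<in> {0..T} \<Longrightarrow> norm (P k (f t) - f t) < \<eta> / 2" using uniform_P[OF fc h] by blast
    obtain J2 where J2: "\<And>k t. J2 \<le> k \<Longrightarrow> t \<in> {0..T} \<Longrightarrow> norm (P k (f' t) - f' t) < \<eta> / 2" using uniform_P[OF f' h] by blast
    have cP: "convergent (\<lambda>k. P k x)" for x using P_lim convergent_def by blast
    obtain J3 where J3: "\<forall>j\<ge>J3. \<forall>k\<ge>J3. norm (P k u0 - P j u0) < \<eta>" using W_diff_Cauchy[where W=P, OF cP \<eta>] by blast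
    obtain J4 where J4: "\<forall>j\<ge>J4. \<forall>k\<ge>J4. norm (P k v0 - P j v0) < \<eta>" using W_diff_Cauchy[where W=P, OF cP \<eta>] by blast
    obtain J5 where J5: "\<forall>j\<ge>J5. \<forall>k\<ge>J5. norm (W2 k u0 - W2 j u0) < \<eta>" using W_diff_Cauchy[where W=W2 and x=u0, OF u0 \<eta>] by blast
    obtain J6 where J6: "\<forall>j\<ge>J6. \<forall>k\<ge>J6. norm (W1 k v0 - W1 j v0) < \<eta>" using W_diff_Cauchy[where W=W1 and x=v0, OF v0 \<eta>] by blast
    define J where "J = J1 + J2 + J3 + J4 + J5 + J6"
    have "norm (y k t - y j t) < e \<and> norm (v k t - v j t) < e \<and> norm (acc k t - acc j t) < e \<and>
      norm (W1 k (v k t) - W1 j (v j t)) < e \<and> norm (W2 k (y k t) - W2 j (y j t)) < e"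
      if jk: "J \<le> j" "j \<le> k" and t: "t \<in> {0..T}" for j k t
    proof -
      have J: "J1 \<le> j" "J2 \<le> j" "J3 \<le> j" "J4 \<le> j" "J5 \<le> j" "J6 \<le> j" using jk(1) unfolding J_def by linarith+
      note Jk = J[THEN order.trans, OF jk(2)]
      have NN: "N j (y j t) = N k (y j t)" if "t \<in> {0..T}" for t
        using NP[OF jk(2), of "y j t"] Py[OF that, of j] by simp
      have acc: "acc k t - acc j t = (P k (f t) - P j (f t)) - N k (y k t - y j t)" if "t \<in> {0..T}" for t
        unfolding acc_def by (simp add: NN[OF that] N_diff)
      have "norm (y k t - y j t) \<le> A * \<eta> \<and> norm (v k t - v j t) \<le> A * \<eta> \<and>
        norm ((P k (f t) - P j (f t)) - N k (y k t - y j t)) \<le> A * \<eta> \<and>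
        norm (W1 k (v k t - v j t)) \<le> A * \<eta> \<and> norm (W2 k (y k t - y j t)) \<le> A * \<eta>"
      proof (rule est[where y="\<lambda>t. y k t - y j t" and v="\<lambda>t. v k t - v j t" and g="\<lambda>t. P k (f t) - P j (f t)" and g'="\<lambda>t. P k (f' t) - P j (f' t)"])
        fix t assume t: "t \<in> {0..T}"
        have tri: "norm (P k x - P j x) \<le> norm (P k x - x) + norm (P j x - x)" for x
          using norm_triangle_ineq4[of "P k x - x" "P j x - x"] by simp
        have "vderiv T (\<lambda>t. y k t - y j t) (v k t - v j t) t"
          by (intro has_vector_derivative_diff dy t)
        moreover have "vderiv T (\<lambda>t. v k t - v j t) (P k (f t) - P j (f t) - N k (y k t - y j t)) t"
          unfolding acc[OF t, symmetric] unfolding acc_def by (intro has_vector_derivative_diff dv t)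
        moreover have "vderiv T (\<lambda>t. P k (f t) - P j (f t)) (P k (f' t) - P j (f' t)) t"
          by (intro has_vector_derivative_diff bounded_linear.has_vector_derivative[OF P] f t)
        moreover have "norm (P k (f t) - P j (f t)) \<le> \<eta> \<and> norm (P k (f' t) - P j (f' t)) \<le> \<eta>"
          using tri[of "f t"] tri[of "f' t"] J1[OF J(1) t] J1[OF Jk(1) t] J2[OF J(2) t] J2[OF Jk(2) t] by linarith
        ultimately show "vderiv T (\<lambda>t. y k t - y j t) (v k t - v j t) t \<and>
          vderiv T (\<lambda>t. v k t - v j t) (P k (f t) - P j (f t) - N k (y k t - y j t)) t \<and>
          vderiv T (\<lambda>t. P k (f t) - P j (f t)) (P k (f' t) - P j (f' t)) t \<and>
          norm (P k (f t) - P j (f t)) \<le> \<eta> \<and> norm (P k (f' t) - P j (f' t)) \<le> \<eta>" by blast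
      next
        show "norm (y k 0 - y j 0) \<le> \<eta>" "norm (v k 0 - v j 0) \<le> \<eta>"
          using J3 J4 J Jk by (auto simp: init intro!: less_imp_le)
        show "norm (W2 k (y k 0 - y j 0)) \<le> \<eta>"
          using J5 J(5) Jk(5) by (auto simp: init W2_diff W2P[OF order.refl] W2P[OF jk(2)] intro!: less_imp_le)
        show "norm (W1 k (v k 0 - v j 0)) \<le> \<eta>"
          using J6 J(6) Jk(6) by (auto simp: init W1_diff W1P[OF order.refl] W1P[OF jk(2)] intro!: less_imp_le)
      qed (use t in auto)
      moreover have "W1 k (v j t) = W1 j (v j t)" "W2 k (y j t) = W2 j (y j t)"
        using W1P[OF jk(2), of "v j t"] W2P[OF jk(2), of "y j t"] Py[OF t, of j] Pv[OF t, of j] by simp_all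
      ultimately show ?thesis unfolding acc[OF t] using Ae by (simp add: W1_diff W2_diff)
    qed
    then show ?thesis by blast
  qed
  have lim: "\<exists>Z. uniform_limit {0..T} Y Z sequentially"
    if C: "\<And>e. e > 0 \<Longrightarrow> \<exists>J. \<forall>j k t. J \<le> j \<longrightarrow> j \<le> k \<longrightarrow> t \<in> {0..T} \<longrightarrow> norm (Y k t - Y j t :: 'h) < e" for Y
  proof -
    have "uniformly_Cauchy_on {0..T} Y" unfolding uniformly_Cauchy_on_def
    proof (intro allI impI)
      fix e :: real assume "e > 0"
      then obtain J where J: "\<And>j k t. J \<le> j \<Longrightarrow> j \<le> k \<Longrightarrow> t \<in> {0..T} \<Longrightarrow> norm (Y k t - Y j t) < e" using C by blast
      show "\<exists>M. \<forall>x\<in>{0..T}. \<forall>m\<ge>M. \<forall>n\<ge>M. dist (Y m x) (Y n x) < e"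
      proof (intro exI[of _ J] ballI allI impI)
        fix x m n assume "x \<in> {0..T}" "J \<le> m" "J \<le> n"
        then show "dist (Y m x) (Y n x) < e" using J[of m n x] J[of n m x]
          by (cases "m \<le> n") (auto simp: dist_norm norm_minus_commute)
      qed
    qed
    then show ?thesis using Cauchy_uniformly_convergent unfolding uniformly_convergent_on_def by blast
  qed
  have "\<exists>Z. uniform_limit {0..T} y Z sequentially" by (rule lim) (use main in blast)
  then obtain u where u: "uniform_limit {0..T} y u sequentially" ..
  have "\<exists>Z. uniform_limit {0..T} v Z sequentially" by (rule lim) (use main in blast)
  then obtain u1 where u1: "uniform_limit {0..T} v u1 sequentially" ..
  have "\<exists>Z. uniform_limit {0..T} acc Z sequentially" by (rule lim) (use main in blast)
  then obtain u2 where u2: "uniform_limit {0..T} acc u2 sequentially" ..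
  have "\<exists>Z. uniform_limit {0..T} (\<lambda>k t. W1 k (v k t)) Z sequentially" by (rule lim) (use main in blast)
  then obtain a1 where a1: "uniform_limit {0..T} (\<lambda>k t. W1 k (v k t)) a1 sequentially" ..
  have "\<exists>Z. uniform_limit {0..T} (\<lambda>k t. W2 k (y k t)) Z sequentially" by (rule lim) (use main in blast)
  then obtain b where b: "uniform_limit {0..T} (\<lambda>k t. W2 k (y k t)) b sequentially" ..
  \<comment> \<open>\<open>W1 k (y k t)\<close> is not among the quantities of
    \<open>data_bound\<close>, but \<open>W12\<close> controls it by \<open>W2 k (y k t)\<close>.
    Its limit \<open>a\<close> will have the limit \<open>a1\<close> of \<open>W1 k (v k t)\<close>
    as derivative.\<close>
  have "\<exists>J. \<forall>j k t. J \<le> j \<longrightarrow> j \<le> k \<longrightarrow> t \<in> {0..T} \<longrightarrow> norm (W1 k (y k t) - W1 j (y j t)) < e" if e: "e > 0" for e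
  proof -
    have "e / K > 0" using e K by simp
    from main[OF this] obtain J where J: "\<And>j k t. J \<le> j \<Longrightarrow> j \<le> k \<Longrightarrow> t \<in> {0..T} \<Longrightarrow> norm (W2 k (y k t) - W2 j (y j t)) < e / K" by blast
    have "norm (W1 k (y k t) - W1 j (y j t)) < e" if jk: "J \<le> j" "j \<le> k" and t: "t \<in> {0..T}" for j k t
    proof -
      have "W1 k (y j t) = W1 j (y j t)" "W2 k (y j t) = W2 j (y j t)"
        using W1P[OF jk(2), of "y j t"] W2P[OF jk(2), of "y j t"] Py[OF t, of j] by simp_all
      then have "norm (W1 k (y k t) - W1 j (y j t)) \<le> K * norm (W2 k (y k t) - W2 j (y j t))"
        using W12[of k "y k t - y j t"] by (simp add: W1_diff W2_diff)
      also have "\<dots> < K * (e / K)" using J[OF jk t] K by (intro mult_strict_left_mono) auto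
      finally show ?thesis using K by simp
    qed
    then show ?thesis by blast
  qed
  then have "\<exists>Z. uniform_limit {0..T} (\<lambda>k t. W1 k (y k t)) Z sequentially" by (rule lim)
  then obtain a where a: "uniform_limit {0..T} (\<lambda>k t. W1 k (y k t)) a sequentially" ..
  note ul = tendsto_uniform_limitI
  \<comment> \<open>The limit is known only along the diagonal \<open>Q k (Y k t)\<close>. Applying
    \<open>P j\<close> replaces it by \<open>Q j (Y k t)\<close> once k >= j, so
    \<open>Q j (z t)\<close> equals \<open>P j (l t)\<close>, and letting j grow gives the limit for
    the fixed vector \<open>z t\<close>.\<close>
  have shift: "(\<lambda>j. Q j (z t)) \<longlonglongrightarrow> l t"
    if Q: "\<And>j. bounded_linear (Q j)" and PQ: "\<And>j k x. j \<le> k \<Longrightarrow> P j (Q k x) = Q j x"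
      and l: "(\<lambda>k. Q k (Y k t)) \<longlonglongrightarrow> l t" and Y: "(\<lambda>k. Y k t) \<longlonglongrightarrow> z t" for Q Y z l and t :: real
  proof -
    have "Q j (z t) = P j (l t)" for j
    proof (rule LIMSEQ_unique)
      show "(\<lambda>k. Q j (Y k t)) \<longlonglongrightarrow> Q j (z t)" by (rule bounded_linear.tendsto[OF Q Y])
      have "(\<lambda>k. P j (Q k (Y k t))) \<longlonglongrightarrow> P j (l t)" by (rule bounded_linear.tendsto[OF P l])
      then show "(\<lambda>k. Q j (Y k t)) \<longlonglongrightarrow> P j (l t)"
        by (rule Lim_transform_eventually) (auto simp: eventually_sequentially PQ intro!: exI[of _ j])
    qed
    then show ?thesis using P_lim[of "l t"] by simp
  qed
  have z: "0 \<in> {0..T}" using T by simp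
  show ?thesis
  proof (rule that)
    show "u 0 = u0" using LIMSEQ_unique[OF ul[OF u z]] P_lim[of u0] by (simp add: init)
    show "u1 0 = v0" using LIMSEQ_unique[OF ul[OF u1 z]] P_lim[of v0] by (simp add: init)
    show "continuous_on {0..T} u2"
    proof (rule uniform_limit_theorem[OF _ u2])
      show "\<forall>\<^sub>F n in sequentially. continuous_on {0..T} (acc n)"
        unfolding acc_def by (intro always_eventually allI continuous_intros bounded_linear.continuous_on[OF P] bounded_linear.continuous_on[OF N] fc cy)
    qed simp
    show "continuous_on {0..T} b"
      by (rule uniform_limit_theorem[OF _ b]) (auto intro!: always_eventually bounded_linear.continuous_on[OF W2] cy)
    show "continuous_on {0..T} a1"
      by (rule uniform_limit_theorem[OF _ a1]) (auto intro!: always_eventually bounded_linear.continuous_on[OF W1] cy)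
    fix t assume t: "t \<in> {0..T}"
    show "vderiv T u (u1 t) t"
      by (rule has_vector_derivative_uniform_limit[OF dy u1 ul[OF u] t])
    show "vderiv T u1 (u2 t) t"
      by (rule has_vector_derivative_uniform_limit[OF dv[folded acc_def] u2 ul[OF u1] t])
    show "vderiv T a (a1 t) t"
      by (rule has_vector_derivative_uniform_limit[OF bounded_linear.has_vector_derivative[OF W1 dy] a1 ul[OF a] t])
    show "(\<lambda>k. W2 k (u t)) \<longlonglongrightarrow> b t"
      by (rule shift[of W2 y t b u, OF W2 PW2 ul[OF b t] ul[OF u t]])
    show "(\<lambda>k. W1 k (u t)) \<longlonglongrightarrow> a t"
      by (rule shift[of W1 y t a u, OF W1 PW1 ul[OF a t] ul[OF u t]])
    show "(\<lambda>k. W1 k (u1 t)) \<longlonglongrightarrow> a1 t"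
      by (rule shift[of W1 v t a1 u1, OF W1 PW1 ul[OF a1 t] ul[OF u1 t]])
    show "(\<lambda>k. N k (u t)) \<longlonglongrightarrow> f t - u2 t"
    proof (rule shift[of N y t "\<lambda>t. f t - u2 t" u, OF N PN _ ul[OF u t]])
      have "(\<lambda>k. P k (f t) - acc k t) \<longlonglongrightarrow> f t - u2 t" by (intro tendsto_diff P_lim ul[OF u2 t])
      then show "(\<lambda>k. N k (y k t)) \<longlonglongrightarrow> f t - u2 t" by (simp add: acc_def)
    qed
  qed
qed

lemma truncate_equation:
  assumes "(\<lambda>k. N k x) \<longlonglongrightarrow> n"
  shows "N j x = P j n"
proof (rule LIMSEQ_unique[of "\<lambda>k. P j (N k x)"])
  show "(\<lambda>k. P j (N k x)) \<longlonglongrightarrow> P j n" by (rule bounded_linear.tendsto[OF P assms])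
  show "(\<lambda>k. P j (N k x)) \<longlonglongrightarrow> N j x"
    by (rule tendsto_eventually) (auto simp: eventually_sequentially PN intro!: exI[of _ j])
qed

text \<open>By \<open>truncate_equation\<close> each projection \<open>P j (u t - w t)\<close>
  solves the homogeneous equation with the bounded operator \<open>N j\<close> and zero data, so it
  vanishes; the projections converge to u t - w t.\<close>

theorem wave_unique:
  assumes u: "\<And>t. t \<in> {0..T} \<Longrightarrow> vderiv T u (u1 t) t"
    and u1: "\<And>t. t \<in> {0..T} \<Longrightarrow> vderiv T u1 (u2 t) t"
    and eq: "\<And>t. t \<in> {0..T} \<Longrightarrow> (\<lambda>k. N k (u t)) \<longlonglongrightarrow> f t - u2 t"
    and w: "\<And>t. t \<in> {0..T} \<Longrightarrow> vderiv T w (w1 t) t"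
    and w1: "\<And>t. t \<in> {0..T} \<Longrightarrow> vderiv T w1 (w2 t) t"
    and eqw: "\<And>t. t \<in> {0..T} \<Longrightarrow> (\<lambda>k. N k (w t)) \<longlonglongrightarrow> f t - w2 t"
    and init: "u 0 = w 0" "u1 0 = w1 0" and t: "t \<in> {0..T}"
  shows "u t = w t"
proof -
  have "P j (u t - w t) = 0" for j
  proof (rule wave_bounded_unique(1)[OF N N_sym N_pos, of T "\<lambda>t. P j (u t - w t)" "\<lambda>t. P j (u1 t - w1 t)" j])
    fix t assume t: "t \<in> {0..T}"
    show "vderiv T (\<lambda>t. P j (u t - w t)) (P j (u1 t - w1 t)) t"
      by (intro bounded_linear.has_vector_derivative[OF P] has_vector_derivative_diff u w t)
    have "vderiv T (\<lambda>t. P j (u1 t - w1 t)) (P j (u2 t - w2 t)) t"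
      by (intro bounded_linear.has_vector_derivative[OF P] has_vector_derivative_diff u1 w1 t)
    moreover have "P j (u2 t - w2 t) = - N j (P j (u t - w t))"
      using truncate_equation[OF eq[OF t], of j] truncate_equation[OF eqw[OF t], of j]
      by (simp add: NP N_diff P_diff)
    ultimately show "vderiv T (\<lambda>t. P j (u1 t - w1 t)) (- N j (P j (u t - w t))) t" by simp
  qed (use init t in \<open>auto simp: linear_0[OF bounded_linear.linear[OF P]]\<close>)
  then have "(\<lambda>j. P j (u t - w t)) \<longlonglongrightarrow> 0" by simp
  then show ?thesis using LIMSEQ_unique[OF P_lim] by fastforce
qed

text \<open>The energy of the projected solution involves only the bounded operator
  \<open>N j\<close>, so it can be differentiated, and symmetry cancels all terms. The limit in j
  recovers the energy of u, with \<open>f - u2 t\<close> in place of the unbounded operator applied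
  to u.\<close>

theorem wave_energy_conserved:
  assumes u: "\<And>t. t \<in> {0..T} \<Longrightarrow> vderiv T u (u1 t) t"
    and u1: "\<And>t. t \<in> {0..T} \<Longrightarrow> vderiv T u1 (u2 t) t"
    and eq: "\<And>t. t \<in> {0..T} \<Longrightarrow> (\<lambda>k. N k (u t)) \<longlonglongrightarrow> f - u2 t" and t: "t \<in> {0..T}"
  shows "(norm (u1 t))\<^sup>2 + inner (f - u2 t) (u t) - 2 * inner f (u t)
    = (norm (u1 0))\<^sup>2 + inner (f - u2 0) (u 0) - 2 * inner f (u 0)"
proof -
  define E where "E j t = inner (P j (u1 t)) (P j (u1 t)) + inner (N j (P j (u t))) (P j (u t)) - 2 * inner (P j f) (P j (u t))" for j t
  have dE: "(E j has_real_derivative 0) (at s within {0..T})" if s: "s \<in> {0..T}" for j s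
  proof -
    note dP = bounded_linear.has_vector_derivative[OF P]
    have e: "P j (u2 s) = P j f - N j (P j (u s))"
      using truncate_equation[OF eq[OF s], of j] by (simp add: NP P_diff)
    have "(E j has_real_derivative (inner (P j (u1 s)) (P j (u2 s)) + inner (P j (u2 s)) (P j (u1 s)))
       + (inner (N j (P j (u s))) (P j (u1 s)) + inner (N j (P j (u1 s))) (P j (u s))) - 2 * (inner (P j f) (P j (u1 s)) + inner 0 (P j (u s)))) (at s within {0..T})"
      unfolding E_def[abs_def]
      by (intro DERIV_add DERIV_diff DERIV_cmult has_real_derivative_inner bounded_linear.has_vector_derivative[OF N] dP u[OF s] u1[OF s] has_vector_derivative_const)
    moreover have "(inner (P j (u1 s)) (P j (u2 s)) + inner (P j (u2 s)) (P j (u1 s)))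
       + (inner (N j (P j (u s))) (P j (u1 s)) + inner (N j (P j (u1 s))) (P j (u s))) - 2 * (inner (P j f) (P j (u1 s)) + inner 0 (P j (u s))) = 0"
      unfolding e using N_sym[of j "P j (u s)" "P j (u1 s)"] by (simp add: inner_diff_left inner_diff_right inner_commute)
    ultimately show ?thesis by simp
  qed
  \<comment> \<open>A derivative equal to 0 makes both the energy and its negative
    nonincreasing.\<close>
  have eqE: "E j t = E j 0" for j
  proof (rule antisym)
    show "E j t \<le> E j 0" by (rule nonincreasing_within[OF dE _ t]) simp_all
    have "- E j t \<le> - E j 0"
      by (rule nonincreasing_within[where \<phi>'="\<lambda>_. - 0", OF DERIV_minus[OF dE] _ t]) simp_all
    then show "E j 0 \<le> E j t" by simp
  qed
  have lim: "(\<lambda>j. E j s) \<longlonglongrightarrow> inner (u1 s) (u1 s) + inner (f - u2 s) (u s) - 2 * inner f (u s)" if s: "s \<in> {0..T}" for s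
    unfolding E_def NP[OF order.refl] by (intro tendsto_intros P_lim eq s)
  have z: "0 \<in> {0..T}" using t by simp
  show ?thesis unfolding power2_norm_eq_inner by (rule LIMSEQ_unique[OF lim[OF t, unfolded eqE] lim[OF z]])
qed

end

section \<open>The Hartley transform on Schwartz functions and fields\<close>

section \<open>The Hartley transform\<close>

text \<open>The coefficients combine the two exponentials into the real kernel cos + sin
  (\<open>hart_eq\<close>). The transform is its own inverse and its own transpose, and it acts on
  real fields without complexification.\<close>

definition hart :: "(real^'n::finite \<Rightarrow> complex) \<Rightarrow> real^'n \<Rightarrow> complex" where
  "hart f xi = (1 + \<i>) / 2 * fourier f xi + (1 - \<i>) / 2 * inv_fourier f xi"

lemma fourier_fourier:
  assumes "schwartz f"
  shows "fourier (fourier f) x = f (- x)"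
  using fourier_inversion[OF assms, of "- x"] by (simp add: inv_fourier_eq)

lemma inv_fourier_reflect: "inv_fourier f = fourier (\<lambda>x. f (- x))"
  by (simp add: fun_eq_iff inv_fourier_eq fourier_reflect)

lemma schwartz_inv_fourier: "schwartz f \<Longrightarrow> schwartz (inv_fourier f)"
  unfolding inv_fourier_reflect by (intro schwartz_fourier schwartz_reflect)

lemma schwartz_hart: "schwartz f \<Longrightarrow> schwartz (hart f)"
  unfolding hart_def[abs_def] by (intro schwartz_add schwartz_cmult schwartz_fourier schwartz_inv_fourier)

lemma hart_coeffs: "(1 + \<i>) / 2 * ((1 + \<i>) / 2) = \<i> / 2" "(1 - \<i>) / 2 * ((1 - \<i>) / 2) = - (\<i> / 2)"
  "(1 + \<i>) / 2 * ((1 - \<i>) / 2) = 1 / 2"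
  by (simp_all add: complex_eq_iff)

text \<open>For an even weight the terms with two forward or two backward transforms cancel.\<close>

lemma hart_weight_hart:
  fixes f :: "real^'n::finite \<Rightarrow> complex"
  assumes f: "schwartz f" and w: "\<And>g. schwartz g \<Longrightarrow> schwartz (\<lambda>x. w x * g x)" and even: "\<And>x. w (- x) = w x"
  shows "hart (\<lambda>xi. w xi * hart f xi) x = fourier (\<lambda>xi. w xi * inv_fourier f xi) x"
proof -
  define a where "a = (1 + \<i>) / 2"
  define b where "b = (1 - \<i>) / 2"
  define p where "p xi = w xi * fourier f xi" for xi
  define q where "q xi = w xi * inv_fourier f xi" for xi
  have p: "schwartz p" and q: "schwartz q" unfolding p_def[abs_def] q_def[abs_def]
    by (intro w schwartz_fourier schwartz_inv_fourier f)+
  have qp: "q = (\<lambda>xi. p (- xi))" by (simp add: q_def p_def inv_fourier_eq even fun_eq_iff)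
  have lin: "fourier (\<lambda>xi. a * p xi + b * q xi) y = a * fourier p y + b * fourier q y" for y
    using p q by (simp add: fourier_add fourier_cmult schwartz_integrable schwartz_cmult)
  have "(\<lambda>xi. w xi * hart f xi) = (\<lambda>xi. a * p xi + b * q xi)"
    by (simp add: hart_def a_def b_def p_def q_def algebra_simps fun_eq_iff)
  then have "hart (\<lambda>xi. w xi * hart f xi) x = a * fourier (\<lambda>xi. a * p xi + b * q xi) x + b * fourier (\<lambda>xi. a * p xi + b * q xi) (- x)"
    by (simp add: hart_def a_def b_def inv_fourier_eq)
  also have "\<dots> = a * (a * fourier p x + b * fourier q x) + b * (a * fourier p (- x) + b * fourier q (- x))"
    by (simp only: lin)
  also have "fourier p (- x) = fourier q x" unfolding qp by (simp add: fourier_reflect)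
  also have "fourier q (- x) = fourier p x" unfolding qp by (simp add: fourier_reflect)
  also have "a * (a * fourier p x + b * fourier q x) + b * (a * fourier q x + b * fourier p x)
    = (a * a + b * b) * fourier p x + (a * b + a * b) * fourier q x" by (simp add: algebra_simps)
  also have "\<dots> = fourier q x" unfolding a_def b_def hart_coeffs by simp
  finally show ?thesis by (simp add: q_def[abs_def])
qed

lemma hart_hart:
  assumes "schwartz f"
  shows "hart (hart f) x = f x"
proof -
  have "hart (\<lambda>xi. 1 * hart f xi) x = fourier (\<lambda>xi. 1 * inv_fourier f xi) x"
    by (rule hart_weight_hart[OF assms]) auto
  also have "\<dots> = f x"
    using fourier_fourier[OF schwartz_reflect[OF assms], of x] by (simp add: inv_fourier_reflect)
  finally show ?thesis by simp
qed

definition cas :: "real \<Rightarrow> real" where "cas t = cos t + sin t"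

lemma abs_cas_le: "\<bar>cas t\<bar> \<le> 2"
  unfolding cas_def using abs_triangle_ineq[of "cos t" "sin t"] abs_cos_le_one[of t] abs_sin_le_one[of t] by linarith

lemma cas_measurable[measurable (raw)]: "f \<in> borel_measurable M \<Longrightarrow> (\<lambda>x. cas (f x)) \<in> borel_measurable M"
  by (rule borel_measurable_continuous_on[of cas]) (auto intro!: continuous_intros simp: cas_def[abs_def])

lemma integrable_cas_scaleR:
  fixes f :: "real^'n::finite \<Rightarrow> 'b::{banach, second_countable_topology}"
  assumes "integrable lborel f" and [measurable]: "g \<in> borel_measurable borel"
  shows "integrable lborel (\<lambda>x. cas (g x) *\<^sub>R f x)"
proof (rule Bochner_Integration.integrable_bound)
  have [measurable]: "f \<in> borel_measurable borel" using assms by auto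
  show "integrable lborel (\<lambda>x. 2 * norm (f x))" using assms by auto
  show "(\<lambda>x. cas (g x) *\<^sub>R f x) \<in> borel_measurable lborel" by measurable
  show "AE x in lborel. norm (cas (g x) *\<^sub>R f x) \<le> norm (2 * norm (f x))"
    using abs_cas_le by (auto intro!: mult_right_mono)
qed

lemma hart_eq:
  assumes "integrable lborel f"
  shows "hart f xi = (LINT x|lborel. cas (2 * pi * (x \<bullet> xi)) *\<^sub>R f x)"
proof -
  have "hart f xi = (LINT x|lborel. (1 + \<i>) / 2 * (cis (- 2 * pi * (x \<bullet> xi)) * f x) + (1 - \<i>) / 2 * (cis (2 * pi * (x \<bullet> xi)) * f x))"
    unfolding hart_def fourier_cis inv_fourier_cis
    by (subst Bochner_Integration.integral_add) (auto intro!: integrable_mult_right integrable_cis_mult assms)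
  also have "\<dots> = (LINT x|lborel. cas (2 * pi * (x \<bullet> xi)) *\<^sub>R f x)"
  proof (rule Bochner_Integration.integral_cong[OF refl])
    fix x
    define t where "t = 2 * pi * (x \<bullet> xi)"
    have e: "- 2 * pi * (x \<bullet> xi) = - t" by (simp add: t_def)
    have "(1 + \<i>) / 2 * cis (- t) + (1 - \<i>) / 2 * cis t = of_real (cas t)"
      by (simp add: complex_eq_iff cas_def field_simps)
    then show "(1 + \<i>) / 2 * (cis (- 2 * pi * (x \<bullet> xi)) * f x) + (1 - \<i>) / 2 * (cis (2 * pi * (x \<bullet> xi)) * f x) = cas (2 * pi * (x \<bullet> xi)) *\<^sub>R f x"
      unfolding e t_def[symmetric] scaleR_conv_of_real by (metis distrib_right mult.assoc)
  qed
  finally show ?thesis .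
qed

text \<open>The kernel is real, so the transform commutes with real-linear maps of the values;
  applied to the real part, this lets it act on real test fields.\<close>

lemma hart_bounded_linear:
  assumes T: "bounded_linear (T :: complex \<Rightarrow> complex)" and f: "integrable lborel f"
  shows "hart (\<lambda>x. T (f x)) xi = T (hart f xi)"
proof -
  have "T (hart f xi) = (LINT x|lborel. T (cas (2 * pi * (x \<bullet> xi)) *\<^sub>R f x))"
    unfolding hart_eq[OF f] by (rule integral_bounded_linear[OF T, symmetric]) (intro integrable_cas_scaleR f, measurable)
  also have "\<dots> = hart (\<lambda>x. T (f x)) xi"
    unfolding hart_eq[OF integrable_bounded_linear[OF T f]] by (simp add: linear_cmul[OF bounded_linear.linear[OF T]])
  finally show ?thesis by simp
qed

lemma hart_multiplication_formula:
  assumes "integrable lborel f" "integrable lborel g"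
  shows "(LINT x|lborel. hart f x * g x) = (LINT x|lborel. f x * hart g x)"
proof -
  have [measurable]: "f \<in> borel_measurable borel" "g \<in> borel_measurable borel" using assms by auto
  have int: "integrable (lborel \<Otimes>\<^sub>M lborel) (\<lambda>(x, y). (cas (2 * pi * (x \<bullet> y)) *\<^sub>R f y) * g x)"
  proof (rule lborel_pair.Fubini_integrable)
    have i: "integrable lborel (\<lambda>y. (cas (2 * pi * (x \<bullet> y)) *\<^sub>R f y) * g x)" for x
      by (intro integrable_mult_left integrable_cas_scaleR assms) measurable
    show "AE x in lborel. integrable lborel (\<lambda>y. case (x, y) of (x, y) \<Rightarrow> (cas (2 * pi * (x \<bullet> y)) *\<^sub>R f y) * g x)"
      using i by simp
    show "integrable lborel (\<lambda>x. LINT y|lborel. norm (case (x, y) of (x, y) \<Rightarrow> (cas (2 * pi * (x \<bullet> y)) *\<^sub>R f y) * g x))"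
    proof (rule Bochner_Integration.integrable_bound)
      show "integrable lborel (\<lambda>x. (2 * (LINT y|lborel. norm (f y))) * norm (g x))"
        by (intro integrable_mult_right integrable_norm assms)
      show "AE x in lborel. norm (LINT y|lborel. norm (case (x, y) of (x, y) \<Rightarrow> (cas (2 * pi * (x \<bullet> y)) *\<^sub>R f y) * g x))
        \<le> norm ((2 * (LINT y|lborel. norm (f y))) * norm (g x))"
      proof (rule AE_I2)
        fix x
        have "(LINT y|lborel. norm ((cas (2 * pi * (x \<bullet> y)) *\<^sub>R f y) * g x)) \<le> (LINT y|lborel. 2 * norm (f y) * norm (g x))"
          by (intro integral_mono integrable_norm i integrable_mult_left integrable_mult_right assms)
            (simp add: norm_mult mult.assoc mult_right_mono abs_cas_le)
        also have "\<dots> = (2 * (LINT y|lborel. norm (f y))) * norm (g x)" by simp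
        finally show "norm (LINT y|lborel. norm (case (x, y) of (x, y) \<Rightarrow> (cas (2 * pi * (x \<bullet> y)) *\<^sub>R f y) * g x))
        \<le> norm ((2 * (LINT y|lborel. norm (f y))) * norm (g x))" by simp
      qed
    qed measurable
  qed measurable
  have "(LINT x|lborel. hart f x * g x) = (LINT x|lborel. LINT y|lborel. (cas (2 * pi * (x \<bullet> y)) *\<^sub>R f y) * g x)"
    unfolding hart_eq[OF assms(1)] by (simp only: integral_mult_left_zero inner_commute)
  also have "\<dots> = (LINT y|lborel. LINT x|lborel. (cas (2 * pi * (x \<bullet> y)) *\<^sub>R f y) * g x)"
    using lborel_pair.Fubini_integral[OF int] by simp
  also have "\<dots> = (LINT y|lborel. f y * hart g y)"
    unfolding hart_eq[OF assms(2)]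
    by (intro Bochner_Integration.integral_cong refl, subst integral_mult_right_zero[symmetric]) (simp add: mult_ac)
  finally show ?thesis .
qed

definition hfield :: "'n::finite field \<Rightarrow> 'n field" where
  "hfield u xi = (LINT x|lborel. cas (2 * pi * (x \<bullet> xi)) *\<^sub>R u x)"

lemma bounded_linear_component: "bounded_linear (\<lambda>v::real^'n. complex_of_real (v $ i))"
  by (rule bounded_linear_compose[OF bounded_linear_of_real bounded_linear_vec_nth])

lemma comp_hfield:
  assumes "integrable lborel u"
  shows "comp_fun (hfield u) i = hart (comp_fun u i)"
proof
  fix xi
  have i: "integrable lborel (comp_fun u i)"
    unfolding comp_fun_def[abs_def] by (rule integrable_bounded_linear[OF bounded_linear_component assms])
  have "comp_fun (hfield u) i xi = (LINT x|lborel. complex_of_real ((cas (2 * pi * (x \<bullet> xi)) *\<^sub>R u x) $ i))"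
    unfolding comp_fun_def hfield_def
    by (rule integral_bounded_linear[OF bounded_linear_component, symmetric]) (intro integrable_cas_scaleR assms, measurable)
  then show "comp_fun (hfield u) i xi = hart (comp_fun u i) xi"
    unfolding hart_eq[OF i] by (simp add: comp_fun_def scaleR_conv_of_real[where 'a=complex])
qed

lemma field_eqI: "(\<And>i. comp_fun u i = comp_fun v i) \<Longrightarrow> u = v"
  by (simp add: comp_fun_def fun_eq_iff vec_eq_iff)

lemma field_measurableI:
  assumes "\<And>i. (\<lambda>x. u x $ i) \<in> borel_measurable M"
  shows "(u :: 'a \<Rightarrow> real^'n::finite) \<in> borel_measurable M"
  unfolding borel_measurable_euclidean_space[of u]
  using assms by (auto simp: Basis_vec_def inner_axis)

lemma schwartz_field_measurable:
  assumes "schwartz_field u"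
  shows "u \<in> borel_measurable borel"
proof (rule field_measurableI)
  fix i
  have "(\<lambda>x. Re (comp_fun u i x)) \<in> borel_measurable borel"
    by (intro measurable_compose[OF _ borel_measurable_continuous_onI[of Re]]) (use assms in \<open>auto simp: schwartz_field_def intro!: continuous_intros schwartz_measurable\<close>)
  then show "(\<lambda>x. u x $ i) \<in> borel_measurable borel" by (simp add: comp_fun_def)
qed

lemma schwartz_field_le_dec:
  assumes "schwartz_field (u :: 'n::finite field)"
  shows "\<exists>C\<ge>0. \<forall>x. norm (u x) \<le> C * dec x"
proof -
  have "\<forall>i. \<exists>C\<ge>0. \<forall>x. norm (comp_fun u i x) \<le> C * dec x"
    using assms schwartz_le_dec by (auto simp: schwartz_field_def)
  then obtain C where C: "\<And>i. C i \<ge> 0" "\<And>i x. norm (comp_fun u i x) \<le> C i * dec x" by metis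
  have "norm (u x) \<le> (\<Sum>i\<in>UNIV. C i) * dec x" for x
  proof -
    have "norm (u x) \<le> (\<Sum>i\<in>UNIV. \<bar>u x $ i\<bar>)" by (rule norm_le_l1_cart)
    also have "\<dots> \<le> (\<Sum>i\<in>UNIV. C i * dec x)" using C(2) by (intro sum_mono) (simp add: comp_fun_def)
    finally show ?thesis by (simp add: sum_distrib_right)
  qed
  then show ?thesis using C(1) by (intro exI[of _ "\<Sum>i\<in>UNIV. C i"]) (auto intro: sum_nonneg)
qed

lemma dec_le_1: "dec (x :: real^'n::finite) \<le> 1"
proof -
  have "1 \<le> (1 + norm x) ^ (CARD('n) + 1)" by (rule one_le_power) simp
  then show ?thesis by (simp add: dec_def)
qed

lemma schwartz_field_integrable:
  assumes "schwartz_field (u :: 'n::finite field)"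
  shows "integrable lborel u"
proof -
  note [measurable] = schwartz_field_measurable[OF assms]
  obtain C where C: "C \<ge> 0" "\<forall>x. norm (u x) \<le> C * dec x" using schwartz_field_le_dec[OF assms] by blast
  have "integrable lborel (\<lambda>x::real^'n. C * dec x)" by (rule integrable_mult_right[OF integrable_dec])
  then show ?thesis by (rule Bochner_Integration.integrable_bound) (use C in \<open>auto simp: dec_nonneg\<close>)
qed

lemma integrable_lebesgue:
  fixes f :: "'a::euclidean_space \<Rightarrow> 'b::{banach, second_countable_topology}"
  assumes "integrable lborel f"
  shows "integrable lebesgue f"
  using assms integrable_completion[OF borel_measurable_integrable[OF assms]] by simp

lemma schwartz_field_L2:
  assumes "schwartz_field (u :: 'n::finite field)"
  shows "u \<in> L2"
proof -
  obtain C where C: "C \<ge> 0" "\<forall>x. norm (u x) \<le> C * dec x" using schwartz_field_le_dec[OF assms] by blast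
  show ?thesis
  proof (rule L2I[where g="\<lambda>x. C\<^sup>2 * dec x"])
    show "u \<in> borel_measurable lebesgue"
      by (rule borel_measurable_lebesgueI[OF schwartz_field_measurable[OF assms]]) simp
    have "integrable lborel (\<lambda>x::real^'n. C\<^sup>2 * dec x)" by (rule integrable_mult_right[OF integrable_dec])
    then show "integrable lebesgue (\<lambda>x::real^'n. C\<^sup>2 * dec x)" by (rule integrable_lebesgue)
    fix x
    have "(norm (u x))\<^sup>2 \<le> (C * dec x)\<^sup>2" using C by (intro power_mono) auto
    also have "\<dots> = C\<^sup>2 * (dec x * dec x)" by (simp add: power2_eq_square)
    also have "\<dots> \<le> C\<^sup>2 * (dec x * 1)" by (intro mult_left_mono dec_le_1 dec_nonneg) auto
    finally show "(norm (u x))\<^sup>2 \<le> C\<^sup>2 * dec x" by simp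
  qed
qed

lemma schwartz_field_hfield: "schwartz_field u \<Longrightarrow> schwartz_field (hfield u)"
  by (simp add: schwartz_field_def comp_hfield[OF schwartz_field_integrable] schwartz_hart)

lemma hfield_hfield: "schwartz_field u \<Longrightarrow> hfield (hfield u) = u"
  by (rule field_eqI)
    (simp only: comp_hfield[OF schwartz_field_integrable] comp_hfield[OF schwartz_field_integrable[OF schwartz_field_hfield]],
      simp add: hart_hart fun_eq_iff schwartz_field_def)

lemma schwartz_field_add: "schwartz_field u \<Longrightarrow> schwartz_field v \<Longrightarrow> schwartz_field (\<lambda>x. u x + v x)"
  by (auto simp: schwartz_field_def comp_fun_def[abs_def] intro: schwartz_add)

lemma schwartz_field_scaleR: "schwartz_field u \<Longrightarrow> schwartz_field (\<lambda>x. c *\<^sub>R u x)"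
  by (auto simp: schwartz_field_def comp_fun_def[abs_def] intro: schwartz_cmult)

lemma schwartz_field_diff: "schwartz_field u \<Longrightarrow> schwartz_field v \<Longrightarrow> schwartz_field (\<lambda>x. u x - v x)"
  using schwartz_field_add[OF _ schwartz_field_scaleR[of v "-1"]] by fastforce

lemma schwartz_zero: "schwartz (\<lambda>x. 0)"
  using schwartz_cmult[OF schwartz_gauss, of 0] by simp

lemma schwartz_field_weight:
  assumes "schwartz_field u"
  shows "schwartz_field (\<lambda>xi. ((1 + 4 * pi\<^sup>2 * (norm xi)\<^sup>2) powr \<tau>) *\<^sub>R u xi)"
  unfolding schwartz_field_def
proof
  fix i
  have "schwartz (\<lambda>xi. of_real ((1 + 4 * pi\<^sup>2 * (norm xi)\<^sup>2) powr \<tau>) * comp_fun u i xi)"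
    using assms by (intro schwartz_slow_mult slow.weight) (simp add: schwartz_field_def)
  then show "schwartz (comp_fun (\<lambda>xi. ((1 + 4 * pi\<^sup>2 * (norm xi)\<^sup>2) powr \<tau>) *\<^sub>R u xi) i)"
    by (simp add: comp_fun_def[abs_def])
qed

section \<open>Fields as distributions, Plancherel's identity and the Hartley transform on
  L2\<close>

section \<open>Square integrable fields as distributions\<close>

definition pairing :: "'n::finite field \<Rightarrow> 'n \<Rightarrow> (real^'n \<Rightarrow> complex) \<Rightarrow> complex" where
  "pairing u i = dist_of (comp_fun u i)"

text \<open>Complex test functions reach the real Hilbert space through their real parts. The
  imaginary part of a pairing is recovered by testing with \<open>- \<i> * f\<close>, as in
  \<open>pairing_Re_eqI\<close>.\<close>

definition test_field :: "'n::finite \<Rightarrow> (real^'n \<Rightarrow> complex) \<Rightarrow> 'n field" where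
  "test_field i f x = axis i (Re (f x))"

lemma schwartz_Re: "schwartz f \<Longrightarrow> schwartz (\<lambda>x. of_real (Re (f x)))"
  by (rule schwartz_bounded_linear[of "\<lambda>z. of_real (Re z)"]) (intro bounded_linear_compose[OF bounded_linear_of_real bounded_linear_Re])

lemma comp_test_field: "comp_fun (test_field i f) j = (if j = i then (\<lambda>x. of_real (Re (f x))) else (\<lambda>x. 0))"
  by (auto simp: comp_fun_def test_field_def axis_def)

lemma schwartz_test_field: "schwartz f \<Longrightarrow> schwartz_field (test_field i f)"
  by (simp add: schwartz_field_def comp_test_field schwartz_Re schwartz_zero)

lemma hfield_test_field:
  assumes "schwartz f"
  shows "hfield (test_field i f) = test_field i (hart f)"
proof (rule field_eqI)
  fix j
  have R: "bounded_linear (\<lambda>z. complex_of_real (Re z))" by (intro bounded_linear_compose[OF bounded_linear_of_real bounded_linear_Re])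
  show "comp_fun (hfield (test_field i f)) j = comp_fun (test_field i (hart f)) j"
    unfolding comp_hfield[OF schwartz_field_integrable[OF schwartz_test_field[OF assms]]] comp_test_field
    using hart_bounded_linear[OF R schwartz_integrable[OF assms]]
    by (auto simp: fun_eq_iff hart_eq)
qed

lemma comp_fun_measurable: "u \<in> borel_measurable lebesgue \<Longrightarrow> comp_fun u i \<in> borel_measurable lebesgue"
  unfolding comp_fun_def[abs_def]
  using borel_measurable_continuous_onI[OF linear_continuous_on[OF bounded_linear_component]] measurable_compose by blast

lemma norm_comp_fun_le: "norm (comp_fun u i x) \<le> norm (u x)"
  by (simp add: comp_fun_def component_le_norm_cart)

lemma L2_schwartz_integrable:
  fixes u :: "'n::finite field"
  assumes u: "u \<in> L2" and f: "schwartz f"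
  shows "integrable lebesgue (\<lambda>x. comp_fun u i x * f x)"
proof -
  obtain C where C: "C \<ge> 0" "\<forall>x. norm (f x) \<le> C * dec x" using schwartz_le_dec[OF f] by blast
  show ?thesis
  proof (rule Bochner_Integration.integrable_bound)
  have "integrable lborel (\<lambda>x::real^'n. C\<^sup>2 * dec x)" by (rule integrable_mult_right[OF integrable_dec])
  then have "integrable lebesgue (\<lambda>x::real^'n. C\<^sup>2 * dec x)"
    by (rule integrable_lebesgue)
  then show "integrable lebesgue (\<lambda>x. (norm (u x))\<^sup>2 + C\<^sup>2 * dec x)"
    by (rule Bochner_Integration.integrable_add[OF L2_integrable[OF u]])
  have f': "f \<in> borel_measurable lebesgue" by (rule borel_measurable_lebesgueI[OF schwartz_measurable[OF f]]) simp
  show "(\<lambda>x. comp_fun u i x * f x) \<in> borel_measurable lebesgue"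
    by (rule borel_measurable_times[OF comp_fun_measurable[OF L2_measurable[OF u]] f'])
  show "AE x in lebesgue. norm (comp_fun u i x * f x) \<le> norm ((norm (u x))\<^sup>2 + C\<^sup>2 * dec x)"
  proof (rule AE_I2)
    fix x
    have "norm (comp_fun u i x * f x) \<le> norm (u x) * norm (f x)"
      unfolding norm_mult by (intro mult_right_mono norm_comp_fun_le) auto
    also have "\<dots> \<le> (norm (u x))\<^sup>2 + (norm (f x))\<^sup>2"
      using zero_le_power2[of "norm (u x) - norm (f x)"] mult_nonneg_nonneg[OF norm_ge_zero norm_ge_zero, of "u x" "f x"]
      unfolding power2_diff by linarith
    also have "(norm (f x))\<^sup>2 \<le> (C * dec x)\<^sup>2" using C by (intro power_mono) auto
    also have "\<dots> = C\<^sup>2 * (dec x * dec x)" by (simp add: power2_eq_square)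
    also have "\<dots> \<le> C\<^sup>2 * (dec x * 1)" by (intro mult_left_mono dec_le_1 dec_nonneg) auto
    finally show "norm (comp_fun u i x * f x) \<le> norm ((norm (u x))\<^sup>2 + C\<^sup>2 * dec x)" by (simp add: dec_nonneg)
  qed
  qed
qed

lemma inner_test_field:
  assumes "u \<in> L2" "schwartz f"
  shows "inner (cls u) (cls (test_field i f)) = Re (pairing u i f)"
proof -
  have "inner (cls u) (cls (test_field i f)) = (LINT x|lebesgue. u x \<bullet> test_field i f x)"
    by (intro inner_cls assms schwartz_field_L2 schwartz_test_field)
  also have "\<dots> = (LINT x|lebesgue. Re (comp_fun u i x * f x))"
    by (simp add: test_field_def comp_fun_def inner_axis)
  also have "\<dots> = Re (LINT x|lebesgue. comp_fun u i x * f x)"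
    by (rule integral_Re[OF L2_schwartz_integrable[OF assms]])
  finally show ?thesis unfolding pairing_def dist_of_def .
qed

lemma pairing_cmult: "pairing u i (\<lambda>x. c * f x) = c * pairing u i f"
proof -
  have "(\<lambda>x. comp_fun u i x * (c * f x)) = (\<lambda>x. c * (comp_fun u i x * f x))" by (simp add: fun_eq_iff)
  then show ?thesis unfolding pairing_def dist_of_def by (simp only: integral_mult_right_zero)
qed

lemma pairing_cong_AE:
  assumes "u \<in> L2" "v \<in> L2" "AE x in lebesgue. u x = v x" "schwartz f"
  shows "pairing u i f = pairing v i f"
  unfolding pairing_def dist_of_def
proof (rule integral_cong_AE)
  show "(\<lambda>x. comp_fun u i x * f x) \<in> borel_measurable lebesgue" "(\<lambda>x. comp_fun v i x * f x) \<in> borel_measurable lebesgue"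
    by (intro borel_measurable_integrable L2_schwartz_integrable assms)+
  show "AE x in lebesgue. comp_fun u i x * f x = comp_fun v i x * f x"
    using assms(3) by eventually_elim (simp add: comp_fun_def)
qed

lemma pairing_rep_cls: "u \<in> L2 \<Longrightarrow> schwartz f \<Longrightarrow> pairing (rep (cls u)) i f = pairing u i f"
  by (rule pairing_cong_AE[OF rep_L2 _ rep_cls])

lemma pairing_eqI:
  assumes "\<And>i f. schwartz f \<Longrightarrow> pairing (rep X) i f = pairing v i f"
    and v: "v \<in> borel_measurable lebesgue" "\<And>i f. schwartz f \<Longrightarrow> integrable lebesgue (\<lambda>x. comp_fun v i x * f x)"
  shows "AE x in lebesgue. rep X x = v x"
proof -
  have "AE x in lebesgue. comp_fun (rep X) i x - comp_fun v i x = 0" for i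
  proof (rule zero_if_orthogonal_to_schwartz)
    show "(\<lambda>x. comp_fun (rep X) i x - comp_fun v i x) \<in> borel_measurable lebesgue"
      using comp_fun_measurable[OF L2_measurable[OF rep_L2]] comp_fun_measurable[OF v(1)] by (intro borel_measurable_diff)
    fix f :: "real^'a \<Rightarrow> complex" assume f: "schwartz f"
    show "integrable lebesgue (\<lambda>x. (comp_fun (rep X) i x - comp_fun v i x) * f x)"
      unfolding left_diff_distrib by (intro Bochner_Integration.integrable_diff L2_schwartz_integrable rep_L2 f v(2))
    show "(LINT x|lebesgue. (comp_fun (rep X) i x - comp_fun v i x) * f x) = 0"
      unfolding left_diff_distrib using assms(1)[OF f, of i]
      by (subst Bochner_Integration.integral_diff) (auto intro: L2_schwartz_integrable f v(2) simp: pairing_def dist_of_def)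
  qed
  then have "AE x in lebesgue. \<forall>i. comp_fun (rep X) i x - comp_fun v i x = 0"
    by (simp add: AE_all_countable)
  then show ?thesis by eventually_elim (simp add: comp_fun_def vec_eq_iff)
qed

lemma pairing_Re_eqI:
  assumes "\<And>f. schwartz f \<Longrightarrow> Re (pairing u i f) = Re (pairing v i (T f))"
    and T: "\<And>f. T (\<lambda>x. - \<i> * f x) = (\<lambda>x. - \<i> * T f x)" and f: "schwartz f"
  shows "pairing u i f = pairing v i (T f)"
proof (rule complex_eqI)
  show "Re (pairing u i f) = Re (pairing v i (T f))" by (rule assms(1)[OF f])
  have "Re (pairing u i (\<lambda>x. - \<i> * f x)) = Re (pairing v i (\<lambda>x. - \<i> * T f x))"
    using assms(1)[OF schwartz_cmult[OF f, of "- \<i>"]] unfolding T .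
  then show "Im (pairing u i f) = Im (pairing v i (T f))" unfolding pairing_cmult by simp
qed

lemma Lt_eqI_pairing:
  assumes "\<And>i f. schwartz f \<Longrightarrow> Re (pairing (rep X) i f) = Re (pairing (rep Y) i f)"
  shows "X = Y"
proof (rule Lt_eqI, rule pairing_eqI)
  show "pairing (rep X) i f = pairing (rep Y) i f" if "schwartz f" for i f
    using pairing_Re_eqI[of "rep X" i "rep Y" "\<lambda>f. f"] assms that by blast
qed (auto intro: L2_measurable L2_schwartz_integrable)

text \<open>By \<open>dense_if_orthogonal_trivial\<close> it suffices that a class orthogonal to all
  Schwartz fields is 0, and the test fields already separate classes.\<close>

lemma schwartz_dense:
  fixes X :: "'n::finite Lt"
  shows "\<exists>s. (\<forall>k. schwartz_field (s k)) \<and> (\<lambda>k. cls (s k)) \<longlonglongrightarrow> X"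
proof -
  have "\<exists>S. (\<forall>k::nat. S k \<in> cls ` Collect schwartz_field) \<and> S \<longlonglongrightarrow> X"
  proof (rule dense_if_orthogonal_trivial)
    let ?S = "cls ` Collect schwartz_field :: 'n Lt set"
    have "schwartz_field (\<lambda>x. 0 :: real^'n)" by (simp add: schwartz_field_def comp_fun_def[abs_def] schwartz_zero)
    then have zero: "0 \<in> ?S" unfolding cls_zero[symmetric] by blast
    have add: "x + y \<in> ?S" if xy: "x \<in> ?S" "y \<in> ?S" for x y
    proof -
      obtain u v where u: "schwartz_field u" "x = cls u" and v: "schwartz_field v" "y = cls v" using xy by auto
      show ?thesis
        unfolding u v cls_add[OF u(1)[THEN schwartz_field_L2] v(1)[THEN schwartz_field_L2], symmetric]
        by (intro imageI CollectI schwartz_field_add u v)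
    qed
    have scale: "c *\<^sub>R x \<in> ?S" if x: "x \<in> ?S" for c x
    proof -
      obtain u where u: "schwartz_field u" "x = cls u" using x by auto
      show ?thesis
        unfolding u cls_scaleR[OF u(1)[THEN schwartz_field_L2], symmetric]
        by (intro imageI CollectI schwartz_field_scaleR u)
    qed
    show "subspace ?S" by (rule subspaceI[OF zero add scale])
    fix X :: "'n Lt" assume X: "\<And>s. s \<in> cls ` Collect schwartz_field \<Longrightarrow> inner X s = 0"
    show "X = 0"
    proof (rule Lt_eqI_pairing)
      fix i and f :: "real^'n \<Rightarrow> complex" assume f: "schwartz f"
      have "inner X (cls (test_field i f)) = 0" "inner 0 (cls (test_field i f)) = 0"
        using X schwartz_test_field[OF f] by auto
      then show "Re (pairing (rep X) i f) = Re (pairing (rep 0) i f)"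
        using inner_test_field[OF rep_L2 f, of X i] inner_test_field[OF rep_L2 f, of 0 i] by simp
    qed
  qed
  then obtain S where S: "\<forall>k::nat. S k \<in> cls ` Collect schwartz_field" "S \<longlonglongrightarrow> X" by blast
  then have "\<forall>k. \<exists>u. schwartz_field u \<and> S k = cls u" by blast
  then obtain s where s: "\<And>k. schwartz_field (s k)" "\<And>k. S k = cls (s k)" by metis
  then have "(\<lambda>k. cls (s k)) = S" by auto
  then show ?thesis using S(2) s(1) by auto
qed

lemma inner_hfield:
  assumes "schwartz_field u" "schwartz_field v"
  shows "inner (cls (hfield u)) (cls v) = inner (cls u) (cls (hfield v))"
proof -
  have L: "(LINT x|lebesgue. a x \<bullet> b x) = (\<Sum>i\<in>UNIV. Re (LINT x|lborel. comp_fun a i x * comp_fun b i x))"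
    if a: "schwartz_field a" and b: "schwartz_field b" for a b :: "'a field"
  proof -
    have int: "integrable lborel (\<lambda>x. comp_fun a i x * comp_fun b i x)" for i
    proof -
      have ai: "schwartz (comp_fun a i)" and bi: "schwartz (comp_fun b i)" using a b by (auto simp: schwartz_field_def)
      have "integrable lebesgue (\<lambda>x. comp_fun a i x * comp_fun b i x)"
        by (rule L2_schwartz_integrable[OF schwartz_field_L2[OF a] bi])
      then show ?thesis using borel_measurable_times[OF schwartz_measurable[OF ai] schwartz_measurable[OF bi]]
        integrable_completion[of "\<lambda>x. comp_fun a i x * comp_fun b i x" lborel] by simp
    qed
    have "(LINT x|lebesgue. a x \<bullet> b x) = (LINT x|lborel. a x \<bullet> b x)"
      using schwartz_field_measurable[OF a] schwartz_field_measurable[OF b] by (intro integral_completion) simp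
    also have "\<dots> = (LINT x|lborel. (\<Sum>i\<in>UNIV. Re (comp_fun a i x * comp_fun b i x)))"
      by (simp add: inner_vec_def comp_fun_def)
    also have "\<dots> = (\<Sum>i\<in>UNIV. LINT x|lborel. Re (comp_fun a i x * comp_fun b i x))"
      by (rule Bochner_Integration.integral_sum) (intro integrable_Re int)
    also have "\<dots> = (\<Sum>i\<in>UNIV. Re (LINT x|lborel. comp_fun a i x * comp_fun b i x))"
      by (intro sum.cong refl integral_Re int)
    finally show ?thesis .
  qed
  note u = assms(1) and v = assms(2)
  note hu = schwartz_field_hfield[OF u] and hv = schwartz_field_hfield[OF v]
  have "inner (cls (hfield u)) (cls v) = (\<Sum>i\<in>UNIV. Re (LINT x|lborel. hart (comp_fun u i) x * comp_fun v i x))"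
    unfolding inner_cls[OF schwartz_field_L2[OF hu] schwartz_field_L2[OF v]] L[OF hu v]
      comp_hfield[OF schwartz_field_integrable[OF u]] ..
  also have "\<dots> = (\<Sum>i\<in>UNIV. Re (LINT x|lborel. comp_fun u i x * hart (comp_fun v i) x))"
    using assms by (intro sum.cong refl arg_cong[where f=Re] hart_multiplication_formula schwartz_integrable) (auto simp: schwartz_field_def)
  also have "\<dots> = inner (cls u) (cls (hfield v))"
    unfolding inner_cls[OF schwartz_field_L2[OF u] schwartz_field_L2[OF hv]] L[OF u hv]
      comp_hfield[OF schwartz_field_integrable[OF v]] ..
  finally show ?thesis .
qed

text \<open>Plancherel's identity: the transform is symmetric by \<open>inner_hfield\<close> and its
  own inverse.\<close>

lemma norm_hfield: "schwartz_field u \<Longrightarrow> norm (cls (hfield u)) = norm (cls u)"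
  unfolding norm_eq_sqrt_inner by (subst inner_hfield) (auto simp: schwartz_field_hfield hfield_hfield)

lemma hfield_diff:
  assumes "schwartz_field u" "schwartz_field v"
  shows "hfield (\<lambda>x. u x - v x) = (\<lambda>x. hfield u x - hfield v x)"
proof
  fix xi
  have "integrable lborel (\<lambda>x. cas (2 * pi * (x \<bullet> xi)) *\<^sub>R u x)" "integrable lborel (\<lambda>x. cas (2 * pi * (x \<bullet> xi)) *\<^sub>R v x)"
    by (intro integrable_cas_scaleR schwartz_field_integrable assms, measurable)+
  then show "hfield (\<lambda>x. u x - v x) xi = hfield u xi - hfield v xi"
    unfolding hfield_def by (simp add: scaleR_diff_right)
qed

text \<open>The transform is an isometry on a dense subspace, so the transforms of an approximating
  sequence converge. The limit is recorded by its inner products with Schwartz fields, which do not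
  depend on the sequence and determine it by \<open>Lt_eqI_schwartz\<close>.\<close>

lemma hartley_exists: "\<exists>Y. \<forall>s. schwartz_field s \<longrightarrow> inner Y (cls s) = inner X (cls (hfield s))"
proof -
  obtain s where s: "\<And>k. schwartz_field (s k)" "(\<lambda>k. cls (s k)) \<longlonglongrightarrow> X" using schwartz_dense[of X] by blast
  have d: "norm (cls (hfield (s j)) - cls (hfield (s k))) = norm (cls (s j) - cls (s k))" for j k
    using norm_hfield[OF schwartz_field_diff[OF s(1) s(1)], of j k]
    by (simp add: hfield_diff s cls_diff schwartz_field_L2 schwartz_field_hfield)
  have "Cauchy (\<lambda>k. cls (s k))" using s(2) by (rule LIMSEQ_imp_Cauchy)
  then have "Cauchy (\<lambda>k. cls (hfield (s k)))" unfolding Cauchy_iff d .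
  then obtain Y where Y: "(\<lambda>k. cls (hfield (s k))) \<longlonglongrightarrow> Y" using Cauchy_convergent convergent_def by blast
  have "inner Y (cls v) = inner X (cls (hfield v))" if v: "schwartz_field v" for v
  proof (rule LIMSEQ_unique)
    show "(\<lambda>k. inner (cls (hfield (s k))) (cls v)) \<longlonglongrightarrow> inner Y (cls v)" by (intro tendsto_intros Y)
    show "(\<lambda>k. inner (cls (hfield (s k))) (cls v)) \<longlonglongrightarrow> inner X (cls (hfield v))"
      unfolding inner_hfield[OF s(1) v] by (intro tendsto_intros s(2))
  qed
  then show ?thesis by blast
qed

definition hartley :: "'n::finite Lt \<Rightarrow> 'n Lt" where
  "hartley X = (SOME Y. \<forall>s. schwartz_field s \<longrightarrow> inner Y (cls s) = inner X (cls (hfield s)))"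

lemma inner_hartley_schwartz: "schwartz_field s \<Longrightarrow> inner (hartley X) (cls s) = inner X (cls (hfield s))"
  unfolding hartley_def using someI_ex[OF hartley_exists[of X]] by blast

lemma Lt_eqI_schwartz:
  assumes "\<And>s. schwartz_field s \<Longrightarrow> inner X (cls s) = inner Y (cls s)"
  shows "X = Y"
proof -
  obtain s where s: "\<And>k. schwartz_field (s k)" "(\<lambda>k. cls (s k)) \<longlonglongrightarrow> X - Y" using schwartz_dense by blast
  have "(\<lambda>k. inner (X - Y) (cls (s k))) \<longlonglongrightarrow> inner (X - Y) (X - Y)" by (intro tendsto_intros s)
  then have "inner (X - Y) (X - Y) = 0" using assms[OF s(1)] by (simp add: inner_diff_left LIMSEQ_const_iff)
  then show ?thesis by simp
qed

lemma hartley_cls: "schwartz_field u \<Longrightarrow> hartley (cls u) = cls (hfield u)"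
  by (rule Lt_eqI_schwartz) (simp add: inner_hartley_schwartz inner_hfield)

lemma hartley_hartley[simp]: "hartley (hartley X) = X"
  by (rule Lt_eqI_schwartz) (simp add: inner_hartley_schwartz schwartz_field_hfield hfield_hfield)

lemma inner_hartley:
  fixes X Y :: "'n::finite Lt"
  shows "inner (hartley X) Y = inner X (hartley Y)"
proof -
  have eq: "inner (hartley X) (cls s) = inner X (hartley (cls s))" if "schwartz_field s" for X :: "'n Lt" and s
    using that by (simp add: hartley_cls inner_hartley_schwartz)
  have h: "inner (hartley X) (hartley Y) = inner X Y" for X Y :: "'n Lt"
  proof -
    \<comment> \<open>Continuity of \<open>hartley\<close> is not yet established. The transforms of
      a Schwartz approximation of \<open>hartley Y\<close> are Cauchy by Plancherel, and their limit
      is identified with Y by testing against Schwartz fields.\<close>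
    obtain t where t: "\<And>k. schwartz_field (t k)" "(\<lambda>k. cls (t k)) \<longlonglongrightarrow> hartley Y" using schwartz_dense by blast
    have "(\<lambda>k. inner (hartley X) (cls (t k))) \<longlonglongrightarrow> inner (hartley X) (hartley Y)" by (intro tendsto_intros t)
    have "norm (hartley (cls (t k)) - hartley (cls (t j))) = norm (cls (t k) - cls (t j))" for j k
      using norm_hfield[OF schwartz_field_diff[OF t(1) t(1)], of k j]
      by (simp add: hartley_cls hfield_diff t cls_diff schwartz_field_L2 schwartz_field_hfield)
    then have "Cauchy (\<lambda>k. hartley (cls (t k)))" using LIMSEQ_imp_Cauchy[OF t(2)] unfolding Cauchy_iff by simp
    then obtain Z where Z: "(\<lambda>k. hartley (cls (t k))) \<longlonglongrightarrow> Z" using Cauchy_convergent convergent_def by blast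
    have "Z = Y"
    proof (rule Lt_eqI_schwartz)
      fix v :: "'n field" assume v: "schwartz_field v"
      have "(\<lambda>k. inner (hartley (cls (t k))) (cls v)) \<longlonglongrightarrow> inner Z (cls v)" by (intro tendsto_intros Z)
      moreover have "(\<lambda>k. inner (hartley (cls (t k))) (cls v)) \<longlonglongrightarrow> inner (hartley Y) (cls (hfield v))"
        unfolding inner_hartley_schwartz[OF v] by (intro tendsto_intros t)
      moreover have "inner (hartley Y) (cls (hfield v)) = inner Y (cls v)"
        using v by (simp add: inner_hartley_schwartz schwartz_field_hfield hfield_hfield)
      ultimately show "inner Z (cls v) = inner Y (cls v)" using LIMSEQ_unique by metis
    qed
    have "(\<lambda>k. inner X (hartley (cls (t k)))) \<longlonglongrightarrow> inner X Y" using Z unfolding \<open>Z = Y\<close> by (intro tendsto_intros)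
    moreover have "inner X (hartley (cls (t k))) = inner (hartley X) (cls (t k))" for k using eq[OF t(1)] by simp
    ultimately show ?thesis
      using LIMSEQ_unique[OF \<open>(\<lambda>k. inner (hartley X) (cls (t k))) \<longlonglongrightarrow> inner (hartley X) (hartley Y)\<close>] by simp
  qed
  show ?thesis using h[of X "hartley Y"] by simp
qed

lemma norm_hartley[simp]: "norm (hartley X) = norm X"
  by (simp add: norm_eq_sqrt_inner inner_hartley)

lemma bounded_linear_hartley: "bounded_linear hartley"
proof (rule bounded_linear_intro[where K=1])
  show "hartley (X + Y) = hartley X + hartley Y" for X Y :: "'a Lt"
    by (rule Lt_eqI_schwartz) (simp add: inner_hartley_schwartz inner_add_left)
  show "hartley (c *\<^sub>R X) = c *\<^sub>R hartley X" for c and X :: "'a Lt"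
    by (rule Lt_eqI_schwartz) (simp add: inner_hartley_schwartz)
qed simp

lemma hartley_diff: "hartley (X - Y) = hartley X - hartley Y"
  by (rule linear_diff[OF bounded_linear.linear[OF bounded_linear_hartley]])

lemma hart_cmult: "hart (\<lambda>x. c * f x) = (\<lambda>x. c * hart f x)"
  by (simp add: hart_def fourier_cmult inv_fourier_eq algebra_simps fun_eq_iff)

lemma pairing_hartley:
  assumes "schwartz f"
  shows "pairing (rep (hartley X)) i f = pairing (rep X) i (hart f)"
proof (rule pairing_Re_eqI[where T=hart, OF _ hart_cmult assms])
  fix f :: "real^'a \<Rightarrow> complex" assume f: "schwartz f"
  have "Re (pairing (rep (hartley X)) i f) = inner (hartley X) (cls (test_field i f))"
    using inner_test_field[OF rep_L2 f, of "hartley X" i] by simp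
  also have "\<dots> = inner X (cls (test_field i (hart f)))"
    by (simp add: inner_hartley_schwartz schwartz_test_field f hfield_test_field)
  also have "\<dots> = Re (pairing (rep X) i (hart f))"
    using inner_test_field[OF rep_L2 schwartz_hart[OF f], of X i] by simp
  finally show "Re (pairing (rep (hartley X)) i f) = Re (pairing (rep X) i (hart f))" .
qed

section \<open>Sobolev spaces and fractional Laplacians as multiplication operators\<close>

section \<open>Sobolev spaces\<close>

abbreviation hat :: "'n::finite field \<Rightarrow> 'n Lt" where
  "hat u \<equiv> hartley (cls u)"

definition wt :: "real \<Rightarrow> real^'n::finite \<Rightarrow> real" where
  "wt \<sigma> xi = (1 + 4 * pi\<^sup>2 * (norm xi)\<^sup>2) powr (\<sigma> / 2)"

definition wmul :: "real \<Rightarrow> real^'n::finite \<Rightarrow> real^'n \<Rightarrow> real^'n" where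
  "wmul \<sigma> xi v = wt \<sigma> xi *\<^sub>R v"

lemma wt_pos: "0 < wt \<sigma> xi"
  using weight_pos[of xi] by (simp add: wt_def)

lemma wt_ge_1: "0 \<le> \<sigma> \<Longrightarrow> 1 \<le> wt \<sigma> xi"
  unfolding wt_def by (rule ge_one_powr_ge_zero) auto

lemma wt_add: "wt (\<sigma> + \<tau>) xi = wt \<sigma> xi * wt \<tau> xi"
  by (simp add: wt_def add_divide_distrib powr_add)

lemma wt_minus: "wt \<sigma> xi * wt (- \<sigma>) xi = 1"
proof -
  have "wt (\<sigma> + - \<sigma>) xi = 1" using weight_pos[of xi] by (simp add: wt_def)
  then show ?thesis by (simp only: wt_add)
qed

lemma wt_minus_le_1: "0 \<le> \<sigma> \<Longrightarrow> wt (- \<sigma>) xi \<le> 1"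
  using wt_minus[of \<sigma> xi] wt_ge_1[of \<sigma> xi] wt_pos[of "- \<sigma>" xi]
  by (smt (verit, best) mult_le_cancel_right1)

lemma wt_continuous: "continuous_on UNIV (wt \<sigma>)"
proof -
  have "\<forall>xi::real^'a. 1 + 4 * pi\<^sup>2 * (norm xi)\<^sup>2 \<noteq> 0" using weight_pos by (metis less_irrefl)
  then show ?thesis unfolding wt_def[abs_def] by (intro continuous_intros) auto
qed

lemma wt_measurable: "wt \<sigma> \<in> borel_measurable lebesgue"
  by (rule borel_measurable_lebesgueI[OF borel_measurable_continuous_onI[OF wt_continuous]]) simp

lemma multiplier_wmul: "multiplier (wmul \<sigma>)"
  unfolding wmul_def[abs_def] by (rule multiplier_scalar[OF wt_measurable])

lemma schwartz_wt: "schwartz f \<Longrightarrow> schwartz (\<lambda>xi. of_real (wt \<sigma> xi) * f xi)"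
  unfolding wt_def by (rule schwartz_slow_mult[OF slow.weight])

text \<open>The weight is even, so by \<open>hart_weight_hart\<close> conjugation with the Fourier
  transform may be replaced by conjugation with the Hartley transform.\<close>

lemma bessel_potential_hart:
  assumes "schwartz f"
  shows "bessel_potential \<sigma> D f = D (hart (\<lambda>xi. of_real (wt \<sigma> xi) * hart f xi))"
proof -
  have "hart (\<lambda>xi. of_real (wt \<sigma> xi) * hart f xi) = fourier (\<lambda>xi. of_real (wt \<sigma> xi) * inv_fourier f xi)"
    by (rule ext, rule hart_weight_hart[OF assms schwartz_wt]) (simp_all add: wt_def)
  then show ?thesis
    unfolding bessel_potential_def dist_inv_fourier_def dist_mult_def dist_fourier_def wt_def by simp
qed

lemma pairing_mop_scalar:
  assumes X: "X \<in> mdom (\<lambda>xi v. w xi *\<^sub>R v)" and f: "schwartz f" and wf: "schwartz (\<lambda>xi. of_real (w xi) * f xi)"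
  shows "pairing (rep (mop (\<lambda>xi v. w xi *\<^sub>R v) X)) i f = pairing (rep X) i (\<lambda>xi. of_real (w xi) * f xi)"
  unfolding pairing_def dist_of_def
proof (rule integral_cong_AE)
  show "(\<lambda>x. comp_fun (rep (mop (\<lambda>xi v. w xi *\<^sub>R v) X)) i x * f x) \<in> borel_measurable lebesgue"
    "(\<lambda>x. comp_fun (rep X) i x * (of_real (w x) * f x)) \<in> borel_measurable lebesgue"
    by (intro borel_measurable_integrable L2_schwartz_integrable rep_L2 f wf)+
  show "AE x in lebesgue. comp_fun (rep (mop (\<lambda>xi v. w xi *\<^sub>R v) X)) i x * f x = comp_fun (rep X) i x * (of_real (w x) * f x)"
    using rep_mop[OF X] by eventually_elim (simp add: comp_fun_def)
qed

lemma pairing_hartley_cls: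
  assumes "u \<in> L2" "schwartz f"
  shows "pairing (rep (hat u)) i f = pairing u i (hart f)"
  using pairing_hartley[OF assms(2)] pairing_rep_cls[OF assms(1) schwartz_hart[OF assms(2)]] by simp

lemma bessel_fieldI:
  assumes u: "u \<in> L2" and v: "v \<in> L2" and dom: "hat u \<in> mdom (wmul \<sigma>)"
    and eq: "cls v = hartley (mop (wmul \<sigma>) (hat u))"
  shows "bessel_field \<sigma> u v"
  unfolding bessel_field_def dist_eq_def
proof (intro allI impI)
  fix i f assume f: "schwartz (f :: real^'a \<Rightarrow> complex)"
  have "dist_of (comp_fun v i) f = pairing (rep (cls v)) i f"
    unfolding pairing_rep_cls[OF v f] unfolding pairing_def ..
  also have "\<dots> = pairing (rep (mop (wmul \<sigma>) (hat u))) i (hart f)"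
    unfolding eq by (rule pairing_hartley[OF f])
  also have "\<dots> = pairing (rep (hat u)) i (\<lambda>xi. of_real (wt \<sigma> xi) * hart f xi)"
    using dom unfolding wmul_def[abs_def] by (intro pairing_mop_scalar schwartz_hart f schwartz_wt)
  also have "\<dots> = pairing u i (hart (\<lambda>xi. of_real (wt \<sigma> xi) * hart f xi))"
    by (rule pairing_hartley_cls[OF u schwartz_wt[OF schwartz_hart[OF f]]])
  finally show "dist_of (comp_fun v i) f = bessel_potential \<sigma> (dist_of (comp_fun u i)) f"
    unfolding bessel_potential_hart[OF f] pairing_def .
qed

lemma comp_measurable_field:
  assumes "\<And>i. comp_fun u i \<in> borel_measurable M"
  shows "u \<in> borel_measurable M"
proof (rule field_measurableI)
  fix i
  have "(\<lambda>x. Re (comp_fun u i x)) \<in> borel_measurable M"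
    by (rule measurable_compose[OF assms borel_measurable_Re])
  then show "(\<lambda>x. u x $ i) \<in> borel_measurable M" by (simp add: comp_fun_def)
qed

text \<open>The candidate for u is the Hartley transform of \<open>U\<close>, which arises from the
  transform of v by division by the weight; it lies in L2 and has the same Bessel potential v. The
  potential determines the distribution, because every test function f is the transposed potential
  of another one, namely \<open>g\<close>; hence u agrees with the candidate almost
  everywhere.\<close>

lemma bessel_fieldD:
  fixes u v :: "'n::finite field"
  assumes u: "\<And>i. tempered_fun (comp_fun u i)" and v: "v \<in> L2" and b: "bessel_field \<sigma> u v" and \<sigma>: "0 \<le> \<sigma>"
  shows "u \<in> L2" "hat u \<in> mdom (wmul \<sigma>)" "cls v = hartley (mop (wmul \<sigma>) (hat u))"
proof -
  define V where "V = hat v"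
  define U where "U = mop (wmul (- \<sigma>)) V"
  have le: "norm (wmul (- \<sigma>) xi x) \<le> 1 * norm x" for xi x :: "real^'n"
    unfolding wmul_def
    using mult_right_mono[OF wt_minus_le_1[OF \<sigma>, of xi] norm_ge_zero[of x]] wt_pos[of "- \<sigma>" xi] by simp
  have r: "AE xi in lebesgue. rep U xi = wmul (- \<sigma>) xi (rep V xi)"
    unfolding U_def by (rule rep_mop[OF mop_bounded(1)[where X=V, OF multiplier_wmul[of "- \<sigma>"] le zero_le_one]])
  have VU: "AE xi in lebesgue. rep V xi = wmul \<sigma> xi (rep U xi)"
    using r by eventually_elim (simp add: wmul_def wt_minus)
  have U: "U \<in> mdom (wmul \<sigma>)" "mop (wmul \<sigma>) U = V"
    using mdomI_AE[OF multiplier_wmul VU] by auto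
  have bu': "bessel_field \<sigma> (rep (hartley U)) v"
    by (rule bessel_fieldI) (simp_all add: v U V_def)
  have "AE x in lebesgue. rep (hartley U) x = u x"
  proof (rule pairing_eqI)
    show "u \<in> borel_measurable lebesgue"
      using u by (intro comp_measurable_field) (simp add: tempered_fun_def)
    fix i and f :: "real^'n \<Rightarrow> complex" assume f: "schwartz f"
    show "integrable lebesgue (\<lambda>x. comp_fun u i x * f x)" using u f by (simp add: tempered_fun_def)
    define g where "g = hart (\<lambda>xi. of_real (wt (- \<sigma>) xi) * hart f xi)"
    have sg: "schwartz g" unfolding g_def by (intro schwartz_hart schwartz_wt f)
    have "(\<lambda>xi. of_real (wt \<sigma> xi) * hart g xi) = hart f"
    proof
      fix xi
      have "of_real (wt \<sigma> xi) * hart g xi = of_real (wt \<sigma> xi * wt (- \<sigma>) xi) * hart f xi"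
        unfolding g_def by (simp add: hart_hart schwartz_wt schwartz_hart f)
      then show "of_real (wt \<sigma> xi) * hart g xi = hart f xi" by (simp only: wt_minus of_real_1 mult_1)
    qed
    then have J: "hart (\<lambda>xi. of_real (wt \<sigma> xi) * hart g xi) = f"
      by (simp add: fun_eq_iff hart_hart f)
    have "pairing w i f = dist_of (comp_fun v i) g" if "bessel_field \<sigma> w v" for w
    proof -
      have "dist_of (comp_fun v i) g = bessel_potential \<sigma> (dist_of (comp_fun w i)) g"
        using that sg unfolding bessel_field_def dist_eq_def by blast
      then show ?thesis unfolding bessel_potential_hart[OF sg] J pairing_def by simp
    qed
    from this[OF bu'] this[OF b] show "pairing (rep (hartley U)) i f = pairing u i f" by simp
  qed
  note ae = this
  show uL: "u \<in> L2"
    by (rule L2_cong_AE[OF rep_L2 measurable_cong_AE_lebesgue[OF L2_measurable[OF rep_L2] ae] ae])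
  have cu: "cls u = hartley U" using cls_eqI[OF rep_L2 uL ae] by simp
  show "hat u \<in> mdom (wmul \<sigma>)" "cls v = hartley (mop (wmul \<sigma>) (hat u))"
    by (simp_all add: cu U V_def)
qed

lemma schwartz_iter_partial: "schwartz f \<Longrightarrow> schwartz (iter_partial js f)"
  by (induction js) (auto intro: schwartz_partial)

lemma schwartz_seminorm_le:
  assumes "schwartz f"
  shows "norm x ^ k * norm (iter_partial js f x) \<le> schwartz_seminorm k js f"
proof -
  obtain C where "\<forall>x. norm x ^ k * norm (iter_partial js f x) \<le> C"
    using schwartz_decay[OF schwartz_iter_partial[OF assms]] by blast
  then have "bdd_above (range (\<lambda>x. norm x ^ k * norm (iter_partial js f x)))" by (auto intro: bdd_aboveI)
  then show ?thesis unfolding schwartz_seminorm_def by (rule cSUP_upper[OF UNIV_I])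
qed

lemma schwartz_seminorm_nonneg: "schwartz f \<Longrightarrow> 0 \<le> schwartz_seminorm k js f"
  by (rule order.trans[OF _ schwartz_seminorm_le[of f 0 k js]]) auto

text \<open>The test function is at most a sum of seminorms without derivatives times
  \<open>dec\<close>, and the product of \<open>dec\<close> with the norm of u is
  integrable.\<close>

lemma tempered_fun_L2:
  fixes u :: "'n::finite field"
  assumes u: "u \<in> L2"
  shows "tempered_fun (comp_fun u i)"
  unfolding tempered_fun_def tempered_dist_def
proof (intro conjI allI impI)
  show "comp_fun u i \<in> borel_measurable lebesgue" by (rule comp_fun_measurable[OF L2_measurable[OF u]])
  show "integrable lebesgue (\<lambda>x. comp_fun u i x * f x)" if "schwartz f" for f by (rule L2_schwartz_integrable[OF u that])
  show "dist_of (comp_fun u i) (\<lambda>x. f x + g x) = dist_of (comp_fun u i) f + dist_of (comp_fun u i) g"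
    if "schwartz f" "schwartz g" for f g
    unfolding dist_of_def distrib_left by (rule Bochner_Integration.integral_add) (intro L2_schwartz_integrable u that)+
  show "dist_of (comp_fun u i) (\<lambda>x. c * f x) = c * dist_of (comp_fun u i) f" for c f
    using pairing_cmult[of u i c f] unfolding pairing_def .
  \<comment> \<open>The decay exponent of \<open>dec\<close>, so that the seminorms with powers 0
    and \<open>N\<close> control f.\<close>
  define N where "N = CARD('n) + 1"
  define A where "A = (LINT x|lebesgue. (norm (u x))\<^sup>2 + dec x)"
  have inth: "integrable lebesgue (\<lambda>x::real^'n. (norm (u x))\<^sup>2 + dec x)"
    by (intro Bochner_Integration.integrable_add L2_integrable u integrable_lebesgue integrable_dec)
  have A0: "0 \<le> A" unfolding A_def by (rule integral_nonneg_AE) (simp add: dec_nonneg)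
  have "norm (dist_of (comp_fun u i) f) \<le> (A * 2 ^ N * 2) * (\<Sum>k\<le>N. \<Sum>js\<in>{js. length js \<le> N}. schwartz_seminorm k js f)"
    if f: "schwartz f" for f
  proof -
    let ?s = "\<lambda>k. schwartz_seminorm k [] f"
    let ?S = "\<Sum>k\<le>N. \<Sum>js\<in>{js. length js \<le> N}. schwartz_seminorm k js f"
    have fin: "finite {js :: 'n list. length js \<le> N}"
      using finite_lists_length_le[of "UNIV :: 'n set" N] by simp
    have sS: "?s k \<le> ?S" if "k \<le> N" for k
    proof -
      have "?s k \<le> (\<Sum>js\<in>{js. length js \<le> N}. schwartz_seminorm k js f)"
        using fin by (intro member_le_sum) (auto simp: schwartz_seminorm_nonneg f)
      also have "\<dots> \<le> ?S"
        using that by (intro member_le_sum[where f="\<lambda>k. \<Sum>js\<in>{js. length js \<le> N}. schwartz_seminorm k js f"])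
          (auto intro!: sum_nonneg schwartz_seminorm_nonneg f)
      finally show ?thesis .
    qed
    have fx: "norm (f x) \<le> (2 ^ N * 2 * ?S) * dec x" for x
    proof -
      have "(1 + norm x) ^ N \<le> (2 * max 1 (norm x)) ^ N" by (intro power_mono) auto
      also have "\<dots> \<le> 2 ^ N * (1 + norm x ^ N)" by (auto simp: power_mult_distrib max_def)
      finally have "(1 + norm x) ^ N * norm (f x) \<le> 2 ^ N * (1 + norm x ^ N) * norm (f x)" by (intro mult_right_mono) auto
      also have "\<dots> = 2 ^ N * (norm x ^ 0 * norm (f x) + norm x ^ N * norm (f x))" by (simp add: algebra_simps)
      also have "\<dots> \<le> 2 ^ N * (?S + ?S)"
        using schwartz_seminorm_le[OF f, of x 0 "[]"] schwartz_seminorm_le[OF f, of x N "[]"] sS[of 0] sS[of N]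
        by (intro mult_left_mono add_mono) auto
      finally have "(1 + norm x) ^ N * norm (f x) \<le> 2 ^ N * 2 * ?S" by simp
      moreover have "0 < (1 + norm x) ^ N" by (intro zero_less_power add_pos_nonneg) auto
      ultimately show ?thesis unfolding dec_def N_def[symmetric] by (simp add: pos_le_divide_eq mult.commute)
    qed
    have B0: "0 \<le> 2 ^ N * 2 * ?S" by (intro mult_nonneg_nonneg sum_nonneg schwartz_seminorm_nonneg f) auto
    have "norm (dist_of (comp_fun u i) f) \<le> (LINT x|lebesgue. norm (comp_fun u i x * f x))"
      unfolding dist_of_def by (rule integral_norm_bound)
    also have "\<dots> \<le> (LINT x|lebesgue. (2 ^ N * 2 * ?S) * ((norm (u x))\<^sup>2 + dec x))"
    proof (intro integral_mono integrable_norm L2_schwartz_integrable[OF u f] integrable_mult_right inth)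
      fix x
      \<comment> \<open>Young's inequality would square the seminorms of f; this bound keeps them
        linear, as required of a tempered distribution.\<close>
      have d1: "norm (u x) * dec x \<le> (norm (u x))\<^sup>2 + dec x"
      proof (cases "norm (u x) \<le> 1")
        case True
        then have "norm (u x) * dec x \<le> 1 * dec x" by (intro mult_right_mono dec_nonneg)
        then show ?thesis by (simp add: add_increasing)
      next
        case False
        then have "norm (u x) * dec x \<le> norm (u x) * norm (u x)" using dec_le_1[of x] by (intro mult_left_mono) auto
        then show ?thesis using dec_nonneg[of x] by (simp add: power2_eq_square)
      qed
      have "norm (comp_fun u i x * f x) \<le> norm (u x) * ((2 ^ N * 2 * ?S) * dec x)"
        unfolding norm_mult by (intro mult_mono norm_comp_fun_le fx) auto
      also have "\<dots> = (2 ^ N * 2 * ?S) * (norm (u x) * dec x)" by simp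
      also have "\<dots> \<le> (2 ^ N * 2 * ?S) * ((norm (u x))\<^sup>2 + dec x)" by (intro mult_left_mono d1 B0)
      finally show "norm (comp_fun u i x * f x) \<le> (2 ^ N * 2 * ?S) * ((norm (u x))\<^sup>2 + dec x)" .
    qed
    also have "\<dots> = (A * 2 ^ N * 2) * ?S" unfolding A_def by (subst integral_mult_right_zero) (simp only: mult_ac)
    finally show ?thesis .
  qed
  then show "\<exists>C N. \<forall>f. schwartz f \<longrightarrow> norm (dist_of (comp_fun u i) f) \<le> C * (\<Sum>k\<le>N. \<Sum>js\<in>{js. length js \<le> N}. schwartz_seminorm k js f)"
    by blast
qed

lemma bessel_field_exists:
  assumes "u \<in> L2" "hat u \<in> mdom (wmul \<sigma>)"
  shows "bessel_field \<sigma> u (rep (hartley (mop (wmul \<sigma>) (hat u))))"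
  by (rule bessel_fieldI) (simp_all add: assms)

theorem sobolev_iff:
  assumes "0 \<le> \<sigma>"
  shows "u \<in> sobolev \<sigma> \<longleftrightarrow> u \<in> L2 \<and> hat u \<in> mdom (wmul \<sigma>)"
proof
  assume "u \<in> sobolev \<sigma>"
  then obtain v where "\<And>i. tempered_fun (comp_fun u i)" "v \<in> L2" "bessel_field \<sigma> u v" by (auto simp: sobolev_def)
  from bessel_fieldD[OF this assms] show "u \<in> L2 \<and> hat u \<in> mdom (wmul \<sigma>)" by blast
next
  assume "u \<in> L2 \<and> hat u \<in> mdom (wmul \<sigma>)"
  then show "u \<in> sobolev \<sigma>" unfolding sobolev_def
    using bessel_field_exists[of u \<sigma>] tempered_fun_L2[of u] rep_L2 by blast
qed

text \<open>The field in the definition of the norm is chosen by \<open>SOME\<close>, but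
  \<open>bessel_fieldD\<close> shows that its class is determined by u.\<close>

theorem sobolev_norm_eq:
  assumes "0 \<le> \<sigma>" and u: "u \<in> L2" "hat u \<in> mdom (wmul \<sigma>)"
  shows "sobolev_norm \<sigma> u = norm (mop (wmul \<sigma>) (hat u))"
proof -
  define v where "v = (SOME v. v \<in> L2 \<and> bessel_field \<sigma> u v)"
  have v: "v \<in> L2" "bessel_field \<sigma> u v"
    using someI_ex[of "\<lambda>v. v \<in> L2 \<and> bessel_field \<sigma> u v"] bessel_field_exists[OF u] rep_L2 unfolding v_def by blast+
  have "cls v = hartley (mop (wmul \<sigma>) (hat u))"
    by (rule bessel_fieldD(3)[OF tempered_fun_L2[OF u(1)] v assms(1)])
  then have "norm (cls v) = norm (mop (wmul \<sigma>) (hat u))" by simp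
  then show ?thesis unfolding sobolev_norm_def v_def[symmetric] norm_cls[OF v(1)] .
qed

lemma lebesgue_reflect: "(lebesgue :: (real^'n::finite) measure) = distr lebesgue lebesgue uminus"
  and uminus_measurable_lebesgue: "uminus \<in> (lebesgue :: (real^'n) measure) \<rightarrow>\<^sub>M lebesgue"
proof -
  have T: "(\<lambda>x::real^'n. 0 + (\<Sum>j\<in>Basis. (- 1 * (x \<bullet> j)) *\<^sub>R j)) = uminus"
    by (simp add: sum_negf euclidean_representation fun_eq_iff)
  have "(lebesgue :: (real^'n) measure) = density (distr lebesgue lebesgue uminus) (\<lambda>_. ennreal (\<Prod>j\<in>(Basis :: (real^'n) set). \<bar>- 1\<bar>))"
    by (rule lebesgue_affine_euclidean[where c="\<lambda>_. - 1" and t="0::real^'n", unfolded T]) simp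
  then show "(lebesgue :: (real^'n) measure) = distr lebesgue lebesgue uminus" by (simp add: density_1)
  show "uminus \<in> (lebesgue :: (real^'n) measure) \<rightarrow>\<^sub>M lebesgue"
    by (rule lebesgue_affine_measurable[where c="\<lambda>_. - 1" and t="0::real^'n", unfolded T]) simp
qed

lemma lebesgue_integral_reflect:
  fixes f :: "real^'n::finite \<Rightarrow> complex"
  assumes "f \<in> borel_measurable lebesgue"
  shows "(LINT x|lebesgue. f (- x)) = (LINT x|lebesgue. f x)"
    and "integrable lebesgue (\<lambda>x. f (- x)) \<longleftrightarrow> integrable lebesgue f"
    and "(\<lambda>x. f (- x)) \<in> borel_measurable lebesgue"
proof -
  note m = uminus_measurable_lebesgue[where 'n='n]
  show "(LINT x|lebesgue. f (- x)) = (LINT x|lebesgue. f x)"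
    using integral_distr[OF m assms] lebesgue_reflect[where 'n='n] by simp
  show "integrable lebesgue (\<lambda>x. f (- x)) \<longleftrightarrow> integrable lebesgue f"
    using integrable_distr_eq[OF m assms] lebesgue_reflect[where 'n='n] by simp
  show "(\<lambda>x. f (- x)) \<in> borel_measurable lebesgue" by (rule measurable_compose[OF m assms])
qed

lemma hart_as_fourier:
  assumes f: "schwartz f"
  shows "hart f = fourier (\<lambda>x. (1 + \<i>) / 2 * f x + (1 - \<i>) / 2 * f (- x))"
proof
  fix xi
  have "fourier (\<lambda>x. (1 + \<i>) / 2 * f x + (1 - \<i>) / 2 * f (- x)) xi
    = fourier (\<lambda>x. (1 + \<i>) / 2 * f x) xi + fourier (\<lambda>x. (1 - \<i>) / 2 * f (- x)) xi"
    by (intro fourier_add schwartz_integrable schwartz_cmult schwartz_reflect f)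
  then show "hart f xi = fourier (\<lambda>x. (1 + \<i>) / 2 * f x + (1 - \<i>) / 2 * f (- x)) xi"
    by (simp only: hart_def fourier_cmult inv_fourier_reflect)
qed

definition lap :: "real \<Rightarrow> real^'n::finite \<Rightarrow> real" where
  "lap \<sigma> xi = (4 * pi\<^sup>2 * (norm xi)\<^sup>2) powr \<sigma>"

lemma lap_nonneg: "0 \<le> lap \<sigma> xi" by (simp add: lap_def)

lemma lap_measurable: "lap \<sigma> \<in> borel_measurable borel"
  unfolding lap_def[abs_def] by measurable

text \<open>Only complex Fourier transforms \<open>U i\<close> are given. The Hartley transform is
  the combination \<open>sym\<close> of the Fourier transform with its reflection, and
  multiplication by an even weight commutes with \<open>sym\<close>; both identities hold almost
  everywhere by testing.\<close>

lemma frac_laplacian_hartley: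
  fixes u v :: "'n::finite field"
  assumes u: "u \<in> L2" and v: "v \<in> L2" and fl: "frac_laplacian \<sigma> u v"
  shows "hat u \<in> mdom (\<lambda>xi x. lap \<sigma> xi *\<^sub>R x)" "mop (\<lambda>xi x. lap \<sigma> xi *\<^sub>R x) (hat u) = hat v"
proof -
  obtain U where U: "\<And>i. tempered_fun (U i)" "\<And>i. dist_eq (dist_of (U i)) (dist_fourier (dist_of (comp_fun u i)))"
    "\<And>i. tempered_fun (\<lambda>xi. of_real (lap \<sigma> xi) * U i xi)"
    "\<And>i. dist_eq (dist_of (comp_fun v i)) (dist_inv_fourier (dist_of (\<lambda>xi. of_real (lap \<sigma> xi) * U i xi)))"
    using fl unfolding frac_laplacian_def lap_def by blast
  define sym where "sym h x = (1 + \<i>) / 2 * h x + (1 - \<i>) / 2 * h (- x)" for h :: "real^'n \<Rightarrow> complex" and x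
  have ssym: "schwartz (sym f)" if "schwartz f" for f
    unfolding sym_def[abs_def] by (intro schwartz_add schwartz_cmult schwartz_reflect that)
  have sym: "integrable lebesgue (\<lambda>x. sym h x * f x) \<and> (LINT x|lebesgue. h x * sym f x) = (LINT x|lebesgue. sym h x * f x)"
    and msym: "sym h \<in> borel_measurable lebesgue"
    if h: "tempered_fun h" and f: "schwartz f" for h f
  proof -
    have hm: "h \<in> borel_measurable lebesgue" and hi: "\<And>g. schwartz g \<Longrightarrow> integrable lebesgue (\<lambda>x. h x * g x)"
      using h by (auto simp: tempered_fun_def)
    have m: "(\<lambda>x. h x * f (- x)) \<in> borel_measurable lebesgue"
      by (intro borel_measurable_integrable hi schwartz_reflect f)
    have i1: "integrable lebesgue (\<lambda>x. h x * f x)" and i2: "integrable lebesgue (\<lambda>x. h x * f (- x))"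
      by (intro hi f schwartz_reflect)+
    have i3: "integrable lebesgue (\<lambda>x. h (- x) * f x)" and e3: "(LINT x|lebesgue. h (- x) * f x) = (LINT x|lebesgue. h x * f (- x))"
      using lebesgue_integral_reflect[OF m] i2 by simp_all
    have e1: "(\<lambda>x. h x * sym f x) = (\<lambda>x. (1 + \<i>) / 2 * (h x * f x) + (1 - \<i>) / 2 * (h x * f (- x)))"
      and e2: "(\<lambda>x. sym h x * f x) = (\<lambda>x. (1 + \<i>) / 2 * (h x * f x) + (1 - \<i>) / 2 * (h (- x) * f x))"
      by (simp_all add: sym_def algebra_simps fun_eq_iff)
    have c: "integrable lebesgue (\<lambda>x. (1 + \<i>) / 2 * (h x * f x))" "integrable lebesgue (\<lambda>x. (1 - \<i>) / 2 * (h x * f (- x)))"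
      "integrable lebesgue (\<lambda>x. (1 - \<i>) / 2 * (h (- x) * f x))" by (intro integrable_mult_right i1 i2 i3)+
    show "integrable lebesgue (\<lambda>x. sym h x * f x) \<and> (LINT x|lebesgue. h x * sym f x) = (LINT x|lebesgue. sym h x * f x)"
      unfolding e1 e2 Bochner_Integration.integral_add[OF c(1) c(2)] Bochner_Integration.integral_add[OF c(1) c(3)] integral_mult_right_zero e3
      by (intro conjI Bochner_Integration.integrable_add c refl)
    show "sym h \<in> borel_measurable lebesgue"
      unfolding sym_def[abs_def]
      by (intro borel_measurable_add borel_measurable_times borel_measurable_const hm lebesgue_integral_reflect(3))
  qed
  have key: "AE x in lebesgue. comp_fun (rep (hat w)) i x = sym h x"
    if w: "w \<in> L2" and h: "tempered_fun h" and eq: "\<And>f. schwartz f \<Longrightarrow> pairing w i (hart f) = dist_of h (sym f)" for w h i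
  proof -
    have "AE x in lebesgue. comp_fun (rep (hat w)) i x - sym h x = 0"
    proof (rule zero_if_orthogonal_to_schwartz)
      show "(\<lambda>x. comp_fun (rep (hat w)) i x - sym h x) \<in> borel_measurable lebesgue"
        by (intro borel_measurable_diff comp_fun_measurable L2_measurable rep_L2 msym[OF h schwartz_zero])
      fix f :: "real^'n \<Rightarrow> complex" assume f: "schwartz f"
      have i: "integrable lebesgue (\<lambda>x. comp_fun (rep (hat w)) i x * f x)" "integrable lebesgue (\<lambda>x. sym h x * f x)"
        using L2_schwartz_integrable[OF rep_L2 f] sym[OF h f] by auto
      show "integrable lebesgue (\<lambda>x. (comp_fun (rep (hat w)) i x - sym h x) * f x)"
        unfolding left_diff_distrib by (intro Bochner_Integration.integrable_diff i)
      show "(LINT x|lebesgue. (comp_fun (rep (hat w)) i x - sym h x) * f x) = 0"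
        unfolding left_diff_distrib Bochner_Integration.integral_diff[OF i]
        using pairing_hartley_cls[OF w f, of i] eq[OF f] sym[OF h f] by (simp add: pairing_def dist_of_def)
    qed
    then show ?thesis by simp
  qed
  have ku: "AE x in lebesgue. comp_fun (rep (hat u)) i x = sym (U i) x" for i
  proof (rule key[OF u U(1)])
    fix f :: "real^'n \<Rightarrow> complex" assume f: "schwartz f"
    have "hart f = fourier (sym f)" unfolding sym_def[abs_def] by (rule hart_as_fourier[OF f])
    then show "pairing u i (hart f) = dist_of (U i) (sym f)"
      using U(2)[of i] ssym[OF f] by (simp add: pairing_def dist_eq_def dist_fourier_def)
  qed
  have kv: "AE x in lebesgue. comp_fun (rep (hat v)) i x = sym (\<lambda>xi. of_real (lap \<sigma> xi) * U i xi) x" for i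
  proof (rule key[OF v U(3)])
    fix f :: "real^'n \<Rightarrow> complex" assume f: "schwartz f"
    have "hart f = fourier (sym f)" unfolding sym_def[abs_def] by (rule hart_as_fourier[OF f])
    then have "inv_fourier (hart f) = inv_fourier (fourier (sym f))" by (simp only:)
    also have "\<dots> = sym f" by (rule ext) (rule fourier_inversion[OF ssym[OF f]])
    finally have "inv_fourier (hart f) = sym f" .
    then show "pairing v i (hart f) = dist_of (\<lambda>xi. of_real (lap \<sigma> xi) * U i xi) (sym f)"
      using U(4)[of i] schwartz_hart[OF f] by (simp add: pairing_def dist_eq_def dist_inv_fourier_def)
  qed
  have "AE x in lebesgue. \<forall>i. comp_fun (rep (hat u)) i x = sym (U i) x"
    "AE x in lebesgue. \<forall>i. comp_fun (rep (hat v)) i x = sym (\<lambda>xi. of_real (lap \<sigma> xi) * U i xi) x"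
    using ku kv by (simp_all add: AE_all_countable)
  then have ae: "AE xi in lebesgue. rep (hat v) xi = lap \<sigma> xi *\<^sub>R rep (hat u) xi"
  proof eventually_elim
    case (elim xi)
    have "complex_of_real (rep (hat v) xi $ i) = of_real (lap \<sigma> xi * rep (hat u) xi $ i)" for i
    proof -
      have "sym (\<lambda>xi. of_real (lap \<sigma> xi) * U i xi) xi = of_real (lap \<sigma> xi) * sym (U i) xi"
        unfolding sym_def lap_def norm_minus_cancel by (simp add: algebra_simps)
      then show ?thesis using elim unfolding comp_fun_def by simp
    qed
    then show ?case unfolding of_real_eq_iff by (simp add: vec_eq_iff)
  qed
  have m: "multiplier (\<lambda>xi x::real^'n. lap \<sigma> xi *\<^sub>R x)"
    by (rule multiplier_scalar[OF borel_measurable_lebesgueI[OF lap_measurable]]) simp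
  show "hat u \<in> mdom (\<lambda>xi x. lap \<sigma> xi *\<^sub>R x)" "mop (\<lambda>xi x. lap \<sigma> xi *\<^sub>R x) (hat u) = hat v"
    using mdomI_AE[OF m ae] by auto
qed

text \<open>Pointwise evaluation of the Hartley transform of integrable square integrable fields.\<close>

lemma hartley_cls_integrable:
  fixes h :: "'n::finite field"
  assumes h: "integrable lborel h" and L: "h \<in> L2"
  shows "AE x in lebesgue. rep (hat h) x = hfield h x" "hfield h \<in> L2" "hat h = cls (hfield h)"
proof -
  have ci: "integrable lborel (comp_fun h i)" for i
    unfolding comp_fun_def[abs_def] by (rule integrable_bounded_linear[OF bounded_linear_component h])
  have hb: "hart (comp_fun h i) \<in> borel_measurable borel" for i
  proof -
    have [measurable]: "comp_fun h i \<in> borel_measurable borel" using ci[of i] by auto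
    have "(\<lambda>xi. LINT x|lborel. cas (2 * pi * (x \<bullet> xi)) *\<^sub>R comp_fun h i x) \<in> borel_measurable borel" by measurable
    then show ?thesis unfolding hart_eq[OF ci, abs_def] .
  qed
  have bound: "norm (hart (comp_fun h i) xi) \<le> 2 * (LINT x|lborel. norm (comp_fun h i x))" for i xi
  proof -
    have "norm (hart (comp_fun h i) xi) \<le> (LINT x|lborel. norm (cas (2 * pi * (x \<bullet> xi)) *\<^sub>R comp_fun h i x))"
      unfolding hart_eq[OF ci] by (rule integral_norm_bound)
    also have "\<dots> \<le> (LINT x|lborel. 2 * norm (comp_fun h i x))"
      using abs_cas_le by (intro integral_mono integrable_norm integrable_cas_scaleR ci integrable_mult_right) (auto intro!: mult_right_mono)
    finally show ?thesis by simp
  qed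
  have int: "integrable lborel (\<lambda>x. hart (comp_fun h i) x * f x)" if f: "schwartz f" for i f
  proof (rule Bochner_Integration.integrable_bound)
    show "integrable lborel (\<lambda>x. (2 * (LINT x|lborel. norm (comp_fun h i x))) * norm (f x))"
      by (intro integrable_mult_right integrable_norm schwartz_integrable f)
    show "(\<lambda>x. hart (comp_fun h i) x * f x) \<in> borel_measurable lborel"
      using borel_measurable_times[OF hb schwartz_measurable[OF f]] by simp
    show "AE x in lborel. norm (hart (comp_fun h i) x * f x) \<le> norm ((2 * (LINT x|lborel. norm (comp_fun h i x))) * norm (f x))"
      unfolding norm_mult using bound by (intro AE_I2) (auto intro!: mult_right_mono)
  qed
  show ae: "AE x in lebesgue. rep (hat h) x = hfield h x"
  proof (rule pairing_eqI)
    have "hfield h \<in> borel_measurable borel" by (rule comp_measurable_field) (simp add: comp_hfield[OF h] hb)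
    then show "hfield h \<in> borel_measurable lebesgue" by (rule borel_measurable_lebesgueI) simp
    fix i and f :: "real^'n \<Rightarrow> complex" assume f: "schwartz f"
    show "integrable lebesgue (\<lambda>x. comp_fun (hfield h) i x * f x)"
      unfolding comp_hfield[OF h] by (rule integrable_lebesgue[OF int[OF f]])
    have "pairing (rep (hat h)) i f = (LINT x|lebesgue. comp_fun h i x * hart f x)"
      unfolding pairing_hartley_cls[OF L f] by (simp only: pairing_def dist_of_def)
    also have "\<dots> = (LINT x|lborel. comp_fun h i x * hart f x)"
    proof (rule integral_completion)
      have "comp_fun h i \<in> borel_measurable lborel" using ci[of i] by auto
      then show "(\<lambda>x. comp_fun h i x * hart f x) \<in> borel_measurable lborel"
        using schwartz_measurable[OF schwartz_hart[OF f]] by (intro borel_measurable_times) simp_all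
    qed
    also have "\<dots> = (LINT x|lborel. hart (comp_fun h i) x * f x)"
      by (rule hart_multiplication_formula[symmetric, OF ci schwartz_integrable[OF f]])
    also have "\<dots> = (LINT x|lebesgue. hart (comp_fun h i) x * f x)"
      by (rule integral_completion[symmetric, OF borel_measurable_integrable[OF int[OF f]]])
    finally show "pairing (rep (hat h)) i f = pairing (hfield h) i f"
      unfolding pairing_def dist_of_def comp_hfield[OF h] .
  qed
  show hL: "hfield h \<in> L2" by (rule L2_cong_AE[OF rep_L2 measurable_cong_AE_lebesgue[OF L2_measurable[OF rep_L2] ae] ae])
  show "hat h = cls (hfield h)" using cls_eqI[OF rep_L2 hL ae] by simp
qed

section \<open>Kernel bounds and the matrix symbol of the operator\<close>

section \<open>The symbol of the operator\<close>

lemma four_pi_sq: "1 \<le> 4 * pi\<^sup>2"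
  using one_le_power[of pi 2] pi_gt3 by linarith

lemma one_minus_cos_le: "1 - cos t \<le> t\<^sup>2 / 2" for t :: real
proof -
  have "cos t = 1 - 2 * (sin (t / 2))\<^sup>2" using cos_double_sin[of "t / 2"] by simp
  moreover have "(sin (t / 2))\<^sup>2 \<le> (t / 2)\<^sup>2"
    using abs_sin_x_le_abs_x[of "t / 2"] by (rule abs_le_square_iff[THEN iffD1])
  ultimately show ?thesis by (simp add: power_divide)
qed

text \<open>Half the symbol of the second difference 2 u(x) - u(x + y) - u(x - y).\<close>

definition om :: "real^'n::finite \<Rightarrow> real^'n \<Rightarrow> real" where
  "om y xi = 1 - cos (2 * pi * (y \<bullet> xi))"

lemma om_nonneg: "0 \<le> om y xi" by (simp add: om_def)

lemma om_le: "om y xi \<le> 2 * pi\<^sup>2 * min 1 ((norm xi)\<^sup>2 * (norm y)\<^sup>2)"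
proof -
  have "pi\<^sup>2 \<ge> 1" using pi_gt3 by (simp add: one_le_power)
  moreover have "om y xi \<le> 2" unfolding om_def using cos_ge_minus_one[of "2 * pi * (y \<bullet> xi)"] by linarith
  moreover have "om y xi \<le> 2 * pi\<^sup>2 * ((norm xi)\<^sup>2 * (norm y)\<^sup>2)"
  proof -
    have "om y xi \<le> (2 * pi * (y \<bullet> xi))\<^sup>2 / 2" unfolding om_def by (rule one_minus_cos_le)
    also have "\<dots> = 2 * pi\<^sup>2 * (y \<bullet> xi)\<^sup>2" by (simp add: power_mult_distrib)
    also have "(y \<bullet> xi)\<^sup>2 \<le> (norm xi * norm y)\<^sup>2"
      using Cauchy_Schwarz_ineq2[of y xi] by (intro abs_le_square_iff[THEN iffD1]) (simp add: mult.commute)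
    finally show ?thesis by (simp add: power_mult_distrib mult_left_mono)
  qed
  ultimately show ?thesis by (simp add: min_def)
qed

lemma min_scale: "min 1 (a * b) \<le> (1 + a) * min 1 b" if "0 \<le> a" "0 \<le> b" for a b :: real
proof (cases "b \<le> 1")
  case True
  then have "min 1 (a * b) \<le> (1 + a) * b" using that by (simp add: distrib_right min.coboundedI2)
  then show ?thesis using True by simp
next
  case False
  then show ?thesis using that by (simp add: min.coboundedI1)
qed

lemma om_le': "om y xi \<le> 2 * pi\<^sup>2 * (1 + (norm xi)\<^sup>2) * min 1 ((norm y)\<^sup>2)"
proof -
  have "om y xi \<le> 2 * pi\<^sup>2 * min 1 ((norm xi)\<^sup>2 * (norm y)\<^sup>2)" by (rule om_le)
  also have "\<dots> \<le> 2 * pi\<^sup>2 * ((1 + (norm xi)\<^sup>2) * min 1 ((norm y)\<^sup>2))"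
    by (intro mult_left_mono min_scale) auto
  finally show ?thesis by (simp only: mult.assoc)
qed

definition dyad :: "real^'n::finite \<Rightarrow> real^'n \<Rightarrow> real^'n" where
  "dyad y v = ((y \<bullet> v) / (norm y)\<^sup>2) *\<^sub>R y"

lemma linear_dyad: "linear (dyad y)"
  by (intro linearI) (simp_all add: dyad_def inner_add_right add_divide_distrib scaleR_add_left)

lemma inner_dyad: "dyad y v \<bullet> w = (y \<bullet> v) * (y \<bullet> w) / (norm y)\<^sup>2"
  by (simp add: dyad_def)

lemma norm_dyad_le: "norm (dyad y v) \<le> norm v"
proof (cases "y = 0")
  case False
  have "norm (dyad y v) = \<bar>y \<bullet> v\<bar> / norm y" using False by (simp add: dyad_def power2_eq_square)
  also have "\<dots> \<le> norm v" using Cauchy_Schwarz_ineq2[of y v] False by (simp add: divide_le_eq mult.commute)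
  finally show ?thesis .
qed (simp add: dyad_def)

lemma dyad_minus: "dyad (- y) v = dyad y v"
  by (simp add: dyad_def)

lemma dyad_measurable[measurable (raw)]:
  fixes f g :: "'a \<Rightarrow> real^'n::finite"
  assumes [measurable]: "f \<in> borel_measurable M" "g \<in> borel_measurable M"
  shows "(\<lambda>x. dyad (f x) (g x)) \<in> borel_measurable M"
  unfolding dyad_def by measurable

lemma om_measurable[measurable (raw)]:
  fixes f g :: "'a \<Rightarrow> real^'n::finite"
  shows "f \<in> borel_measurable M \<Longrightarrow> g \<in> borel_measurable M \<Longrightarrow> (\<lambda>x. om (f x) (g x)) \<in> borel_measurable M"
proof -
  assume [measurable]: "f \<in> borel_measurable M" "g \<in> borel_measurable M"
  have "(\<lambda>x. 2 * pi * (f x \<bullet> g x)) \<in> borel_measurable M" by measurable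
  then have "(\<lambda>x. cos (2 * pi * (f x \<bullet> g x))) \<in> borel_measurable M"
    by (rule borel_measurable_continuous_on[rotated]) (intro continuous_intros)
  then show "(\<lambda>x. om (f x) (g x)) \<in> borel_measurable M" unfolding om_def by measurable
qed

text \<open>Majorises the kernel times the truncated quadratic factor, up to a constant. The
  quadratic factor gives integrability at the origin because s < 1, its truncation integrability at
  infinity because s > 0.\<close>

definition kap :: "real \<Rightarrow> real \<Rightarrow> real^'n::finite \<Rightarrow> real" where
  "kap s t y = norm y powr (- (real CARD('n) + 2 * s)) * min 1 (t * (norm y)\<^sup>2)"

lemma kap_nonneg: "0 \<le> t \<Longrightarrow> 0 \<le> kap s t y" by (simp add: kap_def)

lemma kap_measurable[measurable]: "kap s t \<in> borel_measurable borel"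
  unfolding kap_def[abs_def] by measurable

lemma integrable_kap_1:
  assumes "0 < s" "s < 1"
  shows "integrable lborel (kap s 1 :: real^'n::finite \<Rightarrow> real)"
proof (rule integrableI_bounded)
  have "(\<integral>\<^sup>+y. ennreal (norm (kap s 1 y)) \<partial>(lborel :: (real^'n) measure)) \<le>
    (\<integral>\<^sup>+y. ennreal (indicator {x. 1 < norm x} y * norm y powr (- (real CARD('n) + 2 * s)))
       + ennreal (indicator {x. norm x \<le> 1} y * norm y powr ((2 - 2 * s) - real CARD('n))) \<partial>(lborel :: (real^'n) measure))"
  proof (rule nn_integral_mono)
    fix y :: "real^'n"
    show "ennreal (norm (kap s 1 y)) \<le> ennreal (indicator {x. 1 < norm x} y * norm y powr (- (real CARD('n) + 2 * s)))
       + ennreal (indicator {x. norm x \<le> 1} y * norm y powr ((2 - 2 * s) - real CARD('n)))"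
    proof (cases "1 < norm y")
      case True
      then have "1 \<le> (norm y)\<^sup>2" by (intro one_le_power) simp
      then show ?thesis using True by (simp add: kap_def)
    next
      case False
      show ?thesis
      proof (cases "y = 0")
        case y: False
        have "(norm y)\<^sup>2 \<le> 1" using False by (simp add: power_le_one)
        moreover have "norm y powr (- (real CARD('n) + 2 * s)) * (norm y)\<^sup>2 = norm y powr ((2 - 2 * s) - real CARD('n))"
        proof -
          have "(norm y)\<^sup>2 = norm y powr 2" using y by (simp add: powr_numeral)
          show ?thesis unfolding \<open>(norm y)\<^sup>2 = norm y powr 2\<close> powr_add[symmetric] by (rule arg_cong[where f="\<lambda>a. norm y powr a"]) simp
        qed
        ultimately show ?thesis using False by (simp add: kap_def)
      qed (simp add: kap_def)
    qed
  qed
  also have "\<dots> = (\<integral>\<^sup>+y. ennreal (indicator {x. 1 < norm x} y * norm y powr (- (real CARD('n) + 2 * s))) \<partial>(lborel :: (real^'n) measure))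
       + (\<integral>\<^sup>+y. ennreal (indicator {x. norm x \<le> 1} y * norm y powr ((2 - 2 * s) - real CARD('n))) \<partial>(lborel :: (real^'n) measure))"
    by (rule nn_integral_add) measurable
  also have "\<dots> < \<infinity>"
    using nn_integral_powr_outside[of "2 * s", where 'n='n] nn_integral_powr_inside[of "2 - 2 * s", where 'n='n] assms by simp
  finally show "(\<integral>\<^sup>+y. ennreal (norm (kap s 1 y)) \<partial>(lborel :: (real^'n) measure)) < \<infinity>" .
qed measurable

lemma integrable_kap:
  assumes "0 < s" "s < 1" "0 \<le> t"
  shows "integrable lborel (kap s t :: real^'n::finite \<Rightarrow> real)"
proof (rule Bochner_Integration.integrable_bound)
  show "integrable lborel (\<lambda>y::real^'n. (1 + t) * kap s 1 y)" by (intro integrable_mult_right integrable_kap_1 assms)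
  show "AE y in lborel. norm (kap s t y) \<le> norm ((1 + t) * kap s 1 (y::real^'n))"
  proof (rule AE_I2)
    fix y :: "real^'n"
    have "kap s t y \<le> norm y powr (- (real CARD('n) + 2 * s)) * ((1 + t) * min 1 ((norm y)\<^sup>2))"
      unfolding kap_def using assms(3) by (intro mult_left_mono min_scale) auto
    then show "norm (kap s t y) \<le> norm ((1 + t) * kap s 1 y)"
      using assms(3) kap_nonneg[of t s y] by (simp add: kap_def mult_ac)
  qed
qed measurable

text \<open>The substitution y = z / t. The homogeneity of degree 2 s obtained here is the growth
  rate of the symbol.\<close>

lemma integral_kap_scale:
  assumes "0 < t"
  shows "(LINT y|lborel. kap s (t\<^sup>2) (y :: real^'n::finite)) = t powr (2 * s) * (LINT y|lborel. kap s 1 (y :: real^'n))"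
proof -
  have "kap s (t\<^sup>2) (0 + (1 / t) *\<^sub>R z) = t powr (real CARD('n) + 2 * s) * kap s 1 z" for z :: "real^'n"
  proof -
    have "norm ((1 / t) *\<^sub>R z) = norm z / t" using assms by simp
    moreover have "(norm z / t) powr (- (real CARD('n) + 2 * s)) = t powr (real CARD('n) + 2 * s) * norm z powr (- (real CARD('n) + 2 * s))"
      unfolding powr_divide powr_minus[of t] by (simp add: divide_inverse)
    moreover have "t\<^sup>2 * (norm z / t)\<^sup>2 = (norm z)\<^sup>2" using assms by (simp add: power_divide)
    ultimately show ?thesis unfolding kap_def by (simp only: add_0_left mult_1 mult.assoc)
  qed
  then have "(LINT y|lborel. kap s (t\<^sup>2) (y :: real^'n)) = (1 / t) ^ CARD('n) *\<^sub>R (LINT z|lborel. t powr (real CARD('n) + 2 * s) * kap s 1 (z :: real^'n))"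
    using lborel_integral_affine[of "1 / t" "kap s (t\<^sup>2) :: real^'n \<Rightarrow> real" 0] assms by simp
  also have "\<dots> = ((1 / t) ^ CARD('n) * t powr (real CARD('n) + 2 * s)) * (LINT z|lborel. kap s 1 (z :: real^'n))" by simp
  also have "(1 / t) ^ CARD('n) * t powr (real CARD('n) + 2 * s) = t powr (2 * s)"
    using assms by (simp add: powr_add powr_realpow power_divide)
  finally show ?thesis .
qed

text \<open>Collects nonnegativity, evenness and the bound of the kernel from above; the bound of
  its symbol from below is drawn later from the steady problem.\<close>

locale even_kernel =
  fixes \<rho> :: "real^'n::finite \<Rightarrow> real" and s \<alpha> :: real
  assumes s: "0 < s" "s < 1" and \<alpha>: "0 \<le> \<alpha>"
    and \<rho>_measurable: "\<rho> \<in> borel_measurable lebesgue"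
    and \<rho>_nonneg: "0 \<le> \<rho> y"
    and \<rho>_le: "\<rho> y \<le> \<alpha> * norm y powr (- (real CARD('n) + 2 * s))"
    and \<rho>_even: "\<rho> (- y) = \<rho> y"
begin

lemma \<rho>_kap_le: "\<rho> y * min 1 (t * (norm y)\<^sup>2) \<le> \<alpha> * kap s t y" if "0 \<le> t"
  using mult_right_mono[OF \<rho>_le[of y], of "min 1 (t * (norm y)\<^sup>2)"] that by (simp add: kap_def mult.assoc)

lemma \<rho>_times_measurable:
  fixes g :: "real^'n \<Rightarrow> 'b::{second_countable_topology, real_normed_vector}"
  shows "g \<in> borel_measurable borel \<Longrightarrow> (\<lambda>y. \<rho> y *\<^sub>R g y) \<in> borel_measurable lebesgue"
  by (intro borel_measurable_scaleR \<rho>_measurable borel_measurable_lebesgueI[of g borel]) auto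

lemma \<rho>_integrableI:
  fixes g :: "real^'n \<Rightarrow> 'b::{second_countable_topology, banach}"
  assumes g: "g \<in> borel_measurable borel" and le: "\<And>y. norm (g y) \<le> C * min 1 (t * (norm y)\<^sup>2)" and t: "0 \<le> t" and C: "0 \<le> C"
  shows "integrable lebesgue (\<lambda>y. \<rho> y *\<^sub>R g y)"
    and "norm (LINT y|lebesgue. \<rho> y *\<^sub>R g y) \<le> C * \<alpha> * (LINT y|lborel. kap s t (y :: real^'n))"
proof -
  have int: "integrable lebesgue (\<lambda>y::real^'n. C * (\<alpha> * kap s t y))"
    by (intro integrable_lebesgue integrable_mult_right integrable_kap s t)
  have b: "norm (\<rho> y *\<^sub>R g y) \<le> C * (\<alpha> * kap s t y)" for y
  proof -
    have "norm (\<rho> y *\<^sub>R g y) \<le> \<rho> y * (C * min 1 (t * (norm y)\<^sup>2))"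
      using \<rho>_nonneg[of y] le[of y] by (simp add: mult_left_mono)
    also have "\<dots> = C * (\<rho> y * min 1 (t * (norm y)\<^sup>2))" by simp
    also have "\<dots> \<le> C * (\<alpha> * kap s t y)" by (intro mult_left_mono \<rho>_kap_le t C)
    finally show ?thesis .
  qed
  show i: "integrable lebesgue (\<lambda>y. \<rho> y *\<^sub>R g y)"
    by (rule Bochner_Integration.integrable_bound[OF int \<rho>_times_measurable[OF g]])
      (intro AE_I2 order.trans[OF b], simp)
  have "norm (LINT y|lebesgue. \<rho> y *\<^sub>R g y) \<le> (LINT y|lebesgue. norm (\<rho> y *\<^sub>R g y))" by (rule integral_norm_bound)
  also have "\<dots> \<le> (LINT y::real^'n|lebesgue. C * (\<alpha> * kap s t y))" by (rule Bochner_Integration.integral_mono[OF integrable_norm[OF i] int]) (rule b)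
  also have "\<dots> = (LINT y|lborel. C * (\<alpha> * kap s t (y :: real^'n)))" by (rule integral_completion) measurable
  finally show "norm (LINT y|lebesgue. \<rho> y *\<^sub>R g y) \<le> C * \<alpha> * (LINT y|lborel. kap s t (y :: real^'n))"
    by (simp add: mult.assoc)
qed

text \<open>The matrix by which the operator acts on the Hartley side, an integral of nonnegative
  multiples of the projections onto the lines spanned by y.\<close>

definition symb :: "real^'n \<Rightarrow> real^'n \<Rightarrow> real^'n" where
  "symb xi v = (LINT y|lebesgue. \<rho> y *\<^sub>R (om y xi *\<^sub>R dyad y v))"

definition Csymb :: real where
  "Csymb = 2 * pi\<^sup>2 * \<alpha> * (LINT y|lborel. kap s 1 (y :: real^'n))"

lemma Csymb_nonneg: "0 \<le> Csymb"
  unfolding Csymb_def using \<alpha> by (intro mult_nonneg_nonneg Bochner_Integration.integral_nonneg kap_nonneg) auto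

lemma om_dyad_le: "norm (om y xi *\<^sub>R dyad y v) \<le> (2 * pi\<^sup>2 * norm v) * min 1 ((norm xi)\<^sup>2 * (norm y)\<^sup>2)"
proof -
  have "norm (om y xi *\<^sub>R dyad y v) \<le> (2 * pi\<^sup>2 * min 1 ((norm xi)\<^sup>2 * (norm y)\<^sup>2)) * norm v"
    using om_nonneg[of y xi] by (simp add: mult_mono om_le norm_dyad_le)
  then show ?thesis by (simp only: mult_ac)
qed

lemma om_dyad_measurable: "(\<lambda>y. om y xi *\<^sub>R dyad y v) \<in> borel_measurable borel"
  by measurable

lemma symb_integrable: "integrable lebesgue (\<lambda>y. \<rho> y *\<^sub>R (om y xi *\<^sub>R dyad y v))"
  by (rule \<rho>_integrableI(1)[OF om_dyad_measurable om_dyad_le]) auto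

lemma linear_symb: "linear (symb xi)"
proof (rule linearI)
  show "symb xi (v + w) = symb xi v + symb xi w" for v w
    unfolding symb_def linear_add[OF linear_dyad] scaleR_add_right
    by (rule Bochner_Integration.integral_add[OF symb_integrable symb_integrable])
  show "symb xi (c *\<^sub>R v) = c *\<^sub>R symb xi v" for c v
    unfolding symb_def linear_cmul[OF linear_dyad]
    by (simp only: scaleR_left_commute[of _ c] integral_scaleR_right)
qed

lemma inner_symb: "symb xi v \<bullet> w = (LINT y|lebesgue. \<rho> y * (om y xi * ((y \<bullet> v) * (y \<bullet> w) / (norm y)\<^sup>2)))"
  unfolding symb_def using symb_integrable
  by (subst integral_inner_left[symmetric]) (auto simp: inner_dyad mult_ac)

lemma symb_symmetric: "symb xi v \<bullet> w = v \<bullet> symb xi w"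
  unfolding inner_symb inner_commute[of v] by (simp only: mult.commute[of "_ \<bullet> v"])

lemma symb_nonneg: "0 \<le> symb xi v \<bullet> v"
  unfolding inner_symb by (intro Bochner_Integration.integral_nonneg mult_nonneg_nonneg \<rho>_nonneg om_nonneg) simp

text \<open>The integrand is majorised by \<open>kap\<close> with parameter |xi|^2, whose integral
  scales like |xi| to the power 2 s. The frequency 0 is separate because scaling needs a positive
  parameter.\<close>

lemma symb_le: "norm (symb xi v) \<le> Csymb * wt (2 * s) xi * norm v"
proof (cases "xi = 0")
  case True
  then have "symb xi v = 0" by (simp add: symb_def om_def)
  then show ?thesis using Csymb_nonneg wt_pos[of "2 * s" xi] by (simp add: less_imp_le)
next
  case False
  have "norm (symb xi v) \<le> (2 * pi\<^sup>2 * norm v) * \<alpha> * (LINT y|lborel. kap s ((norm xi)\<^sup>2) (y :: real^'n))"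
    unfolding symb_def by (rule \<rho>_integrableI(2)[OF om_dyad_measurable om_dyad_le]) auto
  also have "\<dots> = Csymb * norm xi powr (2 * s) * norm v"
    using False by (simp add: integral_kap_scale Csymb_def)
  also have "\<dots> \<le> Csymb * wt (2 * s) xi * norm v"
  proof (intro mult_right_mono mult_left_mono Csymb_nonneg)
    have "norm xi powr (2 * s) = ((norm xi)\<^sup>2) powr s"
      using False powr_powr[of "norm xi" 2 s] by (simp add: powr_numeral)
    also have "(norm xi)\<^sup>2 \<le> 1 + 4 * pi\<^sup>2 * (norm xi)\<^sup>2"
    proof -
      from mult_right_mono[OF four_pi_sq, of "(norm xi)\<^sup>2"] show ?thesis by simp
    qed
    then have "((norm xi)\<^sup>2) powr s \<le> (1 + 4 * pi\<^sup>2 * (norm xi)\<^sup>2) powr s" using s by (intro powr_mono2) auto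
    finally show "norm xi powr (2 * s) \<le> wt (2 * s) xi" by (simp add: wt_def)
  qed auto
  finally show ?thesis .
qed

lemma symb_continuous: "continuous_on UNIV (\<lambda>xi. symb xi v)"
proof -
  have "(\<lambda>k. symb (X k) v) \<longlonglongrightarrow> symb xi v" if X: "X \<longlonglongrightarrow> xi" for X :: "nat \<Rightarrow> real^'n" and xi
  proof -
    obtain R where R: "\<And>k. norm (X k) \<le> R" using convergent_imp_Bseq[OF convergentI[OF X]] by (auto simp: Bseq_def)
    show ?thesis unfolding symb_def
    proof (rule integral_dominated_convergence)
      show "integrable lebesgue (\<lambda>y::real^'n. (2 * pi\<^sup>2 * norm v) * (\<alpha> * kap s (R\<^sup>2) y))"
        by (intro integrable_lebesgue integrable_mult_right integrable_kap s) auto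
      show "AE y::real^'n in lebesgue. (\<lambda>k. \<rho> y *\<^sub>R (om y (X k) *\<^sub>R dyad y v)) \<longlonglongrightarrow> \<rho> y *\<^sub>R (om y xi *\<^sub>R dyad y v)"
        unfolding om_def by (intro AE_I2 tendsto_intros X)
      show "AE y in lebesgue. norm (\<rho> y *\<^sub>R (om y (X k) *\<^sub>R dyad y v)) \<le> (2 * pi\<^sup>2 * norm v) * (\<alpha> * kap s (R\<^sup>2) y)" for k
      proof (rule AE_I2)
        fix y :: "real^'n"
        have "(norm (X k))\<^sup>2 * (norm y)\<^sup>2 \<le> R\<^sup>2 * (norm y)\<^sup>2" using R[of k] by (intro mult_right_mono power_mono) auto
        then have "min 1 ((norm (X k))\<^sup>2 * (norm y)\<^sup>2) \<le> min 1 (R\<^sup>2 * (norm y)\<^sup>2)" by linarith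
        then have "norm (om y (X k) *\<^sub>R dyad y v) \<le> (2 * pi\<^sup>2 * norm v) * min 1 (R\<^sup>2 * (norm y)\<^sup>2)"
          by (intro order.trans[OF om_dyad_le] mult_left_mono) auto
        then have "norm (\<rho> y *\<^sub>R (om y (X k) *\<^sub>R dyad y v)) \<le> \<rho> y * ((2 * pi\<^sup>2 * norm v) * min 1 (R\<^sup>2 * (norm y)\<^sup>2))"
          unfolding norm_scaleR[of "\<rho> y"] using \<rho>_nonneg[of y] by (simp only: abs_of_nonneg mult_left_mono)
        also have "\<dots> = (2 * pi\<^sup>2 * norm v) * (\<rho> y * min 1 (R\<^sup>2 * (norm y)\<^sup>2))" by (simp only: mult_ac)
        also have "\<dots> \<le> (2 * pi\<^sup>2 * norm v) * (\<alpha> * kap s (R\<^sup>2) y)" by (intro mult_left_mono \<rho>_kap_le) auto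
        finally show "norm (\<rho> y *\<^sub>R (om y (X k) *\<^sub>R dyad y v)) \<le> (2 * pi\<^sup>2 * norm v) * (\<alpha> * kap s (R\<^sup>2) y)" .
      qed
    qed (rule \<rho>_times_measurable[OF om_dyad_measurable])+
  qed
  then show ?thesis by (simp add: continuous_on_sequentially o_def)
qed

lemma symb_expand: "symb xi v = (\<Sum>j\<in>UNIV. (v $ j) *\<^sub>R symb xi (axis j 1))"
proof -
  have "symb xi v = symb xi (\<Sum>j\<in>UNIV. (v $ j) *\<^sub>R axis j 1)"
    using basis_expansion[of v] by (simp add: scalar_mult_eq_scaleR)
  then show ?thesis by (simp add: linear_sum[OF linear_symb] linear_cmul[OF linear_symb])
qed

lemma symb_borel:
  assumes "u \<in> borel_measurable borel"
  shows "(\<lambda>xi. symb xi (u xi)) \<in> borel_measurable borel"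
proof -
  have "(\<lambda>xi. u xi $ j) \<in> borel_measurable borel" for j
    by (rule measurable_compose[OF assms borel_measurable_continuous_onI[OF linear_continuous_on[OF bounded_linear_vec_nth]]])
  then show ?thesis unfolding symb_expand[of _ "u _"]
    by (intro borel_measurable_sum borel_measurable_scaleR borel_measurable_continuous_onI[OF symb_continuous])
qed

text \<open>The symbol is continuous in the frequency for each fixed vector; expanding the field in
  the standard basis reduces measurability along a variable field to this.\<close>

lemma multiplier_symb: "multiplier symb"
  unfolding multiplier_def
proof (intro conjI allI ballI linear_symb)
  fix u :: "real^'n \<Rightarrow> real^'n" assume u: "u \<in> borel_measurable lebesgue"
  have c: "(\<lambda>xi. symb xi w) \<in> borel_measurable lebesgue" for w
    by (rule borel_measurable_lebesgueI[OF borel_measurable_continuous_onI[OF symb_continuous]]) simp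
  have "(\<lambda>xi. \<Sum>j\<in>UNIV. (u xi $ j) *\<^sub>R symb xi (axis j 1)) \<in> borel_measurable lebesgue"
    by (intro borel_measurable_sum borel_measurable_scaleR c measurable_compose[OF u] borel_measurable_continuous_onI linear_continuous_on bounded_linear_vec_nth)
  then show "(\<lambda>xi. symb xi (u xi)) \<in> borel_measurable lebesgue" by (simp only: symb_expand[symmetric])
qed

section \<open>The operator on Schwartz fields and its extension by continuity\<close>

section \<open>The operator on Schwartz fields\<close>

text \<open>Hartley inversion together with 2 cas a - cas(a + b) - cas(a - b) = 2 (1 - cos b) cas
  a.\<close>

lemma second_difference:
  assumes u: "schwartz_field u"
  shows "2 *\<^sub>R u x - u (x + y) - u (x - y) = (LINT xi|lborel. (2 * om y xi * cas (2 * pi * (xi \<bullet> x))) *\<^sub>R hfield u xi)"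
proof -
  have hu: "u z = (LINT xi|lborel. cas (2 * pi * (xi \<bullet> z)) *\<^sub>R hfield u xi)" for z
    using hfield_hfield[OF u] unfolding hfield_def[of "hfield u"] by (metis (no_types))
  have i: "integrable lborel (\<lambda>xi. cas (2 * pi * (xi \<bullet> z)) *\<^sub>R hfield u xi)" for z
    by (intro integrable_cas_scaleR schwartz_field_integrable schwartz_field_hfield u) measurable
  have "2 *\<^sub>R u x - u (x + y) - u (x - y) = (LINT xi|lborel. 2 *\<^sub>R (cas (2 * pi * (xi \<bullet> x)) *\<^sub>R hfield u xi)
     - cas (2 * pi * (xi \<bullet> (x + y))) *\<^sub>R hfield u xi - cas (2 * pi * (xi \<bullet> (x - y))) *\<^sub>R hfield u xi)"
    unfolding hu[of x] hu[of "x + y"] hu[of "x - y"]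
    by (simp only: i Bochner_Integration.integral_diff Bochner_Integration.integrable_diff integral_scaleR_right integrable_scaleR_right)
  also have "\<dots> = (LINT xi|lborel. (2 * om y xi * cas (2 * pi * (xi \<bullet> x))) *\<^sub>R hfield u xi)"
  proof (rule Bochner_Integration.integral_cong[OF refl])
    fix xi
    define a where "a = 2 * pi * (xi \<bullet> x)"
    define b where "b = 2 * pi * (y \<bullet> xi)"
    have ab: "2 * pi * (xi \<bullet> (x + y)) = a + b" "2 * pi * (xi \<bullet> (x - y)) = a - b"
      unfolding a_def b_def by (simp_all add: inner_add_right inner_diff_right inner_commute distrib_left right_diff_distrib)
    have "2 * cas a - cas (a + b) - cas (a - b) = 2 * om y xi * cas a"
      unfolding cas_def om_def b_def[symmetric] by (simp add: cos_add cos_diff sin_add sin_diff algebra_simps)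
    then show "2 *\<^sub>R (cas (2 * pi * (xi \<bullet> x)) *\<^sub>R hfield u xi) - cas (2 * pi * (xi \<bullet> (x + y))) *\<^sub>R hfield u xi - cas (2 * pi * (xi \<bullet> (x - y))) *\<^sub>R hfield u xi
      = (2 * om y xi * cas (2 * pi * (xi \<bullet> x))) *\<^sub>R hfield u xi"
      unfolding ab a_def[symmetric] by (simp flip: scaleR_diff_left)
  qed
  finally show ?thesis .
qed

lemma integrable_moment:
  assumes u: "schwartz_field (u :: 'n field)"
  shows "integrable lborel (\<lambda>xi. (1 + (norm xi)\<^sup>2) * norm (u xi))"
proof (rule Bochner_Integration.integrable_bound)
  note [measurable] = schwartz_field_measurable[OF u]
  have "schwartz_field (\<lambda>xi. ((1 + 4 * pi\<^sup>2 * (norm xi)\<^sup>2) powr 1) *\<^sub>R u xi)" by (rule schwartz_field_weight[OF u])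
  from integrable_norm[OF schwartz_field_integrable[OF this]]
  show "integrable lborel (\<lambda>xi. norm (((1 + 4 * pi\<^sup>2 * (norm xi)\<^sup>2) powr 1) *\<^sub>R u xi))" .
  show "(\<lambda>xi. (1 + (norm xi)\<^sup>2) * norm (u xi)) \<in> borel_measurable lborel" by measurable
  show "AE xi in lborel. norm ((1 + (norm xi)\<^sup>2) * norm (u xi)) \<le> norm (norm (((1 + 4 * pi\<^sup>2 * (norm xi)\<^sup>2) powr 1) *\<^sub>R u xi))"
  proof (rule AE_I2)
    fix xi :: "real^'n"
    from mult_right_mono[OF four_pi_sq, of "(norm xi)\<^sup>2"] have "1 + (norm xi)\<^sup>2 \<le> 1 + 4 * pi\<^sup>2 * (norm xi)\<^sup>2" by simp
    from mult_right_mono[OF this norm_ge_zero[of "u xi"]]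
    show "norm ((1 + (norm xi)\<^sup>2) * norm (u xi)) \<le> norm (norm (((1 + 4 * pi\<^sup>2 * (norm xi)\<^sup>2) powr 1) *\<^sub>R u xi))"
      using weight_pos[of xi] by (simp add: add_nonneg_nonneg)
  qed
qed

lemma second_difference_bound:
  assumes u: "schwartz_field (u :: 'n field)"
  shows "\<exists>C\<ge>0. \<forall>x y. norm (2 *\<^sub>R u x - u (x + y) - u (x - y)) \<le> C * min 1 (1 * (norm y)\<^sup>2)"
proof -
  define h where "h = hfield u"
  have h: "schwartz_field h" unfolding h_def by (rule schwartz_field_hfield[OF u])
  note [measurable] = schwartz_field_measurable[OF h]
  define C where "C = 8 * pi\<^sup>2 * (LINT xi|lborel. (1 + (norm xi)\<^sup>2) * norm (h xi))"
  have "norm (2 *\<^sub>R u x - u (x + y) - u (x - y)) \<le> C * min 1 (1 * (norm y)\<^sup>2)" for x y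
  proof -
    have "norm (2 *\<^sub>R u x - u (x + y) - u (x - y)) \<le> (LINT xi|lborel. norm ((2 * om y xi * cas (2 * pi * (xi \<bullet> x))) *\<^sub>R h xi))"
      unfolding second_difference[OF u] h_def[symmetric] by (rule integral_norm_bound)
    also have "\<dots> \<le> (LINT xi|lborel. (8 * pi\<^sup>2 * min 1 ((norm y)\<^sup>2)) * ((1 + (norm xi)\<^sup>2) * norm (h xi)))"
    proof (rule integral_mono')
      show "integrable lborel (\<lambda>xi. (8 * pi\<^sup>2 * min 1 ((norm y)\<^sup>2)) * ((1 + (norm xi)\<^sup>2) * norm (h xi)))"
        by (rule integrable_mult_right[OF integrable_moment[OF h]])
      fix xi
      have "norm ((2 * om y xi * cas (2 * pi * (xi \<bullet> x))) *\<^sub>R h xi) = 2 * om y xi * \<bar>cas (2 * pi * (xi \<bullet> x))\<bar> * norm (h xi)"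
        using om_nonneg[of y xi] by (simp add: abs_mult)
      also have "\<dots> \<le> 2 * (2 * pi\<^sup>2 * (1 + (norm xi)\<^sup>2) * min 1 ((norm y)\<^sup>2)) * 2 * norm (h xi)"
        using om_nonneg[of y xi] abs_cas_le by (intro mult_right_mono mult_mono om_le' mult_left_mono) (auto intro!: mult_nonneg_nonneg)
      finally show "norm ((2 * om y xi * cas (2 * pi * (xi \<bullet> x))) *\<^sub>R h xi) \<le> (8 * pi\<^sup>2 * min 1 ((norm y)\<^sup>2)) * ((1 + (norm xi)\<^sup>2) * norm (h xi))"
        by (simp add: mult_ac)
    qed (auto intro!: mult_nonneg_nonneg add_nonneg_nonneg)
    also have "\<dots> = C * min 1 (1 * (norm y)\<^sup>2)" unfolding C_def by (subst integral_mult_right_zero) simp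
    finally show ?thesis .
  qed
  moreover have "0 \<le> C" unfolding C_def by (intro mult_nonneg_nonneg Bochner_Integration.integral_nonneg) (auto intro!: add_nonneg_nonneg)
  ultimately show ?thesis by blast
qed

text \<open>The strain term is odd, hence it disappears from the truncated integrals after symmetrisation.\<close>

lemma truncated_integral:
  assumes u: "schwartz_field u" and \<delta>: "0 < \<delta>"
  shows "(LINT y:{y. \<delta> < norm y}|lebesgue. \<rho> y *\<^sub>R
       ((y \<bullet> (u (x + y) - u x - cutoff s y *\<^sub>R (strain u x *v y)) / (norm y)\<^sup>2) *\<^sub>R y))
    = - (1/2) *\<^sub>R (LINT y|lebesgue. \<rho> y *\<^sub>R (indicator {y. \<delta> < norm y} y *\<^sub>R dyad y (2 *\<^sub>R u x - u (x + y) - u (x - y))))"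
proof -
  define E where "E = strain u x"
  define D where "D y = indicator {y. \<delta> < norm y} y *\<^sub>R dyad y (u (x + y) - u x - cutoff s y *\<^sub>R (E *v y))" for y
  note [measurable] = schwartz_field_measurable[OF u]
  have "(cutoff s :: real^'n \<Rightarrow> real) = (if s < 1/2 then (\<lambda>_. 0) else if s = 1/2 then indicator (ball 0 1) else (\<lambda>_. 1))"
    by (auto simp: cutoff_def fun_eq_iff)
  then have cm[measurable]: "(cutoff s :: real^'n \<Rightarrow> real) \<in> borel_measurable borel" by (simp add: borel_measurable_indicator)
  have [measurable]: "(\<lambda>y. E *v y) \<in> borel_measurable borel"
    by (rule borel_measurable_continuous_onI[OF linear_continuous_on[OF matrix_vector_mul_bounded_linear]])
  have Dm[measurable]: "D \<in> borel_measurable borel" unfolding D_def[abs_def] by measurable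
  obtain B where B: "B \<ge> 0" "\<And>z. norm (u z) \<le> B"
  proof -
    obtain C where C: "C \<ge> 0" "\<forall>x. norm (u x) \<le> C * dec x" using schwartz_field_le_dec[OF u] by blast
    have "norm (u z) \<le> C" for z using C mult_left_mono[OF dec_le_1[of z] C(1)] by (smt (verit) mult.right_neutral)
    then show ?thesis using that C(1) by blast
  qed
  obtain L where L: "L \<ge> 0" "\<And>y. norm (E *v y) \<le> L * norm y"
    using bounded_linear.nonneg_bounded[OF matrix_vector_mul_bounded_linear[of E]] by (auto simp: mult.commute)
  \<comment> \<open>The growth exponent of the strain term: linear for s > 1/2, while otherwise the
    cutoff is 0 or supported in the unit ball. In both cases the kernel of order
    \<open>s - p / 2\<close> is still integrable at infinity. The constant \<open>m\<close> bounds
    the truncated quadratic factor of \<open>kap\<close> from below outside the radius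
    \<open>\<delta>\<close>, so that this factor can be inserted.\<close>
  define p where "p = (if s \<le> 1/2 then 0 else 1 :: real)"
  define m where "m = min 1 (\<delta>\<^sup>2)"
  define M where "M = 2 * B / \<delta> powr p + L"
  have m: "0 < m" and M: "0 \<le> M" using \<delta> B(1) L(1) by (simp_all add: m_def M_def)
  have p: "0 < s - p / 2" "s - p / 2 < 1" "0 \<le> p" using s by (auto simp: p_def)
  have intD: "integrable lebesgue (\<lambda>y. \<rho> y *\<^sub>R D y)"
  proof (rule Bochner_Integration.integrable_bound)
    show "integrable lebesgue (\<lambda>y::real^'n. (\<alpha> * (M / m)) * kap (s - p / 2) 1 y)"
      by (intro integrable_lebesgue integrable_mult_right integrable_kap p) simp
    show "(\<lambda>y. \<rho> y *\<^sub>R D y) \<in> borel_measurable lebesgue" by (rule \<rho>_times_measurable[OF Dm])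
    show "AE y in lebesgue. norm (\<rho> y *\<^sub>R D y) \<le> norm ((\<alpha> * (M / m)) * kap (s - p / 2) 1 y)"
    proof (rule AE_I2)
      fix y :: "real^'n"
      show "norm (\<rho> y *\<^sub>R D y) \<le> norm ((\<alpha> * (M / m)) * kap (s - p / 2) 1 y)"
      proof (cases "\<delta> < norm y")
        case True
        then have y: "0 < norm y" using \<delta> by linarith
        have "norm (D y) \<le> norm (u (x + y) - u x - cutoff s y *\<^sub>R (E *v y))"
          unfolding D_def using True norm_dyad_le by simp
        also have "\<dots> \<le> norm (u (x + y)) + norm (u x) + norm (cutoff s y *\<^sub>R (E *v y))"
          using norm_triangle_ineq4[of "u (x + y) - u x"] norm_triangle_ineq4[of "u (x + y)" "u x"] by (meson add_mono order.refl order.trans)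
        also have "norm (cutoff s y *\<^sub>R (E *v y)) \<le> cutoff s y * (L * norm y)"
          using L(2)[of y] by (simp add: cutoff_def indicator_def)
        also have "\<dots> \<le> L * norm y powr p"
          using y L(1) by (auto simp: cutoff_def indicator_def p_def mult_left_le)
        finally have "norm (D y) \<le> 2 * B * 1 + L * norm y powr p" using B(2)[of "x + y"] B(2)[of x] by linarith
        also have "2 * B * 1 \<le> 2 * B * (norm y powr p / \<delta> powr p)"
          using True \<delta> B(1) p powr_mono2[of p \<delta> "norm y"] by (intro mult_left_mono) (auto simp: pos_le_divide_eq)
        finally have "norm (D y) \<le> M * norm y powr p" by (simp add: M_def algebra_simps)
        also have "\<dots> = M / m * (norm y powr p * m)" using m by simp
        also have "\<dots> \<le> M / m * (norm y powr p * min 1 ((norm y)\<^sup>2))"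
          using True \<delta> m M by (intro mult_left_mono) (auto simp: m_def min.coboundedI2 power_mono)
        finally have "norm (D y) \<le> M / m * (norm y powr p * min 1 ((norm y)\<^sup>2))" .
        from mult_mono[OF \<rho>_le[of y] this mult_nonneg_nonneg[OF \<alpha> powr_ge_zero] norm_ge_zero]
        have "norm (\<rho> y *\<^sub>R D y) \<le> (\<alpha> * norm y powr (- (real CARD('n) + 2 * s))) * (M / m * (norm y powr p * min 1 ((norm y)\<^sup>2)))"
          by (simp only: norm_scaleR abs_of_nonneg[OF \<rho>_nonneg])
        also have "\<dots> = (\<alpha> * (M / m)) * ((norm y powr (- (real CARD('n) + 2 * s)) * norm y powr p) * min 1 ((norm y)\<^sup>2))" by simp
        also have "\<dots> = (\<alpha> * (M / m)) * kap (s - p / 2) 1 y"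
          unfolding kap_def powr_add[symmetric] by (simp add: algebra_simps)
        finally show ?thesis unfolding real_norm_def by (rule order.trans[OF _ abs_ge_self])
      qed (simp add: D_def)
    qed
  qed
  have r: "(LINT y|lebesgue. \<rho> (- y) *\<^sub>R D (- y)) = (LINT y|lebesgue. \<rho> y *\<^sub>R D y)"
    and ri: "integrable lebesgue (\<lambda>y. \<rho> (- y) *\<^sub>R D (- y))"
    using integral_distr[OF uminus_measurable_lebesgue borel_measurable_integrable[OF intD]]
      integrable_distr_eq[OF uminus_measurable_lebesgue borel_measurable_integrable[OF intD]] intD
      lebesgue_reflect[where 'n='n] by simp_all
  have "2 *\<^sub>R (LINT y|lebesgue. \<rho> y *\<^sub>R D y) = (LINT y|lebesgue. \<rho> y *\<^sub>R D y + \<rho> (- y) *\<^sub>R D (- y))"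
    unfolding Bochner_Integration.integral_add[OF intD ri] r by (simp add: scaleR_2)
  also have "\<dots> = (LINT y|lebesgue. - (\<rho> y *\<^sub>R (indicator {y. \<delta> < norm y} y *\<^sub>R dyad y (2 *\<^sub>R u x - u (x + y) - u (x - y)))))"
  proof (rule Bochner_Integration.integral_cong[OF refl])
    fix y :: "real^'n"
    have cm: "cutoff s (- y) = cutoff s y" by (simp add: cutoff_def indicator_def)
    have Em: "E *v (- y) = - (E *v y)" using matrix_vector_mult_diff_distrib[of E 0 y] by simp
    have "D y + D (- y) = indicator {y. \<delta> < norm y} y *\<^sub>R (dyad y (u (x + y) - u x - cutoff s y *\<^sub>R (E *v y)) + dyad y (u (x - y) - u x + cutoff s y *\<^sub>R (E *v y)))"
      unfolding D_def dyad_minus cm Em by (simp add: scaleR_add_right indicator_def)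
    also have "\<dots> = - (indicator {y. \<delta> < norm y} y *\<^sub>R dyad y (2 *\<^sub>R u x - u (x + y) - u (x - y)))"
      unfolding linear_add[OF linear_dyad, symmetric] scaleR_minus_right[symmetric] linear_neg[OF linear_dyad, symmetric]
      by (rule arg_cong[where f="\<lambda>v. indicator {y. \<delta> < norm y} y *\<^sub>R dyad y v"]) (simp add: scaleR_2)
    finally show "\<rho> y *\<^sub>R D y + \<rho> (- y) *\<^sub>R D (- y) = - (\<rho> y *\<^sub>R (indicator {y. \<delta> < norm y} y *\<^sub>R dyad y (2 *\<^sub>R u x - u (x + y) - u (x - y))))"
      unfolding \<rho>_even scaleR_add_right[symmetric] by simp
  qed
  finally have 2: "2 *\<^sub>R (LINT y|lebesgue. \<rho> y *\<^sub>R D y) = - (LINT y|lebesgue. \<rho> y *\<^sub>R (indicator {y. \<delta> < norm y} y *\<^sub>R dyad y (2 *\<^sub>R u x - u (x + y) - u (x - y))))"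
    by simp
  have "(LINT y:{y. \<delta> < norm y}|lebesgue. \<rho> y *\<^sub>R
       ((y \<bullet> (u (x + y) - u x - cutoff s y *\<^sub>R (strain u x *v y)) / (norm y)\<^sup>2) *\<^sub>R y)) = (LINT y|lebesgue. \<rho> y *\<^sub>R D y)"
    unfolding set_lebesgue_integral_def D_def dyad_def E_def by (simp only: scaleR_left_commute[of "indicator _ _"])
  also have "\<dots> = (1/2) *\<^sub>R (2 *\<^sub>R (LINT y|lebesgue. \<rho> y *\<^sub>R D y))" by simp
  finally show ?thesis unfolding 2 by simp
qed

text \<open>After symmetrisation the integrand is absolutely integrable by
  \<open>second_difference_bound\<close>, so the principal value is an ordinary limit by dominated
  convergence.\<close>

lemma nonlocal_op_schwartz_integral:
  assumes u: "schwartz_field u"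
  shows "nonlocal_op \<rho> s u x = (1/2) *\<^sub>R (LINT y|lebesgue. \<rho> y *\<^sub>R dyad y (2 *\<^sub>R u x - u (x + y) - u (x - y)))"
proof -
  define D where "D y = dyad y (2 *\<^sub>R u x - u (x + y) - u (x - y))" for y
  note [measurable] = schwartz_field_measurable[OF u]
  have Dm: "D \<in> borel_measurable borel" unfolding D_def[abs_def] by measurable
  obtain C where C: "C \<ge> 0" "\<And>x y. norm (2 *\<^sub>R u x - u (x + y) - u (x - y)) \<le> C * min 1 (1 * (norm y)\<^sup>2)"
    using second_difference_bound[OF u] by blast
  have Dle: "norm (D y) \<le> C * min 1 (1 * (norm y)\<^sup>2)" for y
    unfolding D_def by (rule order.trans[OF norm_dyad_le C(2)])
  have intD: "integrable lebesgue (\<lambda>y. \<rho> y *\<^sub>R D y)" by (rule \<rho>_integrableI(1)[OF Dm Dle]) (use C in auto)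
  have lim: "((\<lambda>\<delta>. LINT y|lebesgue. \<rho> y *\<^sub>R (indicator {y. \<delta> < norm y} y *\<^sub>R D y)) \<longlongrightarrow> (LINT y|lebesgue. \<rho> y *\<^sub>R D y)) (at_right 0)"
    unfolding tendsto_at_iff_sequentially o_def
  proof (intro allI impI)
    fix X :: "nat \<Rightarrow> real" assume X: "\<forall>i. X i \<in> {0<..} - {0}" "X \<longlonglongrightarrow> 0"
    show "(\<lambda>k. LINT y|lebesgue. \<rho> y *\<^sub>R (indicator {y. X k < norm y} y *\<^sub>R D y)) \<longlonglongrightarrow> (LINT y|lebesgue. \<rho> y *\<^sub>R D y)"
    proof (rule integral_dominated_convergence)
      show "integrable lebesgue (\<lambda>y. norm (\<rho> y *\<^sub>R D y))" by (rule integrable_norm[OF intD])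
      show "(\<lambda>y. \<rho> y *\<^sub>R D y) \<in> borel_measurable lebesgue" by (rule \<rho>_times_measurable[OF Dm])
      show "(\<lambda>y. \<rho> y *\<^sub>R (indicator {y. X k < norm y} y *\<^sub>R D y)) \<in> borel_measurable lebesgue" for k
        by (rule \<rho>_times_measurable) (use Dm in measurable)
      show "AE y in lebesgue. norm (\<rho> y *\<^sub>R (indicator {y. X k < norm y} y *\<^sub>R D y)) \<le> norm (\<rho> y *\<^sub>R D y)" for k
        by (intro AE_I2) (simp add: indicator_def)
      show "AE y in lebesgue. (\<lambda>k. \<rho> y *\<^sub>R (indicator {y. X k < norm y} y *\<^sub>R D y)) \<longlonglongrightarrow> \<rho> y *\<^sub>R D y"
      proof (rule AE_I2)
        fix y
        show "(\<lambda>k. \<rho> y *\<^sub>R (indicator {y. X k < norm y} y *\<^sub>R D y)) \<longlonglongrightarrow> \<rho> y *\<^sub>R D y"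
        proof (cases "y = 0")
          case True
          then show ?thesis by (simp add: D_def dyad_def)
        next
          case False
          then have "\<forall>\<^sub>F k in sequentially. X k < norm y" by (intro order_tendstoD(2)[OF X(2)]) simp
          then have "\<forall>\<^sub>F k in sequentially. \<rho> y *\<^sub>R (indicator {y. X k < norm y} y *\<^sub>R D y) = \<rho> y *\<^sub>R D y"
            by eventually_elim simp
          then show ?thesis by (rule tendsto_eventually)
        qed
      qed
    qed
  qed
  have "((\<lambda>\<delta>. LINT y:{y. \<delta> < norm y}|lebesgue. \<rho> y *\<^sub>R
       ((y \<bullet> (u (x + y) - u x - cutoff s y *\<^sub>R (strain u x *v y)) / (norm y)\<^sup>2) *\<^sub>R y)) \<longlongrightarrow> - (1/2) *\<^sub>R (LINT y|lebesgue. \<rho> y *\<^sub>R D y)) (at_right 0)"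
  proof (rule Lim_transform_eventually)
    show "((\<lambda>\<delta>. - (1/2) *\<^sub>R (LINT y|lebesgue. \<rho> y *\<^sub>R (indicator {y. \<delta> < norm y} y *\<^sub>R D y))) \<longlongrightarrow> - (1/2) *\<^sub>R (LINT y|lebesgue. \<rho> y *\<^sub>R D y)) (at_right 0)"
      by (intro tendsto_scaleR tendsto_const lim)
    show "\<forall>\<^sub>F \<delta> in at_right 0. - (1/2) *\<^sub>R (LINT y|lebesgue. \<rho> y *\<^sub>R (indicator {y. \<delta> < norm y} y *\<^sub>R D y)) =
      (LINT y:{y. \<delta> < norm y}|lebesgue. \<rho> y *\<^sub>R ((y \<bullet> (u (x + y) - u x - cutoff s y *\<^sub>R (strain u x *v y)) / (norm y)\<^sup>2) *\<^sub>R y))"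
      unfolding D_def using eventually_at_right_less[of 0] by eventually_elim (rule truncated_integral[OF u, symmetric])
  qed
  from tendsto_Lim[OF trivial_limit_at_right_real this] show ?thesis unfolding nonlocal_op_def D_def by simp
qed

text \<open>Insert the frequency representation of the second difference and exchange the integrals
  over y and xi; the integral over y then is the symbol. The exchange is justified by a product
  majorant: \<open>kap s 1\<close> in y times a second moment of the transform in xi.\<close>

theorem nonlocal_op_schwartz:
  assumes u: "schwartz_field u"
  shows "nonlocal_op \<rho> s u x = hfield (\<lambda>xi. symb xi (hfield u xi)) x"
proof -
  define h where "h = hfield u"
  have h: "schwartz_field h" unfolding h_def by (rule schwartz_field_hfield[OF u])
  note [measurable] = schwartz_field_measurable[OF h]
  define c where "c xi = cas (2 * pi * (xi \<bullet> x))" for xi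
  have [measurable]: "c \<in> borel_measurable borel" unfolding c_def[abs_def] by measurable
  have cle: "\<bar>c xi\<bar> \<le> 2" for xi unfolding c_def by (rule abs_cas_le)
  interpret L: sigma_finite_measure "lebesgue :: (real^'n) measure" by (rule sigma_finite_lebesgue)
  interpret P: pair_sigma_finite "lebesgue :: (real^'n) measure" "lborel :: (real^'n) measure" ..
  define \<Phi> where "\<Phi> = (\<lambda>(y, xi). \<rho> y *\<^sub>R ((om y xi * c xi) *\<^sub>R dyad y (h xi)))"
  have fm: "fst \<in> lebesgue \<Otimes>\<^sub>M lborel \<rightarrow>\<^sub>M (borel :: (real^'n) measure)"
    by (rule measurable_compose[OF measurable_fst measurable_ident_lebesgue])
  have rm: "(\<lambda>p. \<rho> (fst p)) \<in> borel_measurable (lebesgue \<Otimes>\<^sub>M (lborel :: (real^'n) measure))"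
    by (rule measurable_compose[OF measurable_fst \<rho>_measurable])
  have \<Phi>m: "\<Phi> \<in> borel_measurable (lebesgue \<Otimes>\<^sub>M lborel)"
  proof -
    note [measurable] = fm
    have "(\<lambda>p. (om (fst p) (snd p) * c (snd p)) *\<^sub>R dyad (fst p) (h (snd p))) \<in> borel_measurable (lebesgue \<Otimes>\<^sub>M lborel)"
      by measurable
    from borel_measurable_scaleR[OF rm this] show ?thesis unfolding \<Phi>_def by (simp add: case_prod_beta')
  qed
  define G where "G xi = (1 + (norm xi)\<^sup>2) * norm (h xi)" for xi
  have G: "integrable lborel G" unfolding G_def[abs_def] by (rule integrable_moment[OF h])
  have ik: "integrable lebesgue (\<lambda>y::real^'n. \<alpha> * kap s 1 y)"
    by (intro integrable_lebesgue integrable_mult_right integrable_kap s) simp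
  have \<Phi>le: "norm (\<Phi> (y, xi)) \<le> (4 * pi\<^sup>2 * (\<alpha> * kap s 1 y)) * G xi" for y xi
  proof -
    have "norm (\<Phi> (y, xi)) = \<rho> y * (om y xi * \<bar>c xi\<bar> * norm (dyad y (h xi)))"
      using \<rho>_nonneg[of y] om_nonneg[of y xi] by (simp add: \<Phi>_def abs_mult)
    also have "\<dots> \<le> \<rho> y * ((2 * pi\<^sup>2 * (1 + (norm xi)\<^sup>2) * min 1 ((norm y)\<^sup>2)) * 2 * norm (h xi))"
      using om_nonneg[of y xi] by (intro mult_left_mono mult_mono om_le' cle norm_dyad_le \<rho>_nonneg) (auto intro!: mult_nonneg_nonneg)
    also have "\<dots> = 4 * pi\<^sup>2 * (\<rho> y * min 1 (1 * (norm y)\<^sup>2)) * G xi" by (simp add: G_def mult_ac)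
    also have "\<dots> \<le> (4 * pi\<^sup>2 * (\<alpha> * kap s 1 y)) * G xi"
      unfolding G_def by (intro mult_right_mono mult_left_mono \<rho>_kap_le) (auto intro!: mult_nonneg_nonneg add_nonneg_nonneg)
    finally show ?thesis .
  qed
  have int: "integrable (lebesgue \<Otimes>\<^sub>M lborel) \<Phi>"
  proof (rule Bochner_Integration.integrable_bound)
    show "integrable ((lebesgue :: (real^'n) measure) \<Otimes>\<^sub>M (lborel :: (real^'n) measure)) (\<lambda>(y, xi). (4 * pi\<^sup>2 * (\<alpha> * kap s 1 y)) * G xi)"
    proof (rule P.Fubini_integrable)
      have "(\<lambda>p. 4 * pi\<^sup>2 * (\<alpha> * kap s 1 (fst p))) \<in> borel_measurable ((lebesgue :: (real^'n) measure) \<Otimes>\<^sub>M (lborel :: (real^'n) measure))"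
        by (intro borel_measurable_times borel_measurable_const measurable_compose[OF fm kap_measurable])
      moreover have "(\<lambda>p. G (snd p)) \<in> borel_measurable ((lebesgue :: (real^'n) measure) \<Otimes>\<^sub>M lborel)"
        using borel_measurable_integrable[OF G] by measurable
      ultimately show "(\<lambda>(y :: real^'n, xi). (4 * pi\<^sup>2 * (\<alpha> * kap s 1 y)) * G xi) \<in> borel_measurable (lebesgue \<Otimes>\<^sub>M lborel)"
        unfolding case_prod_beta' by (rule borel_measurable_times)
      have "(\<lambda>y. LINT xi|lborel. norm (case (y, xi) of (y, xi) \<Rightarrow> (4 * pi\<^sup>2 * (\<alpha> * kap s 1 y)) * G xi))
        = (\<lambda>y. (4 * pi\<^sup>2 * (LINT xi|lborel. norm (G xi))) * (\<alpha> * kap s 1 (y::real^'n)))"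
        using \<alpha> by (simp add: abs_mult mult_ac fun_eq_iff kap_nonneg)
      then show "integrable lebesgue (\<lambda>y::real^'n. LINT xi|lborel. norm (case (y, xi) of (y, xi) \<Rightarrow> (4 * pi\<^sup>2 * (\<alpha> * kap s 1 y)) * G xi))"
        using integrable_mult_right[OF ik] by simp
      show "AE y in lebesgue. integrable lborel (\<lambda>xi. case (y, xi) of (y, xi) \<Rightarrow> (4 * pi\<^sup>2 * (\<alpha> * kap s 1 (y::real^'n))) * G xi)"
        by (intro AE_I2) (simp add: integrable_mult_right G)
    qed
    show "AE p in lebesgue \<Otimes>\<^sub>M lborel. norm (\<Phi> p) \<le> norm (case p of (y, xi) \<Rightarrow> (4 * pi\<^sup>2 * (\<alpha> * kap s 1 y)) * G xi)"
      using \<Phi>le by (intro AE_I2) (auto intro: order.trans[OF _ abs_ge_self])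
  qed (rule \<Phi>m)
  have "nonlocal_op \<rho> s u x = (1/2) *\<^sub>R (LINT y|lebesgue. \<rho> y *\<^sub>R dyad y (2 *\<^sub>R u x - u (x + y) - u (x - y)))"
    by (rule nonlocal_op_schwartz_integral[OF u])
  also have "\<dots> = (1/2) *\<^sub>R (LINT y|lebesgue. 2 *\<^sub>R (LINT xi|lborel. \<Phi> (y, xi)))"
  proof (intro arg_cong[where f="\<lambda>z. (1/2) *\<^sub>R z"] Bochner_Integration.integral_cong refl)
    fix y
    have i: "integrable lborel (\<lambda>xi. (2 * om y xi * c xi) *\<^sub>R h xi)"
    proof (rule Bochner_Integration.integrable_bound)
      show "integrable lborel (\<lambda>xi. 8 * norm (h xi))" by (intro integrable_mult_right integrable_norm schwartz_field_integrable h)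
      show "AE xi in lborel. norm ((2 * om y xi * c xi) *\<^sub>R h xi) \<le> norm (8 * norm (h xi))"
      proof (rule AE_I2)
        fix xi
        have "om y xi \<le> 2" unfolding om_def using cos_ge_minus_one[of "2 * pi * (y \<bullet> xi)"] by linarith
        then have "2 * om y xi * \<bar>c xi\<bar> \<le> 2 * 2 * 2" using cle om_nonneg by (intro mult_mono) auto
        from mult_right_mono[OF this norm_ge_zero[of "h xi"]]
        show "norm ((2 * om y xi * c xi) *\<^sub>R h xi) \<le> norm (8 * norm (h xi))" using om_nonneg[of y xi] by (simp add: abs_mult)
      qed
    qed measurable
    have bl: "bounded_linear (\<lambda>v. \<rho> y *\<^sub>R dyad y v)"
      by (intro bounded_linear_compose[OF bounded_linear_scaleR_right] linear_conv_bounded_linear[THEN iffD1] linear_dyad)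
    have "\<rho> y *\<^sub>R dyad y (2 *\<^sub>R u x - u (x + y) - u (x - y)) = \<rho> y *\<^sub>R dyad y (LINT xi|lborel. (2 * om y xi * c xi) *\<^sub>R h xi)"
      unfolding second_difference[OF u] c_def h_def ..
    also have "\<dots> = (LINT xi|lborel. \<rho> y *\<^sub>R dyad y ((2 * om y xi * c xi) *\<^sub>R h xi))"
      by (rule integral_bounded_linear[OF bl i, symmetric])
    also have "\<dots> = (LINT xi|lborel. 2 *\<^sub>R \<Phi> (y, xi))"
      by (intro Bochner_Integration.integral_cong refl) (simp add: \<Phi>_def linear_cmul[OF linear_dyad] mult_ac)
    finally show "\<rho> y *\<^sub>R dyad y (2 *\<^sub>R u x - u (x + y) - u (x - y)) = 2 *\<^sub>R (LINT xi|lborel. \<Phi> (y, xi))" by simp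
  qed
  also have "\<dots> = (LINT y|lebesgue. LINT xi|lborel. \<Phi> (y, xi))" by simp
  also have "\<dots> = (LINT xi|lborel. LINT y|lebesgue. \<Phi> (y, xi))"
    using P.Fubini_integral[of "\<lambda>y xi. \<Phi> (y, xi)"] int by (simp add: case_prod_eta)
  also have "\<dots> = (LINT xi|lborel. c xi *\<^sub>R symb xi (h xi))"
  proof (intro Bochner_Integration.integral_cong refl)
    fix xi
    have "(\<lambda>y. \<Phi> (y, xi)) = (\<lambda>y. c xi *\<^sub>R (\<rho> y *\<^sub>R (om y xi *\<^sub>R dyad y (h xi))))"
      by (simp add: \<Phi>_def fun_eq_iff mult_ac)
    then show "(LINT y|lebesgue. \<Phi> (y, xi)) = c xi *\<^sub>R symb xi (h xi)"
      unfolding symb_def by (simp only: integral_scaleR_right)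
  qed
  finally show ?thesis unfolding hfield_def[of "\<lambda>xi. symb xi (hfield u xi)"] c_def h_def .
qed

end

lemma schwartz_field_wt: "schwartz_field u \<Longrightarrow> schwartz_field (\<lambda>xi. wt \<sigma> xi *\<^sub>R u xi)"
  unfolding wt_def by (rule schwartz_field_weight)

lemma wmul_schwartz:
  fixes h :: "'n::finite field"
  assumes "schwartz_field h"
  shows "cls h \<in> mdom (wmul \<sigma>)" "mop (wmul \<sigma>) (cls h) = cls (\<lambda>xi. wt \<sigma> xi *\<^sub>R h xi)"
  using mdomI[OF multiplier_wmul schwartz_field_L2[OF assms], of \<sigma>] schwartz_field_L2[OF schwartz_field_wt[OF assms, of \<sigma>]]
  unfolding wmul_def by auto

lemma sobolev_norm_diff:
  fixes u v :: "'n::finite field"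
  assumes "0 \<le> \<sigma>" and u: "u \<in> L2" "hat u \<in> mdom (wmul \<sigma>)" and v: "v \<in> L2" "hat v \<in> mdom (wmul \<sigma>)"
  shows "sobolev_norm \<sigma> (\<lambda>x. u x - v x) = norm (mop (wmul \<sigma>) (hat u) - mop (wmul \<sigma>) (hat v))"
  using sobolev_norm_eq[OF assms(1) L2_diff[OF u(1) v(1)]] mop_diff[OF multiplier_wmul u(2) v(2)]
  by (simp add: cls_diff[OF u(1) v(1)] hartley_diff)

lemma tendsto_cls_iff:
  assumes "\<And>k. u k \<in> L2" "v \<in> L2"
  shows "(\<lambda>k. L2_norm (\<lambda>x. u k x - v x)) \<longlonglongrightarrow> 0 \<longleftrightarrow> (\<lambda>k. cls (u k)) \<longlonglongrightarrow> cls v"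
  unfolding norm_cls[OF L2_diff[OF assms], symmetric] cls_diff[OF assms] tendsto_norm_zero_iff LIM_zero_iff ..

context even_kernel
begin

lemma symb_le_wmul: "norm (symb xi v) \<le> Csymb * norm (wmul (2 * s) xi v)"
  using symb_le[of xi v] wt_pos[of "2 * s" xi] by (simp add: wmul_def mult.assoc)

lemmas symb_dom = mop_dominated[OF _ multiplier_symb symb_le_wmul Csymb_nonneg]

lemma nonlocal_op_hartley:
  assumes u: "schwartz_field u"
  shows "nonlocal_op \<rho> s u \<in> L2" "cls (nonlocal_op \<rho> s u) = hartley (mop symb (hat u))"
proof -
  define h where "h = hfield u"
  define g where "g xi = symb xi (h xi)" for xi
  define k where "k xi = wt (2 * s) xi *\<^sub>R h xi" for xi
  have h: "schwartz_field h" unfolding h_def by (rule schwartz_field_hfield[OF u])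
  have k: "schwartz_field k" unfolding k_def by (rule schwartz_field_wt[OF h])
  have le: "norm (g xi) \<le> Csymb * norm (k xi)" for xi
    using symb_le_wmul[of xi "h xi"] unfolding g_def k_def wmul_def .
  have gm: "g \<in> borel_measurable borel"
    unfolding g_def by (rule symb_borel[OF schwartz_field_measurable[OF h]])
  have gi: "integrable lborel g"
    using gm order.trans[OF le abs_ge_self]
    by (intro Bochner_Integration.integrable_bound[OF integrable_mult_right[OF integrable_norm[OF schwartz_field_integrable[OF k]], of Csymb]]) auto
  have gL: "g \<in> L2"
  proof (rule L2I)
    show "g \<in> borel_measurable lebesgue" by (rule borel_measurable_lebesgueI[OF gm]) simp
    show "integrable lebesgue (\<lambda>xi. Csymb\<^sup>2 * (norm (k xi))\<^sup>2)"
      by (rule integrable_mult_right[OF L2_integrable[OF schwartz_field_L2[OF k]]])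
    show "(norm (g xi))\<^sup>2 \<le> Csymb\<^sup>2 * (norm (k xi))\<^sup>2" for xi
      using power_mono[OF le norm_ge_zero, of xi 2] by (simp add: power_mult_distrib)
  qed
  have n: "nonlocal_op \<rho> s u = hfield g"
    unfolding g_def h_def by (rule ext) (rule nonlocal_op_schwartz[OF u])
  show "nonlocal_op \<rho> s u \<in> L2" unfolding n by (rule hartley_cls_integrable(2)[OF gi gL])
  have "mop symb (cls h) = cls g"
    unfolding g_def by (rule mdomI(2)[OF multiplier_symb schwartz_field_L2[OF h]]) (rule gL[unfolded g_def[abs_def]])
  then show "cls (nonlocal_op \<rho> s u) = hartley (mop symb (hat u))"
    unfolding n hartley_cls[OF u] h_def[symmetric] hartley_cls_integrable(3)[OF gi gL, symmetric] by simp
qed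

text \<open>The symbol is dominated by the weight of order 2 s, so along any approximation by
  Schwartz fields in the Sobolev norm the operator values converge to the multiplier. Such
  approximations exist because Schwartz fields are dense in the Sobolev space.\<close>

theorem nonlocal_op_ext_iff:
  "nonlocal_op_ext \<rho> s u w \<longleftrightarrow> u \<in> L2 \<and> hat u \<in> mdom (wmul (2 * s)) \<and> w \<in> L2 \<and>
     cls w = hartley (mop symb (hat u))"
proof -
  have s2: "0 \<le> 2 * s" using s by simp
  have lim: "(\<lambda>k. cls (nonlocal_op \<rho> s (\<phi> k))) \<longlonglongrightarrow> hartley (mop symb (hat u))"
    if u: "u \<in> L2" "hat u \<in> mdom (wmul (2 * s))" and \<phi>: "\<And>k. schwartz_field (\<phi> k)"
      and l: "(\<lambda>k. sobolev_norm (2 * s) (\<lambda>x. \<phi> k x - u x)) \<longlonglongrightarrow> 0" for \<phi> :: "nat \<Rightarrow> 'n field"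
  proof -
    have d: "hat (\<phi> k) \<in> mdom (wmul (2 * s))" for k
      unfolding hartley_cls[OF \<phi>] by (rule wmul_schwartz[OF schwartz_field_hfield[OF \<phi>]])
    have "norm (mop symb (hat (\<phi> k)) - mop symb (hat u)) \<le> sobolev_norm (2 * s) (\<lambda>x. \<phi> k x - u x) * Csymb" for k
      using symb_dom(2)[OF mop_diff(1)[OF multiplier_wmul d u(2)]]
      unfolding mop_diff(2)[OF multiplier_symb symb_dom(1)[OF d] symb_dom(1)[OF u(2)]] mop_diff(2)[OF multiplier_wmul d u(2)]
        sobolev_norm_diff[OF s2 schwartz_field_L2[OF \<phi>] d u] by (simp add: mult.commute)
    then have "(\<lambda>k. mop symb (hat (\<phi> k)) - mop symb (hat u)) \<longlonglongrightarrow> 0"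
      by (intro Lim_null_comparison[OF always_eventually tendsto_mult_left_zero[OF l]]) auto
    then have "(\<lambda>k. mop symb (hat (\<phi> k))) \<longlonglongrightarrow> mop symb (hat u)" by (simp add: LIM_zero_iff)
    from bounded_linear.tendsto[OF bounded_linear_hartley this] show ?thesis
      by (simp add: nonlocal_op_hartley(2)[OF \<phi>])
  qed
  show ?thesis
  proof
    assume "nonlocal_op_ext \<rho> s u w"
    then obtain \<phi> where u: "u \<in> L2" "hat u \<in> mdom (wmul (2 * s))" and w: "w \<in> L2"
      and \<phi>: "\<And>k. schwartz_field (\<phi> k)" "(\<lambda>k. sobolev_norm (2 * s) (\<lambda>x. \<phi> k x - u x)) \<longlonglongrightarrow> 0"
        "(\<lambda>k. L2_norm (\<lambda>x. nonlocal_op \<rho> s (\<phi> k) x - w x)) \<longlonglongrightarrow> 0"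
      unfolding nonlocal_op_ext_def sobolev_iff[OF s2] by blast
    have "(\<lambda>k. cls (nonlocal_op \<rho> s (\<phi> k))) \<longlonglongrightarrow> cls w"
      using \<phi>(3) by (simp only: tendsto_cls_iff[OF nonlocal_op_hartley(1)[OF \<phi>(1)] w])
    from LIMSEQ_unique[OF this lim[OF u \<phi>(1,2)]] u w
    show "u \<in> L2 \<and> hat u \<in> mdom (wmul (2 * s)) \<and> w \<in> L2 \<and> cls w = hartley (mop symb (hat u))"
      by simp
  next
    assume "u \<in> L2 \<and> hat u \<in> mdom (wmul (2 * s)) \<and> w \<in> L2 \<and> cls w = hartley (mop symb (hat u))"
    then have u: "u \<in> L2" "hat u \<in> mdom (wmul (2 * s))" and w: "w \<in> L2"
      and cw: "cls w = hartley (mop symb (hat u))" by auto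
    \<comment> \<open>Density in the Sobolev norm: approximate the weighted transform in L2, divide
      by the weight, which preserves Schwartz fields, and transform back.\<close>
    obtain \<sigma> where \<sigma>: "\<And>k. schwartz_field (\<sigma> k)" "(\<lambda>k. cls (\<sigma> k)) \<longlonglongrightarrow> mop (wmul (2 * s)) (hat u)"
      using schwartz_dense by blast
    define \<psi> where "\<psi> k xi = wt (- (2 * s)) xi *\<^sub>R \<sigma> k xi" for k xi
    define \<phi> where "\<phi> k = hfield (\<psi> k)" for k
    have \<psi>: "schwartz_field (\<psi> k)" for k unfolding \<psi>_def by (rule schwartz_field_wt[OF \<sigma>(1)])
    have \<phi>: "schwartz_field (\<phi> k)" for k unfolding \<phi>_def by (rule schwartz_field_hfield[OF \<psi>])
    have h\<phi>: "hat (\<phi> k) = cls (\<psi> k)" for k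
      unfolding hartley_cls[OF \<phi>] unfolding \<phi>_def hfield_hfield[OF \<psi>] ..
    have m: "mop (wmul (2 * s)) (cls (\<psi> k)) = cls (\<sigma> k)" for k
      unfolding wmul_schwartz(2)[OF \<psi>] unfolding \<psi>_def by (simp add: wt_minus)
    have "sobolev_norm (2 * s) (\<lambda>x. \<phi> k x - u x) = norm (cls (\<sigma> k) - mop (wmul (2 * s)) (hat u))" for k
      using sobolev_norm_diff[OF s2 schwartz_field_L2[OF \<phi>] _ u, of k] wmul_schwartz(1)[OF \<psi>] by (simp add: h\<phi> m)
    then have l: "(\<lambda>k. sobolev_norm (2 * s) (\<lambda>x. \<phi> k x - u x)) \<longlonglongrightarrow> 0"
      using \<sigma>(2) by (simp add: tendsto_norm_zero_iff LIM_zero_iff)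
    have "(\<lambda>k. L2_norm (\<lambda>x. nonlocal_op \<rho> s (\<phi> k) x - w x)) \<longlonglongrightarrow> 0"
      unfolding tendsto_cls_iff[OF nonlocal_op_hartley(1)[OF \<phi>] w] cw by (rule lim[OF u \<phi> l])
    then show "nonlocal_op_ext \<rho> s u w"
      unfolding nonlocal_op_ext_def sobolev_iff[OF s2] using u w \<phi> l nonlocal_op_hartley(1)[OF \<phi>] by blast
  qed
qed

end

section \<open>Coercivity of the symbol from the steady estimate\<close>

section \<open>Coercivity from the steady problem\<close>

text \<open>A minimiser of the quadratic form on the unit sphere is an eigenvector, and for eigenvectors the
  two inequalities agree.\<close>

lemma form_lower_bound:
  fixes A :: "'a::euclidean_space \<Rightarrow> 'a"
  assumes A: "linear A" and sym: "\<And>x y. A x \<bullet> y = x \<bullet> A y" and pos: "\<And>x. 0 \<le> A x \<bullet> x"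
    and le: "\<And>x. L * norm x \<le> C * norm (A x)" and C: "0 \<le> C"
  shows "L * (norm x)\<^sup>2 \<le> C * (A x \<bullet> x)"
proof (cases "x = 0")
  case False
  define S where "S = sphere (0::'a) 1"
  have "x /\<^sub>R norm x \<in> S" using False by (simp add: S_def)
  then have "S \<noteq> {}" by blast
  moreover have "continuous_on S (\<lambda>x. A x \<bullet> x)" by (intro continuous_intros linear_continuous_on linear_conv_bounded_linear[THEN iffD1] A)
  moreover have "compact S" by (simp add: S_def)
  ultimately obtain e where e: "e \<in> S" and "\<forall>y\<in>S. A e \<bullet> e \<le> A y \<bullet> y"
    using continuous_attains_inf[of S "\<lambda>x. A x \<bullet> x"] by blast
  then have emin: "A e \<bullet> e \<le> A y \<bullet> y" if "y \<in> S" for y using that by blast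
  define \<mu> where "\<mu> = A e \<bullet> e"
  have ne: "norm e = 1" using e by (simp add: S_def)
  have low: "\<mu> * (norm y)\<^sup>2 \<le> A y \<bullet> y" for y
  proof (cases "y = 0")
    case False
    have "\<mu> \<le> A (y /\<^sub>R norm y) \<bullet> (y /\<^sub>R norm y)" unfolding \<mu>_def by (rule emin) (use False in \<open>simp add: S_def\<close>)
    also have "\<dots> = (A y \<bullet> y) / (norm y)\<^sup>2" by (simp add: linear_cmul[OF A] power2_eq_square divide_inverse)
    finally show ?thesis using False by (simp add: pos_le_divide_eq)
  qed (simp add: linear_0[OF A])
  \<comment> \<open>The residual of the eigenvector equation. At \<open>e + t *\<^sub>R y\<close>
    the form minus \<open>\<mu>\<close> times the squared norm equals
    \<open>2 * t * b + t\<^sup>2 * c\<close>, and it is nonnegative by minimality; this forces b =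
    0.\<close>
  define y where "y = A e - \<mu> *\<^sub>R e"
  define b where "b = (norm y)\<^sup>2"
  define c where "c = A y \<bullet> y - \<mu> * (norm y)\<^sup>2"
  have c: "0 \<le> c" unfolding c_def using low[of y] by simp
  have q: "0 \<le> 2 * t * b + t\<^sup>2 * c" for t
  proof -
    have "b = A e \<bullet> y - \<mu> * (e \<bullet> y)" unfolding b_def by (simp add: power2_norm_eq_inner y_def inner_diff_left)
    moreover have "A y \<bullet> e = A e \<bullet> y" using sym[of e y] by (simp add: inner_commute)
    moreover have "(norm (e + t *\<^sub>R y))\<^sup>2 = 1 + 2 * t * (e \<bullet> y) + t\<^sup>2 * (norm y)\<^sup>2"
      unfolding power2_norm_eq_inner using ne[unfolded norm_eq_1]
      by (simp add: inner_add_left inner_add_right inner_commute[of y e] power2_eq_square distrib_left)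
    moreover have "A (e + t *\<^sub>R y) \<bullet> (e + t *\<^sub>R y) = \<mu> + t * (A e \<bullet> y) + t * (A y \<bullet> e) + t\<^sup>2 * (A y \<bullet> y)"
      by (simp add: linear_add[OF A] linear_cmul[OF A] inner_add_left inner_add_right \<mu>_def power2_eq_square distrib_left)
    moreover have "2 * t * b + t\<^sup>2 * c = \<mu> + t * (A e \<bullet> y) + t * (A e \<bullet> y) + t\<^sup>2 * (A y \<bullet> y) - \<mu> * (1 + 2 * t * (e \<bullet> y) + t\<^sup>2 * (norm y)\<^sup>2)"
      if "b = A e \<bullet> y - \<mu> * (e \<bullet> y)" unfolding that c_def by (simp add: algebra_simps)
    ultimately show ?thesis using low[of "e + t *\<^sub>R y"] by simp
  qed
  have "b = 0"
  proof (rule ccontr)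
    assume "b \<noteq> 0"
    then have b: "0 < b" by (simp add: b_def)
    \<comment> \<open>With this t the quadratic term is at most \<open>- (t * b)\<close>, so the
      whole expression is at most \<open>t * b\<close>, which is negative.\<close>
    define t where "t = - b / (c + 1)"
    have t: "t * (c + 1) = - b" "t < 0" using b c by (simp_all add: t_def divide_less_0_iff)
    have "t\<^sup>2 * c \<le> t * (t * (c + 1))" by (simp add: power2_eq_square distrib_left)
    also have "\<dots> = - (t * b)" unfolding t(1) by simp
    finally have "0 \<le> t * b" using q[of t] by simp
    then show False using mult_neg_pos[OF t(2) b] by simp
  qed
  then have Ae: "A e = \<mu> *\<^sub>R e" by (simp add: b_def y_def)
  have "0 \<le> \<mu>" unfolding \<mu>_def by (rule pos)
  then have "norm (A e) = \<mu>" unfolding Ae using ne by simp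
  then have "L \<le> C * \<mu>" using le[of e] ne by simp
  from mult_right_mono[OF this, of "(norm x)\<^sup>2"] mult_left_mono[OF low[of x] C]
  show ?thesis by (simp add: mult.assoc)
qed (simp add: linear_0[OF A])

lemma lap_continuous:
  assumes "0 < \<sigma>"
  shows "continuous_on UNIV (lap \<sigma>)"
  unfolding lap_def[abs_def] using assms by (intro continuous_on_powr' continuous_intros) auto

lemma wt_le_lap:
  assumes "0 < s" "s < 1"
  shows "wt (2 * s) xi \<le> 2 * (1 + lap s xi)"
proof -
  define x where "x = 4 * pi\<^sup>2 * (norm xi)\<^sup>2"
  have x: "0 \<le> x" by (simp add: x_def)
  have "(1 + x) powr s \<le> (2 * max 1 x) powr s" using x assms by (intro powr_mono2) auto
  also have "\<dots> = 2 powr s * max 1 x powr s" using x by (intro powr_mult)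
  also have "\<dots> \<le> 2 * (1 + x powr s)"
  proof (intro mult_mono)
    show "2 powr s \<le> 2" using powr_mono[of s 1 2] assms by simp
    show "max 1 x powr s \<le> 1 + x powr s" by (simp add: max_def)
  qed auto
  finally show ?thesis by (simp add: wt_def lap_def x_def)
qed

context even_kernel
begin

text \<open>A vector \<open>U\<close> of the domain defines the right-hand side for which
  \<open>hartley U\<close> solves the steady problem. By uniqueness it is the solution to which the
  estimate refers, and both sides of the estimate are read on the frequency side.\<close>

lemma symb_wmul_linear_resolvent:
  assumes lam: "0 \<le> lam" and C: "0 \<le> C"
    and steady: "\<And>g. g \<in> L2 \<Longrightarrow> \<exists>u. steady_solution \<rho> s lam g u \<and>
          (\<forall>w. steady_solution \<rho> s lam g w \<longrightarrow> (AE x in lebesgue. w x = u x)) \<and>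
          (\<exists>a\<in>L2. frac_laplacian s u a \<and> L2_norm a \<le> C * L2_norm g)"
    and U: "U \<in> mdom (wmul (2 * s))"
  shows "U \<in> mdom (\<lambda>xi v. lap s xi *\<^sub>R v)" "norm (mop (\<lambda>xi v. lap s xi *\<^sub>R v) U) \<le> C * norm (mop symb U + lam *\<^sub>R U)"
proof -
  define G where "G = hartley (mop symb U + lam *\<^sub>R U)"
  have G: "G = hartley (mop symb U) + lam *\<^sub>R hartley U"
    unfolding G_def by (simp add: bounded_linear.linear[OF bounded_linear_hartley] linear_add linear_cmul)
  obtain u a where u: "steady_solution \<rho> s lam (rep G) u"
    and uniq: "\<And>w. steady_solution \<rho> s lam (rep G) w \<Longrightarrow> AE x in lebesgue. w x = u x"
    and a: "a \<in> L2" "frac_laplacian s u a" "L2_norm a \<le> C * L2_norm (rep G)"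
    using steady[OF rep_L2[of G]] by blast
  have "nonlocal_op_ext \<rho> s (rep (hartley U)) (rep (hartley (mop symb U)))"
    unfolding nonlocal_op_ext_iff using U by simp
  moreover have "AE x in lebesgue. rep (hartley (mop symb U)) x + lam *\<^sub>R rep (hartley U) x = rep G x"
    using rep_add[of "hartley (mop symb U)" "lam *\<^sub>R hartley U"] rep_scaleR[of lam "hartley U"] unfolding G
    by eventually_elim simp
  ultimately have "steady_solution \<rho> s lam (rep G) (rep (hartley U))"
    unfolding steady_solution_def using nonlocal_op_ext_def by blast
  note ae = uniq[OF this]
  have uL: "u \<in> L2" using u unfolding steady_solution_def nonlocal_op_ext_iff by blast
  have "hat u = U" using cls_eqI[OF rep_L2 uL ae] by (metis cls_rep hartley_hartley)
  note fl = frac_laplacian_hartley[OF uL a(1,2), unfolded this]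
  show "U \<in> mdom (\<lambda>xi v. lap s xi *\<^sub>R v)" by (rule fl(1))
  show "norm (mop (\<lambda>xi v. lap s xi *\<^sub>R v) U) \<le> C * norm (mop symb U + lam *\<^sub>R U)"
    using a(3) unfolding fl(2) norm_cls[OF rep_L2, symmetric] by (simp add: norm_cls a G_def)
qed

text \<open>Testing with the indicator function of a small ball turns the estimate into a pointwise one.\<close>

lemma symb_pointwise:
  assumes lam: "0 \<le> lam" and C: "0 \<le> C"
    and est: "\<And>U. U \<in> mdom (wmul (2 * s)) \<Longrightarrow> U \<in> mdom (\<lambda>xi v. lap s xi *\<^sub>R v) \<and>
      norm (mop (\<lambda>xi v. lap s xi *\<^sub>R v) U) \<le> C * norm (mop symb U + lam *\<^sub>R U)"
  shows "lap s xi0 * norm a \<le> C * norm (symb xi0 a + lam *\<^sub>R a)"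
proof (rule ccontr)
  define F where "F xi = lap s xi * norm a" for xi :: "real^'n"
  define E where "E xi = C * norm (symb xi a + lam *\<^sub>R a)" for xi
  assume "\<not> ?thesis"
  then have "E xi0 < F xi0" by (simp add: E_def F_def)
  \<comment> \<open>Two levels strictly between the two sides: by continuity they separate the sides
    on a whole ball \<open>B\<close>. The test field equals a on \<open>B\<close> and 0 elsewhere,
    and comparing its two norms contradicts q < p.\<close>
  then obtain q p where qp: "E xi0 < q" "q < p" "p < F xi0" by (meson dense)
  have "0 \<le> E xi0" using C by (simp add: E_def)
  have cF: "isCont F xi0" and cE: "isCont E xi0"
    using continuous_on_eq_continuous_at[OF open_UNIV] lap_continuous[OF s(1)] symb_continuous[of a]
    unfolding F_def[abs_def] E_def[abs_def] by (auto intro!: continuous_intros)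
  have "\<forall>\<^sub>F xi in nhds xi0. E xi < q \<and> p < F xi"
    using order_tendstoD(2)[OF cE[unfolded isCont_def tendsto_at_iff_tendsto_nhds] qp(1)]
      order_tendstoD(1)[OF cF[unfolded isCont_def tendsto_at_iff_tendsto_nhds] qp(3)] by eventually_elim simp
  then obtain \<delta> where \<delta>: "\<delta> > 0" "\<And>xi. dist xi xi0 < \<delta> \<Longrightarrow> E xi < q \<and> p < F xi"
    unfolding eventually_nhds_metric by blast
  define B where "B = ball xi0 \<delta>"
  have EF: "E xi < q" "p < F xi" if "xi \<in> B" for xi using \<delta>(2)[of xi] that by (auto simp: B_def dist_commute)
  have Bm[measurable]: "B \<in> sets lebesgue" by (simp add: B_def)
  have iB: "integrable lebesgue (\<lambda>xi. c * indicator B xi :: real)" for c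
    by (intro integrable_mult_right integrable_real_indicator Bm) (use emeasure_lborel_ball_finite[of xi0 \<delta>] in \<open>simp add: B_def\<close>)
  define f where "f xi = indicator B xi *\<^sub>R a" for xi
  have fm: "f \<in> borel_measurable lebesgue" unfolding f_def[abs_def] by measurable
  have fL: "f \<in> L2" by (rule L2I[OF fm iB[of "(norm a)\<^sup>2"]]) (simp add: f_def indicator_def)
  have "(\<lambda>xi. wmul (2 * s) xi (f xi)) \<in> L2"
  proof -
    obtain M where M: "\<And>xi. xi \<in> B \<Longrightarrow> wt (2 * s) xi \<le> M"
    proof -
      have "bounded (wt (2 * s) ` cball xi0 \<delta>)"
        by (intro compact_imp_bounded compact_continuous_image continuous_on_subset[OF wt_continuous]) auto
      then obtain M where "\<forall>x\<in>wt (2 * s) ` cball xi0 \<delta>. norm x \<le> M" unfolding bounded_iff by blast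
      then have "wt (2 * s) xi \<le> M" if "xi \<in> B" for xi
        using that abs_ge_self[of "wt (2 * s) xi"] by (auto simp: B_def intro: order.trans)
      then show ?thesis by (rule that)
    qed
    show ?thesis
    proof (rule L2I[OF multiplierD(2)[OF multiplier_wmul fm] iB[of "(M * norm a)\<^sup>2"]])
      show "(norm (wmul (2 * s) xi (f xi)))\<^sup>2 \<le> (M * norm a)\<^sup>2 * indicator B xi" for xi
        using M[of xi] wt_pos[of "2 * s" xi] by (auto simp: f_def wmul_def indicator_def intro!: power_mono mult_right_mono)
    qed
  qed
  then have U: "cls f \<in> mdom (wmul (2 * s))" by (rule mdomI(1)[OF multiplier_wmul fL])
  note e = est[OF U]
  have ae: "AE xi in lebesgue. rep (cls f) xi = f xi" by (rule rep_cls[OF fL])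
  have "(norm (mop (\<lambda>xi v. lap s xi *\<^sub>R v) (cls f)))\<^sup>2 = (LINT xi|lebesgue. (norm (rep (mop (\<lambda>xi v. lap s xi *\<^sub>R v) (cls f)) xi))\<^sup>2)"
    by (rule norm_sq_rep)
  also have "\<dots> \<ge> (LINT xi|lebesgue. p\<^sup>2 * indicator B xi)"
  proof (rule integral_mono_AE[OF iB L2_integrable[OF rep_L2]])
    show "AE xi in lebesgue. p\<^sup>2 * indicator B xi \<le> (norm (rep (mop (\<lambda>xi v. lap s xi *\<^sub>R v) (cls f)) xi))\<^sup>2"
      using rep_mop[OF conjunct1[OF e]] ae
    proof eventually_elim
      case (elim xi)
      have "p\<^sup>2 \<le> (F xi)\<^sup>2" if "xi \<in> B" using EF(2)[OF that] qp \<open>0 \<le> E xi0\<close> by (intro power_mono) auto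
      then show ?case unfolding elim f_def by (auto simp: F_def power_mult_distrib indicator_def lap_nonneg)
    qed
  qed
  finally have 1: "p\<^sup>2 * measure lebesgue B \<le> (norm (mop (\<lambda>xi v. lap s xi *\<^sub>R v) (cls f)))\<^sup>2" by simp
  have "C\<^sup>2 * (norm (mop symb (cls f) + lam *\<^sub>R cls f))\<^sup>2 = (LINT xi|lebesgue. C\<^sup>2 * (norm (rep (mop symb (cls f) + lam *\<^sub>R cls f) xi))\<^sup>2)"
    by (simp add: norm_sq_rep)
  also have "\<dots> \<le> (LINT xi|lebesgue. q\<^sup>2 * indicator B xi)"
  proof (rule integral_mono_AE[OF integrable_mult_right[OF L2_integrable[OF rep_L2]] iB])
    show "AE xi in lebesgue. C\<^sup>2 * (norm (rep (mop symb (cls f) + lam *\<^sub>R cls f) xi))\<^sup>2 \<le> q\<^sup>2 * indicator B xi"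
      using rep_mop[OF symb_dom(1)[OF U]] ae rep_add[of "mop symb (cls f)" "lam *\<^sub>R cls f"] rep_scaleR[of lam "cls f"]
    proof eventually_elim
      case (elim xi)
      have "(E xi)\<^sup>2 \<le> q\<^sup>2" if "xi \<in> B" using EF(1)[OF that] C by (intro power_mono) (auto simp: E_def)
      then show ?case unfolding elim f_def
        by (cases "xi \<in> B") (auto simp: E_def power_mult_distrib linear_0[OF linear_symb])
    qed
  qed
  finally have 2: "(C * norm (mop symb (cls f) + lam *\<^sub>R cls f))\<^sup>2 \<le> q\<^sup>2 * measure lebesgue B" by (simp add: power_mult_distrib)
  have "p\<^sup>2 * measure lebesgue B \<le> q\<^sup>2 * measure lebesgue B"
    using 1 2 power_mono[OF conjunct2[OF e] norm_ge_zero, of 2] by linarith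
  moreover have "0 < measure lebesgue B"
    using \<delta>(1) content_ball_pos[of \<delta> xi0] by (simp add: B_def measure_completion)
  moreover have "q\<^sup>2 < p\<^sup>2" using qp \<open>0 \<le> E xi0\<close> by (intro power_strict_mono) auto
  ultimately show False by simp
qed

text \<open>By \<open>wt_le_lap\<close> the weight is controlled by 1 plus the symbol of the
  fractional Laplacian. For the form version \<open>form_lower_bound\<close> is applied to the
  shifted matrix, and \<open>K\<close> absorbs the shift \<open>lam\<close>.\<close>

lemma symb_coercive:
  assumes lam: "0 \<le> lam" and C: "0 \<le> C" and le: "\<And>xi v. lap s xi * norm v \<le> C * norm (symb xi v + lam *\<^sub>R v)"
  defines "K \<equiv> 2 + 2 * C + 2 * C * lam"
  shows "wt (2 * s) xi * (norm v)\<^sup>2 \<le> K * (symb xi v \<bullet> v + (norm v)\<^sup>2)" "wt (2 * s) xi * norm v \<le> K * (norm (symb xi v) + norm v)"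
proof -
  have "lap s xi * (norm v)\<^sup>2 \<le> C * ((symb xi v + lam *\<^sub>R v) \<bullet> v)"
  proof (rule form_lower_bound[OF _ _ _ le C])
    show "linear (\<lambda>v. symb xi v + lam *\<^sub>R v)"
      by (intro linear_compose_add linear_symb linear_compose_scale_right linear_ident)
    show "(symb xi v + lam *\<^sub>R v) \<bullet> w = v \<bullet> (symb xi w + lam *\<^sub>R w)" for v w
      by (simp add: inner_add_left inner_add_right symb_symmetric)
    show "0 \<le> (symb xi v + lam *\<^sub>R v) \<bullet> v" for v using symb_nonneg[of xi v] lam by (simp add: inner_add_left)
  qed
  then have "lap s xi * (norm v)\<^sup>2 \<le> C * (symb xi v \<bullet> v) + C * lam * (norm v)\<^sup>2"
    by (simp add: inner_add_left power2_norm_eq_inner distrib_left)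
  moreover have "wt (2 * s) xi * (norm v)\<^sup>2 \<le> 2 * (norm v)\<^sup>2 + 2 * (lap s xi * (norm v)\<^sup>2)"
    using mult_right_mono[OF wt_le_lap[OF s, of xi] zero_le_power2[of "norm v"]] by (simp add: algebra_simps)
  moreover have "0 \<le> C * (norm v)\<^sup>2" "0 \<le> (symb xi v \<bullet> v)" "0 \<le> (C * lam) * (symb xi v \<bullet> v)" using C lam symb_nonneg by auto
  moreover have "K * (symb xi v \<bullet> v + (norm v)\<^sup>2) = 2 * (symb xi v \<bullet> v) + 2 * (norm v)\<^sup>2 + 2 * (C * (symb xi v \<bullet> v))
    + 2 * (C * (norm v)\<^sup>2) + 2 * (C * lam * (symb xi v \<bullet> v)) + 2 * (C * lam * (norm v)\<^sup>2)"
    by (simp add: K_def algebra_simps)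
  ultimately show "wt (2 * s) xi * (norm v)\<^sup>2 \<le> K * (symb xi v \<bullet> v + (norm v)\<^sup>2)" by linarith
  have "C * norm (symb xi v + lam *\<^sub>R v) \<le> C * (norm (symb xi v) + lam * norm v)"
    using norm_triangle_ineq[of "symb xi v" "lam *\<^sub>R v"] lam by (intro mult_left_mono C) simp
  then have "lap s xi * norm v \<le> C * norm (symb xi v) + C * lam * norm v"
    using le[of xi v] by (simp add: distrib_left mult.assoc)
  moreover have "wt (2 * s) xi * norm v \<le> 2 * norm v + 2 * (lap s xi * norm v)"
    using mult_right_mono[OF wt_le_lap[OF s, of xi] norm_ge_zero[of v]] by (simp add: algebra_simps)
  moreover have "0 \<le> C * norm v" "0 \<le> norm (symb xi v)" "0 \<le> (C * lam) * norm (symb xi v)" using C lam by auto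
  moreover have "K * (norm (symb xi v) + norm v) = 2 * norm (symb xi v) + 2 * norm v + 2 * (C * norm (symb xi v))
    + 2 * (C * norm v) + 2 * (C * lam * norm (symb xi v)) + 2 * (C * lam * norm v)"
    by (simp add: K_def algebra_simps)
  ultimately show "wt (2 * s) xi * norm v \<le> K * (norm (symb xi v) + norm v)" by linarith
qed

end

section \<open>The nonlocal energy as the quadratic form of the symbol\<close>

section \<open>The nonlocal energy\<close>

lemma schwartz_sum: "finite J \<Longrightarrow> (\<And>j. j \<in> J \<Longrightarrow> schwartz (f j)) \<Longrightarrow> schwartz (\<lambda>x. \<Sum>j\<in>J. f j x)"
  by (induction J rule: finite_induct) (auto intro: schwartz_add schwartz_zero)

text \<open>For a unit vector the squared component along e becomes the squared norm of a field, to
  which Plancherel's identity applies.\<close>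

definition proj :: "real^'n::finite \<Rightarrow> real^'n \<Rightarrow> real^'n" where
  "proj e v = (e \<bullet> v) *\<^sub>R e"

lemma linear_proj: "linear (proj e)"
  by (intro linearI) (simp_all add: proj_def inner_add_right scaleR_add_left)

lemma inner_proj: "proj e v \<bullet> w = v \<bullet> proj e w"
  by (simp add: proj_def inner_commute)

lemma norm_proj: "norm e = 1 \<Longrightarrow> (norm (proj e v))\<^sup>2 = (e \<bullet> v)\<^sup>2"
  by (simp add: proj_def)

lemma proj_borel: "proj e \<in> borel_measurable borel"
  by (intro borel_measurable_continuous_onI linear_continuous_on linear_conv_bounded_linear[THEN iffD1] linear_proj)

lemma L2_proj: "u \<in> L2 \<Longrightarrow> (\<lambda>x. proj e (u x)) \<in> L2"
proof -
  assume u: "u \<in> L2"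
  obtain B where B: "\<And>v. norm (proj e v) \<le> B * norm v" using linear_bounded[OF linear_proj] by blast
  show ?thesis
  proof (rule L2I)
    show "(\<lambda>x. proj e (u x)) \<in> borel_measurable lebesgue" by (rule measurable_compose[OF L2_measurable[OF u] proj_borel])
    show "integrable lebesgue (\<lambda>x. B\<^sup>2 * (norm (u x))\<^sup>2)" by (rule integrable_mult_right[OF L2_integrable[OF u]])
    show "(norm (proj e (u x)))\<^sup>2 \<le> B\<^sup>2 * (norm (u x))\<^sup>2" for x
      using power_mono[OF B norm_ge_zero, of "u x" 2] by (simp add: power_mult_distrib)
  qed
qed

lemma schwartz_field_proj: "schwartz_field u \<Longrightarrow> schwartz_field (\<lambda>x. proj e (u x))"
  unfolding schwartz_field_def
proof
  fix i assume u: "\<forall>i. schwartz (comp_fun u i)"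
  have "comp_fun (\<lambda>x. proj e (u x)) i = (\<lambda>x. \<Sum>j\<in>UNIV. of_real (e $ j * e $ i) * comp_fun u j x)"
    by (simp add: comp_fun_def proj_def inner_vec_def fun_eq_iff sum_distrib_left sum_distrib_right mult_ac)
  moreover have "schwartz \<dots>" using u by (intro schwartz_sum schwartz_cmult) auto
  ultimately show "schwartz (comp_fun (\<lambda>x. proj e (u x)) i)" by simp
qed

lemma hfield_proj:
  assumes "schwartz_field u"
  shows "hfield (\<lambda>x. proj e (u x)) = (\<lambda>xi. proj e (hfield u xi))"
proof
  fix xi
  have "integrable lborel (\<lambda>x. cas (2 * pi * (x \<bullet> xi)) *\<^sub>R u x)"
    by (intro integrable_cas_scaleR schwartz_field_integrable assms) measurable
  from integral_bounded_linear[OF linear_conv_bounded_linear[THEN iffD1, OF linear_proj] this, of e]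
  show "hfield (\<lambda>x. proj e (u x)) xi = proj e (hfield u xi)"
    by (simp add: hfield_def linear_cmul[OF linear_proj])
qed

lemma hartley_proj:
  assumes u: "u \<in> L2"
  shows "hat (\<lambda>x. proj e (u x)) = cls (\<lambda>xi. proj e (rep (hat u) xi))"
proof (rule Lt_eqI_schwartz)
  fix \<phi> :: "'a field" assume \<phi>: "schwartz_field \<phi>"
  have move: "inner (cls (\<lambda>x. proj e (v x))) (cls w) = inner (cls v) (cls (\<lambda>x. proj e (w x)))" if "v \<in> L2" "w \<in> L2" for v w :: "'a field"
    by (simp add: that inner_cls L2_proj inner_proj)
  note L = schwartz_field_L2[OF \<phi>] schwartz_field_L2[OF schwartz_field_hfield[OF \<phi>]]
  have "inner (hat (\<lambda>x. proj e (u x))) (cls \<phi>) = inner (cls u) (cls (\<lambda>x. proj e (hfield \<phi> x)))"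
    by (simp add: inner_hartley_schwartz \<phi> move u L)
  also have "\<dots> = inner (hat u) (cls (\<lambda>x. proj e (\<phi> x)))"
    by (simp add: inner_hartley_schwartz schwartz_field_proj \<phi> hfield_proj)
  also have "\<dots> = inner (cls (\<lambda>xi. proj e (rep (hat u) xi))) (cls \<phi>)"
    by (simp add: move L)
  finally show "inner (hat (\<lambda>x. proj e (u x))) (cls \<phi>) = inner (cls (\<lambda>xi. proj e (rep (hat u) xi))) (cls \<phi>)" .
qed

lemma L2_shift:
  assumes [measurable]: "u \<in> borel_measurable borel" and u: "u \<in> L2"
  shows "(\<lambda>x. u (x + z)) \<in> L2"
proof (rule L2I[OF _ _ order.refl])
  show "(\<lambda>x. u (x + z)) \<in> borel_measurable lebesgue" by (rule borel_measurable_lebesgueI[of _ borel]) auto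
  have "integrable lborel (\<lambda>x. (norm (u x))\<^sup>2)" using L2_integrable[OF u] by (subst (asm) integrable_completion) auto
  from integrable_lebesgue[OF integrable_shift[OF this]] show "integrable lebesgue (\<lambda>x. (norm (u (x + z)))\<^sup>2)" .
qed

definition omul :: "real^'n::finite \<Rightarrow> real^'n \<Rightarrow> real^'n \<Rightarrow> real^'n" where
  "omul z xi v = (2 * om z xi) *\<^sub>R v"

lemma om_le_2: "om z xi \<le> 2"
  unfolding om_def using cos_ge_minus_one[of "2 * pi * (z \<bullet> xi)"] by linarith

lemma om_borel: "om z \<in> borel_measurable borel"
  by measurable

lemma multiplier_omul: "multiplier (omul z)"
  unfolding omul_def[abs_def]
  by (intro multiplier_scalar borel_measurable_times borel_measurable_const borel_measurable_lebesgueI[OF om_borel]) simp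

lemma omul_le: "norm (omul z xi v) \<le> 4 * norm v"
  using om_nonneg[of z xi] om_le_2[of z xi] by (simp add: omul_def mult_right_mono)

lemmas omul_dom = mop_bounded(1)[OF multiplier_omul omul_le]

context even_kernel
begin

text \<open>By duality: translations and transform are moved onto a Schwartz test field, where the
  identity is \<open>second_difference\<close>.\<close>

lemma second_difference_L2:
  fixes u :: "'n field"
  assumes um[measurable]: "u \<in> borel_measurable borel" and u: "u \<in> L2"
  shows "2 *\<^sub>R cls u - cls (\<lambda>x. u (x + z)) - cls (\<lambda>x. u (x - z)) = hartley (mop (omul z) (hat u))"
proof (rule Lt_eqI_schwartz)
  fix \<phi> :: "'n field" assume \<phi>: "schwartz_field \<phi>"
  note [measurable] = schwartz_field_measurable[OF \<phi>]
  define h where "h xi = omul z xi (hfield \<phi> xi)" for xi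
  have L: "\<phi> \<in> L2" "hfield \<phi> \<in> L2" by (intro schwartz_field_L2 schwartz_field_hfield \<phi>)+
  have sL: "(\<lambda>x. v (x + y)) \<in> L2" "(\<lambda>x. v (x - y)) \<in> L2" if "v \<in> {u, \<phi>}" for v y
    using that L2_shift[of v _ ] u L um schwartz_field_measurable[OF \<phi>] L2_shift[of v "- y"] by (auto simp: insert_iff)
  have hi: "integrable lborel h"
  proof (rule Bochner_Integration.integrable_bound)
    show "integrable lborel (\<lambda>xi. 4 * norm (hfield \<phi> xi))"
      by (intro integrable_mult_right integrable_norm schwartz_field_integrable schwartz_field_hfield \<phi>)
    show "h \<in> borel_measurable lborel"
      using schwartz_field_measurable[OF schwartz_field_hfield[OF \<phi>]] unfolding h_def[abs_def] omul_def by measurable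
    show "AE x in lborel. norm (h x) \<le> norm (4 * norm (hfield \<phi> x))"
      unfolding h_def using omul_le by (intro AE_I2) simp
  qed
  have "(\<lambda>xi. omul z xi (rep (cls (hfield \<phi>)) xi)) \<in> L2" using omul_dom[of "cls (hfield \<phi>)" z] by (simp add: mdom_def)
  have hL: "h \<in> L2"
  proof (rule L2I)
    show "h \<in> borel_measurable lebesgue" unfolding h_def by (rule multiplierD(2)[OF multiplier_omul L2_measurable[OF L(2)]])
    show "integrable lebesgue (\<lambda>xi. 16 * (norm (hfield \<phi> xi))\<^sup>2)" by (rule integrable_mult_right[OF L2_integrable[OF L(2)]])
    show "(norm (h xi))\<^sup>2 \<le> 16 * (norm (hfield \<phi> xi))\<^sup>2" for xi
      unfolding h_def using power_mono[OF omul_le norm_ge_zero, of z xi "hfield \<phi> xi" 2] by (simp add: power_mult_distrib)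
  qed
  have e: "2 *\<^sub>R \<phi> x - \<phi> (x + z) - \<phi> (x - z) = hfield h x" for x
    unfolding second_difference[OF \<phi>] hfield_def[of h] h_def omul_def by (simp add: mult.commute mult.left_commute)
  have move: "inner (cls (\<lambda>x. u (x + y))) (cls \<phi>) = inner (cls u) (cls (\<lambda>x. \<phi> (x - y)))" for y
  proof -
    have "inner (cls (\<lambda>x. u (x + y))) (cls \<phi>) = (LINT x|lborel. u (x + y) \<bullet> \<phi> x)"
      using sL(1)[of u y] by (simp add: inner_cls L integral_completion)
    also have "\<dots> = (LINT x|lborel. u (x + y) \<bullet> \<phi> ((x + y) - y))" by simp
    also have "\<dots> = (LINT x|lborel. u x \<bullet> \<phi> (x - y))" by (rule lborel_integral_shift[of "\<lambda>x. u x \<bullet> \<phi> (x - y)"]) measurable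
    also have "\<dots> = inner (cls u) (cls (\<lambda>x. \<phi> (x - y)))"
      using sL(2)[of \<phi> y] by (simp add: inner_cls u integral_completion)
    finally show ?thesis .
  qed
  have "inner (2 *\<^sub>R cls u - cls (\<lambda>x. u (x + z)) - cls (\<lambda>x. u (x - z))) (cls \<phi>)
    = inner (cls u) (2 *\<^sub>R cls \<phi> - cls (\<lambda>x. \<phi> (x + z)) - cls (\<lambda>x. \<phi> (x - z)))"
    using move[of z] move[of "- z"] by (simp add: inner_diff_left inner_diff_right)
  also have "2 *\<^sub>R cls \<phi> - cls (\<lambda>x. \<phi> (x + z)) - cls (\<lambda>x. \<phi> (x - z)) = cls (\<lambda>x. 2 *\<^sub>R \<phi> x - \<phi> (x + z) - \<phi> (x - z))"
    using sL[of \<phi> z] L by (simp add: cls_diff cls_scaleR L2_diff L2_scaleR)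
  also have "\<dots> = hat h" unfolding e hartley_cls_integrable(3)[OF hi hL] ..
  also have "cls h = mop (omul z) (hat \<phi>)"
    unfolding hartley_cls[OF \<phi>] h_def by (rule mdomI(2)[OF multiplier_omul L(2) hL[unfolded h_def[abs_def]], symmetric])
  also have "inner (cls u) (hartley (mop (omul z) (hat \<phi>))) = inner (mop (omul z) (hat u)) (hat \<phi>)"
  proof -
    have "inner (mop (omul z) (hat u)) (hat \<phi>) = inner (hat u) (mop (omul z) (hat \<phi>))"
      by (rule mop_symmetric) (simp_all add: omul_dom, simp add: omul_def)
    then show ?thesis by (simp add: inner_hartley)
  qed
  finally show "inner (2 *\<^sub>R cls u - cls (\<lambda>x. u (x + z)) - cls (\<lambda>x. u (x - z))) (cls \<phi>) = inner (hartley (mop (omul z) (hat u))) (cls \<phi>)"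
    by (simp add: inner_hartley)
qed

text \<open>After expansion of the square, translation invariance turns the norm of a difference
  into the inner product of u with its second difference.\<close>

lemma difference_norm:
  fixes u :: "'n field"
  assumes um[measurable]: "u \<in> borel_measurable borel" and u: "u \<in> L2"
  shows "(norm (cls u - cls (\<lambda>x. u (x - z))))\<^sup>2 = inner (mop (omul z) (hat u)) (hat u)"
proof -
  have sL: "(\<lambda>x. u (x + y)) \<in> L2" "(\<lambda>x. u (x - y)) \<in> L2" for y
    using L2_shift[OF um u, of y] L2_shift[OF um u, of "- y"] by auto
  have i: "inner (cls (\<lambda>x. u (x - z))) (cls (\<lambda>x. u (x - z))) = inner (cls u) (cls u)"
    using lborel_integral_shift[of "\<lambda>x. u x \<bullet> u x" "- z"] by (simp add: inner_cls sL u integral_completion)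
  have c: "inner (cls u) (cls (\<lambda>x. u (x - z))) = inner (cls u) (cls (\<lambda>x. u (x + z)))"
    using lborel_integral_shift[of "\<lambda>x. u x \<bullet> u (x - z)" z] by (simp add: inner_cls sL u integral_completion inner_commute)
  have "(norm (cls u - cls (\<lambda>x. u (x - z))))\<^sup>2 = inner (cls u) (2 *\<^sub>R cls u - cls (\<lambda>x. u (x + z)) - cls (\<lambda>x. u (x - z)))"
    by (simp add: power2_norm_eq_inner inner_diff_left inner_diff_right i c inner_commute[of "cls (\<lambda>x. u (x - z))" "cls u"])
  then show ?thesis unfolding second_difference_L2[OF um u] by (simp add: inner_hartley inner_commute)
qed

text \<open>Plancherel's identity for the component of a difference along e. It is stated with
  nonnegative integrals so that integration over z can follow by Tonelli's theorem.\<close>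

lemma nn_integral_difference:
  fixes u :: "'n field"
  assumes um[measurable]: "u \<in> borel_measurable borel" and u: "u \<in> L2" and e: "norm e = 1"
  shows "(\<integral>\<^sup>+x. ennreal (((u x - u (x - z)) \<bullet> e)\<^sup>2) \<partial>lborel) =
    (\<integral>\<^sup>+xi. ennreal (2 * om z xi * (e \<bullet> rep (hat u) xi)\<^sup>2) \<partial>lebesgue)"
proof -
  define w where "w x = proj e (u x)" for x
  define U where "U = rep (hat u)"
  have wm[measurable]: "w \<in> borel_measurable borel" unfolding w_def[abs_def] by (rule measurable_compose[OF um proj_borel])
  have w: "w \<in> L2" unfolding w_def by (rule L2_proj[OF u])
  have wz: "(\<lambda>x. w (x - z)) \<in> L2" using L2_shift[OF wm w, of "- z"] by simp
  have UL: "U \<in> L2" "(\<lambda>xi. proj e (U xi)) \<in> L2" unfolding U_def by (simp_all add: L2_proj)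
  define V where "V = hat w"
  have V: "AE xi in lebesgue. rep V xi = proj e (U xi)"
    unfolding V_def w_def[abs_def] hartley_proj[OF u] U_def[symmetric] by (rule rep_cls[OF UL(2)])
  have "((u x - u (x - z)) \<bullet> e)\<^sup>2 = (norm (w x - w (x - z)))\<^sup>2" for x
  proof -
    have "w x - w (x - z) = proj e (u x - u (x - z))" by (simp add: w_def linear_diff[OF linear_proj])
    then show ?thesis by (simp add: norm_proj[OF e] inner_commute[of e])
  qed
  then have "(\<integral>\<^sup>+x. ennreal (((u x - u (x - z)) \<bullet> e)\<^sup>2) \<partial>lborel) = (\<integral>\<^sup>+x. ennreal ((norm (w x - w (x - z)))\<^sup>2) \<partial>lebesgue)"
    by (simp add: nn_integral_completion)
  also have "\<dots> = (\<integral>\<^sup>+x. ennreal ((norm (rep (cls w - cls (\<lambda>x. w (x - z))) x))\<^sup>2) \<partial>lebesgue)"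
    using rep_cls[OF L2_diff[OF w wz]] unfolding cls_diff[OF w wz]
    by (intro nn_integral_cong_AE) (auto elim!: eventually_mono)
  also have "\<dots> = ennreal (inner (mop (omul z) V) V)"
    unfolding nn_integral_rep difference_norm[OF wm w] V_def ..
  also have "\<dots> = ennreal (LINT xi|lebesgue. omul z xi (rep V xi) \<bullet> rep V xi)"
    unfolding inner_mop[OF omul_dom[of V z, simplified]] ..
  also have "\<dots> = (\<integral>\<^sup>+xi. ennreal (omul z xi (rep V xi) \<bullet> rep V xi) \<partial>lebesgue)"
  proof (rule nn_integral_eq_integral[symmetric])
    have "V \<in> mdom (omul z)" by (rule omul_dom) simp
    then show "integrable lebesgue (\<lambda>xi. omul z xi (rep V xi) \<bullet> rep V xi)"
      by (intro L2_integrable_inner) (simp_all add: mdom_def)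
    show "AE xi in lebesgue. 0 \<le> omul z xi (rep V xi) \<bullet> rep V xi" by (simp add: omul_def om_nonneg)
  qed
  also have "\<dots> = (\<integral>\<^sup>+xi. ennreal (2 * om z xi * (e \<bullet> U xi)\<^sup>2) \<partial>lebesgue)"
  proof (rule nn_integral_cong_AE)
    show "AE xi in lebesgue. ennreal (omul z xi (rep V xi) \<bullet> rep V xi) = ennreal (2 * om z xi * (e \<bullet> U xi)\<^sup>2)"
      using V by eventually_elim (simp add: omul_def power2_norm_eq_inner[symmetric] norm_proj[OF e])
  qed
  finally show ?thesis unfolding U_def .
qed

end

lemma lborel_reflect: "distr lborel borel (\<lambda>y. x - y) = (lborel :: (real^'n::finite) measure)"
proof -
  have T: "(\<lambda>y::real^'n. x + (\<Sum>j\<in>Basis. (- 1 * (y \<bullet> j)) *\<^sub>R j)) = (\<lambda>y. x - y)"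
    by (simp add: sum_negf euclidean_representation fun_eq_iff)
  have "lborel = density (distr lborel borel (\<lambda>y::real^'n. x - y)) (\<lambda>_. ennreal (\<Prod>j\<in>(Basis :: (real^'n) set). \<bar>- 1\<bar>))"
    by (rule lborel_affine_euclidean[where c="\<lambda>_. - 1" and t=x, unfolded T]) simp
  then show ?thesis by (simp add: density_1)
qed

lemma nn_integral_reflect:
  fixes x :: "real^'n::finite"
  assumes [measurable]: "f \<in> borel_measurable borel"
  shows "(\<integral>\<^sup>+y. f (x - y) \<partial>lborel) = (\<integral>\<^sup>+y. f y \<partial>lborel)"
proof -
  have "(\<integral>\<^sup>+y. f y \<partial>distr lborel borel (\<lambda>y. x - y)) = (\<integral>\<^sup>+y. f (x - y) \<partial>lborel)"
    by (rule nn_integral_distr) auto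
  then show ?thesis unfolding lborel_reflect by simp
qed

lemma AE_reflect:
  fixes x :: "real^'n::finite"
  assumes "AE y in lborel. P y"
  shows "AE y in lborel. P (x - y)"
proof -
  have "AE y in distr lborel borel (\<lambda>y. x - y). P y" unfolding lborel_reflect by (rule assms)
  then show ?thesis by (rule AE_distrD[rotated]) simp
qed

lemma AE_lebesgue_iff: "(AE x in lebesgue. P x) \<longleftrightarrow> (AE x in lborel. P x)"
  by (rule AE_completion_iff)

lemma lebesgue_ex_borel:
  fixes u :: "'a::euclidean_space \<Rightarrow> real^'n::finite"
  assumes u: "u \<in> borel_measurable lebesgue"
  shows "\<exists>u'\<in>borel_measurable borel. AE x in lborel. u x = u' x"
proof -
  have "\<exists>g\<in>borel_measurable lborel. AE x in lborel. u x $ i = g x" for i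
    by (rule completion_ex_borel_measurable_real)
      (rule measurable_compose[OF u borel_measurable_continuous_onI[OF linear_continuous_on[OF bounded_linear_vec_nth]]])
  then obtain g where g: "\<And>i. g i \<in> borel_measurable lborel" "\<And>i. AE x in lborel. u x $ i = g i x" by metis
  show ?thesis
  proof
    show "(\<lambda>x. \<chi> i. g i x) \<in> borel_measurable borel"
      using g(1) by (intro field_measurableI) simp
    have "AE x in lborel. \<forall>i\<in>UNIV. u x $ i = g i x" using g(2) by (intro AE_finite_allI) auto
    then show "AE x in lborel. u x = (\<chi> i. g i x)" by eventually_elim (simp add: vec_eq_iff)
  qed
qed

lemma integral_enn2real_eq:
  assumes [measurable]: "g \<in> borel_measurable M" and g: "(\<integral>\<^sup>+x. g x \<partial>M) = ennreal c" and c: "0 \<le> c"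
  shows "(LINT x|M. enn2real (g x)) = c"
proof -
  have "AE x in M. g x \<noteq> \<infinity>" by (rule nn_integral_PInf_AE) (simp_all add: g)
  then have "(\<integral>\<^sup>+x. ennreal (enn2real (g x)) \<partial>M) = (\<integral>\<^sup>+x. g x \<partial>M)"
    by (intro nn_integral_cong_AE) (auto elim!: eventually_mono simp: less_top)
  moreover have "(LINT x|M. enn2real (g x)) = enn2real (\<integral>\<^sup>+x. ennreal (enn2real (g x)) \<partial>M)"
    by (rule integral_eq_nn_integral) auto
  ultimately show ?thesis using g c by simp
qed

context even_kernel
begin

text \<open>Written as an integral so that it is available on the form domain, given by the weight
  of order s, where \<open>mop symb\<close> need not be meaningful.\<close>

definition sform :: "'n Lt \<Rightarrow> real" where
  "sform X = (LINT xi|lebesgue. symb xi (rep X xi) \<bullet> rep X xi)"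

lemma sform_integrable:
  assumes X: "X \<in> mdom (wmul s)"
  shows "integrable lebesgue (\<lambda>xi. symb xi (rep X xi) \<bullet> rep X xi)"
proof (rule Bochner_Integration.integrable_bound)
  have "(\<lambda>xi. wmul s xi (rep X xi)) \<in> L2" using X by (simp add: mdom_def)
  then show "integrable lebesgue (\<lambda>xi. Csymb * (norm (wmul s xi (rep X xi)))\<^sup>2)"
    by (intro integrable_mult_right L2_integrable)
  show "(\<lambda>xi. symb xi (rep X xi) \<bullet> rep X xi) \<in> borel_measurable lebesgue"
    by (intro borel_measurable_inner multiplier_rep multiplier_symb L2_measurable rep_L2)
  show "AE xi in lebesgue. norm (symb xi (rep X xi) \<bullet> rep X xi) \<le> norm (Csymb * (norm (wmul s xi (rep X xi)))\<^sup>2)"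
  proof (rule AE_I2)
    fix xi
    have "\<bar>symb xi (rep X xi) \<bullet> rep X xi\<bar> \<le> norm (symb xi (rep X xi)) * norm (rep X xi)" by (rule Cauchy_Schwarz_ineq2)
    also have "\<dots> \<le> (Csymb * wt (2 * s) xi * norm (rep X xi)) * norm (rep X xi)" by (intro mult_right_mono symb_le) simp
    also have "\<dots> = Csymb * (norm (wmul s xi (rep X xi)))\<^sup>2"
      using wt_pos[of s xi] wt_add[of s s xi] by (simp add: wmul_def power2_eq_square mult_ac)
    finally show "norm (symb xi (rep X xi) \<bullet> rep X xi) \<le> norm (Csymb * (norm (wmul s xi (rep X xi)))\<^sup>2)"
      using Csymb_nonneg by simp
  qed
qed

lemma sform_mop: "X \<in> mdom symb \<Longrightarrow> inner (mop symb X) X = sform X"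
  unfolding sform_def by (rule inner_mop)

text \<open>Substitute y = x - z and exchange the integrals. For fixed z,
  \<open>nn_integral_difference\<close> in the direction of z turns the integral over x into one
  over frequencies; after a second exchange the integral over z is twice the form of the symbol at
  that frequency.\<close>

theorem pair_energy:
  assumes u: "u \<in> L2" and X: "hat u \<in> mdom (wmul s)"
  shows "(\<integral>\<^sup>+x. \<integral>\<^sup>+y. ennreal (pair_density \<rho> u x y) \<partial>lebesgue \<partial>lebesgue) = ennreal (2 * sform (hat u))"
    and "(LINT x|lebesgue. LINT y|lebesgue. pair_density \<rho> u x y) = 2 * sform (hat u)"
proof -
  \<comment> \<open>Borel versions of kernel and field provide joint measurability in both
    variables. The maximum with 0 restores nonnegativity on the null set where the version may
    differ from \<open>\<rho>\<close>.\<close>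
  obtain r where rm[measurable]: "r \<in> borel_measurable borel" and r: "AE x in lborel. \<rho> x = r x"
    using completion_ex_borel_measurable_real[OF \<rho>_measurable] by auto
  define \<rho>' where "\<rho>' x = max 0 (r x)" for x
  have [measurable]: "\<rho>' \<in> borel_measurable borel" unfolding \<rho>'_def[abs_def] by measurable
  have \<rho>': "AE x in lborel. \<rho> x = \<rho>' x" using r
  proof eventually_elim
    case (elim x)
    then show ?case using \<rho>_nonneg[of x] by (simp add: \<rho>'_def)
  qed
  have \<rho>'0: "0 \<le> \<rho>' x" for x by (simp add: \<rho>'_def)
  obtain u' where um[measurable]: "u' \<in> borel_measurable borel" and u': "AE x in lborel. u x = u' x"
    using lebesgue_ex_borel[OF L2_measurable[OF u]] by blast
  have u'l: "AE x in lebesgue. u x = u' x" unfolding AE_lebesgue_iff by (rule u')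
  have u'L: "u' \<in> L2" by (rule L2_cong_AE[OF u borel_measurable_lebesgueI[OF um] u'l]) simp
  have cu: "cls u' = cls u" by (rule cls_eqI[OF u u'L u'l, symmetric])
  define U where "U = rep (hat u)"
  define P where "P x y = pair_density \<rho>' u' x y" for x y
  have P0: "0 \<le> P x y" for x y unfolding P_def pair_density_def by (intro mult_nonneg_nonneg \<rho>'0) simp
  have Pm[measurable]: "(\<lambda>p. P (fst p) (snd p)) \<in> borel_measurable (lborel \<Otimes>\<^sub>M lborel)"
    unfolding P_def pair_density_def by measurable
  have Pm': "P x \<in> borel_measurable borel" for x unfolding P_def[abs_def] pair_density_def by measurable
  define T where "T x = (\<integral>\<^sup>+y. ennreal (P x y) \<partial>lborel)" for x
  have Tm[measurable]: "T \<in> borel_measurable borel"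
  proof -
    have "(\<lambda>p. ennreal (P (fst p) (snd p))) \<in> borel_measurable (lborel \<Otimes>\<^sub>M lborel)" by measurable
    from lborel.borel_measurable_nn_integral_fst[OF this] show ?thesis unfolding T_def[abs_def] by simp
  qed
  have ae: "AE x in lborel. AE y in lborel. pair_density \<rho> u x y = P x y"
    using u'
  proof eventually_elim
    case (elim x)
    show ?case using AE_reflect[OF \<rho>', of x] u'
      by eventually_elim (simp add: P_def pair_density_def elim)
  qed
  \<comment> \<open>If the inner integral is infinite, the Bochner integral and
    \<open>enn2real\<close> both give 0, so the second identity does not depend on
    finiteness.\<close>
  have inner: "AE x in lborel. (\<integral>\<^sup>+y. ennreal (pair_density \<rho> u x y) \<partial>lebesgue) = T x \<and>
    (LINT y|lebesgue. pair_density \<rho> u x y) = enn2real (T x)"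
    using ae
  proof eventually_elim
    case (elim x)
    have n: "(\<integral>\<^sup>+y. ennreal (pair_density \<rho> u x y) \<partial>lebesgue) = T x"
      unfolding nn_integral_completion T_def by (rule nn_integral_cong_AE) (use elim in eventually_elim, simp)
    have "pair_density \<rho> u x \<in> borel_measurable lebesgue"
      by (rule measurable_cong_AE_lebesgue[OF borel_measurable_lebesgueI[OF Pm']])
        (use elim in \<open>auto simp: AE_lebesgue_iff elim!: eventually_mono\<close>)
    then have "(LINT y|lebesgue. pair_density \<rho> u x y) = enn2real (T x)"
      unfolding n[symmetric] by (rule integral_eq_nn_integral) (simp add: pair_density_def \<rho>_nonneg)
    with n show ?case by simp
  qed
  interpret L: sigma_finite_measure "lebesgue :: (real^'n) measure" by (rule sigma_finite_lebesgue)
  interpret C: pair_sigma_finite "lborel :: (real^'n) measure" "lebesgue :: (real^'n) measure" ..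
  define G where "G z xi = 2 * (\<rho>' z * (om z xi * ((z \<bullet> U xi) * (z \<bullet> U xi) / (norm z)\<^sup>2)))" for z xi
  have U: "U \<in> L2" "U \<in> borel_measurable lebesgue" unfolding U_def by (simp_all add: L2_measurable)
  have Gm: "(\<lambda>(z, xi). ennreal (G z xi)) \<in> borel_measurable (lborel \<Otimes>\<^sub>M lebesgue)"
  proof -
    note [measurable] = U(2) measurable_ident_lebesgue
    have [measurable]: "snd \<in> lborel \<Otimes>\<^sub>M lebesgue \<rightarrow>\<^sub>M (borel :: (real^'n) measure)"
      by (rule measurable_compose[OF measurable_snd measurable_ident_lebesgue])
    have [measurable]: "(\<lambda>p. U (snd p)) \<in> borel_measurable ((lborel :: (real^'n) measure) \<Otimes>\<^sub>M lebesgue)"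
      by (rule measurable_compose[OF measurable_snd U(2)])
    show ?thesis unfolding G_def case_prod_beta' by measurable
  qed
  have diff: "(\<integral>\<^sup>+x. ennreal (P x (x - z)) \<partial>lborel) = (\<integral>\<^sup>+xi. ennreal (G z xi) \<partial>lebesgue)" for z
  proof (cases "z = 0")
    case True
    then show ?thesis by (simp add: P_def pair_density_def G_def)
  next
    case False
    define e where "e = z /\<^sub>R norm z"
    have e: "norm e = 1" using False by (simp add: e_def)
    have "(\<integral>\<^sup>+x. ennreal (P x (x - z)) \<partial>lborel) = (\<integral>\<^sup>+x. ennreal (\<rho>' z) * ennreal (((u' x - u' (x - z)) \<bullet> e)\<^sup>2) \<partial>lborel)"
      by (simp add: P_def pair_density_def e_def ennreal_mult'' )
    also have "\<dots> = ennreal (\<rho>' z) * (\<integral>\<^sup>+xi. ennreal (2 * om z xi * (e \<bullet> U xi)\<^sup>2) \<partial>lebesgue)"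
      unfolding U_def cu[symmetric] nn_integral_difference[OF um u'L e, symmetric] by (rule nn_integral_cmult) measurable
    also have "\<dots> = (\<integral>\<^sup>+xi. ennreal (\<rho>' z) * ennreal (2 * om z xi * (e \<bullet> U xi)\<^sup>2) \<partial>lebesgue)"
    proof (rule nn_integral_cmult[symmetric])
      note [measurable] = U(2) measurable_ident_lebesgue
      show "(\<lambda>xi. ennreal (2 * om z xi * (e \<bullet> U xi)\<^sup>2)) \<in> borel_measurable lebesgue" by measurable
    qed
    also have "\<dots> = (\<integral>\<^sup>+xi. ennreal (G z xi) \<partial>lebesgue)"
    proof (rule nn_integral_cong)
      fix xi
      have "\<rho>' z * (2 * om z xi * (e \<bullet> U xi)\<^sup>2) = G z xi"
        using False by (simp add: G_def e_def power_mult_distrib power_inverse divide_inverse power2_eq_square)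
      then show "ennreal (\<rho>' z) * ennreal (2 * om z xi * (e \<bullet> U xi)\<^sup>2) = ennreal (G z xi)"
        using \<rho>'0[of z] by (simp add: ennreal_mult'[symmetric])
    qed
    finally show ?thesis .
  qed
  have "(\<integral>\<^sup>+x. T x \<partial>lborel) = (\<integral>\<^sup>+x. \<integral>\<^sup>+z. ennreal (P x (x - z)) \<partial>lborel \<partial>lborel)"
    unfolding T_def by (intro nn_integral_cong nn_integral_reflect[symmetric]) (use Pm' in measurable)
  also have "\<dots> = (\<integral>\<^sup>+z. \<integral>\<^sup>+x. ennreal (P x (x - z)) \<partial>lborel \<partial>lborel)"
    by (rule lborel_pair.Fubini') (unfold P_def pair_density_def, measurable)
  also have "\<dots> = (\<integral>\<^sup>+z. \<integral>\<^sup>+xi. ennreal (G z xi) \<partial>lebesgue \<partial>lborel)" unfolding diff ..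
  also have "\<dots> = (\<integral>\<^sup>+xi. \<integral>\<^sup>+z. ennreal (G z xi) \<partial>lborel \<partial>lebesgue)"
    by (rule C.Fubini'[OF Gm, symmetric])
  also have "\<dots> = (\<integral>\<^sup>+xi. ennreal (2 * (symb xi (U xi) \<bullet> U xi)) \<partial>lebesgue)"
  proof (rule nn_integral_cong)
    fix xi
    define g where "g z = 2 * (\<rho> z * (om z xi * ((z \<bullet> U xi) * (z \<bullet> U xi) / (norm z)\<^sup>2)))" for z
    have "(\<integral>\<^sup>+z. ennreal (G z xi) \<partial>lborel) = (\<integral>\<^sup>+z. ennreal (g z) \<partial>lborel)"
      by (rule nn_integral_cong_AE) (use \<rho>' in eventually_elim, simp add: G_def g_def)
    also have "\<dots> = (\<integral>\<^sup>+z. ennreal (g z) \<partial>lebesgue)" by (simp only: nn_integral_completion)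
    also have "\<dots> = ennreal (LINT z|lebesgue. g z)"
    proof (rule nn_integral_eq_integral)
      have "integrable lebesgue (\<lambda>z. 2 * ((\<rho> z *\<^sub>R (om z xi *\<^sub>R dyad z (U xi))) \<bullet> U xi))"
        by (intro integrable_mult_right integrable_inner_left symb_integrable)
      then show "integrable lebesgue g" by (simp add: g_def[abs_def] inner_dyad mult_ac)
      show "AE z in lebesgue. 0 \<le> g z"
        unfolding g_def by (intro AE_I2 mult_nonneg_nonneg \<rho>_nonneg om_nonneg) simp_all
    qed
    also have "(LINT z|lebesgue. g z) = 2 * (symb xi (U xi) \<bullet> U xi)" unfolding g_def inner_symb by (rule integral_mult_right_zero)
    finally show "(\<integral>\<^sup>+z. ennreal (G z xi) \<partial>lborel) = ennreal (2 * (symb xi (U xi) \<bullet> U xi))" .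
  qed
  also have "\<dots> = ennreal (2 * sform (hat u))"
    unfolding sform_def U_def
    by (subst nn_integral_eq_integral) (auto intro!: sform_integrable[OF X] symb_nonneg)
  finally have T: "(\<integral>\<^sup>+x. T x \<partial>lborel) = ennreal (2 * sform (hat u))" .
  have "(\<integral>\<^sup>+x. \<integral>\<^sup>+y. ennreal (pair_density \<rho> u x y) \<partial>lebesgue \<partial>lebesgue) = (\<integral>\<^sup>+x. T x \<partial>lborel)"
    unfolding nn_integral_completion[of lborel "\<lambda>x. \<integral>\<^sup>+y. _ x y \<partial>lebesgue"]
    by (rule nn_integral_cong_AE) (use inner in eventually_elim, simp)
  with T show "(\<integral>\<^sup>+x. \<integral>\<^sup>+y. ennreal (pair_density \<rho> u x y) \<partial>lebesgue \<partial>lebesgue) = ennreal (2 * sform (hat u))" by simp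
  have Tl: "(\<lambda>x. enn2real (T x)) \<in> borel_measurable lebesgue" by (rule borel_measurable_lebesgueI[of _ borel]) auto
  have ai: "AE x in lebesgue. enn2real (T x) = (LINT y|lebesgue. pair_density \<rho> u x y)"
    unfolding AE_lebesgue_iff using inner by eventually_elim simp
  have "(LINT x|lebesgue. LINT y|lebesgue. pair_density \<rho> u x y) = (LINT x|lebesgue. enn2real (T x))"
    by (rule integral_cong_AE[OF Tl measurable_cong_AE_lebesgue[OF Tl ai] ai, symmetric])
  also have "\<dots> = (LINT x|lborel. enn2real (T x))" by (rule integral_completion) measurable
  also have "\<dots> = 2 * sform (hat u)"
  proof (rule integral_enn2real_eq[OF _ T])
    show "0 \<le> 2 * sform (hat u)"
      unfolding sform_def by (intro mult_nonneg_nonneg Bochner_Integration.integral_nonneg symb_nonneg) simp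
  qed measurable
  finally show "(LINT x|lebesgue. LINT y|lebesgue. pair_density \<rho> u x y) = 2 * sform (hat u)" .
qed

end

section \<open>Curves of fields as curves in the Hilbert space\<close>

section \<open>Curves\<close>

text \<open>\<open>norm_map X N \<Phi>\<close> identifies \<open>X\<close> with norm \<open>N\<close>, up to null sets, with a subspace of the
  quotient space.\<close>

definition norm_map :: "'n::finite field set \<Rightarrow> ('n field \<Rightarrow> real) \<Rightarrow> ('n field \<Rightarrow> 'n Lt) \<Rightarrow> bool" where
  "norm_map X N \<Phi> \<longleftrightarrow> (\<forall>u\<in>X. N u = norm (\<Phi> u) \<and>
     (\<forall>v\<in>X. (\<lambda>x. u x - v x) \<in> X \<and> \<Phi> (\<lambda>x. u x - v x) = \<Phi> u - \<Phi> v) \<and>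
     (\<forall>c. (\<lambda>x. c *\<^sub>R u x) \<in> X \<and> \<Phi> (\<lambda>x. c *\<^sub>R u x) = c *\<^sub>R \<Phi> u))"

lemma norm_map_L2: "norm_map L2 L2_norm cls"
  by (simp add: norm_map_def norm_cls L2_diff L2_scaleR cls_diff cls_scaleR)

lemma hartley_scaleR: "hartley (c *\<^sub>R X) = c *\<^sub>R hartley X"
  by (rule linear_cmul[OF bounded_linear.linear[OF bounded_linear_hartley]])

lemma hartley_add: "hartley (X + Y) = hartley X + hartley Y"
  by (rule linear_add[OF bounded_linear.linear[OF bounded_linear_hartley]])

lemma norm_map_sobolev:
  assumes "0 \<le> \<sigma>"
  shows "norm_map (sobolev \<sigma>) (sobolev_norm \<sigma>) (\<lambda>u. mop (wmul \<sigma>) (hat u))"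
  unfolding norm_map_def
  by (auto simp: sobolev_iff[OF assms] sobolev_norm_eq[OF assms] L2_diff L2_scaleR cls_diff cls_scaleR hartley_diff hartley_scaleR
      mop_diff[OF multiplier_wmul] mop_scaleR[OF multiplier_wmul])

lemma curve_C0_iff:
  assumes "norm_map X N \<Phi>"
  shows "curve_C0 X N T u \<longleftrightarrow> (\<forall>t\<in>{0..T}. u t \<in> X) \<and> continuous_on {0..T} (\<lambda>t. \<Phi> (u t))"
proof -
  have "((\<lambda>\<tau>. N (\<lambda>x. u \<tau> x - u t x)) \<longlongrightarrow> 0) (at t within {0..T}) \<longleftrightarrow> ((\<lambda>\<tau>. \<Phi> (u \<tau>)) \<longlongrightarrow> \<Phi> (u t)) (at t within {0..T})"
    if u: "\<forall>t\<in>{0..T}. u t \<in> X" and t: "t \<in> {0..T}" for t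
  proof -
    have "\<forall>\<^sub>F \<tau> in at t within {0..T}. N (\<lambda>x. u \<tau> x - u t x) = norm (\<Phi> (u \<tau>) - \<Phi> (u t))"
      unfolding eventually_at_filter using assms u t by (intro always_eventually) (auto simp: norm_map_def)
    from tendsto_cong[OF this] show ?thesis by (simp only: tendsto_norm_zero_iff LIM_zero_iff)
  qed
  then show ?thesis unfolding curve_C0_def continuous_on_def by blast
qed

lemma curve_deriv_iff:
  assumes m: "norm_map X N \<Phi>" and u: "\<forall>t\<in>{0..T}. u t \<in> X" "\<forall>t\<in>{0..T}. u' t \<in> X"
  shows "curve_deriv N T u u' \<longleftrightarrow> (\<forall>t\<in>{0..T}. vderiv T (\<lambda>t. \<Phi> (u t)) (\<Phi> (u' t)) t)"
proof -
  have "((\<lambda>\<tau>. N (\<lambda>x. (u \<tau> x - u t x) /\<^sub>R (\<tau> - t) - u' t x)) \<longlongrightarrow> 0) (at t within {0..T}) \<longleftrightarrow>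
    vderiv T (\<lambda>t. \<Phi> (u t)) (\<Phi> (u' t)) t" if t: "t \<in> {0..T}" for t
  proof -
    have "N (\<lambda>x. (u \<tau> x - u t x) /\<^sub>R (\<tau> - t) - u' t x) = norm (\<Phi> (u \<tau>) - \<Phi> (u t) - (\<tau> - t) *\<^sub>R \<Phi> (u' t)) / norm (\<tau> - t)"
      if \<tau>: "\<tau> \<in> {0..T}" "\<tau> \<noteq> t" for \<tau>
    proof -
      have "(\<lambda>x. u \<tau> x - u t x) \<in> X" "\<Phi> (\<lambda>x. u \<tau> x - u t x) = \<Phi> (u \<tau>) - \<Phi> (u t)"
        using m u \<tau> t by (auto simp: norm_map_def)
      then have "(\<lambda>x. (u \<tau> x - u t x) /\<^sub>R (\<tau> - t)) \<in> X" "\<Phi> (\<lambda>x. (u \<tau> x - u t x) /\<^sub>R (\<tau> - t)) = (\<Phi> (u \<tau>) - \<Phi> (u t)) /\<^sub>R (\<tau> - t)"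
        using m unfolding norm_map_def by metis+
      then have "N (\<lambda>x. (u \<tau> x - u t x) /\<^sub>R (\<tau> - t) - u' t x) = norm ((\<Phi> (u \<tau>) - \<Phi> (u t)) /\<^sub>R (\<tau> - t) - \<Phi> (u' t))"
        using m u t by (auto simp: norm_map_def)
      also have "(\<Phi> (u \<tau>) - \<Phi> (u t)) /\<^sub>R (\<tau> - t) - \<Phi> (u' t) = (\<Phi> (u \<tau>) - \<Phi> (u t) - (\<tau> - t) *\<^sub>R \<Phi> (u' t)) /\<^sub>R (\<tau> - t)"
        using \<tau> by (simp add: scaleR_diff_right)
      finally show ?thesis by (simp add: divide_inverse)
    qed
    then have "\<forall>\<^sub>F \<tau> in at t within {0..T}. N (\<lambda>x. (u \<tau> x - u t x) /\<^sub>R (\<tau> - t) - u' t x)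
        = norm (\<Phi> (u \<tau>) - \<Phi> (u t) - (\<tau> - t) *\<^sub>R \<Phi> (u' t)) / norm (\<tau> - t)"
      unfolding eventually_at_filter by (intro always_eventually) simp
    from tendsto_cong[OF this] show ?thesis
      unfolding has_vector_derivative_def has_derivative_iff_norm
      by (simp add: bounded_linear_scaleR_left)
  qed
  then show ?thesis unfolding curve_deriv_def by blast
qed

lemmas L2_C0_iff = curve_C0_iff[OF norm_map_L2]
lemmas L2_deriv_iff = curve_deriv_iff[OF norm_map_L2]

text \<open>The Hartley transform is bounded, linear and its own inverse, so continuity and
  differentiability may be read on the frequency side.\<close>

lemma L2_curve_deriv_iff:
  assumes "\<forall>t\<in>{0..T}. u t \<in> L2"
  shows "L2_curve_deriv T u u' \<longleftrightarrow> (\<forall>t\<in>{0..T}. u' t \<in> L2) \<and> continuous_on {0..T} (\<lambda>t. hat (u' t)) \<and>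
    (\<forall>t\<in>{0..T}. vderiv T (\<lambda>t. hat (u t)) (hat (u' t)) t)"
proof -
  have c: "continuous_on {0..T} (\<lambda>t. hartley (g t)) \<longleftrightarrow> continuous_on {0..T} g" for g :: "real \<Rightarrow> 'a Lt"
    using bounded_linear.continuous_on[OF bounded_linear_hartley, of "{0..T}" g]
      bounded_linear.continuous_on[OF bounded_linear_hartley, of "{0..T}" "\<lambda>t. hartley (g t)"] by auto
  have d: "((\<lambda>t. hartley (g t)) has_vector_derivative hartley g') F \<longleftrightarrow> (g has_vector_derivative g') F"
    for g :: "real \<Rightarrow> 'a Lt" and g' F
    using bounded_linear.has_vector_derivative[OF bounded_linear_hartley, of g g' F]
      bounded_linear.has_vector_derivative[OF bounded_linear_hartley, of "\<lambda>t. hartley (g t)" "hartley g'" F] by auto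
  show ?thesis unfolding L2_curve_deriv_def L2_C0_iff c d using L2_deriv_iff[OF assms] by blast
qed

section \<open>Truncation to frequency balls and the truncated wave operator\<close>

section \<open>Band truncation\<close>

definition band_bounded :: "(real^'n::finite \<Rightarrow> real^'n \<Rightarrow> real^'n) \<Rightarrow> bool" where
  "band_bounded m \<longleftrightarrow> multiplier m \<and> (\<forall>k. \<exists>B\<ge>0. \<forall>xi v. norm (band k m xi v) \<le> B * norm v)"

lemma band_boundedI:
  assumes "multiplier m" "0 \<le> \<sigma>" "0 \<le> C" "\<And>xi v. norm (m xi v) \<le> C * norm (wmul \<sigma> xi v)"
  shows "band_bounded m"
  unfolding band_bounded_def
proof (intro conjI allI assms(1))
  fix k
  define M where "M = (1 + 4 * pi\<^sup>2 * (real k)\<^sup>2) powr (\<sigma> / 2)"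
  have "norm (band k m xi v) \<le> (C * M) * norm v" for xi v
  proof (cases "xi \<in> cball 0 (real k)")
    case True
    then have "wt \<sigma> xi \<le> M" unfolding wt_def M_def using assms(2)
      by (intro powr_mono2 add_left_mono mult_left_mono power_mono) (auto intro!: add_nonneg_nonneg)
    then have "norm (wmul \<sigma> xi v) \<le> M * norm v" using wt_pos[of \<sigma> xi] by (simp add: wmul_def mult_right_mono)
    from order.trans[OF assms(4) mult_left_mono[OF this assms(3)]] True show ?thesis by (simp add: band_def mult.assoc)
  next
    case False
    then show ?thesis using assms(3) by (simp add: band_def M_def)
  qed
  moreover have "0 \<le> C * M" using assms(3) by (simp add: M_def)
  ultimately show "\<exists>B\<ge>0. \<forall>xi v. norm (band k m xi v) \<le> B * norm v" by blast
qed

lemma band_bounded_dom: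
  assumes "band_bounded m"
  shows "X \<in> mdom (band k m)" "bounded_linear (mop (band k m))" "multiplier (band k m)"
proof -
  show m: "multiplier (band k m)" using assms by (simp add: band_bounded_def multiplier_band)
  obtain B where B: "B \<ge> 0" "\<And>xi v. norm (band k m xi v) \<le> B * norm v" using assms unfolding band_bounded_def by blast
  show "X \<in> mdom (band k m)" "bounded_linear (mop (band k m))"
    using mop_bounded[OF m B(2) B(1)] by auto
qed

abbreviation cut :: "nat \<Rightarrow> 'n::finite Lt \<Rightarrow> 'n Lt" where
  "cut k \<equiv> mop (band k (\<lambda>xi v. v))"

lemma wmul_0: "wmul 0 xi v = v"
  using weight_pos[of xi] by (auto simp: wmul_def wt_def)

lemma multiplier_id: "multiplier (\<lambda>xi v. v)"
  using multiplier_wmul[of 0] by (simp add: wmul_0[abs_def])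

lemma band_bounded_id: "band_bounded (\<lambda>xi v. v)"
  by (rule band_boundedI[OF multiplier_id, of 0 1]) (simp_all add: wmul_0)

lemma cut_mop:
  assumes m: "band_bounded m" and jk: "j \<le> k"
  shows "cut j (mop (band k m) X) = mop (band j m) X" "mop (band k m) (cut j X) = mop (band j m) X"
proof -
  note r = rep_mop[OF band_bounded_dom(1)[OF m]] rep_mop[OF band_bounded_dom(1)[OF band_bounded_id]]
  have i: "indicator (cball 0 (real j)) xi * indicator (cball 0 (real k)) xi = (indicator (cball 0 (real j)) xi :: real)" for xi :: "real^'a"
    using jk by (auto simp: indicator_def)
  have lin: "linear (m xi)" for xi using m by (simp add: band_bounded_def multiplierD)
  show "cut j (mop (band k m) X) = mop (band j m) X"
  proof (rule Lt_eqI)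
    show "AE xi in lebesgue. rep (cut j (mop (band k m) X)) xi = rep (mop (band j m) X) xi"
      using r(1)[of k X] r(1)[of j X] r(2)[of j "mop (band k m) X"]
      by eventually_elim (simp add: band_def i)
  qed
  show "mop (band k m) (cut j X) = mop (band j m) X"
  proof (rule Lt_eqI)
    show "AE xi in lebesgue. rep (mop (band k m) (cut j X)) xi = rep (mop (band j m) X) xi"
      using r(1)[of k "cut j X"] r(1)[of j X] r(2)[of j X]
      by eventually_elim (simp add: band_def linear_cmul[OF lin] i mult.commute)
  qed
qed

lemma band_limit:
  assumes m: "band_bounded m" and lim: "(\<lambda>k. mop (band k m) X) \<longlonglongrightarrow> Y"
  shows "X \<in> mdom m" "mop m X = Y"
proof -
  obtain B where "\<And>k xi v. norm (band k m xi v) \<le> B k * norm v" using m unfolding band_bounded_def by metis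
  from mop_band_convergent[OF _ this lim] m show "X \<in> mdom m" "mop m X = Y" by (auto simp: band_bounded_def)
qed

lemma band_tendsto: "band_bounded m \<Longrightarrow> X \<in> mdom m \<Longrightarrow> (\<lambda>k. mop (band k m) X) \<longlonglongrightarrow> mop m X"
  unfolding band_bounded_def using mop_band_tendsto by blast

lemma band_bounded_wmul: "0 \<le> \<sigma> \<Longrightarrow> band_bounded (wmul \<sigma>)"
  by (rule band_boundedI[OF multiplier_wmul, of \<sigma> 1]) simp_all

text \<open>Together with \<open>symb_le\<close>, the two inequalities make the symbol plus 1
  equivalent to the weight of order 2 s, as a form and as an operator. This is what identifies the
  abstract domains with the Sobolev spaces of orders s and 2 s.\<close>

locale coercive_kernel = even_kernel +
  fixes K lam :: real
  assumes K: "1 \<le> K" and lam: "0 \<le> lam"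
    and form_coercive: "wt (2 * s) xi * (norm v)\<^sup>2 \<le> K * (symb xi v \<bullet> v + (norm v)\<^sup>2)"
    and symb_coercive': "wt (2 * s) xi * norm v \<le> K * (norm (symb xi v) + norm v)"
begin

definition nsym :: "real^'a \<Rightarrow> real^'a \<Rightarrow> real^'a" where
  "nsym xi v = symb xi v + lam *\<^sub>R v"

lemma s_nonneg: "0 \<le> s" "0 \<le> 2 * s" using s by simp_all

lemma multiplier_lam: "multiplier (\<lambda>xi v. lam *\<^sub>R v)"
  by (rule multiplier_scalar) simp

lemma multiplier_nsym: "multiplier nsym"
  unfolding nsym_def[abs_def] by (rule multiplier_add[OF multiplier_symb multiplier_lam])

lemma norm_wmul: "norm (wmul \<sigma> xi v) = wt \<sigma> xi * norm v"
  using wt_pos[of \<sigma> xi] by (simp add: wmul_def)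

lemma nsym_le: "norm (nsym xi v) \<le> (Csymb + lam) * norm (wmul (2 * s) xi v)"
proof -
  have "norm (nsym xi v) \<le> norm (symb xi v) + lam * norm v"
    unfolding nsym_def using norm_triangle_ineq[of "symb xi v" "lam *\<^sub>R v"] lam by simp
  also have "lam * norm v \<le> lam * norm (wmul (2 * s) xi v)"
    using mult_right_mono[OF wt_ge_1[OF s_nonneg(2), of xi] norm_ge_zero[of v]] lam
    by (intro mult_left_mono) (simp_all add: norm_wmul)
  finally show ?thesis using symb_le_wmul[of xi v] by (simp add: distrib_right)
qed

lemma band_bounded_nsym: "band_bounded nsym"
  by (rule band_boundedI[OF multiplier_nsym s_nonneg(2) _ nsym_le]) (use Csymb_nonneg lam in simp)

text \<open>In the square of the norm of the sum, the cross term is a nonnegative multiple of the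
  form of the symbol.\<close>

lemma symb_perturb: "norm (symb xi v) \<le> norm (symb xi v + c *\<^sub>R v)" "c * norm v \<le> norm (symb xi v + c *\<^sub>R v)" if "0 \<le> c"
proof -
  have sq: "(norm (symb xi v + c *\<^sub>R v))\<^sup>2 = (norm (symb xi v))\<^sup>2 + 2 * (c * (symb xi v \<bullet> v)) + (c * norm v)\<^sup>2"
    unfolding power_mult_distrib power2_norm_eq_inner by (simp add: inner_add_left inner_add_right inner_commute[of v "symb xi v"] power2_eq_square distrib_left)
  have "0 \<le> c * (symb xi v \<bullet> v)" using that symb_nonneg by simp
  note this[simp]
  show "norm (symb xi v) \<le> norm (symb xi v + c *\<^sub>R v)" by (rule power2_le_imp_le) (simp_all add: sq)
  show "c * norm v \<le> norm (symb xi v + c *\<^sub>R v)" by (rule power2_le_imp_le) (simp_all add: sq)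
qed

text \<open>Each estimate required reduces to a pointwise inequality between symbols. The constant
  is a sum in order to dominate \<open>K\<close> for form coercivity, \<open>2 * K\<close> for
  operator coercivity, \<open>Csymb + lam\<close> for the upper bounds, and 1.\<close>

sublocale T: truncated_operator cut "\<lambda>k. mop (band k nsym)" "\<lambda>k. mop (band k (wmul s))" "\<lambda>k. mop (band k (wmul (2 * s)))" "2 * K + Csymb + lam"
proof (rule truncated_operator.intro)
  note N = band_bounded_nsym and W1 = band_bounded_wmul[OF s_nonneg(1)] and W2 = band_bounded_wmul[OF s_nonneg(2)] and I = band_bounded_id
  note C = Csymb_nonneg K lam
  show "bounded_linear (cut k :: 'a Lt \<Rightarrow> _)" "bounded_linear (mop (band k nsym))" "bounded_linear (mop (band k (wmul s)) :: 'a Lt \<Rightarrow> _)"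
    "bounded_linear (mop (band k (wmul (2 * s))) :: 'a Lt \<Rightarrow> _)" for k
    by (intro band_bounded_dom N W1 W2 I)+
  show "norm (cut k x) \<le> norm x" for k and x :: "'a Lt"
  proof -
    have le: "norm (band k (\<lambda>xi v. v) xi v) \<le> 1 * norm v" for xi v :: "real^'a" using band_le[of k "\<lambda>xi v. v" xi v] by simp
    from mop_dominated(2)[OF mop_id(1) band_bounded_dom(3)[OF I] le zero_le_one] show ?thesis by (simp add: mop_id)
  qed
  show "(\<lambda>k. cut k x) \<longlonglongrightarrow> x" for x :: "'a Lt" using band_tendsto[OF I mop_id(1), of x] by (simp add: mop_id)
  show "cut j (cut k x) = cut j x" "cut k (cut j x) = cut j x"
    "cut j (mop (band k nsym) x) = mop (band j nsym) x" "mop (band k nsym) (cut j x) = mop (band j nsym) x"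
    "cut j (mop (band k (wmul s)) x) = mop (band j (wmul s)) x" "mop (band k (wmul s)) (cut j x) = mop (band j (wmul s)) x"
    "cut j (mop (band k (wmul (2 * s))) x) = mop (band j (wmul (2 * s))) x"
    "mop (band k (wmul (2 * s))) (cut j x) = mop (band j (wmul (2 * s))) x" if "j \<le> k" for j k and x :: "'a Lt"
    using that by (simp_all add: cut_mop N W1 W2 I)
  show "inner (mop (band k nsym) x) y = inner x (mop (band k nsym) y)" for k and x y :: "'a Lt"
    by (rule mop_symmetric[OF band_bounded_dom(1)[OF N] band_bounded_dom(1)[OF N]])
      (simp add: band_def nsym_def inner_add_left inner_add_right symb_symmetric)
  have pos: "0 \<le> nsym xi v \<bullet> v" for xi v using symb_nonneg[of xi v] lam by (simp add: nsym_def inner_add_left)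
  show "0 \<le> inner (mop (band k nsym) x) x" for k and x :: "'a Lt"
    by (rule mop_nonneg[OF band_bounded_dom(1)[OF N]]) (simp add: band_def pos)
  show "1 \<le> 2 * K + Csymb + lam" using C by linarith
  have KK: "K * a \<le> (2 * K + Csymb + lam) * a" "2 * K * a \<le> (2 * K + Csymb + lam) * a" "(Csymb + lam) * a \<le> (2 * K + Csymb + lam) * a"
    "a \<le> (2 * K + Csymb + lam) * a" if "0 \<le> a" for a :: real
    using mult_right_mono[OF _ that, of K "2 * K + Csymb + lam"] mult_right_mono[OF _ that, of "2 * K" "2 * K + Csymb + lam"]
      mult_right_mono[OF _ that, of "Csymb + lam" "2 * K + Csymb + lam"] mult_right_mono[OF _ that, of 1 "2 * K + Csymb + lam"] C by auto
  have w2: "(norm (wmul s xi v))\<^sup>2 = wt (2 * s) xi * (norm v)\<^sup>2" for xi v :: "real^'a"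
    using wt_add[of s s xi] by (simp add: norm_wmul power_mult_distrib power2_eq_square)
  show "(norm (mop (band k (wmul s)) x))\<^sup>2 \<le> (2 * K + Csymb + lam) * (inner (mop (band k nsym) x) x + (norm x)\<^sup>2)" for k and x :: "'a Lt"
  proof (rule norm_mop_form_le[OF band_bounded_dom(1)[OF W1] band_bounded_dom(1)[OF N]])
    fix xi v :: "real^'a"
    have "wt (2 * s) xi * (norm v)\<^sup>2 \<le> K * (nsym xi v \<bullet> v + (norm v)\<^sup>2)"
    proof -
      have "0 \<le> K * (lam * (v \<bullet> v))" using C by simp
      then show ?thesis using form_coercive[of xi v] by (simp add: nsym_def inner_add_left distrib_left)
    qed
    also have "\<dots> \<le> (2 * K + Csymb + lam) * (nsym xi v \<bullet> v + (norm v)\<^sup>2)" by (rule KK(1)) (simp add: pos)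
    finally show "(norm (band k (wmul s) xi v))\<^sup>2 \<le> (2 * K + Csymb + lam) * (band k nsym xi v \<bullet> v + (norm v)\<^sup>2)"
      using C by (cases "xi \<in> cball 0 (real k)") (simp_all add: band_def w2)
  qed
  show "inner (mop (band k nsym) x) x \<le> (2 * K + Csymb + lam) * (norm (mop (band k (wmul s)) x))\<^sup>2" for k and x :: "'a Lt"
  proof (rule form_le_norm_mop[OF band_bounded_dom(1)[OF W1] band_bounded_dom(1)[OF N]])
    fix xi v :: "real^'a"
    have "nsym xi v \<bullet> v \<le> norm (nsym xi v) * norm v" by (rule norm_cauchy_schwarz)
    also have "\<dots> \<le> ((Csymb + lam) * norm (wmul (2 * s) xi v)) * norm v" by (intro mult_right_mono nsym_le) simp
    also have "\<dots> = (Csymb + lam) * (norm (wmul s xi v))\<^sup>2"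
      unfolding w2 by (simp add: norm_wmul power2_eq_square)
    also have "\<dots> \<le> (2 * K + Csymb + lam) * (norm (wmul s xi v))\<^sup>2" by (rule KK(3)) simp
    finally show "band k nsym xi v \<bullet> v \<le> (2 * K + Csymb + lam) * (norm (band k (wmul s) xi v))\<^sup>2"
      by (cases "xi \<in> cball 0 (real k)") (simp_all add: band_def)
  qed
  show "norm (mop (band k (wmul (2 * s))) x) \<le> (2 * K + Csymb + lam) * (norm (mop (band k nsym) x) + norm x)" for k and x :: "'a Lt"
  proof -
    \<comment> \<open>The weight is compared with \<open>band k nsym\<close> plus the identity,
      taken as a single multiplier. The factor 2 arises from adding both parts of
      \<open>symb_perturb\<close> for the shift \<open>lam + 1\<close>.\<close>
    have "AE xi in lebesgue. rep (mop (band k nsym) x + x) xi = band k nsym xi (rep x xi) + rep x xi"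
      using rep_add[of "mop (band k nsym) x" x] rep_mop[OF band_bounded_dom(1)[OF N, of x k]] by eventually_elim simp
    note D = mdomI_AE[OF multiplier_add[OF band_bounded_dom(3)[OF N] multiplier_id] this]
    have "norm (band k (wmul (2 * s)) xi v) \<le> 2 * K * norm (band k nsym xi v + v)" for xi v
    proof (cases "xi \<in> cball 0 (real k)")
      case True
      have e: "nsym xi v + v = symb xi v + (lam + 1) *\<^sub>R v" by (simp add: nsym_def scaleR_add_left)
      have "1 * norm v \<le> (lam + 1) * norm v" using lam by (intro mult_right_mono) auto
      then have "norm (symb xi v) + norm v \<le> 2 * norm (nsym xi v + v)"
        unfolding e using symb_perturb(1)[of "lam + 1" xi v] symb_perturb(2)[of "lam + 1" v xi] lam by simp
      from order.trans[OF symb_coercive'[of xi v] mult_left_mono[OF this, of K]] show ?thesis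
        using True C by (simp add: band_def norm_wmul mult_ac)
    qed (use C in \<open>simp add: band_def\<close>)
    from mop_dominated(2)[OF D(1) band_bounded_dom(3)[OF W2] this] C
    have "norm (mop (band k (wmul (2 * s))) x) \<le> 2 * K * norm (mop (band k nsym) x + x)" by (simp add: D(2))
    also have "\<dots> \<le> 2 * K * (norm (mop (band k nsym) x) + norm x)" using C by (intro mult_left_mono norm_triangle_ineq) auto
    also have "\<dots> \<le> (2 * K + Csymb + lam) * (norm (mop (band k nsym) x) + norm x)" by (rule KK(2)) simp
    finally show ?thesis .
  qed
  show "norm (mop (band k nsym) x) \<le> (2 * K + Csymb + lam) * norm (mop (band k (wmul (2 * s))) x)" for k and x :: "'a Lt"
  proof (rule mop_dominated(2)[OF band_bounded_dom(1)[OF W2] band_bounded_dom(3)[OF N]])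
    show "norm (band k nsym xi v) \<le> (2 * K + Csymb + lam) * norm (band k (wmul (2 * s)) xi v)" for xi v
      using order.trans[OF nsym_le KK(3)[OF norm_ge_zero], of xi v]
      by (cases "xi \<in> cball 0 (real k)") (simp_all add: band_def)
  qed (use C in linarith)
  show "norm (mop (band k (wmul s)) x) \<le> (2 * K + Csymb + lam) * norm (mop (band k (wmul (2 * s))) x)" for k and x :: "'a Lt"
  proof (rule mop_dominated(2)[OF band_bounded_dom(1)[OF W2] band_bounded_dom(3)[OF W1]])
    fix xi v :: "real^'a"
    have "wt s xi * 1 \<le> wt s xi * wt s xi" using wt_pos[of s xi] by (intro mult_left_mono wt_ge_1 s_nonneg) auto
    then have "norm (wmul s xi v) \<le> norm (wmul (2 * s) xi v)"
      using wt_add[of s s xi] by (simp add: norm_wmul mult_right_mono)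
    from order.trans[OF this KK(4)[OF norm_ge_zero]]
    show "norm (band k (wmul s) xi v) \<le> (2 * K + Csymb + lam) * norm (band k (wmul (2 * s)) xi v)"
      by (cases "xi \<in> cball 0 (real k)") (simp_all add: band_def)
  qed (use C in linarith)
qed

end

section \<open>The nonlocal wave equation: existence, uniqueness, conservation of energy\<close>

section \<open>The wave equation\<close>

context coercive_kernel
begin

lemma dom_s: "(X :: 'a Lt) \<in> mdom (wmul (2 * s)) \<Longrightarrow> X \<in> mdom (wmul s)"
proof -
  assume X: "(X :: 'a Lt) \<in> mdom (wmul (2 * s))"
  have le: "norm (wmul s xi v) \<le> 1 * norm (wmul (2 * s) xi v)" for xi v :: "real^'a"
  proof -
    have "wt s xi * 1 \<le> wt s xi * wt s xi" using wt_pos[of s xi] by (intro mult_left_mono wt_ge_1 s_nonneg) auto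
    then show ?thesis using wt_add[of s s xi] by (simp add: norm_wmul mult_right_mono)
  qed
  show ?thesis by (rule mop_dominated(1)[OF X multiplier_wmul le zero_le_one])
qed

lemma nsym_dom:
  assumes "X \<in> mdom (wmul (2 * s))"
  shows "X \<in> mdom nsym" "mop nsym X = mop symb X + lam *\<^sub>R X"
proof -
  have "AE xi in lebesgue. rep (mop symb X + lam *\<^sub>R X) xi = nsym xi (rep X xi)"
    using rep_add[of "mop symb X" "lam *\<^sub>R X"] rep_scaleR[of lam X] rep_mop[OF symb_dom(1)[OF assms]]
    by eventually_elim (simp add: nsym_def)
  from mdomI_AE[OF multiplier_nsym this] show "X \<in> mdom nsym" "mop nsym X = mop symb X + lam *\<^sub>R X" by auto
qed

text \<open>The equation almost everywhere is an identity of classes, and the Hartley transform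
  replaces the operator by its symbol; \<open>nonlocal_op_ext_iff\<close> supplies the operator
  value in the converse direction.\<close>

lemma equation_iff:
  assumes u: "u \<in> L2" "hat u \<in> mdom (wmul (2 * s))" and v: "v \<in> L2" and g: "g \<in> L2"
  shows "(\<exists>w. nonlocal_op_ext \<rho> s u w \<and> (AE x in lebesgue. v x + w x + lam *\<^sub>R u x = g x)) \<longleftrightarrow>
    mop nsym (hat u) = hat g - hat v"
proof -
  have eq: "(AE x in lebesgue. v x + w x + lam *\<^sub>R u x = g x) \<longleftrightarrow>
    mop nsym (hat u) = hat g - hat v" if w: "w \<in> L2" "cls w = hartley (mop symb (hat u))" for w
  proof -
    have L: "(\<lambda>x. v x + w x + lam *\<^sub>R u x) \<in> L2" by (intro L2_add L2_scaleR u v w)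
    have "(AE x in lebesgue. v x + w x + lam *\<^sub>R u x = g x) \<longleftrightarrow> cls (\<lambda>x. v x + w x + lam *\<^sub>R u x) = cls g"
      using cls_eqI[OF L g] cls_eqD[OF L g] by blast
    also have "cls (\<lambda>x. v x + w x + lam *\<^sub>R u x) = cls v + cls w + lam *\<^sub>R cls u"
      by (simp add: cls_add cls_scaleR L2_add L2_scaleR u v w)
    also have "cls v + cls w + lam *\<^sub>R cls u = cls g \<longleftrightarrow> hartley (cls v + cls w + lam *\<^sub>R cls u) = hat g"
      by (metis hartley_hartley)
    finally show ?thesis unfolding hartley_add hartley_scaleR w(2) hartley_hartley nsym_dom(2)[OF u(2)]
      by (auto simp: algebra_simps)
  qed
  show ?thesis
  proof
    assume "\<exists>w. nonlocal_op_ext \<rho> s u w \<and> (AE x in lebesgue. v x + w x + lam *\<^sub>R u x = g x)"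
    then show "mop nsym (hat u) = hat g - hat v" unfolding nonlocal_op_ext_iff using eq by blast
  next
    assume "mop nsym (hat u) = hat g - hat v"
    then show "\<exists>w. nonlocal_op_ext \<rho> s u w \<and> (AE x in lebesgue. v x + w x + lam *\<^sub>R u x = g x)"
      unfolding nonlocal_op_ext_iff using eq[of "rep (hartley (mop symb (hat u)))"] u
      by (intro exI[of _ "rep (hartley (mop symb (hat u)))"]) simp
  qed
qed

lemma wave_solutionD:
  assumes f: "\<And>t. t \<in> {0..T} \<Longrightarrow> f t \<in> L2" and u0: "u0 \<in> L2" and v0: "v0 \<in> L2" and T: "0 \<le> T"
    and w: "wave_solution \<rho> s lam T f u0 v0 u"
  obtains ut utt where "\<And>t. t \<in> {0..T} \<Longrightarrow> u t \<in> L2" "\<And>t. t \<in> {0..T} \<Longrightarrow> ut t \<in> L2"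
    "\<And>t. t \<in> {0..T} \<Longrightarrow> hat (u t) \<in> mdom (wmul (2 * s))"
    "\<And>t. t \<in> {0..T} \<Longrightarrow> vderiv T (\<lambda>t. hat (u t)) (hat (ut t)) t"
    "\<And>t. t \<in> {0..T} \<Longrightarrow> vderiv T (\<lambda>t. hat (ut t)) (hat (utt t)) t"
    "\<And>t. t \<in> {0..T} \<Longrightarrow> mop nsym (hat (u t)) = hat (f t) - hat (utt t)"
    "cls (u 0) = cls u0" "cls (ut 0) = cls v0"
proof -
  obtain ut utt where c: "curve_C0 (sobolev (2 * s)) (sobolev_norm (2 * s)) T u"
    and d: "L2_curve_deriv T u ut" "L2_curve_deriv T ut utt"
    and e: "\<And>t. t \<in> {0..T} \<Longrightarrow> \<exists>w. nonlocal_op_ext \<rho> s (u t) w \<and> (AE x in lebesgue. utt t x + w x + lam *\<^sub>R u t x = f t x)"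
    and i: "AE x in lebesgue. u 0 x = u0 x" "AE x in lebesgue. ut 0 x = v0 x"
    using w unfolding wave_solution_def by blast
  have u: "u t \<in> L2" "hat (u t) \<in> mdom (wmul (2 * s))" if "t \<in> {0..T}" for t
    using c that unfolding curve_C0_iff[OF norm_map_sobolev[OF s_nonneg(2)]] sobolev_iff[OF s_nonneg(2)] by auto
  have L: "\<forall>t\<in>{0..T}. u t \<in> L2" using u by blast
  note d1 = d(1)[unfolded L2_curve_deriv_iff[OF L]]
  then have L': "\<forall>t\<in>{0..T}. ut t \<in> L2" by blast
  note d2 = d(2)[unfolded L2_curve_deriv_iff[OF L']]
  show thesis
  proof (rule that[of ut utt])
    show "mop nsym (hat (u t)) = hat (f t) - hat (utt t)" if t: "t \<in> {0..T}" for t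
      using e[OF t] d2 t by (subst (asm) equation_iff[OF u[OF t] _ f[OF t]]) auto
    show "cls (u 0) = cls u0" "cls (ut 0) = cls v0"
      using cls_eqI[OF _ u0 i(1)] cls_eqI[OF _ v0 i(2)] L L' T by auto
  qed (use u d1 d2 in auto)
qed

lemma nsym_tendsto:
  assumes "X \<in> mdom (wmul (2 * s))"
  shows "(\<lambda>k. mop (band k nsym) X) \<longlonglongrightarrow> mop nsym X"
  by (rule band_tendsto[OF band_bounded_nsym nsym_dom(1)[OF assms]])

text \<open>The Sobolev conditions on the data give the convergence of truncated weights that
  \<open>T.wave_exists\<close> demands. In return \<open>band_limit\<close> converts the limits a,
  a1 and b into membership in the Sobolev spaces, and their continuity into continuity in the
  Sobolev norms.\<close>

lemma wave_solution_exists: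
  assumes T: "0 \<le> T" and f: "curve_C1 L2 L2_norm T f" and u0: "u0 \<in> sobolev (2 * s)" and v0: "v0 \<in> sobolev s"
  shows "\<exists>u. wave_solution \<rho> s lam T f u0 v0 u"
proof -
  obtain f' where f': "curve_deriv L2_norm T f f'" "curve_C0 L2 L2_norm T f'" and fL: "\<forall>t\<in>{0..T}. f t \<in> L2"
    using f unfolding curve_C1_def L2_C0_iff by blast
  have "L2_curve_deriv T f f'" unfolding L2_curve_deriv_def using f' by blast
  note f' = this[unfolded L2_curve_deriv_iff[OF fL]]
  define F where "F t = hat (f t)" for t
  have u0': "u0 \<in> L2" "hat u0 \<in> mdom (wmul (2 * s))" and v0': "v0 \<in> L2" "hat v0 \<in> mdom (wmul s)"
    using u0 v0 by (simp_all add: sobolev_iff s_nonneg)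
  have W1: "band_bounded (wmul s)" and W2: "band_bounded (wmul (2 * s))" by (intro band_bounded_wmul s_nonneg)+
  obtain y y1 y2 a a1 b where init: "y 0 = hat u0" "y1 0 = hat v0"
    and d: "\<And>t. t \<in> {0..T} \<Longrightarrow> vderiv T y (y1 t) t"
      "\<And>t. t \<in> {0..T} \<Longrightarrow> vderiv T y1 (y2 t) t" "continuous_on {0..T} y2"
    and n: "\<And>t. t \<in> {0..T} \<Longrightarrow> (\<lambda>k. mop (band k nsym) (y t)) \<longlonglongrightarrow> F t - y2 t"
    and b: "\<And>t. t \<in> {0..T} \<Longrightarrow> (\<lambda>k. mop (band k (wmul (2 * s))) (y t)) \<longlonglongrightarrow> b t" "continuous_on {0..T} b"
    and a: "\<And>t. t \<in> {0..T} \<Longrightarrow> (\<lambda>k. mop (band k (wmul s)) (y t)) \<longlonglongrightarrow> a t"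
      "\<And>t. t \<in> {0..T} \<Longrightarrow> (\<lambda>k. mop (band k (wmul s)) (y1 t)) \<longlonglongrightarrow> a1 t"
      "\<And>t. t \<in> {0..T} \<Longrightarrow> vderiv T a (a1 t) t" "continuous_on {0..T} a1"
  proof (rule T.wave_exists[OF T, of F "\<lambda>t. hat (f' t)" "hat u0" "hat v0"])
    show "vderiv T F (hat (f' t)) t" if "t \<in> {0..T}" for t
      using f' that unfolding F_def[abs_def] by blast
    show "continuous_on {0..T} (\<lambda>t. hat (f' t))" using f' by blast
    show "convergent (\<lambda>k. mop (band k (wmul (2 * s))) (hat u0))" by (rule convergentI[OF band_tendsto[OF W2 u0'(2)]])
    show "convergent (\<lambda>k. mop (band k (wmul s)) (hat v0))" by (rule convergentI[OF band_tendsto[OF W1 v0'(2)]])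
  qed (rule that)
  define u where "u t = rep (hartley (y t))" for t
  define ut where "ut t = rep (hartley (y1 t))" for t
  define utt where "utt t = rep (hartley (y2 t))" for t
  have [simp]: "u t \<in> L2" "ut t \<in> L2" "utt t \<in> L2" "cls (u t) = hartley (y t)" "cls (ut t) = hartley (y1 t)" "cls (utt t) = hartley (y2 t)" for t
    by (simp_all add: u_def ut_def utt_def)
  have y: "y t \<in> mdom (wmul (2 * s))" "mop (wmul (2 * s)) (y t) = b t" "y t \<in> mdom (wmul s)" "mop (wmul s) (y t) = a t"
    "y1 t \<in> mdom (wmul s)" "mop (wmul s) (y1 t) = a1 t" if "t \<in> {0..T}" for t
    using band_limit[OF W2 b(1)[OF that]] band_limit[OF W1 a(1)[OF that]] band_limit[OF W1 a(2)[OF that]] by auto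
  have cy: "continuous_on {0..T} y" "continuous_on {0..T} y1" "continuous_on {0..T} a"
    using d a(3) by (intro continuous_on_vector_derivative; blast)+
  have cb: "continuous_on {0..T} (\<lambda>t. mop (wmul (2 * s)) (y t))" "continuous_on {0..T} (\<lambda>t. mop (wmul s) (y t))"
    "continuous_on {0..T} (\<lambda>t. mop (wmul s) (y1 t))"
    by (rule continuous_on_eq[OF b(2)] continuous_on_eq[OF cy(3)] continuous_on_eq[OF a(4)]; simp add: y)+
  have uL: "\<forall>t\<in>{0..T}. u t \<in> L2" "\<forall>t\<in>{0..T}. ut t \<in> L2" "\<forall>t\<in>{0..T}. utt t \<in> L2" by simp_all
  have D1: "L2_curve_deriv T u ut" unfolding L2_curve_deriv_iff[OF uL(1)] using cy d by simp
  have D2: "L2_curve_deriv T ut utt" unfolding L2_curve_deriv_iff[OF uL(2)] using d by simp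
  note hc = bounded_linear.continuous_on[OF bounded_linear_hartley]
  have "curve_C0 (sobolev (2 * s)) (sobolev_norm (2 * s)) T u"
    unfolding curve_C0_iff[OF norm_map_sobolev[OF s_nonneg(2)]] sobolev_iff[OF s_nonneg(2)]
    using y cb by simp
  moreover have S: "\<forall>t\<in>{0..T}. u t \<in> sobolev s" "\<forall>t\<in>{0..T}. ut t \<in> sobolev s"
    using y by (simp_all add: sobolev_iff[OF s_nonneg(1)])
  have "curve_C1 (sobolev s) (sobolev_norm s) T u"
    unfolding curve_C1_def
  proof (intro conjI exI[of _ ut])
    note m = norm_map_sobolev[OF s_nonneg(1), where 'a='a]
    show "curve_C0 (sobolev s) (sobolev_norm s) T u" "curve_C0 (sobolev s) (sobolev_norm s) T ut"
      unfolding curve_C0_iff[OF m] using S cb by simp_all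
    show "curve_deriv (sobolev_norm s) T u ut"
      unfolding curve_deriv_iff[OF m S]
    proof
      fix t assume t: "t \<in> {0..T}"
      have "vderiv T (\<lambda>t. mop (wmul s) (hat (u t))) (a1 t) t"
        by (rule has_vector_derivative_transform[OF t _ a(3)[OF t]]) (simp add: y)
      then show "vderiv T (\<lambda>t. mop (wmul s) (hat (u t))) (mop (wmul s) (hat (ut t))) t"
        using t by (simp add: y)
    qed
  qed
  moreover have "curve_C2 L2 L2_norm T u"
    using D1 D2 unfolding curve_C2_def curve_C1_def L2_curve_deriv_def L2_C0_iff
    by (intro conjI exI[of _ ut] exI[of _ utt]) (auto intro: hc cy)
  moreover have "\<forall>t\<in>{0..T}. \<exists>w. nonlocal_op_ext \<rho> s (u t) w \<and> (AE x in lebesgue. utt t x + w x + lam *\<^sub>R u t x = f t x)"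
  proof
    fix t assume t: "t \<in> {0..T}"
    have "mop nsym (y t) = F t - y2 t" by (rule band_limit(2)[OF band_bounded_nsym n[OF t]])
    then show "\<exists>w. nonlocal_op_ext \<rho> s (u t) w \<and> (AE x in lebesgue. utt t x + w x + lam *\<^sub>R u t x = f t x)"
      using fL t y(1)[OF t] by (subst equation_iff) (simp_all add: F_def)
  qed
  moreover have "AE x in lebesgue. u 0 x = u0 x" "AE x in lebesgue. ut 0 x = v0 x"
    by (rule cls_eqD; simp add: u0' v0' init)+
  ultimately show ?thesis unfolding wave_solution_def using D1 D2 by blast
qed

lemma wave_solution_unique:
  assumes T: "0 \<le> T" and f: "\<And>t. t \<in> {0..T} \<Longrightarrow> f t \<in> L2" and u0: "u0 \<in> L2" and v0: "v0 \<in> L2"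
    and u: "wave_solution \<rho> s lam T f u0 v0 u" and w: "wave_solution \<rho> s lam T f u0 v0 w" and t: "t \<in> {0..T}"
  shows "AE x in lebesgue. w t x = u t x"
proof -
  obtain ut utt where U: "\<And>t. t \<in> {0..T} \<Longrightarrow> u t \<in> L2"
    "\<And>t. t \<in> {0..T} \<Longrightarrow> hat (u t) \<in> mdom (wmul (2 * s))"
    "\<And>t. t \<in> {0..T} \<Longrightarrow> vderiv T (\<lambda>t. hat (u t)) (hat (ut t)) t"
    "\<And>t. t \<in> {0..T} \<Longrightarrow> vderiv T (\<lambda>t. hat (ut t)) (hat (utt t)) t"
    "\<And>t. t \<in> {0..T} \<Longrightarrow> mop nsym (hat (u t)) = hat (f t) - hat (utt t)"
    "cls (u 0) = cls u0" "cls (ut 0) = cls v0"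
    using wave_solutionD[OF f u0 v0 T u] by metis
  obtain wt wtt where W: "\<And>t. t \<in> {0..T} \<Longrightarrow> w t \<in> L2"
    "\<And>t. t \<in> {0..T} \<Longrightarrow> hat (w t) \<in> mdom (wmul (2 * s))"
    "\<And>t. t \<in> {0..T} \<Longrightarrow> vderiv T (\<lambda>t. hat (w t)) (hat (wt t)) t"
    "\<And>t. t \<in> {0..T} \<Longrightarrow> vderiv T (\<lambda>t. hat (wt t)) (hat (wtt t)) t"
    "\<And>t. t \<in> {0..T} \<Longrightarrow> mop nsym (hat (w t)) = hat (f t) - hat (wtt t)"
    "cls (w 0) = cls u0" "cls (wt 0) = cls v0"
    using wave_solutionD[OF f u0 v0 T w] by metis
  have "hat (w t) = hat (u t)"
  proof (rule T.wave_unique[OF W(3,4) _ U(3,4) _ _ _ t])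
    show "(\<lambda>k. mop (band k nsym) (hat (w t))) \<longlonglongrightarrow> hat (f t) - hat (wtt t)" if "t \<in> {0..T}" for t
      using nsym_tendsto[OF W(2)[OF that]] unfolding W(5)[OF that] .
    show "(\<lambda>k. mop (band k nsym) (hat (u t))) \<longlonglongrightarrow> hat (f t) - hat (utt t)" if "t \<in> {0..T}" for t
      using nsym_tendsto[OF U(2)[OF that]] unfolding U(5)[OF that] .
  qed (simp_all add: U(6,7) W(6,7))
  then have "cls (w t) = cls (u t)" by (metis hartley_hartley)
  then show ?thesis by (rule cls_eqD[OF W(1)[OF t] U(1)[OF t]])
qed

lemma finite_pair_energy_L2:
  assumes "u \<in> L2" "hat u \<in> mdom (wmul s)"
  shows "finite_pair_energy \<rho> u"
  unfolding finite_pair_energy_def pair_energy(1)[OF assms] by simp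

text \<open>By \<open>pair_energy\<close> the double integral is twice the form of the symbol, which
  the coefficient 1/2 undoes; the zero-order term completes it to the form of
  \<open>nsym\<close>.\<close>

lemma wave_energy_eq:
  assumes u: "u \<in> L2" "hat u \<in> mdom (wmul (2 * s))" and v: "v \<in> L2" and f0: "f0 \<in> L2"
  shows "wave_energy \<rho> lam f0 u v = (norm (hat v))\<^sup>2 + inner (mop nsym (hat u)) (hat u)
    - 2 * inner (hat f0) (hat u)"
proof -
  have "inner (mop nsym (hat u)) (hat u) = sform (hat u) + lam * (L2_norm u)\<^sup>2"
    unfolding nsym_dom(2)[OF u(2)] inner_add_left sform_mop[OF symb_dom(1)[OF u(2)]]
    by (simp add: power2_norm_eq_inner[symmetric] norm_cls u)
  moreover have "inner (hat f0) (hat u) = (LINT x|lebesgue. f0 x \<bullet> u x)"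
    by (simp add: inner_hartley inner_cls f0 u)
  ultimately show ?thesis
    unfolding wave_energy_def pair_energy(2)[OF u(1) dom_s[OF u(2)]] by (simp add: norm_cls v)
qed

lemma wave_energy_conservation:
  assumes T: "0 < T" and f: "\<And>t. t \<in> {0..T} \<Longrightarrow> f t \<in> L2" and u0: "u0 \<in> L2" and v0: "v0 \<in> L2"
    and u: "wave_solution \<rho> s lam T f u0 v0 u" and f0: "\<forall>t\<in>{0..T}. AE x in lebesgue. f t x = f0 x"
    and ut: "L2_curve_deriv T u ut"
  shows "finite_pair_energy \<rho> u0 \<and> (\<forall>t\<in>{0..T}. finite_pair_energy \<rho> (u t) \<and>
    wave_energy \<rho> lam f0 (u t) (ut t) = wave_energy \<rho> lam f0 u0 v0)"
proof -
  have T0: "0 \<le> T" "0 \<in> {0..T}" using T by auto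
  obtain ut' utt where U: "\<And>t. t \<in> {0..T} \<Longrightarrow> u t \<in> L2"
    "\<And>t. t \<in> {0..T} \<Longrightarrow> hat (u t) \<in> mdom (wmul (2 * s))"
    "\<And>t. t \<in> {0..T} \<Longrightarrow> vderiv T (\<lambda>t. hat (u t)) (hat (ut' t)) t"
    "\<And>t. t \<in> {0..T} \<Longrightarrow> vderiv T (\<lambda>t. hat (ut' t)) (hat (utt t)) t"
    "\<And>t. t \<in> {0..T} \<Longrightarrow> mop nsym (hat (u t)) = hat (f t) - hat (utt t)"
    "cls (u 0) = cls u0" "cls (ut' 0) = cls v0"
    using wave_solutionD[OF f u0 v0 T0(1) u] by metis
  have uL: "\<forall>t\<in>{0..T}. u t \<in> L2" using U(1) by blast
  note ut = ut[unfolded L2_curve_deriv_iff[OF uL]]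
  have utL: "ut t \<in> L2" if "t \<in> {0..T}" for t using ut that by blast
  \<comment> \<open>The given derivative is matched with the one contained in the notion of
    solution: derivatives relative to an interval of positive length are unique, also at its end
    points.\<close>
  have ut_eq: "hat (ut t) = hat (ut' t)" if t: "t \<in> {0..T}" for t
    by (rule vector_derivative_unique_within_closed_interval[OF T, of t]) (use t ut U(3) in auto)
  have f0L: "f0 \<in> L2"
    by (rule L2_cong_AE[OF f[OF T0(2)] measurable_cong_AE_lebesgue[OF L2_measurable[OF f[OF T0(2)]]]]) (use f0 T0 in auto)
  have cf: "cls (f t) = cls f0" if "t \<in> {0..T}" for t using f0 that by (intro cls_eqI f f0L) auto
  have c: "(norm (hat (ut' t)))\<^sup>2 + inner (mop nsym (hat (u t))) (hat (u t)) - 2 * inner (hat f0) (hat (u t))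
    = (norm (hat v0))\<^sup>2 + inner (mop nsym (hat u0)) (hat u0) - 2 * inner (hat f0) (hat u0)"
    if t: "t \<in> {0..T}" for t
  proof -
    have "(\<lambda>k. mop (band k nsym) (hat (u t))) \<longlonglongrightarrow> hat f0 - hat (utt t)" if "t \<in> {0..T}" for t
      using nsym_tendsto[OF U(2)[OF that]] unfolding U(5)[OF that] cf[OF that] .
    from T.wave_energy_conserved[OF U(3,4) this t] show ?thesis
      using U(5)[OF t] U(5)[OF T0(2)] cf[OF t] cf[OF T0(2)] U(6,7) by simp
  qed
  have d0: "hat u0 \<in> mdom (wmul (2 * s))" using U(2)[OF T0(2)] U(6) by simp
  have e: "wave_energy \<rho> lam f0 (u t) (ut t) = wave_energy \<rho> lam f0 u0 v0" if t: "t \<in> {0..T}" for t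
    unfolding wave_energy_eq[OF U(1,2)[OF t] utL[OF t] f0L] wave_energy_eq[OF u0 d0 v0 f0L] ut_eq[OF t] by (rule c[OF t])
  show ?thesis
    using e finite_pair_energy_L2[OF u0 dom_s[OF d0]] finite_pair_energy_L2[OF U(1) dom_s[OF U(2)]] by blast
qed

end

lemma class_B_even_kernel:
  assumes B: "class_B s \<Gamma> r \<alpha>1 \<rho>" and even: "\<forall>y. \<rho> (- y) = \<rho> y"
  shows "\<exists>\<alpha>. even_kernel \<rho> s \<alpha>"
proof -
  obtain m \<alpha>2 where m: "\<And>y. \<alpha>1 \<le> m y" "\<And>y. m y \<le> \<alpha>2"
    and \<rho>: "\<And>y. \<rho> y = (if y \<in> double_cone \<Gamma> \<and> ereal (norm y) < r
                     then m y / norm y powr (real CARD('a) + 2 * s) else 0)"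
    using B unfolding class_B_def by blast
  have s: "0 < s" "s < 1" "0 < \<alpha>1" "\<rho> \<in> borel_measurable lebesgue" using B by (auto simp: class_B_def)
  have \<alpha>: "0 \<le> \<alpha>2" using m[of 0] s by linarith
  have "even_kernel \<rho> s \<alpha>2"
  proof
    fix y
    have "0 \<le> m y" using m(1)[of y] s by linarith
    then show "0 \<le> \<rho> y" unfolding \<rho> by simp
    show "\<rho> y \<le> \<alpha>2 * norm y powr - (real CARD('a) + 2 * s)"
      unfolding \<rho> powr_minus divide_inverse[symmetric] using \<alpha> m(2)[of y] by (auto intro: divide_right_mono)
  qed (use s \<alpha> even in auto)
  then show ?thesis by blast
qed

lemma L2_norm_nonneg: "0 \<le> L2_norm u"
  unfolding L2_norm_def by (intro real_sqrt_ge_zero Bochner_Integration.integral_nonneg) simp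

text \<open>The fractional Laplacian term of order s in the steady estimate becomes the pointwise
  bound of \<open>symb_pointwise\<close>, and \<open>symb_coercive\<close> turns that into the two
  coercivity inequalities.\<close>

lemma coercive_kernel_if_solvable:
  assumes B: "class_B s \<Gamma> r \<alpha>1 \<rho>" and even: "\<forall>y. \<rho> (- y) = \<rho> y"
    and solv: "solvability_constant s \<Gamma> \<alpha>1 lam0" and lam: "0 \<le> lam"
  shows "\<exists>\<alpha> K. coercive_kernel \<rho> s \<alpha> K lam"
proof -
  obtain \<alpha> where "even_kernel \<rho> s \<alpha>" using class_B_even_kernel[OF B even] by blast
  then interpret even_kernel \<rho> s \<alpha> .
  have r: "0 < r" using B by (simp add: class_B_def)
  \<comment> \<open>A parameter above \<open>lam0 r\<close> at which the steady estimate is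
    available. The coercivity obtained concerns \<open>symb\<close> alone; the parameter enters only
    the constant.\<close>
  define lam1 where "lam1 = lam0 r + 1"
  have lam1: "lam0 r < lam1" "0 \<le> lam1" using solv r by (auto simp: lam1_def solvability_constant_def less_imp_le)
  obtain C where C: "0 < C" and steady: "\<And>g. g \<in> L2 \<Longrightarrow> \<exists>u. steady_solution \<rho> s lam1 g u \<and>
          (\<forall>w. steady_solution \<rho> s lam1 g w \<longrightarrow> (AE x in lebesgue. w x = u x)) \<and>
          (\<exists>a\<in>L2. \<exists>b\<in>L2. frac_laplacian s u a \<and> frac_laplacian (s / 2) u b \<and>
             L2_norm a + sqrt lam1 * L2_norm b + (lam1 - lam0 r) * L2_norm u \<le> C * L2_norm g)"
    using solv B r lam1(1) unfolding solvability_constant_def by blast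
  have est: "\<exists>u. steady_solution \<rho> s lam1 g u \<and> (\<forall>w. steady_solution \<rho> s lam1 g w \<longrightarrow> (AE x in lebesgue. w x = u x)) \<and>
      (\<exists>a\<in>L2. frac_laplacian s u a \<and> L2_norm a \<le> C * L2_norm g)" if "g \<in> L2" for g
  proof -
    have le: "L2_norm a \<le> C * L2_norm g"
      if "L2_norm a + sqrt lam1 * L2_norm b + (lam1 - lam0 r) * L2_norm u \<le> C * L2_norm g" for a b u :: "'a field"
    proof -
      have "0 \<le> sqrt lam1 * L2_norm b" "0 \<le> (lam1 - lam0 r) * L2_norm u" using lam1 by (auto intro!: mult_nonneg_nonneg L2_norm_nonneg)
      with that show ?thesis by linarith
    qed
    show ?thesis using steady[OF that] le by blast
  qed
  have "lap s xi * norm v \<le> C * norm (symb xi v + lam1 *\<^sub>R v)" for xi v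
    using C by (intro symb_pointwise lam1 conjI symb_wmul_linear_resolvent[OF lam1(2) _ est]) auto
  note c = symb_coercive[OF lam1(2) less_imp_le[OF C] this]
  have "coercive_kernel \<rho> s \<alpha> (2 + 2 * C + 2 * C * lam1) lam"
  proof
    show "1 \<le> 2 + 2 * C + 2 * C * lam1" using C lam1 by (simp add: add_nonneg_nonneg add_increasing2)
  qed (use c lam in auto)
  then show ?thesis by blast
qed

theorem theorem2p4:
  fixes \<Gamma> :: "(real^'n::finite) set" and \<rho> :: "real^'n \<Rightarrow> real"
    and s \<alpha>1 T lam :: real and r :: ereal and lam0 :: "ereal \<Rightarrow> real"
    and f :: "real \<Rightarrow> 'n field" and u0 v0 :: "'n field"
  assumes "T > 0"
    and "curve_C1 L2 L2_norm T f"
    and "u0 \<in> sobolev (2 * s)"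
    and "v0 \<in> sobolev s"
    and "class_B s \<Gamma> r \<alpha>1 \<rho>"
    and "\<forall>y. \<rho> (- y) = \<rho> y"
    and "solvability_constant s \<Gamma> \<alpha>1 lam0"
    and "lam \<ge> 0"
    and "lam > lam0 r - 1"
  shows "(\<exists>u. wave_solution \<rho> s lam T f u0 v0 u \<and>
            (\<forall>w. wave_solution \<rho> s lam T f u0 v0 w \<longrightarrow>
               (\<forall>t\<in>{0..T}. AE x in lebesgue. w t x = u t x)) \<and>
            (\<forall>f0 ut. (\<forall>t\<in>{0..T}. AE x in lebesgue. f t x = f0 x) \<longrightarrow> L2_curve_deriv T u ut \<longrightarrow>
               finite_pair_energy \<rho> u0 \<and>
               (\<forall>t\<in>{0..T}. finite_pair_energy \<rho> (u t) \<and>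
                  wave_energy \<rho> lam f0 (u t) (ut t) = wave_energy \<rho> lam f0 u0 v0)))
       \<and> (lam0 r < 1 \<longrightarrow>
          (\<exists>u. wave_solution \<rho> s 0 T f u0 v0 u \<and>
            (\<forall>w. wave_solution \<rho> s 0 T f u0 v0 w \<longrightarrow>
               (\<forall>t\<in>{0..T}. AE x in lebesgue. w t x = u t x)) \<and>
            (\<forall>f0 ut. (\<forall>t\<in>{0..T}. AE x in lebesgue. f t x = f0 x) \<longrightarrow> L2_curve_deriv T u ut \<longrightarrow>
               finite_pair_energy \<rho> u0 \<and>
               (\<forall>t\<in>{0..T}. finite_pair_energy \<rho> (u t) \<and>
                  wave_energy \<rho> 0 f0 (u t) (ut t) = wave_energy \<rho> 0 f0 u0 v0))))"
proof -
  have u0: "u0 \<in> L2" and v0: "v0 \<in> L2" using assms by (auto simp: sobolev_iff class_B_def)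
  have f: "f t \<in> L2" if "t \<in> {0..T}" for t
    using assms(2) that unfolding curve_C1_def curve_C0_def by blast
  \<comment> \<open>The argument is run for an arbitrary nonnegative zero-order coefficient
    \<open>\<mu>\<close> and then applied with \<open>lam\<close> and with 0.\<close>
  have main: "\<exists>u. wave_solution \<rho> s \<mu> T f u0 v0 u \<and>
            (\<forall>w. wave_solution \<rho> s \<mu> T f u0 v0 w \<longrightarrow>
               (\<forall>t\<in>{0..T}. AE x in lebesgue. w t x = u t x)) \<and>
            (\<forall>f0 ut. (\<forall>t\<in>{0..T}. AE x in lebesgue. f t x = f0 x) \<longrightarrow> L2_curve_deriv T u ut \<longrightarrow>
               finite_pair_energy \<rho> u0 \<and>
               (\<forall>t\<in>{0..T}. finite_pair_energy \<rho> (u t) \<and>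
                  wave_energy \<rho> \<mu> f0 (u t) (ut t) = wave_energy \<rho> \<mu> f0 u0 v0))" if \<mu>: "0 \<le> \<mu>" for \<mu>
  proof -
    obtain \<alpha> K where "coercive_kernel \<rho> s \<alpha> K \<mu>"
      using coercive_kernel_if_solvable[OF assms(5-7) \<mu>] by blast
    then interpret coercive_kernel \<rho> s \<alpha> K \<mu> .
    have T: "0 \<le> T" using assms(1) by simp
    obtain u where u: "wave_solution \<rho> s \<mu> T f u0 v0 u"
      using wave_solution_exists[OF T assms(2-4)] by blast
    show ?thesis
    proof (intro exI conjI allI impI)
      show "\<forall>t\<in>{0..T}. AE x in lebesgue. w t x = u t x" if "wave_solution \<rho> s \<mu> T f u0 v0 w" for w
        using wave_solution_unique[OF T f u0 v0 u that] by blast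
    qed (use u wave_energy_conservation[OF assms(1) f u0 v0 u] in blast)+
  qed
  from main[OF assms(8)] main[OF order.refl] show ?thesis by blast
qed

end
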